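(* Let $k$ be a noetherian commutative $\mathbb{Q}$-algebra, let $W\in k[x]$, $V\in k[y]=k[y_1,\dots,y_m]$ and $U\in k[z]$ be potentials, let $X$ be a finite rank matrix factorisation of $V-W$ over $k[x,y]$ and $Y$ a finite rank matrix factorisation of $U-V$ over $k[y,z]$. With the notation of the context, there is a homotopy equivalence over $k[x,z]$ $$\Phi: S_m\otimes_k(Y\otimes X)\longrightarrow Y\mid X,\qquad \Phi^{-1}: Y\mid X\longrightarrow S_m\otimes_k(Y\otimes X)$$ (mutually inverse up to $k[x,z]$-linear homotopy) of matrix factorisations of $U-W$, where $\Phi=\pi\exp(-\delta)\epsilon$ and $\Phi^{-1}=\epsilon^{-1}\exp(\delta)\sigma_\infty$.
   Context: **Conventions.** Commutators are graded, $[a,b]=ab-(-1)^{|a||b|}ba$; operators on tensor products act with Koszul signs, $(f\otimes g)(a\otimes b)=(-1)^{|g||a|}f(a)\otimes g(b)$. A potential $W\in k[x_1,\dots,x_n]$ is a polynomial such that $\partial_{x_1}W,\dots,\partial_{x_n}W$ is quasi-regular, $J_W=k[x]/(\partial_{x_1}W,\dots,\partial_{x_n}W)$ is a finitely generated free $k$-module, and the Koszul complex of the partial derivatives is exact except in degree zero. A linear factorisation of $W\in R$ is a $\mathbb{Z}_2$-graded $R$-module with an odd $R$-linear $d$ with $d^2=W$; it is a matrix factorisation if the module is free, of finite rank if also finitely generated. Morphisms are even linear maps commuting with $d$; two are homotopic if they differ by $[d,h]$ with $h$ odd and linear. **Objects.** $Y\otimes X=Y\otimes_{k[y]}X$ with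 differential $d_{Y\otimes X}=d_Y\otimes1+1\otimes d_X$, an (infinite rank) matrix factorisation of $U-W$ over $k[x,z]$. $Y\mid X=Y\otimes_{k[y]}J_V\otimes_{k[y]}X$ with the induced differential, a finite rank matrix factorisation of $U-W$ over $k[x,z]$. $S_m=\bigwedge(k\theta_1\oplus\cdots\oplus k\theta_m)$ with $\theta_i$ odd; $\theta_i$ also denotes left wedge multiplication and $\theta_i^*$ contraction from the left. $S_m\otimes_k(Y\otimes X)$ has differential $1\otimes d_{Y\otimes X}$. **Completion and connection.** $t_i=\partial_{y_i}V$; $\widehat{k[y]}$ is the $(t_1,\dots,t_m)$-adic completion of $k[y]$; $Y\widehat\otimes X=Y\otimes_{k[y]}\widehat{k[y]}\otimes_{k[y]}X$; $\epsilon:Y\otimes X\to Y\widehat\otimes X$ is the canonical map (and also $1\otimes\epsilon$ on $S_m\otimes_k-$), which is known to be a homotopy equivalence over $k[x,z]$, and $\epsilon^{-1}$ is a homotopy inverse. Fix a $k$-linear section $\sigma:J_V\to\widehat{k[y]}$ of the quotient map. Every $h\in\widehat{k[y]}$ is uniquely a series $\sum_u\sigma(r_u)t^u$ with $r_u\in J_V$; put $\partial_{t_i}h=\sum_u u_i\sigma(r_u)t^{u-\epsilon_i}$, with $\epsilon_i$ the $i$th unit vector. (These are the components of a flat $k$-linear connection on $\widehat{k[y]}$ over $k[t]$.) **Koszul complex.** $\widehat K=S_m\otimes_k\widehat{k[y]}$, $d_K=\sum_it_i\theta_i^*$, $\mathbb{Z}$-graded with $\deg\theta_i=-1$. $\nabla$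 is the operator $\sum_i\theta_i\,\partial_{t_i}$ on $\widehat K$; $[d_K,\nabla]$ is invertible on the negative degree part of $\widehat K$ and $H=[d_K,\nabla]^{-1}\nabla$. Choosing homogeneous bases of $X$ and $Y$, so that $\widehat K\otimes_{\widehat{k[y]}}(Y\widehat\otimes X)\cong\widehat K\otimes_kk[x,z]\otimes_kQ$ with $Q$ a free $\mathbb{Z}_2$-graded $k$-module, extend $H$, and $\sigma:J_V\to\widehat{k[y]}\subset\widehat K$, to $k[x,z]$-linear maps $H$ on $\widehat K\otimes_{\widehat{k[y]}}(Y\widehat\otimes X)$ and $\sigma:Y\mid X\to\widehat K\otimes_{\widehat{k[y]}}(Y\widehat\otimes X)$. Then $\sigma_\infty=\sum_{j\ge0}(-1)^j(Hd_{Y\otimes X})^j\sigma$ (a finite sum), and $\pi:\widehat K\otimes_{\widehat{k[y]}}(Y\widehat\otimes X)\to Y\mid X$ is zero on terms of positive $\theta$-degree and the quotient map in $\theta$-degree zero. The middle object carries the differential $d_K+d_{Y\otimes X}$; its underlying module equals that of $S_m\otimes_k(Y\widehat\otimes X)$. **The operator $\delta$.** $\lambda_i=\partial_{y_i}(d_X)$, the entrywise derivative of the matrix of $d_X$ in the chosen basis, acting as $1\otimes\partial_{y_i}(d_X)$; $\delta=\sum_{i=1}^m\lambda_i\theta_i^*$, which is nilpotent; $\exp(\pm\delta)=\sum_{n\ge0}\frac{(\pm1)^n}{n!}\delta^n$. *)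

theory Defs
  imports "HOL-Library.Poly_Mapping" "HOL-Library.Z2" "HOL-Algebra.Module" "HOL-Algebra.QuotRing"
    "HOL-Algebra.Ideal_Product" "HOL-Algebra.Ring_Divisibility"
begin

section \<open>Rings and modules\<close>

definition type_ring :: "'a::comm_ring_1 ring" where
  "type_ring = \<lparr>carrier = UNIV, monoid.mult = (*), one = 1, zero = 0, add = (+)\<rparr>"

definition linear_map ::
  "('r, 'p) ring_scheme \<Rightarrow> ('r, 'm, 'q) module_scheme \<Rightarrow> ('r, 'n, 's) module_scheme \<Rightarrow> ('m \<Rightarrow> 'n) \<Rightarrow> bool" where
  "linear_map R M N f \<longleftrightarrow>
     f \<in> carrier M \<rightarrow> carrier N \<and>
     (\<forall>v\<in>carrier M. \<forall>w\<in>carrier M. f (v \<oplus>\<^bsub>M\<^esub> w) = f v \<oplus>\<^bsub>N\<^esub> f w) \<and>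
     (\<forall>r\<in>carrier R. \<forall>v\<in>carrier M. f (r \<odot>\<^bsub>M\<^esub> v) = r \<odot>\<^bsub>N\<^esub> f v)"

text \<open>The ring \<open>S\<close> as a module along a ring homomorphism \<open>\<phi>\<close> into it.\<close>

definition via_hom :: "('r \<Rightarrow> 's) \<Rightarrow> 's ring \<Rightarrow> ('r, 's) module" where
  "via_hom \<phi> S = \<lparr>carrier = carrier S, monoid.mult = monoid.mult S, one = one S, zero = zero S, add = add S,
                  smult = (\<lambda>r s. \<phi> r \<otimes>\<^bsub>S\<^esub> s)\<rparr>"

definition restrict_scalars :: "('s \<Rightarrow> 'r) \<Rightarrow> ('r, 'm) module \<Rightarrow> ('s, 'm) module" where
  "restrict_scalars \<phi> M = \<lparr>carrier = carrier M, monoid.mult = monoid.mult M, one = one M, zero = zero M, add = add M,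
                  smult = (\<lambda>c v. \<phi> c \<odot>\<^bsub>M\<^esub> v)\<rparr>"

definition basis_expansion ::
  "('r, 'p) ring_scheme \<Rightarrow> ('r, 'm, 'q) module_scheme \<Rightarrow> 'm set \<Rightarrow> 'm \<Rightarrow> ('m \<Rightarrow> 'r) \<Rightarrow> bool" where
  "basis_expansion R M B v c \<longleftrightarrow>
     (\<forall>b\<in>B. c b \<in> carrier R) \<and> (\<forall>b. b \<notin> B \<longrightarrow> c b = \<zero>\<^bsub>R\<^esub>) \<and> finite {b. c b \<noteq> \<zero>\<^bsub>R\<^esub>} \<and>
     v = (\<Oplus>\<^bsub>M\<^esub>b\<in>{b. c b \<noteq> \<zero>\<^bsub>R\<^esub>}. c b \<odot>\<^bsub>M\<^esub> b)"

definition is_basis ::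
  "('r, 'p) ring_scheme \<Rightarrow> ('r, 'm, 'q) module_scheme \<Rightarrow> 'm set \<Rightarrow> bool" where
  "is_basis R M B \<longleftrightarrow> B \<subseteq> carrier M \<and> (\<forall>v\<in>carrier M. \<exists>!c. basis_expansion R M B v c)"

definition coord ::
  "('r, 'p) ring_scheme \<Rightarrow> ('r, 'm, 'q) module_scheme \<Rightarrow> 'm set \<Rightarrow> 'm \<Rightarrow> 'm \<Rightarrow> 'r" where
  "coord R M B v = (THE c. basis_expansion R M B v c)"

definition matrix_of ::
  "('r, 'p) ring_scheme \<Rightarrow> ('r, 'm, 'q) module_scheme \<Rightarrow> 'm set \<Rightarrow> ('m \<Rightarrow> 'm) \<Rightarrow> 'm \<Rightarrow> 'm \<Rightarrow> 'r" where
  "matrix_of R M B f = (\<lambda>b' b. coord R M B (f b) b')"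

definition finitely_generated ::
  "('r, 'p) ring_scheme \<Rightarrow> ('r, 'm, 'q) module_scheme \<Rightarrow> bool" where
  "finitely_generated R M \<longleftrightarrow>
     (\<exists>S. finite S \<and> S \<subseteq> carrier M \<and>
        (\<forall>v\<in>carrier M. \<exists>c\<in>S \<rightarrow> carrier R. v = (\<Oplus>\<^bsub>M\<^esub>s\<in>S. c s \<odot>\<^bsub>M\<^esub> s)))"

definition ideal_pow :: "('r, 'p) ring_scheme \<Rightarrow> 'r set \<Rightarrow> nat \<Rightarrow> 'r set" where
  "ideal_pow R I N = (ideal_prod R I ^^ N) (carrier R)"

text \<open>Elements of \<open>S\<^sub>m \<otimes> M\<close> are functions \<open>g\<close> on the subsets of \<open>{..<m}\<close>, standing for
  \<open>\<Sum>\<^sub>I \<theta>\<^sub>I \<otimes> g I\<close> with \<open>\<theta>\<^sub>I\<close> the wedge product of the \<open>\<theta>\<^sub>i\<close>, \<open>i \<in> I\<close>, in increasing order.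
  Indices run from \<open>0\<close> to \<open>m - 1\<close>. Signs \<open>(-1)\<^sup>s\<close> are indexed by \<open>s \<in> \<int>\<^sub>2\<close>.\<close>

definition signed :: "('m, 'q) ring_scheme \<Rightarrow> bit \<Rightarrow> 'm \<Rightarrow> 'm" where
  "signed M s v = (if s = 0 then v else \<ominus>\<^bsub>M\<^esub> v)"

definition theta_sign :: "nat \<Rightarrow> nat set \<Rightarrow> bit" where
  "theta_sign i I = of_nat (card {j \<in> I. j < i})"

definition wedge :: "('m, 'q) ring_scheme \<Rightarrow> nat \<Rightarrow> (nat set \<Rightarrow> 'm) \<Rightarrow> nat set \<Rightarrow> 'm" where
  "wedge M i g = (\<lambda>I. if i \<in> I then signed M (theta_sign i I) (g (I - {i})) else \<zero>\<^bsub>M\<^esub>)"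

definition contract :: "('m, 'q) ring_scheme \<Rightarrow> nat \<Rightarrow> (nat set \<Rightarrow> 'm) \<Rightarrow> nat set \<Rightarrow> 'm" where
  "contract M i g = (\<lambda>I. if i \<in> I then \<zero>\<^bsub>M\<^esub> else signed M (theta_sign i I) (g (insert i I)))"

definition ext_carrier :: "nat \<Rightarrow> ('m, 'q) ring_scheme \<Rightarrow> (nat set \<Rightarrow> 'm) set" where
  "ext_carrier m M = {g. (\<forall>I. g I \<in> carrier M) \<and> (\<forall>I. \<not> I \<subseteq> {..<m} \<longrightarrow> g I = \<zero>\<^bsub>M\<^esub>)}"

definition koszul_diff ::
  "nat \<Rightarrow> (nat \<Rightarrow> 'r) \<Rightarrow> ('r, 'm, 'q) module_scheme \<Rightarrow> (nat set \<Rightarrow> 'm) \<Rightarrow> nat set \<Rightarrow> 'm" where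
  "koszul_diff m t M g = (\<lambda>I. \<Oplus>\<^bsub>M\<^esub>i\<in>{..<m}. t i \<odot>\<^bsub>M\<^esub> contract M i g I)"

text \<open>The part of \<open>\<theta>\<close>-degree \<open>r\<close>, which has cohomological degree \<open>-r\<close>.\<close>

definition theta_part :: "nat \<Rightarrow> ('m, 'q) ring_scheme \<Rightarrow> nat \<Rightarrow> (nat set \<Rightarrow> 'm) set" where
  "theta_part m M r = {g \<in> ext_carrier m M. \<forall>I. card I \<noteq> r \<longrightarrow> g I = \<zero>\<^bsub>M\<^esub>}"

definition koszul_exact :: "'r ring \<Rightarrow> nat \<Rightarrow> (nat \<Rightarrow> 'r) \<Rightarrow> bool" where
  "koszul_exact R m t \<longleftrightarrow> (let M = via_hom (\<lambda>r. r) R in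
     \<forall>r\<ge>1. \<forall>g\<in>theta_part m M r. koszul_diff m t M g = (\<lambda>_. \<zero>\<^bsub>R\<^esub>) \<longrightarrow>
       (\<exists>h\<in>theta_part m M (Suc r). koszul_diff m t M h = g))"

text \<open>Multi-indices \<open>u \<in> \<nat>\<^sup>m\<close> and the monomials \<open>t\<^sup>u\<close>.\<close>

definition mindex :: "nat \<Rightarrow> (nat \<Rightarrow> nat) set" where
  "mindex m = {u. \<forall>i\<ge>m. u i = 0}"

definition mdeg :: "nat \<Rightarrow> (nat \<Rightarrow> nat) \<Rightarrow> nat" where
  "mdeg m u = (\<Sum>i<m. u i)"

definition mpower :: "('r, 'p) ring_scheme \<Rightarrow> nat \<Rightarrow> (nat \<Rightarrow> 'r) \<Rightarrow> (nat \<Rightarrow> nat) \<Rightarrow> 'r" where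
  "mpower R m t u = (\<Otimes>\<^bsub>R\<^esub>i\<in>{..<m}. t i [^]\<^bsub>R\<^esub> u i)"

text \<open>\<open>t\<close> is quasi-regular if \<open>(R/I)[T\<^sub>1, \<dots>, T\<^sub>m] \<rightarrow> gr\<^sub>I R\<close>, \<open>T\<^sub>i \<mapsto> t\<^sub>i\<close>, is injective (it always is
  surjective), where \<open>I = (t\<^sub>1, \<dots>, t\<^sub>m)\<close>.\<close>

definition quasi_regular :: "('r, 'p) ring_scheme \<Rightarrow> nat \<Rightarrow> (nat \<Rightarrow> 'r) \<Rightarrow> bool" where
  "quasi_regular R m t \<longleftrightarrow> (let I = Idl\<^bsub>R\<^esub> (t ` {..<m}) in
     \<forall>N c. (\<forall>u. c u \<in> carrier R) \<and>
       (\<Oplus>\<^bsub>R\<^esub>u\<in>{u \<in> mindex m. mdeg m u = N}. c u \<otimes>\<^bsub>R\<^esub> mpower R m t u) \<in> ideal_pow R I (Suc N) \<longrightarrow>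
       (\<forall>u\<in>{u \<in> mindex m. mdeg m u = N}. c u \<in> I))"

text \<open>The \<open>I\<close>-adic completion, as the inverse limit of the rings \<open>R / I\<^sup>N\<close>. An element is a
  sequence of cosets; \<open>a (Suc N) \<subseteq> a N\<close> says that \<open>a (Suc N)\<close> maps to \<open>a N\<close>.\<close>

definition completion :: "'r ring \<Rightarrow> 'r set \<Rightarrow> (nat \<Rightarrow> 'r set) ring" where
  "completion R I = (let Q = (\<lambda>N. R Quot ideal_pow R I N) in
     \<lparr>carrier = {a. \<forall>N. a N \<in> carrier (Q N) \<and> a (Suc N) \<subseteq> a N},
      monoid.mult = (\<lambda>a b N. a N \<otimes>\<^bsub>Q N\<^esub> b N), one = (\<lambda>N. \<one>\<^bsub>Q N\<^esub>),
      zero = (\<lambda>N. \<zero>\<^bsub>Q N\<^esub>), add = (\<lambda>a b N. a N \<oplus>\<^bsub>Q N\<^esub> b N)\<rparr>)"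

definition to_completion :: "'r ring \<Rightarrow> 'r set \<Rightarrow> 'r \<Rightarrow> nat \<Rightarrow> 'r set" where
  "to_completion R I r = (\<lambda>N. ideal_pow R I N +>\<^bsub>R\<^esub> r)"


section \<open>Matrix factorisations\<close>

record ('r, 'm) factorisation = "('r, 'm) module" +
  grade :: "bit \<Rightarrow> 'm set"
  differential :: "'m \<Rightarrow> 'm"

definition z2_graded_module ::
  "('r, 'p) ring_scheme \<Rightarrow> ('r, 'm, 'q) factorisation_scheme \<Rightarrow> bool" where
  "z2_graded_module R M \<longleftrightarrow> module R M \<and> (\<forall>s. submodule (grade M s) R M) \<and>
     (\<forall>v\<in>carrier M. \<exists>!w. fst w \<in> grade M 0 \<and> snd w \<in> grade M 1 \<and> v = fst w \<oplus>\<^bsub>M\<^esub> snd w)"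

definition linear_factorisation ::
  "('r, 'p) ring_scheme \<Rightarrow> 'r \<Rightarrow> ('r, 'm, 'q) factorisation_scheme \<Rightarrow> bool" where
  "linear_factorisation R w M \<longleftrightarrow> w \<in> carrier R \<and> z2_graded_module R M \<and>
     linear_map R M M (differential M) \<and>
     (\<forall>s. differential M ` grade M s \<subseteq> grade M (s + 1)) \<and>
     (\<forall>v\<in>carrier M. differential M (differential M v) = w \<odot>\<^bsub>M\<^esub> v)"

definition homogeneous_basis ::
  "('r, 'p) ring_scheme \<Rightarrow> ('r, 'm, 'q) factorisation_scheme \<Rightarrow> 'm set \<Rightarrow> bool" where
  "homogeneous_basis R M B \<longleftrightarrow> is_basis R M B \<and> B \<subseteq> grade M 0 \<union> grade M 1"

text \<open>Freeness is freeness as a graded module, so that homogeneous bases exist.\<close>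

definition matrix_factorisation ::
  "('r, 'p) ring_scheme \<Rightarrow> 'r \<Rightarrow> ('r, 'm, 'q) factorisation_scheme \<Rightarrow> bool" where
  "matrix_factorisation R w M \<longleftrightarrow> linear_factorisation R w M \<and> (\<exists>B. homogeneous_basis R M B)"

definition finite_rank_matrix_factorisation ::
  "('r, 'p) ring_scheme \<Rightarrow> 'r \<Rightarrow> ('r, 'm, 'q) factorisation_scheme \<Rightarrow> bool" where
  "finite_rank_matrix_factorisation R w M \<longleftrightarrow> matrix_factorisation R w M \<and> finitely_generated R M"

definition factorisation_morphism ::
  "('r, 'p) ring_scheme \<Rightarrow> ('r, 'm, 'q) factorisation_scheme \<Rightarrow> ('r, 'n, 's) factorisation_scheme \<Rightarrow>
   ('m \<Rightarrow> 'n) \<Rightarrow> bool" where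
  "factorisation_morphism R M N f \<longleftrightarrow> linear_map R M N f \<and>
     (\<forall>s. f ` grade M s \<subseteq> grade N s) \<and>
     (\<forall>v\<in>carrier M. f (differential M v) = differential N (f v))"

definition homotopic ::
  "('r, 'p) ring_scheme \<Rightarrow> ('r, 'm, 'q) factorisation_scheme \<Rightarrow> ('r, 'n, 's) factorisation_scheme \<Rightarrow>
   ('m \<Rightarrow> 'n) \<Rightarrow> ('m \<Rightarrow> 'n) \<Rightarrow> bool" where
  "homotopic R M N f g \<longleftrightarrow> (\<exists>h. linear_map R M N h \<and> (\<forall>s. h ` grade M s \<subseteq> grade N (s + 1)) \<and>
     (\<forall>v\<in>carrier M. f v \<ominus>\<^bsub>N\<^esub> g v = differential N (h v) \<oplus>\<^bsub>N\<^esub> h (differential M v)))"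

definition inverse_homotopy_equivalences ::
  "('r, 'p) ring_scheme \<Rightarrow> ('r, 'm, 'q) factorisation_scheme \<Rightarrow> ('r, 'n, 's) factorisation_scheme \<Rightarrow>
   ('m \<Rightarrow> 'n) \<Rightarrow> ('n \<Rightarrow> 'm) \<Rightarrow> bool" where
  "inverse_homotopy_equivalences R M N f g \<longleftrightarrow>
     factorisation_morphism R M N f \<and> factorisation_morphism R N M g \<and>
     homotopic R M M (g \<circ> f) (\<lambda>v. v) \<and> homotopic R N N (f \<circ> g) (\<lambda>v. v)"

definition parity :: "('r, 'm, 'q) factorisation_scheme \<Rightarrow> 'm \<Rightarrow> bit" where
  "parity M b = (if b \<in> grade M 1 then 1 else 0)"

text \<open>\<open>S\<^sub>m \<otimes>\<^sub>k M\<close> with differential \<open>1 \<otimes> d\<close>. An operator \<open>f\<close> of degree \<open>1\<close> on \<open>M\<close> acts as \<open>1 \<otimes> f\<close>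
  with the Koszul sign \<open>(-1)\<^sup>\<bar>\<^sup>I\<^sup>\<bar>\<close> on \<open>\<theta>\<^sub>I \<otimes> M\<close>.\<close>

definition ext_odd :: "('m, 'q) ring_scheme \<Rightarrow> ('m \<Rightarrow> 'm) \<Rightarrow> (nat set \<Rightarrow> 'm) \<Rightarrow> nat set \<Rightarrow> 'm" where
  "ext_odd M f g = (\<lambda>I. signed M (of_nat (card I)) (f (g I)))"

definition ext_factorisation ::
  "nat \<Rightarrow> ('r, 'm) factorisation \<Rightarrow> ('r, nat set \<Rightarrow> 'm) factorisation" where
  "ext_factorisation m M =
     \<lparr>carrier = ext_carrier m M, monoid.mult = undefined, one = undefined,
      zero = (\<lambda>_. \<zero>\<^bsub>M\<^esub>), add = (\<lambda>g h I. g I \<oplus>\<^bsub>M\<^esub> h I), smult = (\<lambda>r g I. r \<odot>\<^bsub>M\<^esub> g I),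
      grade = (\<lambda>s. {g \<in> ext_carrier m M. \<forall>I. g I \<in> grade M (s + of_nat (card I))}),
      differential = ext_odd M (differential M)\<rparr>"


section \<open>Polynomials and potentials\<close>

text \<open>All polynomial rings are subrings of one ring in the variables \<open>x\<^sub>i, y\<^sub>i, z\<^sub>i\<close>.\<close>

datatype var = XV nat | YV nat | ZV nat

type_synonym mono = "var \<Rightarrow>\<^sub>0 nat"
type_synonym 'k pol = "mono \<Rightarrow>\<^sub>0 'k"

definition monomials :: "var set \<Rightarrow> mono set" where
  "monomials S = {\<alpha>. Poly_Mapping.keys \<alpha> \<subseteq> S}"

definition pol_ring :: "var set \<Rightarrow> 'k::comm_ring_1 pol ring" where
  "pol_ring S = \<lparr>carrier = {p. Poly_Mapping.keys p \<subseteq> monomials S},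
                 monoid.mult = (*), one = 1, zero = 0, add = (+)\<rparr>"

definition const :: "'k::comm_ring_1 \<Rightarrow> 'k pol" where
  "const c = Poly_Mapping.single 0 c"

definition pdiff :: "var \<Rightarrow> 'k::comm_ring_1 pol \<Rightarrow> 'k pol" where
  "pdiff v p = (\<Sum>\<alpha>\<in>Poly_Mapping.keys p.
     Poly_Mapping.single (\<alpha> - Poly_Mapping.single v 1)
       (of_nat (Poly_Mapping.lookup \<alpha> v) * Poly_Mapping.lookup p \<alpha>))"

abbreviation xvars :: "nat \<Rightarrow> var set" where "xvars n \<equiv> XV ` {..<n}"
abbreviation yvars :: "nat \<Rightarrow> var set" where "yvars m \<equiv> YV ` {..<m}"
abbreviation zvars :: "nat \<Rightarrow> var set" where "zvars l \<equiv> ZV ` {..<l}"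

abbreviation ky :: "nat \<Rightarrow> 'k::comm_ring_1 pol ring" where "ky m \<equiv> pol_ring (yvars m)"
abbreviation kxy :: "nat \<Rightarrow> nat \<Rightarrow> 'k::comm_ring_1 pol ring" where "kxy n m \<equiv> pol_ring (xvars n \<union> yvars m)"
abbreviation kyz :: "nat \<Rightarrow> nat \<Rightarrow> 'k::comm_ring_1 pol ring" where "kyz m l \<equiv> pol_ring (yvars m \<union> zvars l)"
abbreviation kxz :: "nat \<Rightarrow> nat \<Rightarrow> 'k::comm_ring_1 pol ring" where "kxz n l \<equiv> pol_ring (xvars n \<union> zvars l)"

definition jacobi_ideal :: "(nat \<Rightarrow> var) \<Rightarrow> nat \<Rightarrow> 'k::comm_ring_1 pol \<Rightarrow> 'k pol set" where
  "jacobi_ideal v n W = Idl\<^bsub>pol_ring (v ` {..<n})\<^esub> ((\<lambda>i. pdiff (v i) W) ` {..<n})"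

definition jacobi_module :: "(nat \<Rightarrow> var) \<Rightarrow> nat \<Rightarrow> 'k::comm_ring_1 pol \<Rightarrow> ('k pol, 'k pol set) module" where
  "jacobi_module v n W = (let R = pol_ring (v ` {..<n}); I = jacobi_ideal v n W in
     via_hom (\<lambda>p. I +>\<^bsub>R\<^esub> p) (R Quot I))"

definition potential :: "(nat \<Rightarrow> var) \<Rightarrow> nat \<Rightarrow> 'k::comm_ring_1 pol \<Rightarrow> bool" where
  "potential v n W \<longleftrightarrow> (let R = pol_ring (v ` {..<n}); t = (\<lambda>i. pdiff (v i) W) in
     W \<in> carrier R \<and> quasi_regular R n t \<and>
     (\<exists>B. finite B \<and> is_basis type_ring (restrict_scalars const (jacobi_module v n W)) B) \<and>
     koszul_exact R n t)"


section \<open>The tensor products \<open>Y \<otimes>\<^sub>k\<^sub>[\<^sub>y\<^sub>] A \<otimes>\<^sub>k\<^sub>[\<^sub>y\<^sub>] X\<close>\<close>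

text \<open>For a \<open>k[y]\<close>-module \<open>A\<close> let \<open>A[x,z] = A \<otimes>\<^sub>k k[x,z]\<close>: elements are finitely supported functions
  from the monomials in \<open>x, z\<close> to \<open>A\<close>. It is a module over \<open>k[x,y,z]\<close>. Here \<open>ycoeff p \<nu>\<close> is
  the coefficient in \<open>k[y]\<close> of the \<open>x,z\<close>-monomial \<open>\<nu>\<close> in \<open>p\<close>.\<close>

definition ycoeff :: "'k::comm_ring_1 pol \<Rightarrow> mono \<Rightarrow> 'k pol" where
  "ycoeff p \<nu> = (\<Sum>\<beta>\<in>{\<beta> \<in> monomials (range YV). \<nu> + \<beta> \<in> Poly_Mapping.keys p}.
     Poly_Mapping.single \<beta> (Poly_Mapping.lookup p (\<nu> + \<beta>)))"

definition act :: "('k::comm_ring_1 pol, 'a) module \<Rightarrow> 'k pol \<Rightarrow> (mono \<Rightarrow> 'a) \<Rightarrow> mono \<Rightarrow> 'a" where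
  "act A p g = (\<lambda>\<mu>. \<Oplus>\<^bsub>A\<^esub>\<nu>\<in>{\<nu> \<in> monomials (range XV \<union> range ZV). \<exists>\<rho>. \<mu> = \<nu> + \<rho>}.
     ycoeff p \<nu> \<odot>\<^bsub>A\<^esub> g (\<mu> - \<nu>))"

text \<open>With homogeneous bases \<open>BY\<close>, \<open>BX\<close> of \<open>Y\<close>, \<open>X\<close> over \<open>k[y,z]\<close>, \<open>k[x,y]\<close>, the tensor product
  \<open>Y \<otimes>\<^sub>k\<^sub>[\<^sub>y\<^sub>] A \<otimes>\<^sub>k\<^sub>[\<^sub>y\<^sub>] X\<close> is the direct sum of copies of \<open>A[x,z]\<close> indexed by the pairs \<open>(f, e)\<close> of basis
  elements: the function with value \<open>a\<close> at \<open>(f, e)\<close>, \<open>x\<^sup>\<alpha> z\<^sup>\<gamma>\<close> and \<open>0\<close> elsewhere is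
  \<open>z\<^sup>\<gamma> f \<otimes> a \<otimes> x\<^sup>\<alpha> e\<close>. A matrix over \<open>k[y,z]\<close> on \<open>Y\<close> acts from the left; one over \<open>k[x,y]\<close>
  representing an odd operator on \<open>X\<close> acts with the Koszul sign of \<open>f\<close>.\<close>

type_synonym ('my, 'mx, 'a) tens = "'my \<times> 'mx \<Rightarrow> mono \<Rightarrow> 'a"

definition left_op ::
  "'my set \<Rightarrow> ('k::comm_ring_1 pol, 'a) module \<Rightarrow> ('my \<Rightarrow> 'my \<Rightarrow> 'k pol) \<Rightarrow>
   ('my, 'mx, 'a) tens \<Rightarrow> ('my, 'mx, 'a) tens" where
  "left_op BY A D g = (\<lambda>(f, e) \<mu>. \<Oplus>\<^bsub>A\<^esub>f'\<in>BY. act A (D f f') (g (f', e)) \<mu>)"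

definition right_odd_op ::
  "('k::comm_ring_1 pol, 'my) factorisation \<Rightarrow> 'mx set \<Rightarrow> ('k pol, 'a) module \<Rightarrow> ('mx \<Rightarrow> 'mx \<Rightarrow> 'k pol) \<Rightarrow>
   ('my, 'mx, 'a) tens \<Rightarrow> ('my, 'mx, 'a) tens" where
  "right_odd_op Y BX A D g =
     (\<lambda>(f, e) \<mu>. signed A (parity Y f) (\<Oplus>\<^bsub>A\<^esub>e'\<in>BX. act A (D e e') (g (f, e')) \<mu>))"

definition tensor_carrier ::
  "nat \<Rightarrow> nat \<Rightarrow> 'my set \<Rightarrow> 'mx set \<Rightarrow> ('r, 'a) module \<Rightarrow> ('my, 'mx, 'a) tens set" where
  "tensor_carrier n l BY BX A =
     {g. (\<forall>b \<mu>. g b \<mu> \<in> carrier A) \<and>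
         (\<forall>b \<mu>. b \<notin> BY \<times> BX \<or> \<mu> \<notin> monomials (xvars n \<union> zvars l) \<longrightarrow> g b \<mu> = \<zero>\<^bsub>A\<^esub>) \<and>
         (\<forall>b. finite {\<mu>. g b \<mu> \<noteq> \<zero>\<^bsub>A\<^esub>})}"

definition tensor ::
  "nat \<Rightarrow> nat \<Rightarrow> nat \<Rightarrow> ('k::comm_ring_1 pol, 'my) factorisation \<Rightarrow> 'my set \<Rightarrow>
   ('k pol, 'mx) factorisation \<Rightarrow> 'mx set \<Rightarrow> ('k pol, 'a) module \<Rightarrow>
   ('k pol, ('my, 'mx, 'a) tens) factorisation" where
  "tensor n m l Y BY X BX A =
     \<lparr>carrier = tensor_carrier n l BY BX A, monoid.mult = undefined, one = undefined,
      zero = (\<lambda>_ _. \<zero>\<^bsub>A\<^esub>), add = (\<lambda>g h b \<mu>. g b \<mu> \<oplus>\<^bsub>A\<^esub> h b \<mu>),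
      smult = (\<lambda>p g b. act A p (g b)),
      grade = (\<lambda>s. {g \<in> tensor_carrier n l BY BX A.
                 \<forall>f e. parity Y f + parity X e \<noteq> s \<longrightarrow> (\<forall>\<mu>. g (f, e) \<mu> = \<zero>\<^bsub>A\<^esub>)}),
      differential = (\<lambda>g b \<mu>.
        left_op BY A (matrix_of (kyz m l) Y BY (differential Y)) g b \<mu> \<oplus>\<^bsub>A\<^esub>
        right_odd_op Y BX A (matrix_of (kxy n m) X BX (differential X)) g b \<mu>)\<rparr>"

definition coeffwise :: "('a \<Rightarrow> 'b) \<Rightarrow> ('my, 'mx, 'a) tens \<Rightarrow> ('my, 'mx, 'b) tens" where
  "coeffwise \<phi> g = (\<lambda>b \<mu>. \<phi> (g b \<mu>))"


section \<open>Completion and connection\<close>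

type_synonym 'k hat = "nat \<Rightarrow> 'k pol set"

abbreviation tseq :: "'k::comm_ring_1 pol \<Rightarrow> nat \<Rightarrow> 'k pol" where
  "tseq V \<equiv> (\<lambda>i. pdiff (YV i) V)"

definition hat_ring :: "nat \<Rightarrow> 'k::comm_ring_1 pol \<Rightarrow> 'k hat ring" where
  "hat_ring m V = completion (ky m) (jacobi_ideal YV m V)"

definition to_hat :: "nat \<Rightarrow> 'k::comm_ring_1 pol \<Rightarrow> 'k pol \<Rightarrow> 'k hat" where
  "to_hat m V = to_completion (ky m) (jacobi_ideal YV m V)"

definition hat_module :: "nat \<Rightarrow> 'k::comm_ring_1 pol \<Rightarrow> ('k pol, 'k hat) module" where
  "hat_module m V = via_hom (to_hat m V) (hat_ring m V)"

text \<open>The quotient map from the completion to \<open>J\<^sub>V = k[y] / I\<close>, where \<open>I = I\<^sup>1\<close>.\<close>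

definition hat_quotient :: "'k hat \<Rightarrow> 'k pol set" where
  "hat_quotient h = h 1"

definition is_section :: "nat \<Rightarrow> 'k::comm_ring_1 pol \<Rightarrow> ('k pol set \<Rightarrow> 'k hat) \<Rightarrow> bool" where
  "is_section m V \<sigma> \<longleftrightarrow>
     linear_map type_ring (restrict_scalars const (jacobi_module YV m V))
       (restrict_scalars const (hat_module m V)) \<sigma> \<and>
     (\<forall>r\<in>carrier (jacobi_module YV m V). hat_quotient (\<sigma> r) = r)"

text \<open>\<open>h = \<Sum>\<^sub>u f u\<close> in the adic topology.\<close>

definition has_series :: "nat \<Rightarrow> 'k::comm_ring_1 pol \<Rightarrow> ((nat \<Rightarrow> nat) \<Rightarrow> 'k hat) \<Rightarrow> 'k hat \<Rightarrow> bool" where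
  "has_series m V f h \<longleftrightarrow> h \<in> carrier (hat_ring m V) \<and>
     (\<forall>N. \<exists>M0. \<forall>M\<ge>M0. (\<Oplus>\<^bsub>hat_ring m V\<^esub>u\<in>{u \<in> mindex m. mdeg m u < M}. f u) N = h N)"

definition t_power :: "nat \<Rightarrow> 'k::comm_ring_1 pol \<Rightarrow> (nat \<Rightarrow> nat) \<Rightarrow> 'k hat" where
  "t_power m V u = to_hat m V (mpower (ky m) m (tseq V) u)"

definition t_coeffs :: "nat \<Rightarrow> 'k::comm_ring_1 pol \<Rightarrow> ('k pol set \<Rightarrow> 'k hat) \<Rightarrow> 'k hat \<Rightarrow>
    (nat \<Rightarrow> nat) \<Rightarrow> 'k pol set" where
  "t_coeffs m V \<sigma> h = (THE r.
     (\<forall>u\<in>mindex m. r u \<in> carrier (jacobi_module YV m V)) \<and>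
     (\<forall>u. u \<notin> mindex m \<longrightarrow> r u = \<zero>\<^bsub>jacobi_module YV m V\<^esub>) \<and>
     has_series m V (\<lambda>u. \<sigma> (r u) \<otimes>\<^bsub>hat_ring m V\<^esub> t_power m V u) h)"

definition t_deriv :: "nat \<Rightarrow> 'k::comm_ring_1 pol \<Rightarrow> ('k pol set \<Rightarrow> 'k hat) \<Rightarrow> nat \<Rightarrow> 'k hat \<Rightarrow> 'k hat" where
  "t_deriv m V \<sigma> i h = (THE g. has_series m V
     (\<lambda>u. [u i] \<cdot>\<^bsub>hat_ring m V\<^esub> (\<sigma> (t_coeffs m V \<sigma> h u) \<otimes>\<^bsub>hat_ring m V\<^esub> t_power m V (u(i := u i - 1)))) g)"


section \<open>The operators on the Koszul complex over the completion\<close>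

definition hat_koszul_diff :: "nat \<Rightarrow> 'k::comm_ring_1 pol \<Rightarrow> (nat set \<Rightarrow> 'k hat) \<Rightarrow> nat set \<Rightarrow> 'k hat" where
  "hat_koszul_diff m V = koszul_diff m (tseq V) (hat_module m V)"

definition nabla :: "nat \<Rightarrow> 'k::comm_ring_1 pol \<Rightarrow> ('k pol set \<Rightarrow> 'k hat) \<Rightarrow>
    (nat set \<Rightarrow> 'k hat) \<Rightarrow> nat set \<Rightarrow> 'k hat" where
  "nabla m V \<sigma> g = (\<lambda>I. \<Oplus>\<^bsub>hat_ring m V\<^esub>i\<in>{..<m}. wedge (hat_ring m V) i (\<lambda>I'. t_deriv m V \<sigma> i (g I')) I)"

text \<open>\<open>[d\<^sub>K, \<nabla>] = d\<^sub>K \<nabla> + \<nabla> d\<^sub>K\<close>, both operators being odd.\<close>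

definition koszul_nabla_commutator :: "nat \<Rightarrow> 'k::comm_ring_1 pol \<Rightarrow> ('k pol set \<Rightarrow> 'k hat) \<Rightarrow>
    (nat set \<Rightarrow> 'k hat) \<Rightarrow> nat set \<Rightarrow> 'k hat" where
  "koszul_nabla_commutator m V \<sigma> g = (\<lambda>I.
     hat_koszul_diff m V (nabla m V \<sigma> g) I \<oplus>\<^bsub>hat_ring m V\<^esub> nabla m V \<sigma> (hat_koszul_diff m V g) I)"

definition negative_part :: "nat \<Rightarrow> 'k::comm_ring_1 pol \<Rightarrow> (nat set \<Rightarrow> 'k hat) set" where
  "negative_part m V = {g \<in> ext_carrier m (hat_ring m V). g {} = \<zero>\<^bsub>hat_ring m V\<^esub>}"

definition koszul_H :: "nat \<Rightarrow> 'k::comm_ring_1 pol \<Rightarrow> ('k pol set \<Rightarrow> 'k hat) \<Rightarrow>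
    (nat set \<Rightarrow> 'k hat) \<Rightarrow> nat set \<Rightarrow> 'k hat" where
  "koszul_H m V \<sigma> g = inv_into (negative_part m V) (koszul_nabla_commutator m V \<sigma>) (nabla m V \<sigma> g)"


section \<open>The maps\<close>

abbreviation YX where
  "YX n m l Y BY X BX \<equiv> tensor n m l Y BY X BX (via_hom (\<lambda>p. p) (ky m))"

abbreviation YX_hat where
  "YX_hat n m l V Y BY X BX \<equiv> tensor n m l Y BY X BX (hat_module m V)"

abbreviation YX_cut where
  "YX_cut n m l V Y BY X BX \<equiv> tensor n m l Y BY X BX (jacobi_module YV m V)"

definition ext_epsilon :: "nat \<Rightarrow> 'k::comm_ring_1 pol \<Rightarrow>
    (nat set \<Rightarrow> ('my, 'mx, 'k pol) tens) \<Rightarrow> nat set \<Rightarrow> ('my, 'mx, 'k hat) tens" where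
  "ext_epsilon m V g = (\<lambda>I. coeffwise (to_hat m V) (g I))"

definition proj :: "(nat set \<Rightarrow> ('my, 'mx, 'k::comm_ring_1 hat) tens) \<Rightarrow> ('my, 'mx, 'k pol set) tens" where
  "proj g = coeffwise hat_quotient (g {})"

definition ext_sigma :: "nat \<Rightarrow> 'k::comm_ring_1 pol \<Rightarrow> ('k pol set \<Rightarrow> 'k hat) \<Rightarrow>
    ('my, 'mx, 'k pol set) tens \<Rightarrow> nat set \<Rightarrow> ('my, 'mx, 'k hat) tens" where
  "ext_sigma m V \<sigma> g = (\<lambda>I. if I = {} then coeffwise \<sigma> g else (\<lambda>_ _. \<zero>\<^bsub>hat_ring m V\<^esub>))"

definition ext_H :: "nat \<Rightarrow> 'k::comm_ring_1 pol \<Rightarrow> ('k pol set \<Rightarrow> 'k hat) \<Rightarrow>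
    (nat set \<Rightarrow> ('my, 'mx, 'k hat) tens) \<Rightarrow> nat set \<Rightarrow> ('my, 'mx, 'k hat) tens" where
  "ext_H m V \<sigma> g = (\<lambda>I b \<mu>. koszul_H m V \<sigma> (\<lambda>I'. g I' b \<mu>) I)"

text \<open>\<open>\<lambda>\<^sub>i\<close>, acting on \<open>S\<^sub>m \<otimes> Y \<otimes> A \<otimes> X\<close> as \<open>1 \<otimes> \<partial>\<^sub>y\<^sub>i(d\<^sub>X)\<close>, and \<open>\<delta>\<close>, over the completion.\<close>

definition lambda_op :: "nat \<Rightarrow> nat \<Rightarrow> nat \<Rightarrow> 'k::comm_ring_1 pol \<Rightarrow>
    ('k pol, 'my) factorisation \<Rightarrow> 'my set \<Rightarrow> ('k pol, 'mx) factorisation \<Rightarrow> 'mx set \<Rightarrow> nat \<Rightarrow>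
    (nat set \<Rightarrow> ('my, 'mx, 'k hat) tens) \<Rightarrow> nat set \<Rightarrow> ('my, 'mx, 'k hat) tens" where
  "lambda_op n m l V Y BY X BX i = ext_odd (YX_hat n m l V Y BY X BX)
     (right_odd_op Y BX (hat_module m V)
        (\<lambda>e e'. pdiff (YV i) (matrix_of (kxy n m) X BX (differential X) e e')))"

definition delta :: "nat \<Rightarrow> nat \<Rightarrow> nat \<Rightarrow> 'k::comm_ring_1 pol \<Rightarrow>
    ('k pol, 'my) factorisation \<Rightarrow> 'my set \<Rightarrow> ('k pol, 'mx) factorisation \<Rightarrow> 'mx set \<Rightarrow>
    (nat set \<Rightarrow> ('my, 'mx, 'k hat) tens) \<Rightarrow> nat set \<Rightarrow> ('my, 'mx, 'k hat) tens" where
  "delta n m l V Y BY X BX g =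
     (\<Oplus>\<^bsub>ext_factorisation m (YX_hat n m l V Y BY X BX)\<^esub>i\<in>{..<m}.
        lambda_op n m l V Y BY X BX i (contract (YX_hat n m l V Y BY X BX) i g))"

text \<open>\<open>exp (c \<delta>)\<close> for \<open>c = \<plusminus>1\<close>, where \<open>q\<close> is the structure map of the \<open>\<rat>\<close>-algebra \<open>k\<close>. As \<open>\<delta>\<close> lowers
  the \<open>\<theta>\<close>-degree, \<open>\<delta>\<^sup>j = 0\<close> for \<open>j > m\<close>.\<close>

definition exp_delta :: "nat \<Rightarrow> nat \<Rightarrow> nat \<Rightarrow> 'k::comm_ring_1 pol \<Rightarrow>
    ('k pol, 'my) factorisation \<Rightarrow> 'my set \<Rightarrow> ('k pol, 'mx) factorisation \<Rightarrow> 'mx set \<Rightarrow> (rat \<Rightarrow> 'k) \<Rightarrow> rat \<Rightarrow>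
    (nat set \<Rightarrow> ('my, 'mx, 'k hat) tens) \<Rightarrow> nat set \<Rightarrow> ('my, 'mx, 'k hat) tens" where
  "exp_delta n m l V Y BY X BX q c g =
     (let M = ext_factorisation m (YX_hat n m l V Y BY X BX) in
      \<Oplus>\<^bsub>M\<^esub>j\<in>{..m}. const (q (c ^ j / fact j)) \<odot>\<^bsub>M\<^esub> (delta n m l V Y BY X BX ^^ j) g)"

text \<open>\<open>\<sigma>\<^sub>\<infinity> = \<Sum>\<^sub>j (-1)\<^sup>j (H d)\<^sup>j \<sigma>\<close>. As \<open>H d\<close> raises the \<open>\<theta>\<close>-degree, the terms with \<open>j > m\<close> are zero.\<close>

definition sigma_inf :: "nat \<Rightarrow> nat \<Rightarrow> nat \<Rightarrow> 'k::comm_ring_1 pol \<Rightarrow>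
    ('k pol, 'my) factorisation \<Rightarrow> 'my set \<Rightarrow> ('k pol, 'mx) factorisation \<Rightarrow> 'mx set \<Rightarrow>
    ('k pol set \<Rightarrow> 'k hat) \<Rightarrow>
    ('my, 'mx, 'k pol set) tens \<Rightarrow> nat set \<Rightarrow> ('my, 'mx, 'k hat) tens" where
  "sigma_inf n m l V Y BY X BX \<sigma> g =
     (let M = ext_factorisation m (YX_hat n m l V Y BY X BX) in
      \<Oplus>\<^bsub>M\<^esub>j\<in>{..m}. signed M (of_nat j) (((\<lambda>v. ext_H m V \<sigma> (differential M v)) ^^ j) (ext_sigma m V \<sigma> g)))"

definition Phi :: "nat \<Rightarrow> nat \<Rightarrow> nat \<Rightarrow> 'k::comm_ring_1 pol \<Rightarrow>
    ('k pol, 'my) factorisation \<Rightarrow> 'my set \<Rightarrow> ('k pol, 'mx) factorisation \<Rightarrow> 'mx set \<Rightarrow> (rat \<Rightarrow> 'k) \<Rightarrow>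
    (nat set \<Rightarrow> ('my, 'mx, 'k pol) tens) \<Rightarrow> ('my, 'mx, 'k pol set) tens" where
  "Phi n m l V Y BY X BX q = proj \<circ> exp_delta n m l V Y BY X BX q (-1) \<circ> ext_epsilon m V"

definition Phi_inv :: "nat \<Rightarrow> nat \<Rightarrow> nat \<Rightarrow> 'k::comm_ring_1 pol \<Rightarrow>
    ('k pol, 'my) factorisation \<Rightarrow> 'my set \<Rightarrow> ('k pol, 'mx) factorisation \<Rightarrow> 'mx set \<Rightarrow>
    ('k pol set \<Rightarrow> 'k hat) \<Rightarrow> (rat \<Rightarrow> 'k) \<Rightarrow>
    ((nat set \<Rightarrow> ('my, 'mx, 'k hat) tens) \<Rightarrow> nat set \<Rightarrow> ('my, 'mx, 'k pol) tens) \<Rightarrow>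
    ('my, 'mx, 'k pol set) tens \<Rightarrow> nat set \<Rightarrow> ('my, 'mx, 'k pol) tens" where
  "Phi_inv n m l V Y BY X BX \<sigma> q \<epsilon>' =
     \<epsilon>' \<circ> exp_delta n m l V Y BY X BX q 1 \<circ> sigma_inf n m l V Y BY X BX \<sigma>"

end

(* The change of variables exp(delta) conjugates the differential d of S_m (x) (Y (x) X), taken over the
   completion, into d_K + d: as d_X^2 = V - W, the commutator of d with lambda_i = dd_X/dy_i is t_i = dV/dy_i.
   It remains to compare the total complex of d_K + d with Y | X.
   The Koszul differential d_K contracts onto J_V through sigma and H, because [d_K, nabla] multiplies
   sigma(r) t^u theta_I by |u| + |I|. As H d raises the theta-degree, the contraction extends to d_K + d,
   with section sigma_infinity. The same argument over k[y], where exactness of the Koszul complex supplies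
   the contraction, gives a second equivalence S_m (x) (Y (x) X) -> Y | X. It is compatible with the
   completion map, which is therefore an equivalence as well. *)

theory Submission
  imports Defs
begin

text \<open>Three obstacles shape the proof. First, \<open>\<sigma>\<close> and \<open>H\<close> are
  linear over \<open>k\<close> only and do not commute with \<open>d\<close>. On the kernel of
  \<open>\<pi>\<close> the operator \<open>[d_K + d, H]\<close> differs from the identity by
  \<open>[d, H]\<close>, which raises the theta-degree, so it is invertible by a finite filtration.
  That \<open>\<sigma>_\<infinity>\<close> is a morphism then follows from injectivity of this
  operator (\<open>section_morphismI\<close>) and not from a computation with the series. Second, a
  homotopy inverse of the completion map is part of the claim. Over \<open>k[y]\<close> neither
  \<open>\<sigma>\<close> nor \<open>H\<close> is at hand, but the perturbation argument asks only
  for some \<open>k\<close>-linear section and some \<open>k\<close>-linear homotopy of theta-degree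
  one. Third, the same operators act over \<open>k[y]\<close>, its completion and
  \<open>J_V\<close>. Their identities are proved once, for matrices over \<open>k[x,y,z]\<close>,
  and transferred to every coefficient module; naturality in the coefficients comes with the
  transfer. In the completion all computations run in coordinates: a \<open>k\<close>-basis of
  \<open>J_V\<close> turns elements into arrays of scalars on which \<open>d_K\<close>,
  \<open>\<nabla>\<close> and \<open>H\<close> act by explicit formulas.\<close>

abbreviation lookup :: "('a \<Rightarrow>\<^sub>0 'b::zero) \<Rightarrow> 'a \<Rightarrow> 'b" where "lookup \<equiv> Poly_Mapping.lookup"
abbreviation keys :: "('a \<Rightarrow>\<^sub>0 'b::zero) \<Rightarrow> 'a set" where "keys \<equiv> Poly_Mapping.keys"
abbreviation single :: "'a \<Rightarrow> 'b \<Rightarrow> ('a \<Rightarrow>\<^sub>0 'b::zero)" where "single \<equiv> Poly_Mapping.single"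

section \<open>Polynomial rings inside the ring in all variables\<close>

lemma pol_ring_simps [simp]:
  "monoid.mult (pol_ring S) = (*)" "one (pol_ring S) = 1" "zero (pol_ring S) = 0" "add (pol_ring S) = (+)"
  by (simp_all add: pol_ring_def)

lemma in_monomials: "\<alpha> \<in> monomials S \<longleftrightarrow> (\<forall>v. v \<notin> S \<longrightarrow> lookup \<alpha> v = 0)"
  by (auto simp: monomials_def in_keys_iff subset_eq)

lemma zero_monomials [simp]: "0 \<in> monomials S"
  and add_monomials_iff [simp]: "\<alpha> + \<beta> \<in> monomials S \<longleftrightarrow> \<alpha> \<in> monomials S \<and> \<beta> \<in> monomials S"
  by (auto simp: in_monomials lookup_add)

lemma pol_ring_carrier: "p \<in> carrier (pol_ring S) \<longleftrightarrow> (\<forall>\<alpha>. \<alpha> \<notin> monomials S \<longrightarrow> lookup p \<alpha> = 0)"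
  by (auto simp: pol_ring_def in_keys_iff subset_eq)

lemma pol_ring_mono: "p \<in> carrier (pol_ring S) \<Longrightarrow> S \<subseteq> T \<Longrightarrow> p \<in> carrier (pol_ring T)"
  by (auto simp: pol_ring_carrier in_monomials)

lemma pol_ring_closed [simp]:
  "0 \<in> carrier (pol_ring S)" "1 \<in> carrier (pol_ring S)"
  "p \<in> carrier (pol_ring S) \<Longrightarrow> q \<in> carrier (pol_ring S) \<Longrightarrow> p + q \<in> carrier (pol_ring S)"
  "p \<in> carrier (pol_ring S) \<Longrightarrow> q \<in> carrier (pol_ring S) \<Longrightarrow> p - q \<in> carrier (pol_ring S)"
  "p \<in> carrier (pol_ring S) \<Longrightarrow> - p \<in> carrier (pol_ring S)"
  "const c \<in> carrier (pol_ring S)"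
  by (auto simp: pol_ring_carrier lookup_add lookup_minus lookup_one const_def lookup_single when_def)

lemma single_pol_ring [simp]: "\<alpha> \<in> monomials S \<Longrightarrow> single \<alpha> c \<in> carrier (pol_ring S)"
  by (auto simp: pol_ring_carrier lookup_single when_def)

lemma mult_pol_ring [simp]:
  assumes "p \<in> carrier (pol_ring S)" "q \<in> carrier (pol_ring S)"
  shows "p * q \<in> carrier (pol_ring S)"
proof -
  have "keys (p * q) \<subseteq> {a + b |a b. a \<in> keys p \<and> b \<in> keys q}"
    by (rule keys_mult)
  also have "\<dots> \<subseteq> monomials S" using assms by (auto simp: pol_ring_def)
  finally show ?thesis by (simp add: pol_ring_def)
qed

lemma sum_pol_ring [simp]: "(\<And>i. i \<in> I \<Longrightarrow> f i \<in> carrier (pol_ring S)) \<Longrightarrow> sum f I \<in> carrier (pol_ring S)"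
  and prod_pol_ring [simp]: "(\<And>i. i \<in> I \<Longrightarrow> f i \<in> carrier (pol_ring S)) \<Longrightarrow> prod f I \<in> carrier (pol_ring S)"
  by (induction I rule: infinite_finite_induct) auto

lemma power_pol_ring [simp]: "p \<in> carrier (pol_ring S) \<Longrightarrow> p ^ j \<in> carrier (pol_ring S)"
  by (induction j) auto

lemma cring_pol_ring: "cring (pol_ring S)"
proof (intro cringI abelian_groupI comm_monoidI)
  fix p :: "'a pol" assume "p \<in> carrier (pol_ring S)"
  then show "\<exists>q\<in>carrier (pol_ring S). q \<oplus>\<^bsub>pol_ring S\<^esub> p = \<zero>\<^bsub>pol_ring S\<^esub>"
    by (intro bexI[of _ "- p"]) auto
qed (auto simp: algebra_simps)

lemma finsum_pol_ring:
  "(\<And>i. i \<in> I \<Longrightarrow> f i \<in> carrier (pol_ring S)) \<Longrightarrow> finsum (pol_ring S) f I = sum f I"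
proof (induction I rule: infinite_finite_induct)
  case (insert x F)
  interpret cring "pol_ring S" by (rule cring_pol_ring)
  show ?case using insert by (subst finsum_insert) auto
qed (auto simp: finsum_def finprod_def)

lemma finprod_pol_ring:
  "(\<And>i. i \<in> I \<Longrightarrow> f i \<in> carrier (pol_ring S)) \<Longrightarrow> finprod (pol_ring S) f I = prod f I"
proof (induction I rule: infinite_finite_induct)
  case (insert x F)
  interpret cring "pol_ring S" by (rule cring_pol_ring)
  show ?case using insert by (subst finprod_insert) auto
qed (auto simp: finprod_def)

lemma pow_pol_ring: "p \<in> carrier (pol_ring S) \<Longrightarrow> p [^]\<^bsub>pol_ring S\<^esub> (j::nat) = p ^ j"
proof (induction j)
  case (Suc j)
  interpret cring "pol_ring S" by (rule cring_pol_ring)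
  show ?case using Suc by (simp add: mult.commute)
qed (simp add: nat_pow_def)

lemma pol_expansion: "p = (\<Sum>\<alpha>\<in>keys p. single \<alpha> (lookup p \<alpha>))"
  by (rule poly_mapping_eqI) (auto simp: lookup_sum lookup_single when_def in_keys_iff)

text \<open>A polynomial is the finite sum of its terms. Statements additive in \<open>p\<close>,
  such as associativity of \<open>act\<close> and the Leibniz rule, thereby reduce to
  monomials.\<close>

lemma pol_ring_induct [consumes 1, case_names zero single add]:
  assumes p: "p \<in> carrier (pol_ring S)" and "P 0"
    and s: "\<And>\<alpha> c. \<alpha> \<in> monomials S \<Longrightarrow> P (single \<alpha> c)"
    and a: "\<And>p q. p \<in> carrier (pol_ring S) \<Longrightarrow> q \<in> carrier (pol_ring S) \<Longrightarrow> P p \<Longrightarrow> P q \<Longrightarrow> P (p + q)"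
  shows "P p"
proof -
  have "K \<subseteq> monomials S \<Longrightarrow> P (\<Sum>\<alpha>\<in>K. single \<alpha> (lookup p \<alpha>))" if "finite K" for K
    using that by (induction K) (auto intro!: a s \<open>P 0\<close> sum_pol_ring single_pol_ring)
  from this[of "keys p"] p show ?thesis
    by (subst pol_expansion) (simp add: pol_ring_def)
qed

lemma const_simps [simp]: "const 0 = 0" "const 1 = 1" "const (a + b) = const a + const b"
  "const (a * b) = const a * const b" "const (- a) = - const a"
  by (simp_all add: const_def single_add mult_single single_uminus)

lemma const_sum: "const (sum f I) = (\<Sum>i\<in>I. const (f i))"
  by (induction I rule: infinite_finite_induct) auto


lemma (in abelian_monoid) finsum_add_eq:
  assumes "\<And>i. i \<in> I \<Longrightarrow> f i \<in> carrier G" "\<And>i. i \<in> I \<Longrightarrow> g i \<in> carrier G"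
    and "\<And>i. i \<in> I \<Longrightarrow> h i = f i \<oplus> g i"
  shows "finsum G h I = finsum G f I \<oplus> finsum G g I"
proof -
  have "finsum G h I = (\<Oplus>i\<in>I. f i \<oplus> g i)" using assms by (intro finsum_cong') auto
  also have "\<dots> = finsum G f I \<oplus> finsum G g I" using assms by (intro finsum_addf) auto
  finally show ?thesis .
qed

section \<open>Modules over polynomial rings\<close>

locale pol_module = module "pol_ring S" M
  for S :: "var set" and M :: "('k::comm_ring_1 pol, 'a, 'q) module_scheme" (structure)
begin

lemma smult_pol:
  "p \<in> carrier (pol_ring S) \<Longrightarrow> q \<in> carrier (pol_ring S) \<Longrightarrow> v \<in> carrier M \<Longrightarrow> (p + q) \<odot> v = p \<odot> v \<oplus> q \<odot> v"
  "p \<in> carrier (pol_ring S) \<Longrightarrow> q \<in> carrier (pol_ring S) \<Longrightarrow> v \<in> carrier M \<Longrightarrow> (p * q) \<odot> v = p \<odot> (q \<odot> v)"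
  "v \<in> carrier M \<Longrightarrow> 1 \<odot> v = v" "v \<in> carrier M \<Longrightarrow> 0 \<odot> v = \<zero>"
  using smult_l_distr[of p q v] smult_assoc1[of p q v] smult_one[of v] smult_l_null[of v] by simp_all

lemma smult_pol_uminus: 
  assumes "p \<in> carrier (pol_ring S)" "v \<in> carrier M" shows "(- p) \<odot> v = \<ominus> (p \<odot> v)"
proof -
  have "(- p) \<odot> v \<oplus> p \<odot> v = \<zero>" using smult_pol(1)[of "- p" p v] assms by (simp add: smult_pol)
  then show ?thesis using assms by (metis M.minus_equality module.smult_closed module_axioms pol_ring_closed(5))
qed

lemma smult_finsum:
  assumes "p \<in> carrier (pol_ring S)" "\<And>i. i \<in> I \<Longrightarrow> f i \<in> carrier M"
  shows "p \<odot> (\<Oplus>i\<in>I. f i) = (\<Oplus>i\<in>I. p \<odot> f i)"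
  using assms by (cases "finite I") (auto simp: finsum_smult_ldistr M.finsum_infinite)

text \<open>The map out of the free module on \<open>P\<close> that sends the standard generators to
  \<open>g\<close>, evaluated at the coefficient family \<open>c\<close>.\<close>

definition ev :: "'x set \<Rightarrow> ('x \<Rightarrow> 'a) \<Rightarrow> ('x \<Rightarrow> 'k pol) \<Rightarrow> 'a" where
  "ev P g c = (\<Oplus>x\<in>P. c x \<odot> g x)"

context
  fixes P :: "'x set" and g :: "'x \<Rightarrow> 'a"
  assumes P: "finite P" and g: "\<And>x. x \<in> P \<Longrightarrow> g x \<in> carrier M"
begin

lemma ev_closed [simp]: "(\<And>x. c x \<in> carrier (pol_ring S)) \<Longrightarrow> ev P g c \<in> carrier M"
  using g by (auto simp: ev_def)

lemma ev_zero [simp]: "ev P g (\<lambda>x. 0) = \<zero>"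
  using g by (auto simp: ev_def smult_pol intro!: M.finsum_zero cong: M.add.finprod_cong)

lemma ev_add:
  "(\<And>x. c x \<in> carrier (pol_ring S)) \<Longrightarrow> (\<And>x. d x \<in> carrier (pol_ring S)) \<Longrightarrow>
   ev P g (\<lambda>x. c x + d x) = ev P g c \<oplus> ev P g d"
proof -
  assume cd: "\<And>x. c x \<in> carrier (pol_ring S)" "\<And>x. d x \<in> carrier (pol_ring S)"
  then have "ev P g (\<lambda>x. c x + d x) = (\<Oplus>x\<in>P. c x \<odot> g x \<oplus> d x \<odot> g x)"
    unfolding ev_def using g by (intro M.finsum_cong') (auto simp: smult_pol)
  also have "\<dots> = ev P g c \<oplus> ev P g d"
    unfolding ev_def using g cd by (intro M.finsum_addf) auto
  finally show ?thesis .
qed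

lemma ev_smult:
  "(\<And>x. c x \<in> carrier (pol_ring S)) \<Longrightarrow> p \<in> carrier (pol_ring S) \<Longrightarrow>
   ev P g (\<lambda>x. p * c x) = p \<odot> ev P g c"
  using g unfolding ev_def by (subst smult_finsum) (auto simp: smult_pol intro!: M.finsum_cong')

lemma ev_sum:
  "(\<And>i x. i \<in> I \<Longrightarrow> c i x \<in> carrier (pol_ring S)) \<Longrightarrow>
   ev P g (\<lambda>x. \<Sum>i\<in>I. c i x) = (\<Oplus>i\<in>I. ev P g (c i))"
proof (induction I rule: infinite_finite_induct)
  case (insert i F)
  then show ?case by (subst M.finsum_insert) (auto simp: ev_add)
qed (auto simp: M.finsum_infinite)

lemma ev_delta:
  assumes "x \<in> P" shows "ev P g (\<lambda>y. if y = x then 1 else 0) = g x"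
proof -
  have "ev P g (\<lambda>y. if y = x then 1 else 0) = (\<Oplus>y\<in>P. if x = y then g y else \<zero>)"
    unfolding ev_def using g by (intro M.finsum_cong') (auto simp: smult_pol)
  then show ?thesis using M.finsum_singleton[OF assms P, of g] g by (auto simp: Pi_def)
qed

end

end

lemma pol_moduleI: "module (pol_ring S) M \<Longrightarrow> pol_module S M"
  by (simp add: pol_module_def)

section \<open>The polynomial extension of a module\<close>

lemma lookup_ycoeff:
  "lookup (ycoeff p \<nu>) \<beta> = (if \<beta> \<in> monomials (range YV) then lookup p (\<nu> + \<beta>) else 0)"
proof -
  have "inj_on ((+) \<nu>) B" for B by (auto simp: inj_on_def)
  moreover have "(+) \<nu> ` {\<beta> \<in> monomials (range YV). \<nu> + \<beta> \<in> keys p} \<subseteq> keys p" by auto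
  ultimately have "finite {\<beta> \<in> monomials (range YV). \<nu> + \<beta> \<in> keys p}"
    by (meson finite_keys inj_on_finite)
  then show ?thesis by (auto simp: ycoeff_def lookup_sum lookup_single when_def in_keys_iff)
qed

lemma ycoeff_add: "ycoeff (p + q) \<nu> = ycoeff p \<nu> + ycoeff q \<nu>"
  and ycoeff_zero [simp]: "ycoeff 0 \<nu> = 0"
  by (auto intro!: poly_mapping_eqI simp: lookup_ycoeff lookup_add)

definition mono_part :: "var set \<Rightarrow> mono \<Rightarrow> mono" where
  "mono_part S \<alpha> = Poly_Mapping.mapp (\<lambda>v j. if v \<in> S then j else 0) \<alpha>"

lemma lookup_mono_part: "lookup (mono_part S \<alpha>) v = (if v \<in> S then lookup \<alpha> v else 0)"
  by (auto simp: mono_part_def lookup_mapp when_def in_keys_iff)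

abbreviation xz_part :: "mono \<Rightarrow> mono" where "xz_part \<equiv> mono_part (range XV \<union> range ZV)"
abbreviation y_part :: "mono \<Rightarrow> mono" where "y_part \<equiv> mono_part (range YV)"

lemma not_YV: "v \<notin> range YV \<longleftrightarrow> v \<in> range XV \<union> range ZV"
  by (cases v) auto

text \<open>Each variable belongs to exactly one of the families \<open>YV\<close> and
  \<open>XV\<close>, \<open>ZV\<close>, so both factors can be read off from the exponents of
  \<open>\<alpha>\<close>.\<close>

lemma mono_split:
  assumes "\<nu> \<in> monomials (range XV \<union> range ZV)" "\<beta> \<in> monomials (range YV)"
  shows "\<alpha> = \<nu> + \<beta> \<longleftrightarrow> \<nu> = xz_part \<alpha> \<and> \<beta> = y_part \<alpha>" 
proof -
  have *: "lookup \<nu> v = 0" if "v \<in> range YV" for v using assms(1) that by (auto simp: in_monomials)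
  have **: "lookup \<beta> v = 0" if "v \<notin> range YV" for v using assms(2) that by (auto simp: in_monomials)
  show ?thesis
    using * ** not_YV unfolding poly_mapping_eq_iff fun_eq_iff lookup_add lookup_mono_part
    by (metis add_0 add_cancel_left_right)
qed

lemma ycoeff_single:
  assumes "\<nu> \<in> monomials (range XV \<union> range ZV)"
  shows "ycoeff (single \<alpha> c) \<nu> = (if \<nu> = xz_part \<alpha> then single (y_part \<alpha>) c else 0)"
proof (rule poly_mapping_eqI)
  fix \<beta>
  have "y_part \<alpha> \<in> monomials (range YV)" by (auto simp: in_monomials lookup_mono_part)
  then show "lookup (ycoeff (single \<alpha> c) \<nu>) \<beta> =
      lookup (if \<nu> = xz_part \<alpha> then single (y_part \<alpha>) c else 0) \<beta>"
    using mono_split[OF assms, of \<beta> \<alpha>] by (auto simp: lookup_ycoeff lookup_single when_def)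
qed

lemma ycoeff_closed:
  assumes "p \<in> carrier (pol_ring (xvars n \<union> yvars m \<union> zvars l))"
  shows "ycoeff p \<nu> \<in> carrier (ky m)"
proof -
  have "lookup p (\<nu> + \<beta>) = 0" if b: "\<beta> \<in> monomials (range YV)" "\<beta> \<notin> monomials (yvars m)" for \<beta>
  proof -
    obtain v where "v \<notin> yvars m" "lookup \<beta> v \<noteq> 0" using b(2) by (auto simp: in_monomials)
    moreover from this b(1) obtain i where "v = YV i" unfolding in_monomials by (metis rangeE)
    ultimately have "v \<notin> xvars n \<union> yvars m \<union> zvars l \<and> lookup (\<nu> + \<beta>) v \<noteq> 0"
      by (simp add: lookup_add image_iff)
    then have "\<nu> + \<beta> \<notin> monomials (xvars n \<union> yvars m \<union> zvars l)" unfolding in_monomials by metis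
    with assms show ?thesis unfolding pol_ring_carrier by simp
  qed
  then show ?thesis by (auto simp: pol_ring_carrier lookup_ycoeff)
qed

text \<open>The exponents of a divisor are bounded by those of \<open>\<mu>\<close>. The sum in
  \<open>act\<close> runs over divisors, and over an infinite index set \<open>finsum\<close> would
  return its default value.\<close>

lemma finite_divisors: "finite {\<nu> :: mono. \<exists>\<rho>. \<mu> = \<nu> + \<rho>}"
proof -
  let ?K = "keys \<mu>" and ?N = "\<Sum>v\<in>keys \<mu>. lookup \<mu> v"
  have *: "(v \<in> ?K \<longrightarrow> lookup \<nu> v \<in> {..?N}) \<and> (v \<notin> ?K \<longrightarrow> lookup \<nu> v = 0)" if "\<mu> = \<nu> + \<rho>" for \<nu> \<rho> v
  proof -
    have *: "lookup \<nu> v \<le> lookup \<mu> v" by (simp add: that lookup_add)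
    have "lookup \<mu> v \<le> ?N" if "v \<in> ?K" using that by (intro member_le_sum) auto
    with * show ?thesis by (auto simp: in_keys_iff)
  qed
  have "lookup ` {\<nu>. \<exists>\<rho>. \<mu> = \<nu> + \<rho>} \<subseteq> {f. \<forall>v. (v \<in> ?K \<longrightarrow> f v \<in> {..?N}) \<and> (v \<notin> ?K \<longrightarrow> f v = 0)}"
    by (intro image_subsetI CollectI allI, elim CollectE exE, rule *)
  then have "finite (lookup ` {\<nu>. \<exists>\<rho>. \<mu> = \<nu> + \<rho>})"
    by (rule finite_subset) (rule finite_set_of_finite_funs, auto)
  then show ?thesis by (rule finite_imageD) (rule inj_onI, erule poly_mapping_eq_iff[THEN iffD2])
qed


text \<open>Additivity settles finite sums by induction; over an infinite set both sides are the
  default zero, which \<open>\<phi>\<close> preserves.\<close>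

lemma finsum_additive:
  assumes "abelian_monoid N" "abelian_monoid A" "\<phi> \<in> carrier N \<rightarrow> carrier A" "\<phi> \<zero>\<^bsub>N\<^esub> = \<zero>\<^bsub>A\<^esub>"
    and "\<And>v w. v \<in> carrier N \<Longrightarrow> w \<in> carrier N \<Longrightarrow> \<phi> (v \<oplus>\<^bsub>N\<^esub> w) = \<phi> v \<oplus>\<^bsub>A\<^esub> \<phi> w"
    and "\<And>i. i \<in> I \<Longrightarrow> f i \<in> carrier N"
  shows "\<phi> (finsum N f I) = (\<Oplus>\<^bsub>A\<^esub>i\<in>I. \<phi> (f i))"
proof -
  interpret N: abelian_monoid N by fact
  interpret A: abelian_monoid A by fact
  from assms(6) show ?thesis
  proof (induction I rule: infinite_finite_induct)
    case (insert i F)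
    have "\<phi> v \<in> carrier A" if "v \<in> carrier N" for v using assms(3) that by auto
    with insert show ?case by (simp add: assms(5) Pi_def)
  qed (use assms(4) in \<open>auto simp: N.finsum_infinite A.finsum_infinite\<close>)
qed

text \<open>A tensor product is a direct sum of copies of this module over
  \<open>BY \<times> BX\<close>, and tensoring with \<open>S_m\<close> adds a direct sum over
  subsets. Module axioms and bases are established here and lifted pointwise.\<close>

definition poly_ext :: "nat \<Rightarrow> nat \<Rightarrow> ('k::comm_ring_1 pol, 'a) module \<Rightarrow> ('k pol, mono \<Rightarrow> 'a) module" where
  "poly_ext n l A =
     \<lparr>carrier = {g. (\<forall>\<mu>. g \<mu> \<in> carrier A) \<and> (\<forall>\<mu>. \<mu> \<notin> monomials (xvars n \<union> zvars l) \<longrightarrow> g \<mu> = \<zero>\<^bsub>A\<^esub>) \<and>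
                  finite {\<mu>. g \<mu> \<noteq> \<zero>\<^bsub>A\<^esub>}},
      monoid.mult = undefined, one = undefined, zero = (\<lambda>_. \<zero>\<^bsub>A\<^esub>), add = (\<lambda>g h \<mu>. g \<mu> \<oplus>\<^bsub>A\<^esub> h \<mu>),
      smult = act A\<rparr>"

lemma poly_ext_simps [simp]:
  "zero (poly_ext n l A) = (\<lambda>_. \<zero>\<^bsub>A\<^esub>)" "add (poly_ext n l A) = (\<lambda>g h \<mu>. g \<mu> \<oplus>\<^bsub>A\<^esub> h \<mu>)"
  "smult (poly_ext n l A) = act A"
  by (simp_all add: poly_ext_def)

abbreviation kxyz :: "nat \<Rightarrow> nat \<Rightarrow> nat \<Rightarrow> 'k::comm_ring_1 pol ring" where
  "kxyz n m l \<equiv> pol_ring (xvars n \<union> yvars m \<union> zvars l)"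

lemma kxz_kxyz: "p \<in> carrier (kxz n l) \<Longrightarrow> p \<in> carrier (kxyz n m l)"
  and kxy_kxyz: "p \<in> carrier (kxy n m) \<Longrightarrow> p \<in> carrier (kxyz n m l)"
  and kyz_kxyz: "p \<in> carrier (kyz m l) \<Longrightarrow> p \<in> carrier (kxyz n m l)"
  and ky_kxyz: "p \<in> carrier (ky m) \<Longrightarrow> p \<in> carrier (kxyz n m l)"
  by (erule pol_ring_mono, blast)+

text \<open>This is why maps that are linear over \<open>k\<close> only extend to maps linear over
  \<open>k[x,z]\<close>: the coefficients through which such a scalar acts are constants.\<close>

lemma ycoeff_kxz:
  assumes "p \<in> carrier (kxz n l)" "\<nu> \<in> monomials (range XV \<union> range ZV)"
  shows "ycoeff p \<nu> = const (lookup p \<nu>)"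
proof (rule poly_mapping_eqI)
  fix \<beta>
  have "lookup p (\<nu> + \<beta>) = 0" if "\<beta> \<in> monomials (range YV)" "\<beta> \<noteq> 0"
  proof -
    obtain v where "lookup \<beta> v \<noteq> 0" using \<open>\<beta> \<noteq> 0\<close> by (metis ex_in_conv in_keys_iff keys_eq_empty)
    with that(1) have "v \<in> range YV" by (auto simp: in_monomials)
    with \<open>lookup \<beta> v \<noteq> 0\<close> have "\<nu> + \<beta> \<notin> monomials (xvars n \<union> zvars l)" by (auto simp: in_monomials lookup_add)
    with assms(1) show ?thesis unfolding pol_ring_carrier by simp
  qed
  then show "lookup (ycoeff p \<nu>) \<beta> = lookup (const (lookup p \<nu>)) \<beta>"
    by (cases "\<beta> = 0") (simp_all add: lookup_ycoeff const_def lookup_single)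
qed

locale coeff_module = pol_module "yvars m" A for m :: nat and A :: "('k::comm_ring_1 pol, 'a) module" (structure)
begin

lemma act_cong_term:
  assumes "p \<in> carrier (kxyz n m l)" "\<And>\<mu>. g \<mu> \<in> carrier A"
  shows "(\<lambda>\<nu>. ycoeff p \<nu> \<odot> g (\<mu> - \<nu>)) \<in> D \<rightarrow> carrier A"
  by (intro Pi_I smult_closed ycoeff_closed[OF assms(1)] assms(2))

lemma act_closed: 
  assumes "p \<in> carrier (kxyz n m l)" "\<And>\<mu>. g \<mu> \<in> carrier A"
  shows "act A p g \<mu> \<in> carrier A"
  unfolding act_def by (rule M.finsum_closed[OF act_cong_term[OF assms]])

lemma act_zero: "(\<And>\<mu>. g \<mu> \<in> carrier A) \<Longrightarrow> act A 0 g = (\<lambda>_. \<zero>)"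
  unfolding act_def by (simp add: smult_pol)

lemma act_add_left:
  assumes "p \<in> carrier (kxyz n m l)" "q \<in> carrier (kxyz n m l)" "\<And>\<mu>. g \<mu> \<in> carrier A"
  shows "act A (p + q) g = (\<lambda>\<mu>. act A p g \<mu> \<oplus> act A q g \<mu>)"
proof
  fix \<mu>
  show "act A (p + q) g \<mu> = act A p g \<mu> \<oplus> act A q g \<mu>"
    unfolding act_def using act_cong_term[OF assms(1,3)] act_cong_term[OF assms(2,3)]
      ycoeff_closed[OF assms(1)] ycoeff_closed[OF assms(2)] assms(3)
    by (intro M.finsum_add_eq) (auto simp: ycoeff_add smult_pol)
qed

lemma act_add_right:
  assumes "p \<in> carrier (kxyz n m l)" "\<And>\<mu>. g \<mu> \<in> carrier A" "\<And>\<mu>. h \<mu> \<in> carrier A"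
  shows "act A p (\<lambda>\<mu>. g \<mu> \<oplus> h \<mu>) = (\<lambda>\<mu>. act A p g \<mu> \<oplus> act A p h \<mu>)"
proof
  fix \<mu>
  show "act A p (\<lambda>\<mu>. g \<mu> \<oplus> h \<mu>) \<mu> = act A p g \<mu> \<oplus> act A p h \<mu>"
    unfolding act_def using ycoeff_closed[OF assms(1)] assms(2,3)
    by (intro M.finsum_add_eq) (auto simp: smult_r_distr)
qed

lemma mono_part_monomials: "\<alpha> \<in> monomials T \<Longrightarrow> mono_part S \<alpha> \<in> monomials (S \<inter> T)"
  by (auto simp: in_monomials lookup_mono_part)

text \<open>A monomial multiplies by its \<open>y\<close>-part and shifts by its
  \<open>x,z\<close>-part. The difference of monomials is truncated, so divisibility has to be
  tested separately.\<close>

lemma act_single: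
  assumes "\<alpha> \<in> monomials (xvars n \<union> yvars m \<union> zvars l)" "\<And>\<mu>. g \<mu> \<in> carrier A"
  shows "act A (single \<alpha> c) g \<mu> =
    (if \<exists>\<rho>. \<mu> = xz_part \<alpha> + \<rho> then single (y_part \<alpha>) c \<odot> g (\<mu> - xz_part \<alpha>) else \<zero>)"
proof -
  let ?D = "{\<nu> \<in> monomials (range XV \<union> range ZV). \<exists>\<rho>. \<mu> = \<nu> + \<rho>}"
  let ?f = "\<lambda>\<nu>. single (y_part \<alpha>) c \<odot> g (\<mu> - \<nu>)"
  have xz: "xz_part \<alpha> \<in> monomials (range XV \<union> range ZV)"
    by (auto simp: in_monomials lookup_mono_part)
  have y: "single (y_part \<alpha>) c \<in> carrier (ky m)"
    by (rule single_pol_ring) (use mono_part_monomials[OF assms(1), of "range YV"] in \<open>auto simp: in_monomials\<close>)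
  have eq: "act A (single \<alpha> c) g \<mu> = (\<Oplus>\<nu>\<in>?D. if xz_part \<alpha> = \<nu> then ?f \<nu> else \<zero>)"
    unfolding act_def using assms(2) y by (intro M.finsum_cong') (auto simp: ycoeff_single smult_pol)
  show ?thesis
  proof (cases "\<exists>\<rho>. \<mu> = xz_part \<alpha> + \<rho>")
    case True
    moreover have "finite ?D" using finite_divisors[of \<mu>] by (auto intro: finite_subset)
    ultimately show ?thesis unfolding eq using M.finsum_singleton[of "xz_part \<alpha>" ?D ?f] xz y assms(2) by (auto simp: Pi_def)
  next
    case False
    then have "(\<Oplus>\<nu>\<in>?D. if xz_part \<alpha> = \<nu> then ?f \<nu> else \<zero>) = (\<Oplus>\<nu>\<in>?D. \<zero>)"
      by (intro M.finsum_cong') auto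
    then show ?thesis unfolding eq using False by simp
  qed
qed

lemma act_ky:
  assumes "p \<in> carrier (ky m)" "\<And>\<mu>. g \<mu> \<in> carrier A"
  shows "act A p g = (\<lambda>\<mu>. p \<odot> g \<mu>)"
  using assms(1)
proof (induction p rule: pol_ring_induct)
  case (single \<alpha> c)
  have *: "lookup \<alpha> v = 0" if "v \<notin> range YV" for v
  proof -
    have "v \<notin> yvars m" using that by auto
    with single show ?thesis by (simp add: in_monomials)
  qed
  have "xz_part \<alpha> = 0" "y_part \<alpha> = \<alpha>"
    using * single by (auto intro!: poly_mapping_eqI simp: lookup_mono_part in_monomials)
  moreover have "\<alpha> \<in> monomials (xvars n \<union> yvars m \<union> zvars l)" for n l using single by (auto simp: in_monomials)
  ultimately show ?case using act_single[OF _ assms(2)] by auto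
qed (use assms(2) in \<open>auto simp: act_zero smult_pol act_add_left[OF ky_kxyz ky_kxyz]\<close>)

text \<open>Both sides are additive in \<open>p\<close> and in \<open>q\<close>, which leaves two
  monomials. Their \<open>x,z\<close>-parts shift one after the other and their
  \<open>y\<close>-parts multiply.\<close>

lemma act_mult:
  assumes "p \<in> carrier (kxyz n m l)" "q \<in> carrier (kxyz n m l)" "\<And>\<mu>. g \<mu> \<in> carrier A"
  shows "act A (p * q) g = act A p (act A q g)"
  using assms(1)
proof (induction p rule: pol_ring_induct)
  case zero
  show ?case using assms act_closed[OF assms(2,3)] by (simp add: act_zero)
next
  case (single \<alpha> a)
  let ?S = "xvars n \<union> yvars m \<union> zvars l"
  have y: "single (y_part \<beta>) c \<in> carrier (ky m)" if "\<beta> \<in> monomials ?S" for \<beta> and c :: 'k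
    by (rule single_pol_ring) (use mono_part_monomials[OF that, of "range YV"] in \<open>auto simp: in_monomials\<close>)
  have [simp]: "mono_part T (\<alpha> + \<beta>) = mono_part T \<alpha> + mono_part T \<beta>" for T \<beta>
    by (rule poly_mapping_eqI) (simp add: lookup_mono_part lookup_add)
  from assms(2) show ?case
  proof (induction q rule: pol_ring_induct)
    case zero
    have "\<zero> \<in> carrier A" by simp
    then have "act A (single \<alpha> a) (\<lambda>_. \<zero>) = (\<lambda>_. \<zero>)"
      using act_single[OF single, of "\<lambda>_. \<zero>" a] y[OF single] by auto
    then show ?case using assms(3) by (simp add: act_zero)
  next
    case (single \<beta> b)
    note s = \<open>\<alpha> \<in> monomials ?S\<close> \<open>\<beta> \<in> monomials ?S\<close>
    have cl: "act A (single \<beta> b) g \<mu> \<in> carrier A" for \<mu>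
      by (rule act_closed[OF single_pol_ring[OF s(2)] assms(3)])
    show ?case
    proof
      fix \<mu>
      show "act A (single \<alpha> a * single \<beta> b) g \<mu> = act A (single \<alpha> a) (act A (single \<beta> b) g) \<mu>"
      proof (cases "\<exists>\<rho>. \<mu> = xz_part \<alpha> + \<rho>")
        case True
        then obtain \<rho> where \<mu>: "\<mu> = xz_part \<alpha> + \<rho>" by auto
        have [simp]: "xz_part \<alpha> + \<rho> - (xz_part \<alpha> + xz_part \<beta>) = \<rho> - xz_part \<beta>"
          by (rule add_diff_cancel_left)
        have "(\<exists>\<rho>'. xz_part \<alpha> + \<rho> = xz_part \<alpha> + xz_part \<beta> + \<rho>') \<longleftrightarrow> (\<exists>\<rho>'. \<rho> = xz_part \<beta> + \<rho>')"
          by (simp add: add.assoc)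
        then show ?thesis unfolding \<mu> using s y[OF s(1), of a] y[OF s(2), of b] assms(3)
          by (simp add: mult_single act_single cl smult_pol(2)[symmetric])
      next
        case False
        then have "\<not> (\<exists>\<rho>. \<mu> = xz_part \<alpha> + xz_part \<beta> + \<rho>)" by (auto simp: add.assoc)
        with False show ?thesis using s assms(3) act_single[OF s(1), where g = "act A (single \<beta> b) g" and c = a and \<mu> = \<mu>] cl
            by (simp add: act_single mult_single)
      qed
    qed
  next
    case (add q q')
    note s = single_pol_ring[OF \<open>\<alpha> \<in> monomials ?S\<close>, of a]
    show ?case using add s assms(3)
      by (simp add: distrib_left act_add_left[of _ n l] act_add_right[of _ n l] act_closed[of _ n l])
  qed
next
  case (add p p')
  then show ?case using assms act_closed[OF assms(2,3)]
    by (simp add: distrib_right act_add_left[of _ n l])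
qed

abbreviation "B n l \<equiv> poly_ext n l A"

lemma poly_ext_abelian_group: "abelian_group (poly_ext n l A)"
proof (rule abelian_groupI)
  fix g h assume "g \<in> carrier (B n l)" "h \<in> carrier (B n l)"
  moreover from this have "finite ({\<mu>. g \<mu> \<noteq> \<zero>} \<union> {\<mu>. h \<mu> \<noteq> \<zero>})" by (auto simp: poly_ext_def)
  then have "finite {\<mu>. g \<mu> \<oplus> h \<mu> \<noteq> \<zero>}" by (rule rev_finite_subset) auto
  ultimately show "g \<oplus>\<^bsub>B n l\<^esub> h \<in> carrier (B n l)" by (auto simp: poly_ext_def)
next
  fix g assume g: "g \<in> carrier (B n l)"
  then have "finite {\<mu>. \<ominus> g \<mu> \<noteq> \<zero>}" by (auto simp: poly_ext_def elim: rev_finite_subset)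
  with g show "\<exists>h\<in>carrier (B n l). h \<oplus>\<^bsub>B n l\<^esub> g = \<zero>\<^bsub>B n l\<^esub>"
    by (intro bexI[of _ "\<lambda>\<mu>. \<ominus> g \<mu>"]) (auto simp: poly_ext_def M.l_neg)
qed (auto simp: poly_ext_def M.a_ac)

lemma act_poly_ext:
  assumes "p \<in> carrier (kxyz n m l)" "g \<in> carrier (B n l)"
  shows "act A p g \<in> carrier (B n l)"
  using assms(1)
proof (induction p rule: pol_ring_induct)
  case zero
  show ?case using assms(2) by (simp add: act_zero poly_ext_def)
next
  case (single \<alpha> c)
  have g: "\<And>\<mu>. g \<mu> \<in> carrier A" using assms(2) by (auto simp: poly_ext_def)
  have y: "single (y_part \<alpha>) c \<in> carrier (ky m)"
    by (rule single_pol_ring) (use mono_part_monomials[OF single, of "range YV"] in \<open>auto simp: in_monomials\<close>)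
  have xz: "xz_part \<alpha> \<in> monomials (xvars n \<union> zvars l)"
    using mono_part_monomials[OF single, of "range XV \<union> range ZV"] by (auto simp: in_monomials)
  have "{\<mu>. act A (single \<alpha> c) g \<mu> \<noteq> \<zero>} \<subseteq> (+) (xz_part \<alpha>) ` {\<mu>. g \<mu> \<noteq> \<zero>}"
    using y by (auto simp: act_single[OF single g] split: if_splits)
  then have "finite {\<mu>. act A (single \<alpha> c) g \<mu> \<noteq> \<zero>}"
    by (rule finite_subset) (use assms(2) in \<open>auto simp: poly_ext_def\<close>)
  moreover have "act A (single \<alpha> c) g \<mu> = \<zero>" if "\<mu> \<notin> monomials (xvars n \<union> zvars l)" for \<mu>
    using that xz assms(2) y by (auto simp: act_single[OF single g] poly_ext_def)
  ultimately show ?case using act_closed[OF single_pol_ring[OF single] g] by (auto simp: poly_ext_def)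
next
  case (add p q)
  then show ?case using abelian_group.axioms(1)[OF poly_ext_abelian_group, of n l] assms(2)
    abelian_monoid.a_closed[OF abelian_group.axioms(1)[OF poly_ext_abelian_group, of n l] add(3,4)]
    by (subst act_add_left[of _ n l]) (auto simp: poly_ext_def)
qed

lemma poly_ext_module: "module (kxyz n m l) (poly_ext n l A)"
proof (rule moduleI[OF cring_pol_ring poly_ext_abelian_group])
  fix p q :: "'k pol" and g assume "p \<in> carrier (kxyz n m l)" "q \<in> carrier (kxyz n m l)" "g \<in> carrier (B n l)"
  then show "(p \<otimes>\<^bsub>kxyz n m l\<^esub> q) \<odot>\<^bsub>B n l\<^esub> g = p \<odot>\<^bsub>B n l\<^esub> (q \<odot>\<^bsub>B n l\<^esub> g)"
    by (simp add: act_mult poly_ext_def)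
qed (auto simp: act_poly_ext, auto simp: poly_ext_def act_add_left[of _ n l] act_add_right[of _ n l] act_ky smult_pol)

end

text \<open>The action of \<open>k[x,y,z]\<close> consists of sums and of multiplications by
  elements of \<open>k[y]\<close>, and \<open>\<phi>\<close> respects both.\<close>

lemma coeffwise_act:
  assumes "module (ky m) A" "module (ky m) A'" "linear_map (ky m) A A' \<phi>" "p \<in> carrier (kxyz n m l)"
    "\<And>\<mu>. g \<mu> \<in> carrier A"
  shows "\<phi> (act A p g \<mu>) = act A' p (\<lambda>\<mu>. \<phi> (g \<mu>)) \<mu>"
proof -
  interpret A: coeff_module m A using assms(1) by (simp add: coeff_module_def pol_module_def)
  interpret A': coeff_module m A' using assms(2) by (simp add: coeff_module_def pol_module_def)
  have a: "\<phi> (v \<oplus>\<^bsub>A\<^esub> w) = \<phi> v \<oplus>\<^bsub>A'\<^esub> \<phi> w" if "v \<in> carrier A" "w \<in> carrier A" for v w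
    using assms(3) that by (auto simp: linear_map_def)
  have c: "\<phi> \<in> carrier A \<rightarrow> carrier A'" using assms(3) by (auto simp: linear_map_def)
  have s: "\<phi> (r \<odot>\<^bsub>A\<^esub> v) = r \<odot>\<^bsub>A'\<^esub> \<phi> v" if "r \<in> carrier (ky m)" "v \<in> carrier A" for r v
    using assms(3) that by (auto simp: linear_map_def)
  have z: "\<phi> \<zero>\<^bsub>A\<^esub> = \<zero>\<^bsub>A'\<^esub>"
    using s[of 0 "\<zero>\<^bsub>A\<^esub>"] funcset_mem[OF c, of "\<zero>\<^bsub>A\<^esub>"] by (auto simp: A.smult_pol A'.smult_pol)
  show ?thesis unfolding act_def
    by (subst finsum_additive[of _ A', OF A.M.abelian_monoid_axioms A'.M.abelian_monoid_axioms c z a])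
      (use assms c in \<open>auto intro!: A'.M.finsum_cong' A.smult_closed A'.smult_closed s ycoeff_closed\<close>)
qed

section \<open>Homotopies of linear factorisations\<close>

lemma linear_mapD:
  assumes "linear_map R M N f"
  shows "v \<in> carrier M \<Longrightarrow> f v \<in> carrier N"
    and "v \<in> carrier M \<Longrightarrow> w \<in> carrier M \<Longrightarrow> f (v \<oplus>\<^bsub>M\<^esub> w) = f v \<oplus>\<^bsub>N\<^esub> f w"
    and "r \<in> carrier R \<Longrightarrow> v \<in> carrier M \<Longrightarrow> f (r \<odot>\<^bsub>M\<^esub> v) = r \<odot>\<^bsub>N\<^esub> f v"
  using assms by (auto simp: linear_map_def)

lemma linear_mapI:
  assumes "\<And>v. v \<in> carrier M \<Longrightarrow> f v \<in> carrier N"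
    and "\<And>v w. v \<in> carrier M \<Longrightarrow> w \<in> carrier M \<Longrightarrow> f (v \<oplus>\<^bsub>M\<^esub> w) = f v \<oplus>\<^bsub>N\<^esub> f w"
    and "\<And>r v. r \<in> carrier R \<Longrightarrow> v \<in> carrier M \<Longrightarrow> f (r \<odot>\<^bsub>M\<^esub> v) = r \<odot>\<^bsub>N\<^esub> f v"
  shows "linear_map R M N f"
  using assms by (auto simp: linear_map_def)

lemma linear_map_zero_minus:
  assumes "module R M" "module R N" "linear_map R M N f"
  shows "f \<zero>\<^bsub>M\<^esub> = \<zero>\<^bsub>N\<^esub>" and "v \<in> carrier M \<Longrightarrow> f (\<ominus>\<^bsub>M\<^esub> v) = \<ominus>\<^bsub>N\<^esub> f v"
    and "v \<in> carrier M \<Longrightarrow> w \<in> carrier M \<Longrightarrow> f (v \<ominus>\<^bsub>M\<^esub> w) = f v \<ominus>\<^bsub>N\<^esub> f w"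
proof -
  interpret M: module R M by fact
  interpret N: module R N by fact
  note f = linear_mapD[OF assms(3)]
  show z: "f \<zero>\<^bsub>M\<^esub> = \<zero>\<^bsub>N\<^esub>"
    using f(3)[of "\<zero>\<^bsub>R\<^esub>" "\<zero>\<^bsub>M\<^esub>"] f(1)[of "\<zero>\<^bsub>M\<^esub>"] by simp
  show m: "f (\<ominus>\<^bsub>M\<^esub> v) = \<ominus>\<^bsub>N\<^esub> f v" if "v \<in> carrier M" for v
    using f(2)[of "\<ominus>\<^bsub>M\<^esub> v" v] z f(1) that by (simp add: M.M.l_neg N.M.minus_equality)
  show "f (v \<ominus>\<^bsub>M\<^esub> w) = f v \<ominus>\<^bsub>N\<^esub> f w" if "v \<in> carrier M" "w \<in> carrier M"
    using f(2)[of v "\<ominus>\<^bsub>M\<^esub> w"] m[of w] that by (simp add: a_minus_def)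
qed

locale factorisation = 
  fixes R :: "('r, 'p) ring_scheme" and w :: 'r and M :: "('r, 'm, 'q) factorisation_scheme"
  assumes lf: "linear_factorisation R w M"
begin

abbreviation "D \<equiv> differential M"

lemma module: "module R M" and D_linear: "linear_map R M M D" and w_closed: "w \<in> carrier R"
  and D_grade: "v \<in> grade M s \<Longrightarrow> D v \<in> grade M (s + 1)"
  and D_square: "v \<in> carrier M \<Longrightarrow> D (D v) = w \<odot>\<^bsub>M\<^esub> v"
  and grade_submodule: "submodule (grade M s) R M"
  using lf unfolding linear_factorisation_def z2_graded_module_def by blast+

sublocale module R M by (rule module)

lemmas D_closed = linear_mapD(1)[OF D_linear] and D_add = linear_mapD(2)[OF D_linear]
  and D_smult = linear_mapD(3)[OF D_linear]
  and D_zero = linear_map_zero_minus(1)[OF module module D_linear]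
  and D_uminus = linear_map_zero_minus(2)[OF module module D_linear]
  and D_minus = linear_map_zero_minus(3)[OF module module D_linear]

lemma grade_closed: "v \<in> grade M s \<Longrightarrow> v \<in> carrier M"
  and grade_zero: "\<zero>\<^bsub>M\<^esub> \<in> grade M s"
  and grade_add: "u \<in> grade M s \<Longrightarrow> v \<in> grade M s \<Longrightarrow> u \<oplus>\<^bsub>M\<^esub> v \<in> grade M s"
  and grade_minus: "u \<in> grade M s \<Longrightarrow> v \<in> grade M s \<Longrightarrow> u \<ominus>\<^bsub>M\<^esub> v \<in> grade M s"
proof -
  note E = submoduleE[OF grade_submodule[of s]]
  obtain x where "x \<in> grade M s" using E(2) by auto
  then show "\<zero>\<^bsub>M\<^esub> \<in> grade M s" using E(1) E(4)[of "\<zero>\<^bsub>R\<^esub>" x] by auto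
qed (use submoduleE[OF grade_submodule[of s]] in \<open>auto simp: a_minus_def\<close>)

end

lemma (in abelian_group) minus_add_swap:
  assumes "a \<in> carrier G" "b \<in> carrier G" "c \<in> carrier G" "d \<in> carrier G"
  shows "(a \<oplus> b) \<ominus> (c \<oplus> d) = (a \<ominus> c) \<oplus> (b \<ominus> d)"
  using assms by (simp add: a_minus_def minus_add a_ac)

lemma (in abelian_group) add_add_swap:
  assumes "a \<in> carrier G" "b \<in> carrier G" "c \<in> carrier G" "d \<in> carrier G"
  shows "(a \<oplus> b) \<oplus> (c \<oplus> d) = (a \<oplus> c) \<oplus> (b \<oplus> d)"
  using assms by (simp add: a_ac)

lemma (in abelian_group) minus_telescope:
  assumes "a \<in> carrier G" "b \<in> carrier G" "c \<in> carrier G"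
  shows "(a \<ominus> b) \<oplus> (b \<ominus> c) = a \<ominus> c"
  using assms by (simp add: a_minus_def a_assoc) (metis a_assoc a_inv_closed l_neg l_zero)

lemma (in abelian_group) minus_eq_zero:
  "a \<in> carrier G \<Longrightarrow> b \<in> carrier G \<Longrightarrow> a \<ominus> b = \<zero> \<longleftrightarrow> a = b"
  by (metis a_minus_def minus_equality minus_minus r_neg a_inv_closed)

lemma (in abelian_group) minus_swap_inv:
  "a \<in> carrier G \<Longrightarrow> b \<in> carrier G \<Longrightarrow> \<ominus> (a \<ominus> b) = b \<ominus> a"
  by (simp add: a_minus_def minus_add a_comm)

text \<open>The arithmetic of \<open>ex_section\<close>: \<open>a \<ominus> b\<close> is the defect
  of a section, \<open>z \<oplus> x\<close> its contraction identity,
  \<open>x \<oplus> y = \<zero>\<close> comes from the defect anticommuting with the differentials,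
  and the conclusion is the equation of a morphism.\<close>

lemma (in abelian_group) minus_rearrange:
  assumes "a \<in> carrier G" "b \<in> carrier G" "x \<in> carrier G" "y \<in> carrier G" "z \<in> carrier G"
    and "z \<oplus> x = a \<ominus> b" "x \<oplus> y = \<zero>"
  shows "b \<ominus> y = a \<ominus> z"
proof -
  have y: "x = \<ominus> y" using assms(3,4,7) by (metis minus_equality)
  have "a = (a \<ominus> b) \<oplus> b" using assms(1,2) by (simp add: a_minus_def a_assoc l_neg)
  also have "\<dots> = (x \<oplus> b) \<oplus> z" using assms(1-5) unfolding assms(6)[symmetric] by (simp add: a_ac)
  finally have "a \<ominus> z = x \<oplus> b" using assms(1-5) by (simp add: a_minus_def a_assoc r_neg)
  then show ?thesis using assms(1-5) by (simp add: y a_minus_def a_comm)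
qed

lemma (in abelian_group) minus_zero_right [simp]: "a \<in> carrier G \<Longrightarrow> a \<ominus> \<zero> = a"
  by (simp add: a_minus_def)

lemma bit_add_1_1: "s + 1 + 1 = (s :: bit)"
  by (simp add: add.assoc)

lemma linear_map_comp: "linear_map R M N f \<Longrightarrow> linear_map R N P g \<Longrightarrow> linear_map R M P (g \<circ> f)"
  by (auto simp: linear_map_def Pi_iff)

lemma linear_map_minus:
  assumes "module R N" "linear_map R M N f" "linear_map R M N g"
  shows "linear_map R M N (\<lambda>v. f v \<ominus>\<^bsub>N\<^esub> g v)"
proof -
  interpret N: module R N by fact
  note f = linear_mapD[OF assms(2)] and g = linear_mapD[OF assms(3)]
  show ?thesis
    by (rule linear_mapI) (simp_all add: f g N.M.minus_add_swap, simp add: a_minus_def f g N.smult_r_distr N.smult_r_minus)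
qed

lemma linear_map_add:
  assumes "module R N" "linear_map R M N f" "linear_map R M N g"
  shows "linear_map R M N (\<lambda>v. f v \<oplus>\<^bsub>N\<^esub> g v)"
proof -
  interpret N: module R N by fact
  note f = linear_mapD[OF assms(2)] and g = linear_mapD[OF assms(3)]
  show ?thesis
    by (rule linear_mapI) (simp_all add: f g N.M.a_ac N.smult_r_distr)
qed

lemma morphism_comp:
  "factorisation_morphism R M N f \<Longrightarrow> factorisation_morphism R N P g \<Longrightarrow> factorisation_morphism R M P (g \<circ> f)"
  unfolding factorisation_morphism_def
  by (auto intro: linear_map_comp dest: linear_mapD(1) simp: image_subset_iff)

lemma homotopic_cong:
  assumes "homotopic R M N f g" "\<And>v. v \<in> carrier M \<Longrightarrow> f v = f' v" "\<And>v. v \<in> carrier M \<Longrightarrow> g v = g' v"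
  shows "homotopic R M N f' g'"
  using assms unfolding homotopic_def by simp

lemma homotopic_refl:
  assumes "linear_factorisation R w M" "linear_factorisation R w N" "linear_map R M N f"
  shows "homotopic R M N f f"
proof -
  interpret M: factorisation R w M by standard fact
  interpret N: factorisation R w N by standard fact
  show ?thesis unfolding homotopic_def
    by (rule exI[of _ "\<lambda>_. \<zero>\<^bsub>N\<^esub>"])
      (auto intro!: linear_mapI simp: N.D_zero N.grade_zero linear_mapD[OF assms(3)] N.M.minus_eq_zero)
qed

lemma homotopic_trans:
  assumes "linear_factorisation R w M" "linear_factorisation R w N"
    and "\<And>v. v \<in> carrier M \<Longrightarrow> f v \<in> carrier N \<and> g v \<in> carrier N \<and> k v \<in> carrier N"
    and "homotopic R M N f g" "homotopic R M N g k"
  shows "homotopic R M N f k"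
proof -
  interpret M: factorisation R w M by standard fact
  interpret N: factorisation R w N by standard fact
  obtain h where h: "linear_map R M N h" "\<forall>s. h ` grade M s \<subseteq> grade N (s + 1)"
    "\<forall>v\<in>carrier M. f v \<ominus>\<^bsub>N\<^esub> g v = differential N (h v) \<oplus>\<^bsub>N\<^esub> h (differential M v)"
    using assms(4) unfolding homotopic_def by blast
  obtain h' where h': "linear_map R M N h'" "\<forall>s. h' ` grade M s \<subseteq> grade N (s + 1)"
    "\<forall>v\<in>carrier M. g v \<ominus>\<^bsub>N\<^esub> k v = differential N (h' v) \<oplus>\<^bsub>N\<^esub> h' (differential M v)"
    using assms(5) unfolding homotopic_def by blast
  show ?thesis unfolding homotopic_def
  proof (intro exI[of _ "\<lambda>v. h v \<oplus>\<^bsub>N\<^esub> h' v"] conjI ballI allI)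
    show "linear_map R M N (\<lambda>v. h v \<oplus>\<^bsub>N\<^esub> h' v)" by (rule linear_map_add[OF N.module h(1) h'(1)])
    show "(\<lambda>v. h v \<oplus>\<^bsub>N\<^esub> h' v) ` grade M s \<subseteq> grade N (s + 1)" for s
      using h(2) h'(2) N.grade_add unfolding image_subset_iff by blast
    fix v assume v: "v \<in> carrier M"
    note cl = linear_mapD(1)[OF h(1)] linear_mapD(1)[OF h'(1)] v M.D_closed N.D_closed
    have "f v \<ominus>\<^bsub>N\<^esub> k v = (f v \<ominus>\<^bsub>N\<^esub> g v) \<oplus>\<^bsub>N\<^esub> (g v \<ominus>\<^bsub>N\<^esub> k v)"
      using assms(3)[OF v] by (simp add: N.M.minus_telescope)
    also have "\<dots> = differential N (h v \<oplus>\<^bsub>N\<^esub> h' v) \<oplus>\<^bsub>N\<^esub> (h (differential M v) \<oplus>\<^bsub>N\<^esub> h' (differential M v))"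
      using h(3) h'(3) by (simp add: cl N.D_add N.M.a_ac)
    finally show "f v \<ominus>\<^bsub>N\<^esub> k v = \<dots>" .
  qed
qed

lemma homotopic_sym:
  assumes "linear_factorisation R w M" "linear_factorisation R w N"
    and "\<And>v. v \<in> carrier M \<Longrightarrow> f v \<in> carrier N \<and> g v \<in> carrier N" and "homotopic R M N f g"
  shows "homotopic R M N g f"
proof -
  interpret M: factorisation R w M by standard fact
  interpret N: factorisation R w N by standard fact
  obtain h where h: "linear_map R M N h" "\<forall>s. h ` grade M s \<subseteq> grade N (s + 1)"
    "\<forall>v\<in>carrier M. f v \<ominus>\<^bsub>N\<^esub> g v = differential N (h v) \<oplus>\<^bsub>N\<^esub> h (differential M v)"
    using assms(4) unfolding homotopic_def by blast
  have z: "linear_map R M N (\<lambda>_. \<zero>\<^bsub>N\<^esub>)" by (auto intro!: linear_mapI)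
  show ?thesis unfolding homotopic_def
  proof (intro exI[of _ "\<lambda>v. \<zero>\<^bsub>N\<^esub> \<ominus>\<^bsub>N\<^esub> h v"] conjI ballI allI)
    show "linear_map R M N (\<lambda>v. \<zero>\<^bsub>N\<^esub> \<ominus>\<^bsub>N\<^esub> h v)" by (rule linear_map_minus[OF N.module z h(1)])
    show "(\<lambda>v. \<zero>\<^bsub>N\<^esub> \<ominus>\<^bsub>N\<^esub> h v) ` grade M s \<subseteq> grade N (s + 1)" for s
      using h(2) N.grade_minus[OF N.grade_zero] unfolding image_subset_iff by blast
    fix v assume v: "v \<in> carrier M"
    note cl = linear_mapD(1)[OF h(1)] v M.D_closed N.D_closed
    have "g v \<ominus>\<^bsub>N\<^esub> f v = \<ominus>\<^bsub>N\<^esub> (f v \<ominus>\<^bsub>N\<^esub> g v)" using assms(3)[OF v] by (simp add: N.M.minus_swap_inv)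
    also have "\<dots> = \<ominus>\<^bsub>N\<^esub> (differential N (h v) \<oplus>\<^bsub>N\<^esub> h (differential M v))" using h(3) v by simp
    also have "\<dots> = differential N (\<zero>\<^bsub>N\<^esub> \<ominus>\<^bsub>N\<^esub> h v) \<oplus>\<^bsub>N\<^esub> (\<zero>\<^bsub>N\<^esub> \<ominus>\<^bsub>N\<^esub> h (differential M v))"
      by (simp add: a_minus_def cl N.D_uminus N.M.minus_add)
    finally show "g v \<ominus>\<^bsub>N\<^esub> f v = \<dots>" .
  qed
qed

lemma homotopic_comp_left:
  assumes "linear_factorisation R w M" "linear_factorisation R w N" "linear_factorisation R w P"
    and "\<And>v. v \<in> carrier M \<Longrightarrow> f v \<in> carrier N \<and> g v \<in> carrier N" and "homotopic R M N f g"
    and k: "factorisation_morphism R N P k"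
  shows "homotopic R M P (k \<circ> f) (k \<circ> g)"
proof -
  interpret M: factorisation R w M by standard fact
  interpret N: factorisation R w N by standard fact
  interpret P: factorisation R w P by standard fact
  obtain h where h: "linear_map R M N h" "\<forall>s. h ` grade M s \<subseteq> grade N (s + 1)"
    "\<forall>v\<in>carrier M. f v \<ominus>\<^bsub>N\<^esub> g v = differential N (h v) \<oplus>\<^bsub>N\<^esub> h (differential M v)"
    using assms(5) unfolding homotopic_def by blast
  have kl: "linear_map R N P k" and kg: "\<And>s. k ` grade N s \<subseteq> grade P s"
    and kd: "\<And>v. v \<in> carrier N \<Longrightarrow> k (differential N v) = differential P (k v)"
    using k by (auto simp: factorisation_morphism_def)
  show ?thesis unfolding homotopic_def
  proof (intro exI[of _ "k \<circ> h"] conjI ballI allI)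
    show "linear_map R M P (k \<circ> h)" by (rule linear_map_comp[OF h(1) kl])
    show "(k \<circ> h) ` grade M s \<subseteq> grade P (s + 1)" for s
      using h(2) kg by (auto simp: image_subset_iff)
    fix v assume v: "v \<in> carrier M"
    note cl = linear_mapD(1)[OF h(1)] v M.D_closed N.D_closed
    show "(k \<circ> f) v \<ominus>\<^bsub>P\<^esub> (k \<circ> g) v = differential P ((k \<circ> h) v) \<oplus>\<^bsub>P\<^esub> (k \<circ> h) (differential M v)"
      using linear_map_zero_minus(3)[OF N.module P.module kl, of "f v" "g v"] assms(4)[OF v] h(3) v
      by (simp add: cl linear_mapD(2)[OF kl] kd)
  qed
qed

lemma homotopic_comp_right:
  assumes "homotopic R M N f g" and k: "factorisation_morphism R L M k"
  shows "homotopic R L N (f \<circ> k) (g \<circ> k)"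
proof -
  obtain h where h: "linear_map R M N h" "\<forall>s. h ` grade M s \<subseteq> grade N (s + 1)"
    "\<forall>v\<in>carrier M. f v \<ominus>\<^bsub>N\<^esub> g v = differential N (h v) \<oplus>\<^bsub>N\<^esub> h (differential M v)"
    using assms(1) unfolding homotopic_def by blast
  have kl: "linear_map R L M k" and kg: "\<And>s. k ` grade L s \<subseteq> grade M s"
    and kd: "\<And>v. v \<in> carrier L \<Longrightarrow> k (differential L v) = differential M (k v)"
    using k by (auto simp: factorisation_morphism_def)
  show ?thesis unfolding homotopic_def
  proof (intro exI[of _ "h \<circ> k"] conjI ballI allI)
    show "linear_map R L N (h \<circ> k)" by (rule linear_map_comp[OF kl h(1)])
    show "(h \<circ> k) ` grade L s \<subseteq> grade N (s + 1)" for s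
      using h(2) kg by (auto simp: image_subset_iff)
    show "(f \<circ> k) v \<ominus>\<^bsub>N\<^esub> (g \<circ> k) v = differential N ((h \<circ> k) v) \<oplus>\<^bsub>N\<^esub> (h \<circ> k) (differential L v)"
      if "v \<in> carrier L" for v
      using h(3) that linear_mapD(1)[OF kl] by (simp add: kd)
  qed
qed

lemma morphism_closed: "factorisation_morphism R M N f \<Longrightarrow> v \<in> carrier M \<Longrightarrow> f v \<in> carrier N"
  by (auto simp: factorisation_morphism_def dest: linear_mapD(1))

lemma inverse_homotopy_equivalences_comp:
  assumes "linear_factorisation R w M" "linear_factorisation R w N" "linear_factorisation R w P"
    and "inverse_homotopy_equivalences R M N f f'" "inverse_homotopy_equivalences R N P g g'"
  shows "inverse_homotopy_equivalences R M P (g \<circ> f) (f' \<circ> g')"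
proof -
  have f: "factorisation_morphism R M N f" "factorisation_morphism R N M f'"
    "homotopic R M M (f' \<circ> f) (\<lambda>v. v)" "homotopic R N N (f \<circ> f') (\<lambda>v. v)"
    and g: "factorisation_morphism R N P g" "factorisation_morphism R P N g'"
    "homotopic R N N (g' \<circ> g) (\<lambda>v. v)" "homotopic R P P (g \<circ> g') (\<lambda>v. v)"
    using assms(4,5) by (auto simp: inverse_homotopy_equivalences_def)
  note cl = morphism_closed[OF f(1)] morphism_closed[OF f(2)] morphism_closed[OF g(1)] morphism_closed[OF g(2)]
  have "homotopic R M M (f' \<circ> ((g' \<circ> g) \<circ> f)) (f' \<circ> ((\<lambda>v. v) \<circ> f))"
    by (intro homotopic_comp_left[OF assms(1,2,1)] homotopic_comp_right[OF g(3)] f) (auto simp: cl)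
  moreover have "homotopic R M M (f' \<circ> ((\<lambda>v. v) \<circ> f)) (\<lambda>v. v)"
    using f(3) by (simp add: comp_def)
  ultimately have 1: "homotopic R M M (f' \<circ> g' \<circ> (g \<circ> f)) (\<lambda>v. v)"
    by (intro homotopic_trans[OF assms(1,1), of "f' \<circ> g' \<circ> (g \<circ> f)" "f' \<circ> ((\<lambda>v. v) \<circ> f)" "\<lambda>v. v"])
      (auto simp: cl comp_def)
  have "homotopic R P P (g \<circ> ((f \<circ> f') \<circ> g')) (g \<circ> ((\<lambda>v. v) \<circ> g'))"
    by (intro homotopic_comp_left[OF assms(3,2,3)] homotopic_comp_right[OF f(4)] g) (auto simp: cl)
  moreover have "homotopic R P P (g \<circ> ((\<lambda>v. v) \<circ> g')) (\<lambda>v. v)"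
    using g(4) by (simp add: comp_def)
  ultimately have 2: "homotopic R P P (g \<circ> f \<circ> (f' \<circ> g')) (\<lambda>v. v)"
    by (intro homotopic_trans[OF assms(3,3), of "g \<circ> f \<circ> (f' \<circ> g')" "g \<circ> ((\<lambda>v. v) \<circ> g')" "\<lambda>v. v"])
      (auto simp: cl comp_def)
  show ?thesis unfolding inverse_homotopy_equivalences_def
    using morphism_comp[OF f(1) g(1)] morphism_comp[OF g(2) f(2)] 1 2 by blast
qed

text \<open>Two out of three. Up to homotopy
  \<open>e p' q = q' q e p' q = q' p p' q = q' q = 1\<close>, with \<open>q e = p\<close> used in
  the middle, and \<open>p' q e = p' p\<close> is homotopic to the identity directly. This yields
  the homotopy inverse of the completion map.\<close>

lemma inverse_homotopy_equivalences_cancel: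
  assumes "linear_factorisation R w M" "linear_factorisation R w N" "linear_factorisation R w P"
    and "inverse_homotopy_equivalences R M P p p'" "inverse_homotopy_equivalences R N P q q'"
    and e: "factorisation_morphism R M N e" and qe: "\<And>v. v \<in> carrier M \<Longrightarrow> q (e v) = p v"
  shows "inverse_homotopy_equivalences R M N e (p' \<circ> q)"
proof -
  have p: "factorisation_morphism R M P p" "factorisation_morphism R P M p'"
    "homotopic R M M (p' \<circ> p) (\<lambda>v. v)" "homotopic R P P (p \<circ> p') (\<lambda>v. v)"
    and q: "factorisation_morphism R N P q" "factorisation_morphism R P N q'"
    "homotopic R N N (q' \<circ> q) (\<lambda>v. v)" "homotopic R P P (q \<circ> q') (\<lambda>v. v)"
    using assms(4,5) by (auto simp: inverse_homotopy_equivalences_def)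
  note cl = morphism_closed[OF p(1)] morphism_closed[OF p(2)] morphism_closed[OF q(1)] morphism_closed[OF q(2)]
    morphism_closed[OF e]
  note pq = morphism_comp[OF q(1) p(2)]
  have 1: "homotopic R M M (p' \<circ> q \<circ> e) (\<lambda>v. v)"
    by (rule homotopic_cong[OF p(3)]) (auto simp: qe)
  have "homotopic R N N ((\<lambda>v. v) \<circ> (e \<circ> (p' \<circ> q))) ((q' \<circ> q) \<circ> (e \<circ> (p' \<circ> q)))"
    by (rule homotopic_sym[OF assms(2,2) _ homotopic_comp_right[OF q(3) morphism_comp[OF pq e]]]) (simp add: cl)
  then have a: "homotopic R N N (e \<circ> (p' \<circ> q)) ((q' \<circ> q) \<circ> (e \<circ> (p' \<circ> q)))"
    by (rule homotopic_cong) simp_all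
  have "homotopic R N N (q' \<circ> ((p \<circ> p') \<circ> q)) (q' \<circ> ((\<lambda>v. v) \<circ> q))"
    by (intro homotopic_comp_left[OF assms(2,3,2)] homotopic_comp_right[OF p(4)] q) (auto simp: cl)
  then have b: "homotopic R N N ((q' \<circ> q) \<circ> (e \<circ> (p' \<circ> q))) (q' \<circ> q)"
    by (rule homotopic_cong) (auto simp: cl qe)
  have "homotopic R N N (e \<circ> (p' \<circ> q)) (\<lambda>v. v)"
    by (rule homotopic_trans[OF assms(2,2) _ a homotopic_trans[OF assms(2,2) _ b q(3)]]) (auto simp: cl)
  with 1 e pq show ?thesis unfolding inverse_homotopy_equivalences_def by blast
qed

lemma inverse_homotopy_equivalencesI_iso:
  assumes "linear_factorisation R w M" "linear_factorisation R w N"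
    and f: "factorisation_morphism R M N f" and g: "factorisation_morphism R N M g"
    and "\<And>v. v \<in> carrier M \<Longrightarrow> g (f v) = v" "\<And>v. v \<in> carrier N \<Longrightarrow> f (g v) = v"
  shows "inverse_homotopy_equivalences R M N f g"
proof -
  have "homotopic R M M (\<lambda>v. v) (\<lambda>v. v)" "homotopic R N N (\<lambda>v. v) (\<lambda>v. v)"
    by (rule homotopic_refl[OF assms(1,1)] homotopic_refl[OF assms(2,2)], auto intro: linear_mapI)+
  then show ?thesis using assms unfolding inverse_homotopy_equivalences_def
    by (auto elim!: homotopic_cong)
qed

section \<open>Perturbation\<close>

text \<open>\<open>T = [D, h]\<close> commutes with \<open>D\<close> and is the identity on \<open>ker \<pi>\<close> up to terms of higher filtration,
  so it is invertible there and \<open>h T\<^sup>-\<^sup>1\<close> contracts \<open>ker \<pi>\<close>.\<close>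

locale perturbed_retract = M: factorisation R w M + N: factorisation R w N
  for R :: "('r, 'p) ring_scheme" and w and M :: "('r, 'm, 'q) factorisation_scheme"
    and N :: "('r, 'n, 's) factorisation_scheme" +
  fixes \<pi> :: "'m \<Rightarrow> 'n" and \<sigma> :: "'n \<Rightarrow> 'm" and h :: "'m \<Rightarrow> 'm" and F :: "nat \<Rightarrow> 'm set" and b :: nat
  assumes \<pi>: "factorisation_morphism R M N \<pi>"
    and \<sigma>: "linear_map R N M \<sigma>" "\<And>s v. v \<in> grade N s \<Longrightarrow> \<sigma> v \<in> grade M s"
      "\<And>v. v \<in> carrier N \<Longrightarrow> \<pi> (\<sigma> v) = v"
    and h: "linear_map R M M h" "\<And>s v. v \<in> grade M s \<Longrightarrow> h v \<in> grade M (s + 1)"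
      "\<And>v. v \<in> carrier M \<Longrightarrow> \<pi> (h v) = \<zero>\<^bsub>N\<^esub>"
    and F: "carrier M \<subseteq> F 0" "\<And>v. v \<in> carrier M \<Longrightarrow> v \<in> F b \<Longrightarrow> v = \<zero>\<^bsub>M\<^esub>"
      "\<And>r v. v \<in> carrier M \<Longrightarrow> \<ominus>\<^bsub>M\<^esub> v \<in> F r \<Longrightarrow> v \<in> F r"
    and T_F: "\<And>r v. v \<in> carrier M \<Longrightarrow> \<pi> v = \<zero>\<^bsub>N\<^esub> \<Longrightarrow> v \<in> F r \<Longrightarrow>
      (differential M (h v) \<oplus>\<^bsub>M\<^esub> h (differential M v)) \<ominus>\<^bsub>M\<^esub> v \<in> F (Suc r)"
begin

abbreviation d where "d \<equiv> differential N"
definition T where "T v = M.D (h v) \<oplus>\<^bsub>M\<^esub> h (M.D v)"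
definition C where "C = {v \<in> carrier M. \<pi> v = \<zero>\<^bsub>N\<^esub>}"

lemma pi_linear: "linear_map R M N \<pi>" and pi_D: "v \<in> carrier M \<Longrightarrow> \<pi> (M.D v) = d (\<pi> v)"
  using \<pi> by (auto simp: factorisation_morphism_def)

lemmas pi_simps = linear_mapD[OF pi_linear] linear_map_zero_minus[OF M.module N.module pi_linear] pi_D
lemmas h_simps = linear_mapD[OF h(1)] linear_map_zero_minus[OF M.module M.module h(1)]
lemmas sigma_simps = linear_mapD[OF \<sigma>(1)] linear_map_zero_minus[OF N.module M.module \<sigma>(1)]
lemmas D_simps = M.D_closed M.D_add M.D_smult M.D_zero M.D_uminus M.D_minus M.D_square
lemmas d_simps = N.D_closed N.D_add N.D_smult N.D_zero N.D_uminus N.D_minus N.D_square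

lemma T_linear: "linear_map R M M T"
proof -
  have "linear_map R M M (\<lambda>v. (M.D \<circ> h) v \<oplus>\<^bsub>M\<^esub> (h \<circ> M.D) v)"
    by (intro linear_map_add[OF M.module] linear_map_comp[OF h(1) M.D_linear] linear_map_comp[OF M.D_linear h(1)])
  then show ?thesis by (simp add: T_def[abs_def])
qed

lemmas T_simps = linear_mapD[OF T_linear] linear_map_zero_minus[OF M.module M.module T_linear]

lemma T_grade: "v \<in> grade M s \<Longrightarrow> T v \<in> grade M s"
proof -
  assume v: "v \<in> grade M s"
  show ?thesis unfolding T_def
    using M.grade_add[OF M.D_grade[OF h(2)[OF v]] h(2)[OF M.D_grade[OF v]]] unfolding bit_add_1_1 .
qed

text \<open>As \<open>D\<^sup>2\<close> is multiplication by \<open>w\<close>, which commutes with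
  \<open>h\<close>, both sides are \<open>D h D v + w h v\<close>.\<close>

lemma T_D: "v \<in> carrier M \<Longrightarrow> T (M.D v) = M.D (T v)"
  by (simp add: T_def h_simps D_simps M.w_closed M.M.a_comm)

lemma C_closed: "v \<in> C \<Longrightarrow> v \<in> carrier M" by (simp add: C_def)

lemma C_intros:
  "u \<in> C \<Longrightarrow> v \<in> C \<Longrightarrow> u \<oplus>\<^bsub>M\<^esub> v \<in> C" "u \<in> C \<Longrightarrow> v \<in> C \<Longrightarrow> u \<ominus>\<^bsub>M\<^esub> v \<in> C" "r \<in> carrier R \<Longrightarrow> v \<in> C \<Longrightarrow> r \<odot>\<^bsub>M\<^esub> v \<in> C"
  "v \<in> C \<Longrightarrow> M.D v \<in> C" "v \<in> carrier M \<Longrightarrow> h v \<in> C" "v \<in> C \<Longrightarrow> T v \<in> C" "\<zero>\<^bsub>M\<^esub> \<in> C"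
  by (auto simp: C_def pi_simps D_simps d_simps h T_def h_simps)

lemma T_filtration: "v \<in> C \<Longrightarrow> v \<in> F r \<Longrightarrow> T v \<ominus>\<^bsub>M\<^esub> v \<in> F (Suc r)"
  using T_F by (simp add: C_def T_def)

text \<open>If \<open>T v = 0\<close>, then \<open>T v - v = - v\<close>, so \<open>v\<close> climbs
  the filtration one step at a time and vanishes at step \<open>b\<close>.\<close>

lemma T_inj: "v \<in> C \<Longrightarrow> T v = \<zero>\<^bsub>M\<^esub> \<Longrightarrow> v = \<zero>\<^bsub>M\<^esub>"
proof -
  assume v: "v \<in> C" "T v = \<zero>\<^bsub>M\<^esub>"
  have "v \<in> F r" for r
  proof (induction r)
    case (Suc r)
    have "\<zero>\<^bsub>M\<^esub> \<ominus>\<^bsub>M\<^esub> v \<in> F (Suc r)" using T_filtration[OF v(1) Suc] unfolding v(2) .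
    then have "\<ominus>\<^bsub>M\<^esub> v \<in> F (Suc r)" using C_closed[OF v(1)] by (simp add: a_minus_def)
    then show ?case by (rule F(3)[OF C_closed[OF v(1)]])
  qed (use C_closed[OF v(1)] F(1) in auto)
  then show ?thesis using F(2) C_closed[OF v(1)] by blast
qed

text \<open>Descending induction from step \<open>b\<close>. The error \<open>T v - v\<close> lies
  one step deeper, hence equals \<open>T u\<close>, and \<open>v - u\<close> is a preimage of
  \<open>v\<close>. The correction of a homogeneous error is homogeneous, so the degree can be
  carried along.\<close>

lemma T_surj:
  assumes "v \<in> C" "v \<in> F r" "r \<le> b"
  shows "\<exists>u\<in>C. T u = v \<and> (\<forall>s. v \<in> grade M s \<longrightarrow> u \<in> grade M s)"
  using assms(3,1,2)
proof (induction r arbitrary: v rule: inc_induct)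
  case base
  then have "v = \<zero>\<^bsub>M\<^esub>" using F(2) C_closed by blast
  then show ?case by (intro bexI[of _ "\<zero>\<^bsub>M\<^esub>"]) (auto simp: T_simps C_intros M.grade_zero)
next
  case (step r)
  note v = C_closed[OF step(4)]
  have "T v \<ominus>\<^bsub>M\<^esub> v \<in> C" using step(4) by (intro C_intros)
  moreover have "T v \<ominus>\<^bsub>M\<^esub> v \<in> F (Suc r)" using T_filtration[OF step(4,5)] .
  ultimately obtain u where u: "u \<in> C" "T u = T v \<ominus>\<^bsub>M\<^esub> v"
    "\<forall>s. T v \<ominus>\<^bsub>M\<^esub> v \<in> grade M s \<longrightarrow> u \<in> grade M s" using step.IH by blast
  note uc = C_closed[OF u(1)]
  show ?case
  proof (intro bexI[of _ "v \<ominus>\<^bsub>M\<^esub> u"] conjI allI impI)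
    have "T (v \<ominus>\<^bsub>M\<^esub> u) = T v \<ominus>\<^bsub>M\<^esub> (T v \<ominus>\<^bsub>M\<^esub> v)" using u v uc by (simp add: T_simps)
    also have "\<dots> = v" using v T_simps(1)[OF v]
      by (simp add: a_minus_def M.M.minus_add M.M.r_neg2)
    finally show "T (v \<ominus>\<^bsub>M\<^esub> u) = v" .
    show "v \<ominus>\<^bsub>M\<^esub> u \<in> grade M s" if "v \<in> grade M s" for s
      using that u(3) T_grade[OF that] by (intro M.grade_minus) (auto intro: M.grade_minus)
  qed (intro C_intros step u)
qed

definition S where "S v = (THE u. u \<in> C \<and> T u = v)"

lemma S_ex1: assumes "v \<in> C" shows "\<exists>!u. u \<in> C \<and> T u = v"
proof -
  obtain u where u: "u \<in> C" "T u = v" using T_surj[OF assms, of 0] F(1) C_closed[OF assms] by auto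
  show ?thesis
  proof (rule ex1I[of _ u])
    fix u' assume u': "u' \<in> C \<and> T u' = v"
    have "T (u' \<ominus>\<^bsub>M\<^esub> u) = T u' \<ominus>\<^bsub>M\<^esub> T u"
      by (rule T_simps(6)[OF C_closed[OF conjunct1[OF u']] C_closed[OF u(1)]])
    also have "\<dots> = \<zero>\<^bsub>M\<^esub>"
      unfolding u(2) conjunct2[OF u'] using M.M.minus_eq_zero[OF C_closed[OF assms] C_closed[OF assms]] by blast
    finally have "T (u' \<ominus>\<^bsub>M\<^esub> u) = \<zero>\<^bsub>M\<^esub>" .
    then have "u' \<ominus>\<^bsub>M\<^esub> u = \<zero>\<^bsub>M\<^esub>" by (rule T_inj[OF C_intros(2)[OF conjunct1[OF u'] u(1)]])
    then show "u' = u" using M.M.minus_eq_zero[of u' u] C_closed u u' by blast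
  qed (use u in auto)
qed

lemma S: assumes "v \<in> C" shows "S v \<in> C" "T (S v) = v"
  using theI'[OF S_ex1[OF assms]] by (auto simp: S_def)

lemma S_eq: "u \<in> C \<Longrightarrow> T u = v \<Longrightarrow> S v = u"
  unfolding S_def using C_intros(6)[of u] by (intro the1_equality S_ex1) auto

definition contraction where "contraction v = h (S v)"

lemma contraction_linear: "linear_map R (M\<lparr>carrier := C\<rparr>) M contraction"
proof (rule linear_mapI)
  fix u v assume "u \<in> carrier (M\<lparr>carrier := C\<rparr>)" "v \<in> carrier (M\<lparr>carrier := C\<rparr>)"
  then have uv: "u \<in> C" "v \<in> C" by auto
  have "S (u \<oplus>\<^bsub>M\<^esub> v) = S u \<oplus>\<^bsub>M\<^esub> S v"
    using S uv C_closed by (intro S_eq C_intros) (auto simp: T_simps)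
  then show "contraction (u \<oplus>\<^bsub>M\<lparr>carrier := C\<rparr>\<^esub> v) = contraction u \<oplus>\<^bsub>M\<^esub> contraction v"
    using uv S C_closed by (simp add: contraction_def h_simps)
next
  fix r v assume "r \<in> carrier R" "v \<in> carrier (M\<lparr>carrier := C\<rparr>)"
  then have rv: "r \<in> carrier R" "v \<in> C" by auto
  have "S (r \<odot>\<^bsub>M\<^esub> v) = r \<odot>\<^bsub>M\<^esub> S v"
    using S rv C_closed by (intro S_eq C_intros) (auto simp: T_simps)
  then show "contraction (r \<odot>\<^bsub>M\<lparr>carrier := C\<rparr>\<^esub> v) = r \<odot>\<^bsub>M\<^esub> contraction v"
    using rv S C_closed by (simp add: contraction_def h_simps)
qed (auto simp: contraction_def h_simps S C_closed)

lemma contraction_add: "u \<in> C \<Longrightarrow> v \<in> C \<Longrightarrow> contraction (u \<oplus>\<^bsub>M\<^esub> v) = contraction u \<oplus>\<^bsub>M\<^esub> contraction v"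
  using linear_mapD(2)[OF contraction_linear, of u v] by simp

lemma contraction_grade: "v \<in> C \<Longrightarrow> v \<in> grade M s \<Longrightarrow> contraction v \<in> grade M (s + 1)"
proof -
  assume v: "v \<in> C" "v \<in> grade M s"
  then obtain u where "u \<in> C" "T u = v" "u \<in> grade M s"
    using T_surj[OF v(1), of 0] F(1) C_closed[OF v(1)] by blast
  then show ?thesis using h(2) S_eq by (auto simp: contraction_def)
qed

lemma contraction_C: "v \<in> C \<Longrightarrow> contraction v \<in> C"
  by (simp add: contraction_def C_intros S C_closed)

text \<open>\<open>S\<close> inverts \<open>T\<close> and therefore commutes with \<open>D\<close>
  as \<open>T\<close> does. Hence \<open>D h S + h S D = (D h + h D) S = T S = 1\<close>.\<close>

lemma contraction: "v \<in> C \<Longrightarrow> M.D (contraction v) \<oplus>\<^bsub>M\<^esub> contraction (M.D v) = v"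
proof -
  assume v: "v \<in> C"
  have "S (M.D v) = M.D (S v)" using S[OF v] C_closed by (intro S_eq C_intros) (auto simp: T_D)
  then show ?thesis using S[OF v] by (simp add: contraction_def T_def)
qed

text \<open>A morphism \<open>g\<close> with \<open>\<pi> g = 1\<close> needs no further homotopy on
  the side of \<open>N\<close>. On the other side \<open>g \<pi> - 1\<close> is a morphism into the
  contractible kernel, and composing it with the contraction gives the homotopy.\<close>

lemma section_equivalence:
  assumes g: "factorisation_morphism R N M g" and pg: "\<And>v. v \<in> carrier N \<Longrightarrow> \<pi> (g v) = v"
  shows "inverse_homotopy_equivalences R M N \<pi> g"
proof -
  have gl: "linear_map R N M g" and gd: "\<And>v. v \<in> carrier N \<Longrightarrow> g (d v) = M.D (g v)"
    and gg: "\<And>v s. v \<in> grade N s \<Longrightarrow> g v \<in> grade M s"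
    using g by (auto simp: factorisation_morphism_def)
  have pi_g: "\<And>v s. v \<in> grade M s \<Longrightarrow> \<pi> v \<in> grade N s" using \<pi> by (auto simp: factorisation_morphism_def)
  let ?c = "\<lambda>v. g (\<pi> v) \<ominus>\<^bsub>M\<^esub> v"
  note gs = linear_mapD[OF gl] linear_map_zero_minus[OF N.module M.module gl]
  have cC: "?c v \<in> C" if "v \<in> carrier M" for v
    using that by (simp add: C_def gs pi_simps pg N.M.minus_eq_zero)
  have cl: "linear_map R M (M\<lparr>carrier := C\<rparr>) ?c"
  proof -
    have "linear_map R M M (\<lambda>v. (g \<circ> \<pi>) v \<ominus>\<^bsub>M\<^esub> (\<lambda>v. v) v)"
      by (intro linear_map_minus[OF M.module] linear_map_comp[OF pi_linear gl]) (auto intro: linear_mapI)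
    then show ?thesis using cC by (auto simp: linear_map_def)
  qed
  have "homotopic R M M (g \<circ> \<pi>) (\<lambda>v. v)"
    unfolding homotopic_def
  proof (intro exI[of _ "contraction \<circ> ?c"] conjI allI ballI)
    show "linear_map R M M (contraction \<circ> ?c)" by (rule linear_map_comp[OF cl contraction_linear])
    show "(contraction \<circ> ?c) ` grade M s \<subseteq> grade M (s + 1)" for s
      unfolding image_subset_iff comp_apply
      by (intro ballI contraction_grade cC M.grade_minus gg pi_g) (auto intro: M.grade_closed)
    show "(g \<circ> \<pi>) v \<ominus>\<^bsub>M\<^esub> v = M.D ((contraction \<circ> ?c) v) \<oplus>\<^bsub>M\<^esub> (contraction \<circ> ?c) (M.D v)"
      if v: "v \<in> carrier M" for v
      using contraction[OF cC[OF v]] v by (simp add: gs pi_simps gd D_simps)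
  qed
  moreover have "homotopic R N N (\<pi> \<circ> g) (\<lambda>v. v)"
    by (rule homotopic_cong[OF homotopic_refl[OF N.lf N.lf]]) (auto intro: linear_mapI simp: pg)
  ultimately show ?thesis using \<pi> g unfolding inverse_homotopy_equivalences_def by blast
qed

text \<open>The defect \<open>u = D \<sigma> - \<sigma> d\<close> of \<open>\<sigma>\<close> has
  values in the kernel of \<open>\<pi>\<close> and satisfies \<open>D u = - u d\<close>. Subtracting
  the contraction of \<open>u\<close> from \<open>\<sigma>\<close> turns it into a morphism without
  changing its composite with \<open>\<pi>\<close>.\<close>

lemma ex_section: "\<exists>g. inverse_homotopy_equivalences R M N \<pi> g"
proof -
  let ?u = "\<lambda>v. M.D (\<sigma> v) \<ominus>\<^bsub>M\<^esub> \<sigma> (d v)"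
  have uC: "?u v \<in> C" if "v \<in> carrier N" for v
    using that by (simp add: C_def sigma_simps D_simps d_simps pi_simps \<sigma>(3) N.M.minus_eq_zero)
  have ul: "linear_map R N (M\<lparr>carrier := C\<rparr>) ?u"
  proof -
    have "linear_map R N M (\<lambda>v. (M.D \<circ> \<sigma>) v \<ominus>\<^bsub>M\<^esub> (\<sigma> \<circ> d) v)"
      by (intro linear_map_minus[OF M.module] linear_map_comp[OF \<sigma>(1) M.D_linear] linear_map_comp[OF N.D_linear \<sigma>(1)])
    then show ?thesis using uC by (auto simp: linear_map_def)
  qed
  let ?g = "\<lambda>v. \<sigma> v \<ominus>\<^bsub>M\<^esub> (contraction \<circ> ?u) v"
  have su: "linear_map R N M (contraction \<circ> ?u)" by (rule linear_map_comp[OF ul contraction_linear])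
  note cs = linear_mapD[OF su, simplified]
  have "factorisation_morphism R N M ?g"
    unfolding factorisation_morphism_def
  proof (intro conjI allI ballI)
    show "linear_map R N M ?g" by (rule linear_map_minus[OF M.module \<sigma>(1) su])
    have "contraction (?u v) \<in> grade M s" if "v \<in> grade N s" for v s
    proof -
      have "?u v \<in> grade M (s + 1)"
        using that by (intro M.grade_minus M.D_grade \<sigma> N.D_grade)
      from contraction_grade[OF uC[OF N.grade_closed[OF that]] this] show ?thesis unfolding bit_add_1_1 .
    qed
    then show "?g ` grade N s \<subseteq> grade M s" for s by (auto intro!: M.grade_minus \<sigma>)
    fix v assume v: "v \<in> carrier N"
    have "contraction (M.D (?u v)) \<oplus>\<^bsub>M\<^esub> contraction (?u (d v)) = contraction (M.D (?u v) \<oplus>\<^bsub>M\<^esub> ?u (d v))"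
      using contraction_add[OF C_intros(4)[OF uC[OF v]] uC[OF N.D_closed[OF v]]] by simp
    \<comment> \<open>The terms \<open>D \<sigma> d\<close> cancel, and so do
      \<open>D D \<sigma>\<close> and \<open>\<sigma> d d\<close>, both being multiplication by
      \<open>w\<close>.\<close>
    also have "M.D (?u v) \<oplus>\<^bsub>M\<^esub> ?u (d v) = \<zero>\<^bsub>M\<^esub>"
      using v N.w_closed by (simp add: sigma_simps D_simps d_simps a_minus_def M.M.a_assoc M.M.r_neg2 M.M.r_neg1 M.M.l_neg M.M.r_neg)
    finally have e: "contraction (M.D (?u v)) \<oplus>\<^bsub>M\<^esub> contraction (?u (d v)) = \<zero>\<^bsub>M\<^esub>"
      using linear_mapD(3)[OF contraction_linear, of "\<zero>\<^bsub>R\<^esub>" "\<zero>\<^bsub>M\<^esub>"] linear_mapD(1)[OF contraction_linear, of "\<zero>\<^bsub>M\<^esub>"]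
      by (simp add: C_intros)
    have k: "M.D (contraction (?u v)) \<oplus>\<^bsub>M\<^esub> contraction (M.D (?u v)) = ?u v" by (rule contraction[OF uC[OF v]])
    note Cc = contraction_C[THEN C_closed]
    have "M.D (?g v) = M.D (\<sigma> v) \<ominus>\<^bsub>M\<^esub> M.D (contraction (?u v))"
      using D_simps(6)[OF sigma_simps(1)[OF v] Cc[OF uC[OF v]]] by simp
    moreover have "\<sigma> (d v) \<ominus>\<^bsub>M\<^esub> contraction (?u (d v)) = M.D (\<sigma> v) \<ominus>\<^bsub>M\<^esub> M.D (contraction (?u v))"
      by (rule M.M.minus_rearrange[OF _ _ _ _ _ k e])
        (intro D_simps sigma_simps d_simps v Cc uC C_intros(4))+
    ultimately show "?g (d v) = M.D (?g v)" by simp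
  qed
  moreover have "\<pi> (?g v) = v" if "v \<in> carrier N" for v
    using that contraction_C[OF uC[OF that]] by (auto simp: pi_simps sigma_simps \<sigma>(3) cs C_def a_minus_def)
  ultimately show ?thesis using section_equivalence by blast
qed

text \<open>The defect \<open>u = D g - g d\<close> lies in the kernel of \<open>\<pi>\<close>. The
  two conditions on \<open>h\<close> give \<open>h u = 0\<close> and \<open>h D u = 0\<close>, so
  \<open>T u = 0\<close> and \<open>u = 0\<close> by injectivity of \<open>T\<close>.\<close>

lemma section_morphismI:
  assumes gl: "linear_map R N M g" and gg: "\<And>s v. v \<in> grade N s \<Longrightarrow> g v \<in> grade M s"
    and pg: "\<And>v. v \<in> carrier N \<Longrightarrow> \<pi> (g v) = v"
    and hg: "\<And>v. v \<in> carrier N \<Longrightarrow> h (g v) = \<zero>\<^bsub>M\<^esub>" "\<And>v. v \<in> carrier N \<Longrightarrow> h (M.D (g v)) = \<zero>\<^bsub>M\<^esub>"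
  shows "factorisation_morphism R N M g"
proof -
  note gs = linear_mapD[OF gl] linear_map_zero_minus[OF N.module M.module gl]
  have "g (d v) = M.D (g v)" if v: "v \<in> carrier N" for v
  proof -
    let ?u = "\<lambda>v. M.D (g v) \<ominus>\<^bsub>M\<^esub> g (d v)"
    have "?u v \<in> C" using v by (simp add: C_def gs D_simps d_simps pi_simps pg N.M.minus_eq_zero)
    moreover have "M.D (?u v) = w \<odot>\<^bsub>M\<^esub> g v \<ominus>\<^bsub>M\<^esub> M.D (g (d v))"
      using v by (simp add: gs D_simps d_simps)
    then have "T (?u v) = \<zero>\<^bsub>M\<^esub>"
      using v by (simp add: T_def gs D_simps d_simps h_simps hg M.w_closed)
    ultimately have "?u v = \<zero>\<^bsub>M\<^esub>" by (rule T_inj)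
    then show ?thesis using v by (simp add: gs D_simps d_simps M.M.minus_eq_zero)
  qed
  then show ?thesis using gl gg by (auto simp: factorisation_morphism_def)
qed

end

section \<open>Partial derivatives\<close>

lemma mono_minus_add:
  fixes \<alpha> :: mono
  assumes "lookup \<alpha> v \<noteq> 0" shows "\<alpha> - single v 1 + single v 1 = \<alpha>"
proof (rule poly_mapping_eqI)
  fix k
  have "lookup \<alpha> k - (1 when v = k) + (1 when v = k) = lookup \<alpha> k" using assms by (cases "v = k") simp_all
  then show "lookup (\<alpha> - single v 1 + single v 1) k = lookup \<alpha> k"
    by (simp only: lookup_add lookup_minus lookup_single)
qed

text \<open>Terms of exponent \<open>0\<close> at \<open>v\<close> carry the coefficient
  \<open>0\<close>; on the others the truncated subtraction of \<open>v\<close> is inverted by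
  adding \<open>v\<close>. So a single term of \<open>p\<close> contributes to each coefficient,
  which makes additivity evident.\<close>

lemma lookup_pdiff: "lookup (pdiff v p) \<beta> = of_nat (lookup \<beta> v + 1) * lookup p (\<beta> + single v 1)"
proof -
  have "lookup (pdiff v p) \<beta> =
      (\<Sum>\<alpha>\<in>keys p. if \<alpha> - single v 1 = \<beta> then of_nat (lookup \<alpha> v) * lookup p \<alpha> else 0)"
    by (simp add: pdiff_def lookup_sum lookup_single when_def)
  also have "\<dots> = (\<Sum>\<alpha>\<in>keys p. if \<alpha> = \<beta> + single v 1 then of_nat (lookup \<alpha> v) * lookup p \<alpha> else 0)"
  proof (rule sum.cong[OF refl])
    fix \<alpha>
    have "\<alpha> = \<beta> + single v 1" if "\<alpha> - single v 1 = \<beta>" "lookup \<alpha> v \<noteq> 0"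
      using mono_minus_add[OF that(2)] that(1) by simp
    then have "\<alpha> - single v 1 = \<beta> \<and> lookup \<alpha> v \<noteq> 0 \<longleftrightarrow> \<alpha> = \<beta> + single v 1 \<and> lookup \<alpha> v \<noteq> 0" by force
    then show "(if \<alpha> - single v 1 = \<beta> then of_nat (lookup \<alpha> v) * lookup p \<alpha> else 0) =
        (if \<alpha> = \<beta> + single v 1 then of_nat (lookup \<alpha> v) * lookup p \<alpha> else 0)"
      by (cases "lookup \<alpha> v = 0") simp_all
  qed
  also have "\<dots> = of_nat (lookup \<beta> v + 1) * lookup p (\<beta> + single v 1)"
    by (auto simp: in_keys_iff lookup_add)
  finally show ?thesis .
qed

lemma pdiff_add: "pdiff v (p + q) = pdiff v p + pdiff v q"
  and pdiff_zero [simp]: "pdiff v 0 = 0"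
  and pdiff_uminus: "pdiff v (- p) = - pdiff v p"
  by (rule poly_mapping_eqI, simp add: lookup_pdiff lookup_add distrib_left)+

lemma pdiff_minus: "pdiff v (p - q) = pdiff v p - pdiff v q"
  using pdiff_add[of v p "- q"] by (simp add: pdiff_uminus)

lemma pdiff_sum: "pdiff v (sum f I) = (\<Sum>i\<in>I. pdiff v (f i))"
  by (induction I rule: infinite_finite_induct) (auto simp: pdiff_add)

lemma pdiff_single: "pdiff v (single \<alpha> c) = single (\<alpha> - single v 1) (of_nat (lookup \<alpha> v) * c)"
  by (cases "c = 0") (simp_all add: pdiff_def)

text \<open>By additivity it suffices to treat two monomials. Truncated subtraction moves past the
  other factor when the exponent is positive, and the coefficient vanishes when it is zero.\<close>

lemma pdiff_mult: "pdiff v (p * q) = pdiff v p * q + p * pdiff v q"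
proof -
  have s: "pdiff v (single \<alpha> a * single \<beta> b) = pdiff v (single \<alpha> a) * single \<beta> b + single \<alpha> a * pdiff v (single \<beta> b)"
    for \<alpha> \<beta> :: mono and a b :: 'a
  proof -
    have 1: "\<alpha> + \<beta> - single v 1 = \<alpha> - single v 1 + \<beta>" if "lookup \<alpha> v \<noteq> 0" for \<alpha> \<beta> :: mono
    proof -
      have "\<alpha> + \<beta> - single v 1 = (\<alpha> - single v 1 + \<beta>) + single v 1 - single v 1"
        using mono_minus_add[OF that] by (simp add: ac_simps)
      then show ?thesis by simp
    qed
    have 2: "\<alpha> + \<beta> - single v 1 = \<alpha> + (\<beta> - single v 1)" if "lookup \<beta> v \<noteq> 0"
      using 1[OF that, of \<alpha>] by (simp add: ac_simps)
    show ?thesis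
      using 1 2 by (cases "lookup \<alpha> v = 0"; cases "lookup \<beta> v = 0")
        (simp_all add: pdiff_single mult_single lookup_add single_add[symmetric] algebra_simps)
  qed
  have *: "r \<in> carrier (pol_ring UNIV)" for r :: "'a pol" by (simp add: pol_ring_def monomials_def)
  from *[of p] show ?thesis
  proof (induction p rule: pol_ring_induct)
    case (single \<alpha> c)
    from *[of q] show ?case
      by (induction q rule: pol_ring_induct) (auto simp: s pdiff_add algebra_simps)
  qed (auto simp: pdiff_add algebra_simps)
qed

lemma pdiff_closed [simp]: "p \<in> carrier (pol_ring S) \<Longrightarrow> pdiff v p \<in> carrier (pol_ring S)"
  by (auto simp: pol_ring_carrier lookup_pdiff)

lemma pdiff_eq_0: "p \<in> carrier (pol_ring S) \<Longrightarrow> v \<notin> S \<Longrightarrow> pdiff v p = 0"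
proof (rule poly_mapping_eqI)
  fix \<beta> :: mono
  assume p: "p \<in> carrier (pol_ring S)" "v \<notin> S"
  have "lookup (\<beta> + single v 1) v \<noteq> 0" by (simp add: lookup_add)
  with p(2) have "\<beta> + single v 1 \<notin> monomials S" unfolding in_monomials by metis
  with p(1) show "lookup (pdiff v p) \<beta> = lookup 0 \<beta>" by (simp add: pol_ring_carrier lookup_pdiff)
qed

section \<open>Operators on a free module\<close>

text \<open>Signs as scalars of the polynomial ring: Koszul signs then become ordinary matrix
  entries.\<close>

definition sg :: "bit \<Rightarrow> 'k::comm_ring_1 pol" where "sg s = (if s = 0 then 1 else - 1)"

lemma sg_add: "sg (s + t) = sg s * sg t"
  and sg_square [simp]: "sg s * sg s = 1"
  and sg_simps [simp]: "sg 0 = 1" "sg 1 = - 1"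
  and sg_closed [simp]: "sg s \<in> carrier (pol_ring S)"
  by (cases s; cases t; simp add: sg_def)+

lemma sg_neq: "s \<noteq> t \<Longrightarrow> sg s = - sg t"
  by (cases s; cases t; simp)

text \<open>The source of all anticommutation rules: of two distinct indices exactly one changes the
  sign of the other.\<close>

lemma theta_sign_insert:
  assumes "j \<notin> I" shows "theta_sign i (insert j I) = theta_sign i I + (if j < i then 1 else 0)"
proof (cases "j < i")
  case True
  then have "{j' \<in> insert j I. j' < i} = insert j {j' \<in> I. j' < i}" by auto
  with assms True show ?thesis by (simp add: theta_sign_def)
next
  case False
  then have "{j' \<in> insert j I. j' < i} = {j' \<in> I. j' < i}" by auto
  with False show ?thesis by (simp add: theta_sign_def)
qed

text \<open>Used to see that operators of Koszul type square to zero. The diagonal is a separate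
  condition, since antisymmetry alone leaves 2-torsion there.\<close>

lemma sum_antisymmetric:
  fixes a :: "nat \<Rightarrow> nat \<Rightarrow> 'a::ab_group_add"
  assumes "\<And>i j. a i j = - a j i" "\<And>i. a i i = 0"
  shows "(\<Sum>i<k. \<Sum>j<k. a i j) = 0"
proof (induction k)
  case (Suc k)
  have "(\<Sum>i<k. a i k) = - (\<Sum>j<k. a k j)" unfolding sum_negf[symmetric] by (rule sum.cong[OF refl assms(1)])
  with Suc show ?case by (simp add: sum.distrib assms(2))
qed simp

section \<open>Coefficient vectors over \<open>k[x,y,z]\<close> and the matrix forms of the
  operators\<close>

type_synonym ('my, 'mx, 'k) vec = "nat set \<Rightarrow> 'my \<times> 'mx \<Rightarrow> 'k pol"

text \<open>Compatibility with linear combinations of any finite length, so that sums, multiples and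
  differences are instances. A quantifier in a definition cannot range over types; index sets of
  natural numbers stand for all.\<close>

definition lin :: "(('my, 'mx, 'k::comm_ring_1) vec \<Rightarrow> ('my, 'mx, 'k) vec) \<Rightarrow> bool" where
  "lin T \<longleftrightarrow> (\<forall>J::nat set. \<forall>p v. finite J \<longrightarrow>
     T (\<lambda>I b. \<Sum>j\<in>J. p j * v j I b) = (\<lambda>I b. \<Sum>j\<in>J. p j * T (v j) I b))"

lemma linD: "lin T \<Longrightarrow> finite J \<Longrightarrow> T (\<lambda>I b. \<Sum>j\<in>(J::nat set). p j * v j I b) = (\<lambda>I b. \<Sum>j\<in>J. p j * T (v j) I b)"
  by (simp add: lin_def)

lemma lin_add: "lin T \<Longrightarrow> T (\<lambda>I b. u I b + v I b) = (\<lambda>I b. T u I b + T v I b)"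
  using linD[of T "{0, 1}" "\<lambda>_. 1" "\<lambda>j. if j = 0 then u else v"] by simp

lemma lin_smult: "lin T \<Longrightarrow> T (\<lambda>I b. p * v I b) = (\<lambda>I b. p * T v I b)"
  using linD[of T "{0}" "\<lambda>_. p" "\<lambda>_. v"] by simp

lemma lin_uminus: "lin T \<Longrightarrow> T (\<lambda>I b. - v I b) = (\<lambda>I b. - T v I b)"
  using lin_smult[of T "- 1" v] by simp

lemma lin_minus: "lin T \<Longrightarrow> T (\<lambda>I b. u I b - v I b) = (\<lambda>I b. T u I b - T v I b)"
  using lin_add[of T u "\<lambda>I b. - v I b"] by (simp add: lin_uminus)

lemma lin_sum: "lin T \<Longrightarrow> T (\<lambda>I b. \<Sum>j<k. v j I b) = (\<lambda>I b. \<Sum>j<(k::nat). T (v j) I b)"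
  using linD[of T "{..<k}" "\<lambda>_. 1" v] by simp

lemma lin_comp: "lin T \<Longrightarrow> lin T' \<Longrightarrow> lin (\<lambda>v. T (T' v))"
  by (simp add: lin_def)

lemma lin_pow: "lin T \<Longrightarrow> lin (T ^^ j)"
  by (induction j) (simp add: lin_def, simp add: lin_comp comp_def)

lemma lin_combination:
  assumes "\<And>i. i \<in> K \<Longrightarrow> lin (T i)" shows "lin (\<lambda>v I b. \<Sum>i\<in>K. a i I b * T i v I b)"
  unfolding lin_def
proof (intro allI impI ext)
  fix J :: "nat set" and p v I b assume "finite J"
  with assms have "(\<Sum>i\<in>K. a i I b * T i (\<lambda>I b. \<Sum>j\<in>J. p j * v j I b) I b) =
      (\<Sum>i\<in>K. \<Sum>j\<in>J. p j * (a i I b * T i (v j) I b))"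
    by (intro sum.cong refl) (simp add: linD sum_distrib_left mult.left_commute)
  also have "\<dots> = (\<Sum>j\<in>J. p j * (\<Sum>i\<in>K. a i I b * T i (v j) I b))"
    by (subst sum.swap) (simp add: sum_distrib_left)
  finally show "(\<Sum>i\<in>K. a i I b * T i (\<lambda>I b. \<Sum>j\<in>J. p j * v j I b) I b) =
      (\<Sum>j\<in>J. p j * (\<Sum>i\<in>K. a i I b * T i (v j) I b))" .
qed

text \<open>The two matrix factorisations enter the computations with operators through the matrices
  of their differentials alone: their parity and their squares.\<close>

locale mf_pair =
  fixes n m l :: nat and U V W :: "'k::comm_ring_1 pol"
    and Y :: "('k pol, 'my) factorisation" and BY :: "'my set"
    and X :: "('k pol, 'mx) factorisation" and BX :: "'mx set"
    and DY :: "'my \<Rightarrow> 'my \<Rightarrow> 'k pol" and DX :: "'mx \<Rightarrow> 'mx \<Rightarrow> 'k pol"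
  assumes DY_def: "DY = matrix_of (kyz m l) Y BY (differential Y)"
    and DX_def: "DX = matrix_of (kxy n m) X BX (differential X)"
    and finite_BY: "finite BY" and finite_BX: "finite BX"
    and U: "U \<in> carrier (pol_ring (zvars l))" and V: "V \<in> carrier (ky m)" and W: "W \<in> carrier (pol_ring (xvars n))"
    and DY_closed: "\<And>f f'. f' \<in> BY \<Longrightarrow> DY f f' \<in> carrier (kyz m l)"
    and DX_closed: "\<And>e e'. e' \<in> BX \<Longrightarrow> DX e e' \<in> carrier (kxy n m)"
    and DY_out: "\<And>f f'. f \<notin> BY \<Longrightarrow> f' \<in> BY \<Longrightarrow> DY f f' = 0"
    and DX_out: "\<And>e e'. e \<notin> BX \<Longrightarrow> e' \<in> BX \<Longrightarrow> DX e e' = 0"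
    and DY_odd: "\<And>f f'. f \<in> BY \<Longrightarrow> f' \<in> BY \<Longrightarrow> DY f f' \<noteq> 0 \<Longrightarrow> parity Y f = parity Y f' + 1"
    and DX_odd: "\<And>e e'. e \<in> BX \<Longrightarrow> e' \<in> BX \<Longrightarrow> DX e e' \<noteq> 0 \<Longrightarrow> parity X e = parity X e' + 1"
    and DY_square: "\<And>f f''. f \<in> BY \<Longrightarrow> f'' \<in> BY \<Longrightarrow> (\<Sum>f'\<in>BY. DY f f' * DY f' f'') = (if f = f'' then U - V else 0)"
    and DX_square: "\<And>e e''. e \<in> BX \<Longrightarrow> e'' \<in> BX \<Longrightarrow> (\<Sum>e'\<in>BX. DX e e' * DX e' e'') = (if e = e'' then V - W else 0)"
begin

abbreviation "t \<equiv> tseq V"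
abbreviation "DX' i e e' \<equiv> pdiff (YV i) (DX e e')"

text \<open>The operators on \<open>S_m \<otimes> (Y \<otimes> X)\<close> in matrix form:
  \<open>tc i\<close> contracts with \<open>\<theta>_i\<close>, \<open>tE\<close> is the Koszul sign
  of \<open>\<theta>_I\<close>, \<open>tL\<close> and \<open>tR\<close> come from \<open>Y\<close>
  and \<open>X\<close>. From these arise \<open>td\<close> for \<open>d\<close>, \<open>tk\<close>
  for \<open>d_K\<close>, \<open>tlam i\<close> for \<open>\<lambda>_i\<close> and
  \<open>tdel\<close> for \<open>\<delta>\<close>.\<close>

definition tc :: "nat \<Rightarrow> ('my, 'mx, 'k) vec \<Rightarrow> ('my, 'mx, 'k) vec" where
  "tc i v = (\<lambda>I b. if i \<in> I then 0 else sg (theta_sign i I) * v (insert i I) b)"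
definition tE :: "('my, 'mx, 'k) vec \<Rightarrow> ('my, 'mx, 'k) vec" where
  "tE v = (\<lambda>I b. sg (of_nat (card I)) * v I b)"
definition tL :: "('my, 'mx, 'k) vec \<Rightarrow> ('my, 'mx, 'k) vec" where
  "tL v = (\<lambda>I (f, e). \<Sum>f'\<in>BY. DY f f' * v I (f', e))"
definition tR :: "('mx \<Rightarrow> 'mx \<Rightarrow> 'k pol) \<Rightarrow> ('my, 'mx, 'k) vec \<Rightarrow> ('my, 'mx, 'k) vec" where
  "tR D v = (\<lambda>I (f, e). sg (parity Y f) * (\<Sum>e'\<in>BX. D e e' * v I (f, e')))"
definition td where "td v = tE (\<lambda>I b. tL v I b + tR DX v I b)"
definition tk where "tk v = (\<lambda>I b. \<Sum>i<m. t i * tc i v I b)"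
definition tlam where "tlam i v = tE (tR (DX' i) v)"
definition tdel where "tdel v = (\<lambda>I b. \<Sum>i<m. tlam i (tc i v) I b)"

text \<open>Support on indices of basis elements. It forces every \<open>I\<close> that matters to
  be finite, as the sign rules for \<open>card I\<close> require.\<close>

definition valid :: "('my, 'mx, 'k) vec \<Rightarrow> bool" where
  "valid v \<longleftrightarrow> (\<forall>I b. v I b \<in> carrier (kxyz n m l)) \<and> (\<forall>I b. \<not> (I \<subseteq> {..<m} \<and> b \<in> BY \<times> BX) \<longrightarrow> v I b = 0)"

lemma lin_tc: "lin (tc i)" and lin_tE: "lin tE" and lin_tL: "lin tL" and lin_tR: "lin (tR D)"
proof -
  show "lin (tc i)" "lin tE" unfolding lin_def tc_def tE_def
    by (simp_all add: sum_distrib_left fun_eq_iff mult.left_commute)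
  show "lin tL" unfolding lin_def
  proof (intro allI impI ext)
    fix J :: "nat set" and p v I and b :: "'my \<times> 'mx"
    obtain f e where b: "b = (f, e)" by force
    show "tL (\<lambda>I b. \<Sum>j\<in>J. p j * v j I b) I b = (\<Sum>j\<in>J. p j * tL (v j) I b)"
      unfolding b tL_def prod.case by (simp add: sum_distrib_left mult.left_commute) (rule sum.swap)
  qed
  show "lin (tR D)" unfolding lin_def
  proof (intro allI impI ext)
    fix J :: "nat set" and p v I and b :: "'my \<times> 'mx"
    obtain f e where b: "b = (f, e)" by force
    show "tR D (\<lambda>I b. \<Sum>j\<in>J. p j * v j I b) I b = (\<Sum>j\<in>J. p j * tR D (v j) I b)"
      unfolding b tR_def prod.case by (simp add: sum_distrib_left mult.left_commute) (rule sum.swap)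
  qed
qed

lemma lin_td: "lin td"
proof -
  have "lin (\<lambda>v I b. \<Sum>i\<in>{0::nat, 1}. 1 * (if i = 0 then tL else tR DX) v I b)"
    by (rule lin_combination) (auto simp: lin_tL lin_tR)
  then have "lin (\<lambda>v I b. tL v I b + tR DX v I b)" by simp
  from lin_comp[OF lin_tE this] show ?thesis by (simp add: td_def[abs_def])
qed

lemma lin_tk: "lin tk"
  unfolding tk_def[abs_def] by (rule lin_combination[where a = "\<lambda>i _ _. t i"]) (rule lin_tc)

lemma lin_tlam: "lin (tlam i)"
  unfolding tlam_def[abs_def] by (rule lin_comp[OF lin_tE lin_tR])

lemma lin_tdel: "lin tdel"
  using lin_combination[of "{..<m}" "\<lambda>i v. tlam i (tc i v)" "\<lambda>_ _ _. 1"] lin_comp[OF lin_tlam lin_tc]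
  by (simp add: tdel_def[abs_def])

lemma kxyz_closed:
  "f' \<in> BY \<Longrightarrow> DY f f' \<in> carrier (kxyz n m l)" "e' \<in> BX \<Longrightarrow> DX e e' \<in> carrier (kxyz n m l)"
  "t i \<in> carrier (ky m)" "t i \<in> carrier (kxyz n m l)"
  using kyz_kxyz[OF DY_closed] kxy_kxyz[OF DX_closed] ky_kxyz[OF pdiff_closed[OF V]] V by auto

lemma valid_tc: "i < m \<Longrightarrow> valid v \<Longrightarrow> valid (tc i v)"
  by (auto simp: valid_def tc_def)

lemma valid_tE: "valid v \<Longrightarrow> valid (tE v)"
  by (auto simp: valid_def tE_def)

lemma valid_add: "valid u \<Longrightarrow> valid v \<Longrightarrow> valid (\<lambda>I b. u I b + v I b)"
  and valid_smult: "p \<in> carrier (kxyz n m l) \<Longrightarrow> valid v \<Longrightarrow> valid (\<lambda>I b. p * v I b)"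
  and valid_sum: "(\<And>i. i \<in> K \<Longrightarrow> valid (v' i)) \<Longrightarrow> valid (\<lambda>I b. \<Sum>i\<in>K. v' i I b)"
  by (auto simp: valid_def intro!: sum_pol_ring sum.neutral)

lemma validI:
  assumes "\<And>I f e. v I (f, e) \<in> carrier (kxyz n m l)" "\<And>I f e. \<not> I \<subseteq> {..<m} \<Longrightarrow> v I (f, e) = 0"
    "\<And>I f e. f \<notin> BY \<Longrightarrow> v I (f, e) = 0" "\<And>I f e. e \<notin> BX \<Longrightarrow> v I (f, e) = 0"
  shows "valid v"
  using assms unfolding valid_def by (metis SigmaI surj_pair)

lemma validD:
  assumes "valid v"
  shows "v I b \<in> carrier (kxyz n m l)" "\<not> I \<subseteq> {..<m} \<Longrightarrow> v I b = 0"
    "f \<notin> BY \<Longrightarrow> v I (f, e) = 0" "e \<notin> BX \<Longrightarrow> v I (f, e) = 0"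
  using assms unfolding valid_def by (metis mem_Sigma_iff)+

lemma valid_tL: "valid v \<Longrightarrow> valid (tL v)"
  by (rule validI) (auto simp: tL_def kxyz_closed DY_out validD intro!: sum_pol_ring sum.neutral mult_pol_ring)

lemma valid_tR:
  assumes "\<And>e e'. e' \<in> BX \<Longrightarrow> D e e' \<in> carrier (kxyz n m l)" "\<And>e e'. e \<notin> BX \<Longrightarrow> e' \<in> BX \<Longrightarrow> D e e' = 0"
  shows "valid v \<Longrightarrow> valid (tR D v)"
  using assms by (intro validI) (auto simp: tR_def validD sum.neutral intro!: mult_pol_ring sum_pol_ring)

lemma valid_td: "valid v \<Longrightarrow> valid (td v)"
  unfolding td_def by (intro valid_tE valid_add valid_tL valid_tR) (auto simp: kxyz_closed DX_out)

lemma valid_tk: "valid v \<Longrightarrow> valid (tk v)"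
  unfolding tk_def by (intro valid_sum valid_smult valid_tc) (auto simp: kxyz_closed)

lemma valid_tlam: "valid v \<Longrightarrow> valid (tlam i v)"
  unfolding tlam_def by (intro valid_tE valid_tR) (auto simp: kxyz_closed DX_out)

lemma valid_tdel: "valid v \<Longrightarrow> valid (tdel v)"
  unfolding tdel_def by (intro valid_sum valid_tlam valid_tc) auto

lemma valid_pow: "(\<And>v. valid v \<Longrightarrow> valid (T v)) \<Longrightarrow> valid v \<Longrightarrow> valid ((T ^^ j) v)"
  by (induction j) auto

lemma tc_tc: "tc i (tc j v) = (\<lambda>I b. - tc j (tc i v) I b)"
proof (intro ext)
  fix I b
  show "tc i (tc j v) I b = - tc j (tc i v) I b"
    by (cases "i < j"; cases "j < i")
      (auto simp: tc_def theta_sign_insert sg_add insert_commute algebra_simps)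
qed

lemma tE_tE [simp]: "tE (tE v) = v"
  by (simp add: tE_def mult.assoc[symmetric])

text \<open>Contraction changes the parity of \<open>card I\<close>. Validity enters because an
  infinite set has \<open>card\<close> equal to \<open>0\<close> with and without
  \<open>i\<close>.\<close>

lemma tE_tc:
  assumes "valid v" shows "tE (tc i v) = (\<lambda>I b. - tc i (tE v) I b)"
proof (intro ext)
  fix I b
  have "card (insert i I) = card I + 1" if "i \<notin> I" "v (insert i I) b \<noteq> 0"
  proof -
    have "finite I" using assms that finite_subset[of _ "{..<m}"] unfolding valid_def by (metis finite_insert finite_lessThan)
    with that show ?thesis by simp
  qed
  then show "tE (tc i v) I b = - tc i (tE v) I b"
    by (cases "v (insert i I) b = 0") (auto simp: tE_def tc_def sg_add)
qed

lemma tL_tc: "tL (tc i v) = tc i (tL v)" and tR_tc: "tR D (tc i v) = tc i (tR D v)"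
  and tL_tE: "tL (tE v) = tE (tL v)" and tR_tE: "tR D (tE v) = tE (tR D v)"
  by (auto simp: tL_def tR_def tc_def tE_def sum_distrib_left fun_eq_iff mult.left_commute)

text \<open>\<open>DY\<close> changes the parity of \<open>f\<close>, and \<open>tR\<close> carries
  the Koszul sign of \<open>f\<close>, so exchanging them costs a sign.\<close>

lemma tL_tR:
  assumes "valid v" shows "tL (tR D v) = (\<lambda>I b. - tR D (tL v) I b)"
proof (intro ext)
  fix I and b :: "'my \<times> 'mx" obtain f e where b: "b = (f, e)" by force
  have *: "DY f f' * (sg (parity Y f') * (D e e' * v I (f', e'))) = - (sg (parity Y f) * (D e e' * (DY f f' * v I (f', e'))))"
    if "f' \<in> BY" for f' e'
  proof (cases "f \<in> BY \<and> DY f f' \<noteq> 0")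
    case True
    then have "sg (parity Y f) = - (sg (parity Y f') :: 'k pol)" using DY_odd[of f f'] that by (intro sg_neq) auto
    then show ?thesis by (simp add: algebra_simps)
  next
    case False
    then show ?thesis using DY_out[of f f'] that by auto
  qed
  show "tL (tR D v) I b = - tR D (tL v) I b"
    unfolding b tL_def tR_def prod.case
    by (simp add: sum_distrib_left sum_negf[symmetric] * cong: sum.cong)
      (rule sum.swap)
qed

lemma tL_tL:
  assumes "valid v" shows "tL (tL v) = (\<lambda>I b. (U - V) * v I b)"
proof (intro ext)
  fix I and b :: "'my \<times> 'mx" obtain f e where b: "b = (f, e)" by force
  have "tL (tL v) I b = (\<Sum>f''\<in>BY. (\<Sum>f'\<in>BY. DY f f' * DY f' f'') * v I (f'', e))"
    unfolding b tL_def prod.case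
    by (simp add: sum_distrib_left sum_distrib_right mult.assoc) (rule sum.swap)
  also have "\<dots> = (U - V) * v I b"
  proof (cases "f \<in> BY")
    case True
    then have "(\<Sum>f''\<in>BY. (\<Sum>f'\<in>BY. DY f f' * DY f' f'') * v I (f'', e)) =
        (\<Sum>f''\<in>BY. if f'' = f then (U - V) * v I b else 0)"
      by (intro sum.cong) (auto simp: DY_square b)
    then show ?thesis using True finite_BY by simp
  next
    case False
    then have "v I b = 0" "DY f f' * r = 0" if "f' \<in> BY" for f' r using assms that by (auto simp: valid_def b DY_out)
    moreover have "v I b = 0" using False assms by (auto simp: valid_def b)
    ultimately show ?thesis by (simp add: sum.neutral)
  qed
  finally show "tL (tL v) I b = (U - V) * v I b" .
qed

text \<open>The Koszul sign of \<open>f\<close> occurs twice and drops out; what remains is the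
  product of the matrices on \<open>X\<close>.\<close>

lemma tR_tR:
  "tR D (tR D' v) = (\<lambda>I (f, e). \<Sum>e''\<in>BX. (\<Sum>e'\<in>BX. D e e' * D' e' e'') * v I (f, e''))"
proof (intro ext)
  fix I and b :: "'my \<times> 'mx" obtain f e where b: "b = (f, e)" by force
  have *: "sg s * (p * (sg s * r)) = p * r" for s and p r :: "'k pol" by (cases s) auto
  show "tR D (tR D' v) I b = (case b of (f, e) \<Rightarrow> \<Sum>e''\<in>BX. (\<Sum>e'\<in>BX. D e e' * D' e' e'') * v I (f, e''))"
    unfolding b tR_def prod.case
    by (simp add: sum_distrib_left sum_distrib_right mult.assoc *) (rule sum.swap)
qed

lemma sum_delta_valid:
  assumes "valid v" "\<And>e e''. e \<in> BX \<Longrightarrow> e'' \<in> BX \<Longrightarrow> M e e'' = (if e = e'' then p else 0)"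
    "\<And>e e''. e \<notin> BX \<Longrightarrow> e'' \<in> BX \<Longrightarrow> M e e'' = 0"
  shows "(\<Sum>e''\<in>BX. M e e'' * v I (f, e'')) = p * v I (f, e)"
proof (cases "e \<in> BX")
  case True
  then have "(\<Sum>e''\<in>BX. M e e'' * v I (f, e'')) = (\<Sum>e''\<in>BX. if e'' = e then p * v I (f, e) else 0)"
    using assms by (intro sum.cong) auto
  then show ?thesis using True finite_BX by simp
next
  case False
  then have "v I (f, e) = 0" using assms(1) by (auto simp: valid_def)
  with False assms(3) show ?thesis by (simp add: sum.neutral)
qed

lemma tR_DX_square: assumes "valid v" shows "tR DX (tR DX v) = (\<lambda>I b. (V - W) * v I b)"
  unfolding tR_tR by (auto simp: fun_eq_iff intro!: sum_delta_valid[OF assms] DX_square simp: DX_out sum.neutral)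

text \<open>The Leibniz rule applied entrywise to the square of \<open>DX\<close>; \<open>W\<close>
  contains no \<open>y\<close>.\<close>

lemma pdiff_DX_square:
  assumes "e \<in> BX" "e'' \<in> BX" "i < m"
  shows "(\<Sum>e'\<in>BX. DX e e' * DX' i e' e'' + DX' i e e' * DX e' e'') = (if e = e'' then t i else 0)"
proof -
  have "pdiff (YV i) W = 0" by (rule pdiff_eq_0[OF W]) auto
  then have "pdiff (YV i) (\<Sum>e'\<in>BX. DX e e' * DX e' e'') = (if e = e'' then t i else 0)"
    using assms by (simp add: DX_square pdiff_minus)
  then show ?thesis by (simp add: pdiff_sum pdiff_mult add.commute)
qed

lemma tR_anticommutator:
  assumes "valid v" "i < m"
  shows "tR DX (tR (DX' i) v) I b + tR (DX' i) (tR DX v) I b = t i * v I b"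
proof -
  obtain f e where b: "b = (f, e)" by force
  have "tR DX (tR (DX' i) v) I b + tR (DX' i) (tR DX v) I b =
     (\<Sum>e''\<in>BX. (\<Sum>e'\<in>BX. DX e e' * DX' i e' e'' + DX' i e e' * DX e' e'') * v I (f, e''))"
    by (simp add: tR_tR b sum.distrib distrib_right)
  also have "\<dots> = t i * v I (f, e)"
    by (rule sum_delta_valid[OF assms(1)]) (use assms(2) in \<open>auto simp: pdiff_DX_square DX_out sum.neutral\<close>)
  finally show ?thesis by (simp add: b)
qed

lemma td_alt: "td v = (\<lambda>I b. tE (tL v) I b + tE (tR DX v) I b)"
  by (simp add: td_def lin_add[OF lin_tE])

text \<open>The mixed terms cancel by \<open>tL_tR\<close>, and the squares contribute
  \<open>(U - V) + (V - W)\<close>.\<close>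

lemma td_square: assumes "valid v" shows "td (td v) = (\<lambda>I b. (U - W) * v I b)"
proof -
  have L: "tL (td v) I b = tE (tL (tL v)) I b + tE (tL (tR DX v)) I b" for I b
    by (simp add: td_alt lin_add[OF lin_tL] tL_tE)
  have R: "tR DX (td v) I b = tE (tR DX (tL v)) I b + tE (tR DX (tR DX v)) I b" for I b
    by (simp add: td_alt lin_add[OF lin_tR] tR_tE)
  have "tL (td v) I b + tR DX (td v) I b = tE (\<lambda>I b. (U - W) * v I b) I b" for I b
    unfolding L R tL_tL[OF assms] tR_DX_square[OF assms] tL_tR[OF assms] by (simp add: tE_def algebra_simps)
  then have "(\<lambda>I b. tL (td v) I b + tR DX (td v) I b) = tE (\<lambda>I b. (U - W) * v I b)" by blast
  then show ?thesis by (simp add: td_def[of "td v"])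
qed

lemma td_tc: assumes "valid v" shows "td (tc i v) = (\<lambda>I b. - tc i (td v) I b)"
proof -
  have "valid (\<lambda>I b. tL v I b + tR DX v I b)"
    by (intro valid_add valid_tL valid_tR assms) (auto simp: kxyz_closed DX_out)
  from tE_tc[OF this, of i] show ?thesis
    by (simp add: td_def tL_tc tR_tc lin_add[OF lin_tc, symmetric])
qed

lemma tlam_tc: assumes "valid v" shows "tlam j (tc i v) = (\<lambda>I b. - tc i (tlam j v) I b)"
proof -
  have "valid (tR (DX' j) v)" by (intro valid_tR assms) (auto simp: kxyz_closed DX_out)
  from tE_tc[OF this, of i] show ?thesis by (simp add: tlam_def tR_tc)
qed

text \<open>The part of \<open>d\<close> coming from \<open>Y\<close> anticommutes with
  \<open>\<lambda>_i\<close>, so only the anticommutator of \<open>DX\<close> with its derivative is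
  left.\<close>

lemma td_tlam:
  assumes "valid v" "i < m" shows "td (tlam i v) I b = t i * v I b - tlam i (td v) I b"
proof -
  have 1: "tL (tlam i v) I b = - tE (tR (DX' i) (tL v)) I b" for I b
    by (simp add: tlam_def tL_tE tL_tR[OF assms(1)] lin_uminus[OF lin_tE])
  have 2: "tR DX (tlam i v) I b = tE (tR DX (tR (DX' i) v)) I b" for I b
    by (simp add: tlam_def tR_tE)
  have 3: "td (tlam i v) I b = - tR (DX' i) (tL v) I b + tR DX (tR (DX' i) v) I b"
    unfolding td_def 1 2 by (simp add: lin_minus[OF lin_tE])
  have 4: "tlam i (td v) I b = tR (DX' i) (tL v) I b + tR (DX' i) (tR DX v) I b"
    by (simp add: tlam_def td_alt lin_add[OF lin_tR] tR_tE lin_add[OF lin_tE])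
  show ?thesis unfolding 3 4 tR_anticommutator[OF assms, symmetric] by simp
qed

lemma tk_tk: assumes "valid v" shows "tk (tk v) = (\<lambda>I b. 0)"
proof (intro ext)
  fix I b
  have "tk (tk v) I b = (\<Sum>i<m. \<Sum>j<m. t i * t j * tc i (tc j v) I b)"
    unfolding tk_def[of "tk v"] by (simp add: tk_def[of v] linD[OF lin_tc] sum_distrib_left mult.assoc)
  also have "\<dots> = 0"
  proof (rule sum_antisymmetric)
    show "t i * t j * tc i (tc j v) I b = - (t j * t i * tc j (tc i v) I b)" for i j
      using tc_tc[of i j v] by (simp add: mult.commute)
    show "t i * t i * tc i (tc i v) I b = 0" for i by (simp add: tc_def)
  qed
  finally show "tk (tk v) I b = 0" .
qed


lemma td_tk: assumes "valid v" shows "td (tk v) I b = - tk (td v) I b"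
  by (simp add: tk_def linD[OF lin_td] td_tc[OF assms] sum_negf)

text \<open>Moving \<open>d\<close> past \<open>\<lambda>_i\<close> and then past the contraction
  costs two signs, which cancel. The extra term \<open>t_i\<close> of the first move, applied to the
  contraction, sums up to \<open>d_K\<close>.\<close>

lemma td_tdel: assumes "valid v" shows "td (tdel v) I b = tdel (td v) I b + tk v I b"
proof -
  have "td (tlam i (tc i v)) I b = tlam i (tc i (td v)) I b + t i * tc i v I b" if "i < m" for i
    using td_tlam[OF valid_tc[OF that assms] that, of I b]
    by (simp add: td_tc[OF assms] lin_uminus[OF lin_tlam] algebra_simps)
  then show ?thesis by (simp add: tdel_def tk_def lin_sum[OF lin_td] sum.distrib)
qed

text \<open>Since \<open>[d, \<delta>] = d_K\<close> commutes with \<open>\<delta>\<close>, iterated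
  commutators vanish and conjugating \<open>d\<close> by the exponential stops after the linear
  term.\<close>

lemma tk_tdel: assumes "valid v" shows "tk (tdel v) = tdel (tk v)"
proof (intro ext)
  fix I b
  have "tc i (tlam j (tc j v)) I b = tlam j (tc j (tc i v)) I b" if "i < m" "j < m" for i j
  proof -
    have "tlam j (tc i (tc j v)) I b = - tlam j (tc j (tc i v)) I b"
      by (subst tc_tc) (simp add: lin_uminus[OF lin_tlam])
    then show ?thesis using tlam_tc[OF valid_tc[OF \<open>j < m\<close> assms], of j i] by simp
  qed
  then have "tk (tdel v) I b = (\<Sum>i<m. \<Sum>j<m. t i * tlam j (tc j (tc i v)) I b)"
    by (simp add: tk_def tdel_def lin_sum[OF lin_tc] sum_distrib_left)
  also have "\<dots> = (\<Sum>j<m. \<Sum>i<m. t i * tlam j (tc j (tc i v)) I b)" by (rule sum.swap)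
  also have "\<dots> = tdel (tk v) I b"
    by (simp add: tk_def tdel_def linD[OF lin_tc] linD[OF lin_tlam])
  finally show "tk (tdel v) I b = tdel (tk v) I b" .
qed

lemma valid_insert_card:
  assumes "valid v" "i \<notin> I" "v (insert i I) b \<noteq> 0" shows "card (insert i I) = Suc (card I)"
proof -
  have "finite I" using assms finite_subset[of _ "{..<m}"] unfolding valid_def by (metis finite_insert finite_lessThan)
  with assms(2) show ?thesis by simp
qed

lemma tc_vanish:
  assumes "valid v" "\<And>I b. Suc r \<le> card I \<Longrightarrow> v I b = 0" "r \<le> card I" shows "tc i v I b = 0"
  using valid_insert_card[OF assms(1), of i I b] assms(2)[of "insert i I" b] assms(3)
  by (cases "v (insert i I) b = 0") (auto simp: tc_def)

lemma tk_vanish: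
  assumes "valid v" "\<And>I b. Suc r \<le> card I \<Longrightarrow> v I b = 0" "r \<le> card I" shows "tk v I b = 0"
  using tc_vanish[OF assms] by (simp add: tk_def)

lemma tdel_vanish:
  assumes "valid v" "\<And>I b. Suc r \<le> card I \<Longrightarrow> v I b = 0" "r \<le> card I" shows "tdel v I b = 0"
  using tc_vanish[OF assms] by (simp add: tdel_def tlam_def tE_def tR_def split: prod.split)

text \<open>Each factor \<open>\<delta>\<close> contains a contraction and so lowers the highest
  theta-degree.\<close>

lemma tdel_pow_vanish:
  assumes "valid v" "\<And>I b. r + j \<le> card I \<Longrightarrow> v I b = 0" "r \<le> card I" shows "(tdel ^^ j) v I b = 0"
  using assms(2,3)
proof (induction j arbitrary: r I b)
  case (Suc j)
  show ?case unfolding funpow.simps comp_def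
    by (rule tdel_vanish[of _ r, OF valid_pow[OF valid_tdel assms(1)] Suc.IH[of "Suc r"]]) (use Suc.prems in auto)
qed simp

lemma valid_card: assumes "valid v" "m < card I" shows "v I b = 0"
proof -
  have "\<not> I \<subseteq> {..<m}" using assms(2) card_mono[of "{..<m}" I] by auto
  then show ?thesis using validD(2)[OF assms(1)] by blast
qed

lemma tdel_nilpotent: assumes "valid v" "m < j" shows "(tdel ^^ j) v I b = 0"
  by (rule tdel_pow_vanish[of _ 0]) (use assms valid_card in auto)

text \<open>\<open>d_K\<close> and the \<open>m\<close> factors \<open>\<delta>\<close> contract
  \<open>m + 1\<close> times in all. This disposes of the top term when \<open>d\<close> is moved
  through the truncated exponential.\<close>

lemma tdel_pow_tk: assumes "valid v" shows "(tdel ^^ m) (tk v) I b = 0"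
  by (rule tdel_pow_vanish[of _ 0, OF valid_tk[OF assms]])
    (use tk_vanish[OF assms, of m] valid_card[OF assms] in auto)

lemma tk_tdel_pow: "valid v \<Longrightarrow> tk ((tdel ^^ j) v) = (tdel ^^ j) (tk v)"
  by (induction j) (auto simp: tk_tdel valid_pow[OF valid_tdel])

text \<open>The product rule for a derivation whose value \<open>d_K\<close> commutes with
  \<open>\<delta>\<close>. At \<open>j = 0\<close> the truncated exponent \<open>j - 1\<close> is
  harmless because of the factor \<open>0\<close>.\<close>

lemma td_tdel_pow:
  "valid v \<Longrightarrow> td ((tdel ^^ j) v) = (\<lambda>I b. (tdel ^^ j) (td v) I b + of_nat j * (tdel ^^ (j - 1)) (tk v) I b)"
proof (induction j)
  case (Suc j)
  have "td ((tdel ^^ Suc j) v) I b = (tdel ^^ Suc j) (td v) I b + of_nat (Suc j) * (tdel ^^ j) (tk v) I b" for I b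
  proof -
    have "td (tdel ((tdel ^^ j) v)) I b = tdel ((tdel ^^ j) (td v)) I b +
        of_nat j * tdel ((tdel ^^ (j - 1)) (tk v)) I b + (tdel ^^ j) (tk v) I b"
      by (simp only: td_tdel[OF valid_pow[OF valid_tdel Suc.prems]] Suc.IH[OF Suc.prems] tk_tdel_pow[OF Suc.prems]
          lin_add[OF lin_tdel] lin_smult[OF lin_tdel])
    then show ?thesis by (cases j) (simp_all add: algebra_simps)
  qed
  then show ?case by simp
qed simp

definition deg :: "nat set \<Rightarrow> 'my \<times> 'mx \<Rightarrow> bit" where
  "deg I b = of_nat (card I) + parity Y (fst b) + parity X (snd b)"

definition homog :: "bit \<Rightarrow> ('my, 'mx, 'k) vec \<Rightarrow> bool" where
  "homog s v \<longleftrightarrow> (\<forall>I b. v I b \<noteq> 0 \<longrightarrow> deg I b = s)"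

lemma homog_tE: "homog s v \<Longrightarrow> homog s (tE v)"
  unfolding homog_def tE_def by (metis mult_zero_right)

lemma homog_tL:
  assumes "homog s v" shows "homog (s + 1) (tL v)"
  unfolding homog_def
proof (intro allI impI)
  fix I b assume *: "tL v I b \<noteq> 0"
  obtain f e where b: "b = (f, e)" by force
  from * have "(\<Sum>f'\<in>BY. DY f f' * v I (f', e)) \<noteq> 0" unfolding b tL_def by simp
  then obtain f' where f': "f' \<in> BY" "DY f f' \<noteq> 0" "v I (f', e) \<noteq> 0"
    by (metis (no_types, lifting) mult_zero_left mult_zero_right sum.neutral)
  then have "f \<in> BY" using DY_out by blast
  then have "deg I b = deg I (f', e) + 1"
    unfolding b deg_def fst_conv snd_conv by (simp only: DY_odd[OF _ f'(1,2)] ac_simps)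
  then show "deg I b = s + 1" using assms f'(3) unfolding homog_def by simp
qed

text \<open>Stated for any matrix supported where \<open>DX\<close> is nonzero, so that it covers
  the derivatives \<open>DX' i\<close> as well.\<close>

lemma homog_tR:
  assumes "homog s v" "\<And>e e'. e' \<in> BX \<Longrightarrow> D e e' \<noteq> 0 \<Longrightarrow> e \<in> BX \<and> DX e e' \<noteq> 0" shows "homog (s + 1) (tR D v)"
  unfolding homog_def
proof (intro allI impI)
  fix I b assume *: "tR D v I b \<noteq> 0"
  obtain f e where b: "b = (f, e)" by force
  from * have "(\<Sum>e'\<in>BX. D e e' * v I (f, e')) \<noteq> 0" unfolding b tR_def by auto
  then obtain e' where e': "e' \<in> BX" "D e e' \<noteq> 0" "v I (f, e') \<noteq> 0"
    by (metis (no_types, lifting) mult_zero_left mult_zero_right sum.neutral)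
  then have "parity X e = parity X e' + 1" using DX_odd[of e e'] assms(2) by blast
  then have "deg I b = deg I (f, e') + 1"
    unfolding b deg_def fst_conv snd_conv by (simp only: ac_simps)
  then show "deg I b = s + 1" using assms(1) e'(3) unfolding homog_def by simp
qed

lemma homog_add: "homog s u \<Longrightarrow> homog s v \<Longrightarrow> homog s (\<lambda>I b. u I b + v I b)"
  and homog_smult: "homog s v \<Longrightarrow> homog s (\<lambda>I b. p * v I b)"
  unfolding homog_def by (metis add_0, metis mult_zero_right)

lemma homog_sum: "(\<And>i. i \<in> K \<Longrightarrow> homog s (v' i)) \<Longrightarrow> homog s (\<lambda>I b. \<Sum>i\<in>K. v' i I b)"
  unfolding homog_def by (metis (no_types, lifting) sum.neutral)

lemma homog_td: "homog s v \<Longrightarrow> homog (s + 1) (td v)"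
  unfolding td_def by (intro homog_tE homog_add homog_tL homog_tR) (use DX_out in blast)+

lemma homog_tc:
  assumes "valid v" "homog s v" shows "homog (s + 1) (tc i v)"
  unfolding homog_def
proof (intro allI impI)
  fix I b assume "tc i v I b \<noteq> 0"
  then have *: "i \<notin> I" "v (insert i I) b \<noteq> 0" by (auto simp: tc_def split: if_splits)
  then have "deg (insert i I) b = s" using assms(2) unfolding homog_def by blast
  then show "deg I b = s + 1" using valid_insert_card[OF assms(1) *] by (auto simp: deg_def)
qed

lemma homog_tk: "valid v \<Longrightarrow> homog s v \<Longrightarrow> homog (s + 1) (tk v)"
  unfolding tk_def by (intro homog_sum homog_smult homog_tc)

lemma homog_tdel:
  assumes "valid v" "homog s v" shows "homog s (tdel v)"
proof -
  have "homog (s + 1 + 1) (tdel v)"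
    unfolding tdel_def tlam_def
    by (intro homog_sum homog_tE homog_tR homog_tc assms) (use DX_out in \<open>metis pdiff_zero\<close>)
  then show ?thesis unfolding bit_add_1_1 .
qed

lemma homog_tdel_pow: "valid v \<Longrightarrow> homog s v \<Longrightarrow> homog s ((tdel ^^ j) v)"
  by (induction j) (auto intro!: homog_tdel valid_pow[OF valid_tdel])

end

section \<open>The exponential of the nilpotent operator delta\<close>

locale mf_pair_exp = mf_pair +
  fixes q :: "rat \<Rightarrow> 'a"
  assumes q: "q \<in> ring_hom type_ring type_ring"
begin

lemma q_add: "q (a + b) = q a + q b" and q_mult: "q (a * b) = q a * q b" and q_one [simp]: "q 1 = 1"
  using q by (auto simp: ring_hom_def type_ring_def)

lemma q_zero [simp]: "q 0 = 0" using q_add[of 0 0] by simp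

lemma q_sum: "q (sum f I) = (\<Sum>i\<in>I. q (f i))"
  by (induction I rule: infinite_finite_induct) (auto simp: q_add)

lemma q_of_nat: "q (of_nat j) = of_nat j"
  by (induction j) (auto simp: q_add)

definition coeff_exp :: "rat \<Rightarrow> nat \<Rightarrow> 'a pol" where "coeff_exp c j = const (q (c ^ j / fact j))"

text \<open>The binomial theorem for divided powers, carried from the rationals to \<open>k\<close>
  by \<open>q\<close>.\<close>

lemma coeff_exp_add: "coeff_exp (a + b) k = (\<Sum>i\<le>k. coeff_exp a i * coeff_exp b (k - i))"
proof -
  have "(a + b) ^ k / fact k = (\<Sum>i\<le>k. (a ^ i / fact i) * (b ^ (k - i) / fact (k - i)))"
    unfolding binomial_ring by (auto simp: sum_divide_distrib binomial_fact intro!: sum.cong)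
  then show ?thesis unfolding coeff_exp_def const_simps(4)[symmetric] q_mult[symmetric] const_sum[symmetric] q_sum[symmetric]
    by simp
qed

lemma coeff_exp_Suc: "of_nat (Suc j) * coeff_exp c (Suc j) = const (q c) * coeff_exp c j"
proof -
  have "of_nat (Suc j) * (c ^ Suc j / fact (Suc j)) = c * (c ^ j / fact j)"
    by (simp add: fact_Suc of_nat_neq_0 del: of_nat_Suc)
  then have "q (of_nat (Suc j)) * q (c ^ Suc j / fact (Suc j)) = q c * q (c ^ j / fact j)" by (metis q_mult)
  then have "const (q (of_nat (Suc j))) * coeff_exp c (Suc j) = const (q c) * coeff_exp c j"
    unfolding coeff_exp_def by (metis const_simps(4))
  moreover have "const (of_nat i) = (of_nat i :: 'a pol)" for i by (induction i) auto
  ultimately show ?thesis by (simp only: q_of_nat)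
qed

definition texp where "texp c v = (\<lambda>I b. \<Sum>j\<le>m. coeff_exp c j * (tdel ^^ j) v I b)"

lemma homog_texp: "valid v \<Longrightarrow> homog s v \<Longrightarrow> homog s (texp c v)"
  unfolding texp_def by (intro homog_sum homog_smult homog_tdel_pow)

lemma texp_zero: "texp 0 v = v"
proof -
  have "(\<Sum>j\<le>m. coeff_exp 0 j * (tdel ^^ j) v I b) = (\<Sum>j\<le>m. if j = 0 then v I b else 0)" for I b
    by (intro sum.cong) (auto simp: coeff_exp_def zero_power)
  then show ?thesis by (simp add: texp_def)
qed

text \<open>Nilpotency removes the products with \<open>i + j > m\<close> from the square of index
  pairs; the triangle that remains is summed along its diagonals.\<close>

lemma texp_texp: assumes "valid v" shows "texp a (texp b v) = texp (a + b) v"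
proof (intro ext)
  fix I c
  let ?g = "\<lambda>i j. coeff_exp a i * coeff_exp b j * (tdel ^^ (i + j)) v I c"
  have "texp a (texp b v) I c = (\<Sum>i\<le>m. \<Sum>j\<le>m. ?g i j)"
    unfolding texp_def by (simp add: linD[OF lin_pow[OF lin_tdel]] sum_distrib_left mult.assoc funpow_add)
  also have "\<dots> = (\<Sum>(i, j)\<in>{..m} \<times> {..m}. ?g i j)" by (simp add: sum.cartesian_product)
  also have "\<dots> = (\<Sum>(i, j)\<in>{(i, j). i + j \<le> m}. ?g i j)"
  proof (rule sum.mono_neutral_right)
    show "\<forall>x\<in>{..m} \<times> {..m} - {(i, j). i + j \<le> m}. (case x of (i, j) \<Rightarrow> ?g i j) = 0"
    proof
      fix x assume "x \<in> {..m} \<times> {..m} - {(i, j). i + j \<le> m}"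
      then obtain i j where "x = (i, j)" "m < i + j" by (cases x) (auto simp: not_le)
      then show "(case x of (i, j) \<Rightarrow> ?g i j) = 0" by (simp add: tdel_nilpotent[OF assms])
    qed
  qed auto
  also have "\<dots> = (\<Sum>k\<le>m. \<Sum>i\<le>k. ?g i (k - i))" by (rule sum.triangle_reindex_eq)
  also have "\<dots> = texp (a + b) v I c"
    unfolding texp_def coeff_exp_add by (simp add: sum_distrib_right)
  finally show "texp a (texp b v) I c = texp (a + b) v I c" .
qed

text \<open>Differentiating the series shifts the index, since \<open>j\<close> times its
  \<open>j\<close>-th coefficient is \<open>c\<close> times the previous one. The shifted sum ends
  at \<open>m - 1\<close>; the missing term is zero by \<open>tdel_pow_tk\<close>.\<close>

lemma td_texp:
  assumes "valid v"
  shows "td (texp c v) I b = texp c (td v) I b + const (q c) * texp c (tk v) I b"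
proof -
  have "td (texp c v) I b = (\<Sum>j\<le>m. coeff_exp c j * td ((tdel ^^ j) v) I b)"
    unfolding texp_def by (simp add: linD[OF lin_td])
  also have "\<dots> = texp c (td v) I b + (\<Sum>j\<le>m. coeff_exp c j * of_nat j * (tdel ^^ (j - 1)) (tk v) I b)"
    by (simp add: texp_def td_tdel_pow[OF assms] distrib_left sum.distrib mult.assoc)
  also have "(\<Sum>j\<le>m. coeff_exp c j * of_nat j * (tdel ^^ (j - 1)) (tk v) I b) =
      (\<Sum>j<m. coeff_exp c (Suc j) * of_nat (Suc j) * (tdel ^^ j) (tk v) I b)"
    unfolding sum.atMost_shift by simp
  also have "\<dots> = (\<Sum>j<m. const (q c) * (coeff_exp c j * (tdel ^^ j) (tk v) I b))"
  proof (rule sum.cong[OF refl])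
    fix j
    show "coeff_exp c (Suc j) * of_nat (Suc j) * (tdel ^^ j) (tk v) I b = const (q c) * (coeff_exp c j * (tdel ^^ j) (tk v) I b)"
      unfolding mult.commute[of "coeff_exp c (Suc j)"] coeff_exp_Suc by (rule mult.assoc)
  qed
  also have "\<dots> = const (q c) * texp c (tk v) I b"
  proof -
    have "{..m} = insert m {..<m}" by auto
    then show ?thesis by (simp add: texp_def tdel_pow_tk[OF assms] sum_distrib_left)
  qed
  finally show ?thesis .
qed

lemma tk_texp: "valid v \<Longrightarrow> tk (texp c v) = texp c (tk v)"
  unfolding texp_def by (simp add: linD[OF lin_tk] tk_tdel_pow)

end

section \<open>Operators on tensor products\<close>

declare split_paired_All [simp del]

lemma module_pol_ring_mono:
  assumes "module (pol_ring S) M" "T \<subseteq> S" shows "module (pol_ring T) M"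
proof -
  interpret pol_module S M using assms(1) by (rule pol_moduleI)
  note [simp] = pol_ring_mono[OF _ assms(2)]
  show ?thesis
    by (rule moduleI[OF cring_pol_ring M.abelian_group_axioms]) (simp_all add: smult_pol smult_r_distr)
qed

lemma abelian_group_pointwise:
  fixes N :: "('m, 'q) ring_scheme" and G :: "('i \<Rightarrow> 'm, 's) ring_scheme"
  assumes "abelian_group N" "carrier G = {g. (\<forall>i. g i \<in> carrier N) \<and> (\<forall>i. \<not> Q i \<longrightarrow> g i = \<zero>\<^bsub>N\<^esub>)}"
    "zero G = (\<lambda>_. \<zero>\<^bsub>N\<^esub>)" "add G = (\<lambda>g h i. g i \<oplus>\<^bsub>N\<^esub> h i)"
  shows "abelian_group G"
proof -
  interpret N: abelian_group N by fact
  show ?thesis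
  proof (rule abelian_groupI)
    fix g assume g: "g \<in> carrier G"
    show "\<exists>h\<in>carrier G. h \<oplus>\<^bsub>G\<^esub> g = \<zero>\<^bsub>G\<^esub>"
      by (rule bexI[of _ "\<lambda>i. \<ominus>\<^bsub>N\<^esub> g i"]) (use g in \<open>auto simp: assms N.l_neg\<close>)
  qed (auto simp: assms N.a_ac)
qed

text \<open>Evaluation at an index is additive, so it commutes with the sum.\<close>

lemma finsum_pointwise:
  fixes N :: "('m, 'q) ring_scheme" and G :: "('i \<Rightarrow> 'm, 's) ring_scheme"
  assumes "abelian_group N" "abelian_group G" "zero G = (\<lambda>_. \<zero>\<^bsub>N\<^esub>)" "add G = (\<lambda>g h i. g i \<oplus>\<^bsub>N\<^esub> h i)"
    "\<And>g i. g \<in> carrier G \<Longrightarrow> g i \<in> carrier N" "\<And>j. j \<in> J \<Longrightarrow> f j \<in> carrier G"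
  shows "(\<Oplus>\<^bsub>G\<^esub>j\<in>J. f j) = (\<lambda>i. \<Oplus>\<^bsub>N\<^esub>j\<in>J. f j i)"
proof
  fix i
  show "(\<Oplus>\<^bsub>G\<^esub>j\<in>J. f j) i = (\<Oplus>\<^bsub>N\<^esub>j\<in>J. f j i)"
    using finsum_additive[of G N "\<lambda>g. g i" J f] assms(3-6)
      abelian_group.axioms(1)[OF assms(1)] abelian_group.axioms(1)[OF assms(2)] by (simp add: Pi_iff)
qed

locale tensor_module = mf_pair_exp n m l U V W Y BY X BX DY DX q + A: coeff_module m A
  for n m l :: nat and U V W :: "'k::comm_ring_1 pol"
    and Y :: "('k pol, 'my) factorisation" and BY :: "'my set"
    and X :: "('k pol, 'mx) factorisation" and BX :: "'mx set"
    and DY :: "'my \<Rightarrow> 'my \<Rightarrow> 'k pol" and DX :: "'mx \<Rightarrow> 'mx \<Rightarrow> 'k pol" and q :: "rat \<Rightarrow> 'k"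
    and A :: "('k pol, 'c) module"
begin

abbreviation "B \<equiv> poly_ext n l A"
abbreviation "Mt \<equiv> tensor n m l Y BY X BX A"
abbreviation "E \<equiv> ext_factorisation m Mt"
abbreviation "P \<equiv> Pow {..<m} \<times> (BY \<times> BX)"

sublocale B: pol_module "xvars n \<union> yvars m \<union> zvars l" B
  by (rule pol_moduleI) (rule A.poly_ext_module)

lemma finite_P: "finite P"
  by (simp add: finite_BY finite_BX)

lemma Mt_simps [simp]:
  "zero Mt = (\<lambda>_ _. \<zero>\<^bsub>A\<^esub>)" "add Mt = (\<lambda>g h b \<mu>. g b \<mu> \<oplus>\<^bsub>A\<^esub> h b \<mu>)" "smult Mt = (\<lambda>p g b. act A p (g b))"
  by (simp_all add: tensor_def)

lemma E_simps [simp]: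
  "zero E = (\<lambda>_ _ _. \<zero>\<^bsub>A\<^esub>)" "add E = (\<lambda>g h I b \<mu>. g I b \<mu> \<oplus>\<^bsub>A\<^esub> h I b \<mu>)" "smult E = (\<lambda>p g I b. act A p (g I b))"
  by (simp_all add: ext_factorisation_def)

lemma Mt_carrier: "carrier Mt = {g. (\<forall>b. g b \<in> carrier B) \<and> (\<forall>b. \<not> b \<in> BY \<times> BX \<longrightarrow> g b = \<zero>\<^bsub>B\<^esub>)}"
  unfolding tensor_def tensor_carrier_def poly_ext_def by (simp del: split_paired_All mem_Sigma_iff add: fun_eq_iff[of _ "\<lambda>_. \<zero>\<^bsub>A\<^esub>"]) blast

lemma E_carrier': "carrier E = {g. (\<forall>I. g I \<in> carrier Mt) \<and> (\<forall>I. \<not> I \<subseteq> {..<m} \<longrightarrow> g I = \<zero>\<^bsub>Mt\<^esub>)}"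
  by (simp add: ext_factorisation_def ext_carrier_def)

lemma E_carrier:
  "g \<in> carrier E \<longleftrightarrow> (\<forall>I b. g I b \<in> carrier B) \<and> (\<forall>I b. (I, b) \<notin> P \<longrightarrow> g I b = (\<lambda>_. \<zero>\<^bsub>A\<^esub>))"
  unfolding E_carrier' Mt_carrier by (simp del: split_paired_All mem_Sigma_iff add: mem_Sigma_iff[of _ _ "Pow _"]) metis

lemma B_carrier: "g \<in> carrier B \<Longrightarrow> g \<mu> \<in> carrier A"
  by (simp add: poly_ext_def)

lemma E_carrierD:
  assumes "g \<in> carrier E"
  shows "g I b \<in> carrier B" "g I b \<mu> \<in> carrier A" "(I, b) \<notin> P \<Longrightarrow> g I b = (\<lambda>_. \<zero>\<^bsub>A\<^esub>)" "g I \<in> carrier Mt"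
proof -
  show *: "g I b \<in> carrier B" using assms unfolding E_carrier by blast
  show "g I b \<mu> \<in> carrier A" by (rule B_carrier[OF *])
  show "g I b = (\<lambda>_. \<zero>\<^bsub>A\<^esub>)" if "(I, b) \<notin> P" using assms that unfolding E_carrier by blast
  show "g I \<in> carrier Mt" using assms unfolding E_carrier' by blast
qed

lemma Mt_group: "abelian_group Mt"
  by (rule abelian_group_pointwise[OF B.M.abelian_group_axioms Mt_carrier]) simp_all

lemma E_group: "abelian_group E"
  by (rule abelian_group_pointwise[OF Mt_group E_carrier']) simp_all

lemma Mt_module: "module (kxyz n m l) Mt"
proof (rule moduleI[OF cring_pol_ring Mt_group])
  fix p :: "'k pol" and g assume "p \<in> carrier (kxyz n m l)" "g \<in> carrier Mt"
  then show "p \<odot>\<^bsub>Mt\<^esub> g \<in> carrier Mt"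
    unfolding Mt_carrier using B.smult_closed B.smult_r_null by auto
next
  fix p :: "'k pol" and g h assume "p \<in> carrier (kxyz n m l)" "g \<in> carrier Mt" "h \<in> carrier Mt"
  then show "p \<odot>\<^bsub>Mt\<^esub> (g \<oplus>\<^bsub>Mt\<^esub> h) = p \<odot>\<^bsub>Mt\<^esub> g \<oplus>\<^bsub>Mt\<^esub> p \<odot>\<^bsub>Mt\<^esub> h"
    using B.smult_r_distr[of p "g _" "h _"] unfolding Mt_carrier by (simp add: fun_eq_iff)
next
  fix p r :: "'k pol" and g assume "p \<in> carrier (kxyz n m l)" "r \<in> carrier (kxyz n m l)" "g \<in> carrier Mt"
  then show "(p \<oplus>\<^bsub>kxyz n m l\<^esub> r) \<odot>\<^bsub>Mt\<^esub> g = p \<odot>\<^bsub>Mt\<^esub> g \<oplus>\<^bsub>Mt\<^esub> r \<odot>\<^bsub>Mt\<^esub> g"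
    "(p \<otimes>\<^bsub>kxyz n m l\<^esub> r) \<odot>\<^bsub>Mt\<^esub> g = p \<odot>\<^bsub>Mt\<^esub> (r \<odot>\<^bsub>Mt\<^esub> g)"
    using B.smult_pol(1)[of p r "g _"] B.smult_pol(2)[of p r "g _"] unfolding Mt_carrier by (simp_all add: fun_eq_iff)
next
  fix g assume "g \<in> carrier Mt"
  then show "\<one>\<^bsub>kxyz n m l\<^esub> \<odot>\<^bsub>Mt\<^esub> g = g"
    using B.smult_pol(3)[of "g _"] unfolding Mt_carrier by (simp add: fun_eq_iff)
qed

sublocale Mt: pol_module "xvars n \<union> yvars m \<union> zvars l" Mt
  by (rule pol_moduleI) (rule Mt_module)

lemma E_module: "module (kxyz n m l) E"
proof (rule moduleI[OF cring_pol_ring E_group])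
  fix p :: "'k pol" and g assume "p \<in> carrier (kxyz n m l)" "g \<in> carrier E"
  then show "p \<odot>\<^bsub>E\<^esub> g \<in> carrier E"
    unfolding E_carrier' using Mt.smult_closed Mt.smult_r_null by auto
next
  fix p :: "'k pol" and g h assume "p \<in> carrier (kxyz n m l)" "g \<in> carrier E" "h \<in> carrier E"
  then show "p \<odot>\<^bsub>E\<^esub> (g \<oplus>\<^bsub>E\<^esub> h) = p \<odot>\<^bsub>E\<^esub> g \<oplus>\<^bsub>E\<^esub> p \<odot>\<^bsub>E\<^esub> h"
    using Mt.smult_r_distr[of p "g _" "h _"] unfolding E_carrier' by (simp add: fun_eq_iff)
next
  fix p r :: "'k pol" and g assume "p \<in> carrier (kxyz n m l)" "r \<in> carrier (kxyz n m l)" "g \<in> carrier E"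
  then show "(p \<oplus>\<^bsub>kxyz n m l\<^esub> r) \<odot>\<^bsub>E\<^esub> g = p \<odot>\<^bsub>E\<^esub> g \<oplus>\<^bsub>E\<^esub> r \<odot>\<^bsub>E\<^esub> g"
    "(p \<otimes>\<^bsub>kxyz n m l\<^esub> r) \<odot>\<^bsub>E\<^esub> g = p \<odot>\<^bsub>E\<^esub> (r \<odot>\<^bsub>E\<^esub> g)"
    using Mt.smult_pol(1)[of p r "g _"] Mt.smult_pol(2)[of p r "g _"] unfolding E_carrier' by (simp_all add: fun_eq_iff)
next
  fix g assume "g \<in> carrier E"
  then show "\<one>\<^bsub>kxyz n m l\<^esub> \<odot>\<^bsub>E\<^esub> g = g"
    using Mt.smult_pol(3)[of "g _"] unfolding E_carrier' by (simp add: fun_eq_iff)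
qed

sublocale E: pol_module "xvars n \<union> yvars m \<union> zvars l" E
  by (rule pol_moduleI) (rule E_module)

lemma signed_A: "a \<in> carrier A \<Longrightarrow> signed A s a = sg s \<odot>\<^bsub>A\<^esub> a"
  using A.smult_pol_uminus[of 1 a] by (cases s) (auto simp: signed_def A.smult_pol)

lemma signed_Mt: "g \<in> carrier Mt \<Longrightarrow> signed Mt s g = (\<lambda>b. act A (sg s) (g b))"
  using Mt.smult_pol_uminus[of 1 g] Mt.smult_pol(3)[of g] by (cases s) (auto simp: signed_def)

lemma finsum_B: "(\<And>j. j \<in> J \<Longrightarrow> f j \<in> carrier B) \<Longrightarrow> (\<Oplus>\<^bsub>B\<^esub>j\<in>J. f j) = (\<lambda>\<mu>. \<Oplus>\<^bsub>A\<^esub>j\<in>J. f j \<mu>)"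
  by (rule finsum_pointwise[OF A.M.abelian_group_axioms B.M.abelian_group_axioms]) (simp_all add: B_carrier)

lemma finsum_E: 
  assumes "\<And>j. j \<in> J \<Longrightarrow> f j \<in> carrier E" shows "(\<Oplus>\<^bsub>E\<^esub>j\<in>J. f j) = (\<lambda>I b. \<Oplus>\<^bsub>B\<^esub>j\<in>J. f j I b)"
proof -
  have "(\<Oplus>\<^bsub>E\<^esub>j\<in>J. f j) = (\<lambda>I. \<Oplus>\<^bsub>Mt\<^esub>j\<in>J. f j I)"
    by (rule finsum_pointwise[OF Mt_group E_group]) (simp_all add: assms E_carrierD)
  moreover have "(\<Oplus>\<^bsub>Mt\<^esub>j\<in>J. f j I) = (\<lambda>b. \<Oplus>\<^bsub>B\<^esub>j\<in>J. f j I b)" for I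
    by (rule finsum_pointwise[OF B.M.abelian_group_axioms Mt_group]) (use assms in \<open>auto simp: E_carrierD Mt_carrier\<close>)
  ultimately show ?thesis by simp
qed

abbreviation arg :: "(nat set \<Rightarrow> ('my, 'mx, 'c) tens) \<Rightarrow> nat set \<times> 'my \<times> 'mx \<Rightarrow> mono \<Rightarrow> 'c" where
  "arg g \<equiv> \<lambda>x. g (fst x) (snd x)"

text \<open>The matrix with columns \<open>v x\<close>, applied to \<open>g\<close>. Its entries lie
  in \<open>k[x,y,z]\<close>, so it acts on the tensor product over any coefficient module
  \<open>A\<close>.\<close>

definition gen where "gen g v = (\<lambda>I b. B.ev P (arg g) (\<lambda>x. v x I b))"

definition unit :: "nat set \<times> 'my \<times> 'mx \<Rightarrow> ('my, 'mx, 'k) vec" where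
  "unit x = (\<lambda>I b. if x \<in> P \<and> (I, b) = x then 1 else 0)"

lemma valid_unit: "valid (unit x)"
  by (auto simp: valid_def unit_def)

context
  fixes g assumes g: "g \<in> carrier E"
begin

lemma arg_closed: "x \<in> P \<Longrightarrow> arg g x \<in> carrier B"
  by (rule E_carrierD(1)[OF g])

lemmas ev_facts = B.ev_closed[of P "arg g", OF finite_P arg_closed] B.ev_add[of P "arg g", OF finite_P arg_closed]
  B.ev_smult[of P "arg g", OF finite_P arg_closed] B.ev_sum[of P "arg g", OF finite_P arg_closed]
  B.ev_zero[of P "arg g", OF finite_P arg_closed]

lemma gen_closed: assumes "\<And>x. valid (v x)" shows "gen g v \<in> carrier E"
  unfolding E_carrier
proof (intro conjI allI impI)
  show "gen g v I b \<in> carrier B" for I b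
    unfolding gen_def by (rule ev_facts(1)) (auto intro: validD(1)[OF assms])
  show "gen g v I b = (\<lambda>_. \<zero>\<^bsub>A\<^esub>)" if "(I, b) \<notin> P" for I b
  proof -
    have "v x I b = 0" for x using that assms[of x] unfolding valid_def by (metis PowI mem_Sigma_iff)
    then show ?thesis using ev_facts(5) by (simp add: gen_def)
  qed
qed

lemma gen_unit: "gen g unit = g"
proof (intro ext)
  fix I b \<mu>
  show "gen g unit I b \<mu> = g I b \<mu>"
  proof (cases "(I, b) \<in> P")
    case True
    then have "(\<lambda>x. unit x I b) = (\<lambda>x. if x = (I, b) then 1 else 0)" by (auto simp: unit_def)
    then show ?thesis using B.ev_delta[OF finite_P arg_closed True] by (simp add: gen_def)
  next
    case False
    then have "(\<lambda>x. unit x I b) = (\<lambda>x. 0)" by (auto simp: unit_def fun_eq_iff)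
    then show ?thesis using E_carrierD(3)[OF g False] ev_facts(5) by (simp add: gen_def)
  qed
qed

lemma gen_add:
  "(\<And>x. valid (u x)) \<Longrightarrow> (\<And>x. valid (v x)) \<Longrightarrow> gen g (\<lambda>x I b. u x I b + v x I b) = gen g u \<oplus>\<^bsub>E\<^esub> gen g v"
  unfolding gen_def by (simp add: ev_facts(2) validD(1))

lemma gen_smult:
  "p \<in> carrier (kxyz n m l) \<Longrightarrow> (\<And>x. valid (v x)) \<Longrightarrow> gen g (\<lambda>x I b. p * v x I b) = p \<odot>\<^bsub>E\<^esub> gen g v"
  using ev_facts(3)[where p = p] unfolding gen_def by (simp add: validD(1))

lemma gen_sum:
  assumes "\<And>i x. i \<in> K \<Longrightarrow> valid (v i x)"
  shows "gen g (\<lambda>x I b. \<Sum>i\<in>K. v i x I b) = (\<Oplus>\<^bsub>E\<^esub>i\<in>K. gen g (v i))"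
proof -
  have "(\<Oplus>\<^bsub>E\<^esub>i\<in>K. gen g (v i)) = (\<lambda>I b. \<Oplus>\<^bsub>B\<^esub>i\<in>K. gen g (v i) I b)"
    by (rule finsum_E) (auto intro: gen_closed assms)
  also have "\<dots> = gen g (\<lambda>x I b. \<Sum>i\<in>K. v i x I b)"
    unfolding gen_def by (intro ext, subst ev_facts(4)) (auto intro: validD(1)[OF assms])
  finally show ?thesis by simp
qed

end

lemma gen_linear: assumes "\<And>x. valid (v x)" shows "linear_map (kxyz n m l) E E (\<lambda>g. gen g v)"
proof (rule linear_mapI)
  fix g h assume gh: "g \<in> carrier E" "h \<in> carrier E"
  have "B.ev P (arg (g \<oplus>\<^bsub>E\<^esub> h)) (\<lambda>x. v x I b) = B.ev P (arg g) (\<lambda>x. v x I b) \<oplus>\<^bsub>B\<^esub> B.ev P (arg h) (\<lambda>x. v x I b)" for I b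
    unfolding B.ev_def
    by (rule B.M.finsum_add_eq)
      (use gh validD(1)[OF assms] E_carrierD(1) B.smult_closed B.smult_r_distr in simp_all)
  then show "gen (g \<oplus>\<^bsub>E\<^esub> h) v = gen g v \<oplus>\<^bsub>E\<^esub> gen h v" unfolding gen_def by simp
next
  fix p :: "'k pol" and g assume pg: "p \<in> carrier (kxyz n m l)" "g \<in> carrier E"
  have "B.ev P (arg (p \<odot>\<^bsub>E\<^esub> g)) (\<lambda>x. v x I b) = p \<odot>\<^bsub>B\<^esub> B.ev P (arg g) (\<lambda>x. v x I b)" for I b
  proof -
    have e: "v x I b \<odot>\<^bsub>B\<^esub> (p \<odot>\<^bsub>B\<^esub> arg g x) = p \<odot>\<^bsub>B\<^esub> (v x I b \<odot>\<^bsub>B\<^esub> arg g x)" for x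
      using B.smult_pol(2)[of p "v x I b" "arg g x"] B.smult_pol(2)[of "v x I b" p "arg g x"]
      by (simp add: pg validD(1)[OF assms] E_carrierD(1) mult.commute)
    have "p \<odot>\<^bsub>B\<^esub> B.ev P (arg g) (\<lambda>x. v x I b) = (\<Oplus>\<^bsub>B\<^esub>x\<in>P. p \<odot>\<^bsub>B\<^esub> (v x I b \<odot>\<^bsub>B\<^esub> arg g x))"
      unfolding B.ev_def
      by (rule B.smult_finsum[OF pg(1)]) (intro B.smult_closed validD(1)[OF assms] E_carrierD(1)[OF pg(2)])
    then show ?thesis unfolding B.ev_def e[symmetric] by simp
  qed
  then show "gen (p \<odot>\<^bsub>E\<^esub> g) v = p \<odot>\<^bsub>E\<^esub> gen g v" unfolding gen_def by simp
qed (rule gen_closed, auto intro: assms)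

text \<open>\<open>T\<close> is the matrix form of \<open>op\<close>. The equation is required for
  all valid families and not only for \<open>unit\<close>, so that such pairs compose without
  further argument.\<close>

definition rep where
  "rep op T \<longleftrightarrow> (\<forall>v. valid v \<longrightarrow> valid (T v)) \<and>
     (\<forall>g v. g \<in> carrier E \<longrightarrow> (\<forall>x. valid (v x)) \<longrightarrow> op (gen g v) = gen g (\<lambda>x. T (v x)))"

lemma repD: "rep op T \<Longrightarrow> g \<in> carrier E \<Longrightarrow> (\<And>x. valid (v x)) \<Longrightarrow> op (gen g v) = gen g (\<lambda>x. T (v x))"
  by (simp add: rep_def)

lemma rep_valid: "rep op T \<Longrightarrow> valid v \<Longrightarrow> valid (T v)"
  by (simp add: rep_def)

lemma rep_apply: "rep op T \<Longrightarrow> g \<in> carrier E \<Longrightarrow> op g = gen g (\<lambda>x. T (unit x))"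
  using repD[of op T g unit] by (simp add: gen_unit valid_unit)

lemma rep_comp: "rep op T \<Longrightarrow> rep op' T' \<Longrightarrow> rep (\<lambda>g. op (op' g)) (\<lambda>v. T (T' v))"
  unfolding rep_def by simp

text \<open>The transfer principle: an identity checked on coefficient vectors holds for the
  operators, whatever the coefficient module.\<close>

lemma rep_eq:
  assumes "rep op T" "rep op' T'" "\<And>v. valid v \<Longrightarrow> T v = T' v" "g \<in> carrier E" shows "op g = op' g"
  unfolding rep_apply[OF assms(1,4)] rep_apply[OF assms(2,4)] by (simp add: assms(3)[OF valid_unit])

lemma rep_linear: assumes "rep op T" shows "linear_map (kxyz n m l) E E op"
  using gen_linear[of "\<lambda>x. T (unit x)"] rep_apply[OF assms] rep_valid[OF assms valid_unit] E.smult_closed E.M.a_closed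
  unfolding linear_map_def Pi_iff by simp

lemma rep_id: "rep (\<lambda>g. g) (\<lambda>v. v)"
  by (simp add: rep_def)

lemma rep_add: "rep op T \<Longrightarrow> rep op' T' \<Longrightarrow> rep (\<lambda>g. op g \<oplus>\<^bsub>E\<^esub> op' g) (\<lambda>v I b. T v I b + T' v I b)"
  unfolding rep_def by (simp add: gen_add valid_add del: E_simps)

lemma rep_smult: "rep op T \<Longrightarrow> p \<in> carrier (kxyz n m l) \<Longrightarrow> rep (\<lambda>g. p \<odot>\<^bsub>E\<^esub> op g) (\<lambda>v I b. p * T v I b)"
  unfolding rep_def by (simp add: gen_smult valid_smult del: E_simps)

lemma rep_sum:
  "(\<And>i. i \<in> K \<Longrightarrow> rep (op i) (T i)) \<Longrightarrow> rep (\<lambda>g. \<Oplus>\<^bsub>E\<^esub>i\<in>K. op i g) (\<lambda>v I b. \<Sum>i\<in>K. T i v I b)"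
  unfolding rep_def
  by (auto simp: gen_sum intro!: valid_sum E.M.finsum_cong' gen_closed)

lemma rep_pow: "rep op T \<Longrightarrow> rep (op ^^ j) (T ^^ j)"
  by (induction j) (auto simp: rep_id[unfolded id_def[symmetric]] comp_def id_def intro: rep_comp rep_id)

abbreviation dk where "dk g \<equiv> \<lambda>I b \<mu>. koszul_diff m t A (\<lambda>I'. g I' b \<mu>) I"
abbreviation gdelta where "gdelta g \<equiv> (\<Oplus>\<^bsub>E\<^esub>i\<in>{..<m}. ext_odd Mt (right_odd_op Y BX A (DX' i)) (contract Mt i g))"
definition gexp where "gexp c g = (\<Oplus>\<^bsub>E\<^esub>j\<in>{..m}. const (q (c ^ j / fact j)) \<odot>\<^bsub>E\<^esub> (gdelta ^^ j) g)"

lemma contract_gen: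
  assumes "g \<in> carrier E" "\<And>x. valid (v x)" shows "contract Mt i (gen g v) = gen g (\<lambda>x. tc i (v x))"
proof (intro ext)
  fix I b \<mu>
  note cl = gen_closed[OF assms(1), of v, OF assms(2)]
  show "contract Mt i (gen g v) I b \<mu> = gen g (\<lambda>x. tc i (v x)) I b \<mu>"
  proof (cases "i \<in> I")
    case True
    then show ?thesis using ev_facts(5)[OF assms(1)] by (simp add: contract_def gen_def tc_def)
  next
    case False
    then have "contract Mt i (gen g v) I b = sg (theta_sign i I) \<odot>\<^bsub>B\<^esub> gen g v (insert i I) b"
      using cl by (simp add: contract_def signed_Mt E_carrierD)
    also have "\<dots> = gen g (\<lambda>x. tc i (v x)) I b"
      using False unfolding gen_def tc_def by (simp add: ev_facts(3)[OF assms(1), symmetric] validD(1)[OF assms(2)] del: poly_ext_simps)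
    finally show ?thesis by simp
  qed
qed

lemma rep_contract: "i < m \<Longrightarrow> rep (contract Mt i) (tc i)"
  by (simp add: rep_def valid_tc contract_gen)

lemma left_op_gen:
  assumes "g \<in> carrier E" "\<And>x. valid (v x)"
  shows "left_op BY A DY (gen g v I) = gen g (\<lambda>x. tL (v x)) I"
proof (intro ext)
  fix b :: "'my \<times> 'mx" and \<mu> obtain f e where b: "b = (f, e)" by force
  have cl: "DY f f' \<odot>\<^bsub>B\<^esub> gen g v I (f', e) \<in> carrier B" if "f' \<in> BY" for f'
    by (intro B.smult_closed kxyz_closed(1)[OF that] E_carrierD(1) gen_closed assms)
  have "left_op BY A DY (gen g v I) b \<mu> = (\<Oplus>\<^bsub>B\<^esub>f'\<in>BY. DY f f' \<odot>\<^bsub>B\<^esub> gen g v I (f', e)) \<mu>"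
    unfolding b left_op_def by (subst finsum_B) (use cl in auto)
  also have "(\<Oplus>\<^bsub>B\<^esub>f'\<in>BY. DY f f' \<odot>\<^bsub>B\<^esub> gen g v I (f', e)) = (\<Oplus>\<^bsub>B\<^esub>f'\<in>BY. B.ev P (arg g) (\<lambda>x. DY f f' * v x I (f', e)))"
    unfolding gen_def
    by (rule B.M.finsum_cong') (use cl[unfolded gen_def] ev_facts(3)[OF assms(1)] ev_facts(1)[OF assms(1)] validD(1)[OF assms(2)] kxyz_closed in auto)
  also have "\<dots> = gen g (\<lambda>x. tL (v x)) I b"
    unfolding gen_def tL_def b prod.case
    by (rule ev_facts(4)[OF assms(1), symmetric]) (use validD(1)[OF assms(2)] kxyz_closed in auto)
  finally show "left_op BY A DY (gen g v I) b \<mu> = gen g (\<lambda>x. tL (v x)) I b \<mu>" .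
qed

lemma right_op_gen:
  assumes "g \<in> carrier E" "\<And>x. valid (v x)" and D: "\<And>e e'. e' \<in> BX \<Longrightarrow> D e e' \<in> carrier (kxyz n m l)"
  shows "right_odd_op Y BX A D (gen g v I) = gen g (\<lambda>x. tR D (v x)) I"
proof (intro ext)
  fix b :: "'my \<times> 'mx" and \<mu> obtain f e where b: "b = (f, e)" by force
  let ?s = "\<Oplus>\<^bsub>B\<^esub>e'\<in>BX. D e e' \<odot>\<^bsub>B\<^esub> gen g v I (f, e')"
  have cl: "D e e' \<odot>\<^bsub>B\<^esub> gen g v I (f, e') \<in> carrier B" if "e' \<in> BX" for e'
    by (intro B.smult_closed D[OF that] E_carrierD(1) gen_closed assms)
  then have sc: "?s \<in> carrier B" by auto
  have "right_odd_op Y BX A D (gen g v I) b \<mu> = signed A (parity Y f) (?s \<mu>)"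
    unfolding b right_odd_op_def by (subst finsum_B) (use cl in auto)
  also have "\<dots> = (sg (parity Y f) \<odot>\<^bsub>B\<^esub> ?s) \<mu>"
    using A.act_ky[of "sg (parity Y f)" ?s] B_carrier[OF sc] by (simp add: signed_A)
  also have "?s = (\<Oplus>\<^bsub>B\<^esub>e'\<in>BX. B.ev P (arg g) (\<lambda>x. D e e' * v x I (f, e')))"
    unfolding gen_def
    by (rule B.M.finsum_cong') (use cl[unfolded gen_def] ev_facts(3)[OF assms(1)] ev_facts(1)[OF assms(1)] validD(1)[OF assms(2)] D in auto)
  also have "\<dots> = B.ev P (arg g) (\<lambda>x. \<Sum>e'\<in>BX. D e e' * v x I (f, e'))"
    by (rule ev_facts(4)[OF assms(1), symmetric]) (use validD(1)[OF assms(2)] D in auto)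
  also have "sg (parity Y f) \<odot>\<^bsub>B\<^esub> \<dots> = gen g (\<lambda>x. tR D (v x)) I b"
    unfolding gen_def tR_def b prod.case
    by (rule ev_facts(3)[OF assms(1), symmetric]) (use validD(1)[OF assms(2)] D in auto)
  finally show "right_odd_op Y BX A D (gen g v I) b \<mu> = gen g (\<lambda>x. tR D (v x)) I b \<mu>" .
qed

lemma ext_odd_gen:
  assumes "g \<in> carrier E" "\<And>x. valid (v x)" "\<And>x. valid (u x)" "\<And>I. f (gen g v I) = gen g u I"
  shows "ext_odd Mt f (gen g v) = gen g (\<lambda>x. tE (u x))"
proof (intro ext)
  fix I b \<mu>
  have "ext_odd Mt f (gen g v) I b = sg (of_nat (card I)) \<odot>\<^bsub>B\<^esub> gen g u I b"
    using gen_closed[OF assms(1), of u, OF assms(3)] by (simp add: ext_odd_def assms(4) signed_Mt E_carrierD)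
  also have "\<dots> = gen g (\<lambda>x. tE (u x)) I b"
    unfolding gen_def tE_def by (rule ev_facts(3)[OF assms(1), symmetric]) (auto intro: validD(1)[OF assms(3)])
  finally show "ext_odd Mt f (gen g v) I b \<mu> = gen g (\<lambda>x. tE (u x)) I b \<mu>" by simp
qed

lemma Mt_differential:
  "differential Mt g = (\<lambda>b \<mu>. left_op BY A DY g b \<mu> \<oplus>\<^bsub>A\<^esub> right_odd_op Y BX A DX g b \<mu>)"
  by (simp add: tensor_def DY_def[symmetric] DX_def[symmetric])

lemma rep_differential: "rep (differential E) td"
proof -
  have "differential E (gen g v) = gen g (\<lambda>x. td (v x))" if "g \<in> carrier E" "\<And>x. valid (v x)" for g v
  proof -
    have "differential Mt (gen g v I) = gen g (\<lambda>x I b. tL (v x) I b + tR DX (v x) I b) I" for I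
    proof -
      have "gen g (\<lambda>x I b. tL (v x) I b + tR DX (v x) I b) = gen g (\<lambda>x. tL (v x)) \<oplus>\<^bsub>E\<^esub> gen g (\<lambda>x. tR DX (v x))"
        by (rule gen_add[OF that(1)]) (auto intro!: valid_tL valid_tR that simp: kxyz_closed DX_out)
      then show ?thesis
        using left_op_gen[of g v I, OF that] right_op_gen[of g v DX I, OF that]
        by (simp add: Mt_differential kxyz_closed)
    qed
    then have "ext_odd Mt (differential Mt) (gen g v) = gen g (\<lambda>x. tE (\<lambda>I b. tL (v x) I b + tR DX (v x) I b))"
      by (intro ext_odd_gen that) (auto intro!: valid_add valid_tL valid_tR that simp: kxyz_closed DX_out)
    then show ?thesis by (simp add: ext_factorisation_def td_def)
  qed
  then show ?thesis by (simp add: rep_def valid_td)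
qed

lemma rep_lambda: "rep (ext_odd Mt (right_odd_op Y BX A (DX' i))) (tlam i)"
proof -
  have "ext_odd Mt (right_odd_op Y BX A (DX' i)) (gen g v) = gen g (\<lambda>x. tlam i (v x))"
    if "g \<in> carrier E" "\<And>x. valid (v x)" for g v
    unfolding tlam_def
    by (intro ext_odd_gen right_op_gen that valid_tR) (auto simp: kxyz_closed DX_out)
  then show ?thesis by (simp add: rep_def valid_tlam)
qed

lemma rep_delta: "rep (\<lambda>g. gdelta g) tdel"
  unfolding tdel_def[abs_def] by (intro rep_sum rep_comp[OF rep_lambda rep_contract]) simp

lemma rep_exp: "rep (gexp c) (texp c)"
  unfolding gexp_def[abs_def] texp_def[abs_def] coeff_exp_def
  by (intro rep_sum rep_smult rep_pow rep_delta) simp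

text \<open>\<open>koszul_diff\<close> works on each coefficient in \<open>A\<close> separately, the
  matrix through \<open>act\<close>. The signs and the \<open>t_i\<close> lie in
  \<open>k[y]\<close>, where the two actions agree by \<open>act_ky\<close>.\<close>

lemma rep_dk: "rep dk tk"
proof -
  have "dk (gen g v) = gen g (\<lambda>x. tk (v x))" if gv: "g \<in> carrier E" "\<And>x. valid (v x)" for g v
  proof (intro ext)
    fix I b \<mu>
    note cl = gen_closed[OF gv(1), of v, OF gv(2)]
    have c: "contract A i (\<lambda>I'. gen g v I' b \<mu>) I = contract Mt i (gen g v) I b \<mu>" for i
      using A.act_ky[of "sg (theta_sign i I)" "gen g v (insert i I) b"] cl
      by (simp add: contract_def signed_Mt signed_A E_carrierD)
    have "dk (gen g v) I b \<mu> = (\<Oplus>\<^bsub>A\<^esub>i\<in>{..<m}. gen g (\<lambda>x I b. t i * tc i (v x) I b) I b \<mu>)"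
      unfolding koszul_diff_def
    proof (rule A.M.finsum_cong')
      fix i assume "i \<in> {..<m}"
      then have i: "i < m" by simp
      have ccl: "gen g (\<lambda>x. tc i (v x)) \<in> carrier E" by (rule gen_closed[OF gv(1)]) (rule valid_tc[OF i gv(2)])
      have "t i \<odot>\<^bsub>A\<^esub> contract A i (\<lambda>I'. gen g v I' b \<mu>) I = (t i \<odot>\<^bsub>E\<^esub> gen g (\<lambda>x. tc i (v x))) I b \<mu>"
        unfolding c contract_gen[of g v, OF gv] using A.act_ky[OF kxyz_closed(3), of "gen g (\<lambda>x. tc i (v x)) I b"] ccl
        by (simp add: E_carrierD)
      also have "t i \<odot>\<^bsub>E\<^esub> gen g (\<lambda>x. tc i (v x)) = gen g (\<lambda>x I b. t i * tc i (v x) I b)"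
        by (rule gen_smult[OF gv(1) kxyz_closed(4), symmetric]) (rule valid_tc[OF i gv(2)])
      finally show "t i \<odot>\<^bsub>A\<^esub> contract A i (\<lambda>I'. gen g v I' b \<mu>) I = gen g (\<lambda>x I b. t i * tc i (v x) I b) I b \<mu>" .
    qed (auto intro!: E_carrierD(2) gen_closed gv valid_smult valid_tc kxyz_closed)
    also have "\<dots> = (\<Oplus>\<^bsub>E\<^esub>i\<in>{..<m}. gen g (\<lambda>x I b. t i * tc i (v x) I b)) I b \<mu>"
    proof -
      have cl': "gen g (\<lambda>x I b. t i * tc i (v x) I b) \<in> carrier E" if "i \<in> {..<m}" for i
        using that by (intro gen_closed gv valid_smult valid_tc kxyz_closed) auto
      show ?thesis by (subst finsum_E[OF cl'], assumption, subst finsum_B) (auto intro: E_carrierD(1)[OF cl'])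
    qed
    also have "\<dots> = gen g (\<lambda>x. tk (v x)) I b \<mu>"
      unfolding tk_def by (subst gen_sum[OF gv(1)]) (auto intro!: valid_smult valid_tc gv kxyz_closed)
    finally show "dk (gen g v) I b \<mu> = gen g (\<lambda>x. tk (v x)) I b \<mu>" .
  qed
  then show ?thesis by (simp add: rep_def valid_tk)
qed

lemma grade_E: "g \<in> grade E s \<longleftrightarrow> g \<in> carrier E \<and> (\<forall>I b. deg I b \<noteq> s \<longrightarrow> g I b = (\<lambda>_. \<zero>\<^bsub>A\<^esub>))"
proof -
  have *: "parity Y f + parity X e \<noteq> s + of_nat (card I) \<longleftrightarrow> deg I (f, e) \<noteq> s" for f e and I :: "nat set"
    unfolding deg_def by (cases "parity Y f"; cases "parity X e"; cases s; cases "of_nat (card I) :: bit") auto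
  have Mt: "h \<in> grade Mt r \<longleftrightarrow> h \<in> carrier Mt \<and> (\<forall>f e. parity Y f + parity X e \<noteq> r \<longrightarrow> h (f, e) = (\<lambda>_. \<zero>\<^bsub>A\<^esub>))" for h r
    unfolding tensor_def by (simp add: fun_eq_iff)
  have "g \<in> grade E s \<longleftrightarrow> g \<in> carrier E \<and> (\<forall>I. g I \<in> grade Mt (s + of_nat (card I)))"
    by (simp add: ext_factorisation_def)
  then show ?thesis unfolding Mt * using E_carrierD(4) split_paired_All[of "\<lambda>b. deg _ b \<noteq> s \<longrightarrow> g _ b = (\<lambda>_. \<zero>\<^bsub>A\<^esub>)"]
    by auto
qed

text \<open>If \<open>T\<close> shifts degrees by \<open>r\<close>, its matrix entries between basis
  elements whose degrees do not differ by \<open>r\<close> are zero, and these are all that could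
  contribute in a wrong degree.\<close>

lemma rep_grade:
  assumes "rep op T" "\<And>v s. valid v \<Longrightarrow> homog s v \<Longrightarrow> homog (s + r) (T v)" "g \<in> grade E s"
  shows "op g \<in> grade E (s + r)"
proof -
  have g: "g \<in> carrier E" and z: "\<And>I b. deg I b \<noteq> s \<Longrightarrow> g I b = (\<lambda>_. \<zero>\<^bsub>A\<^esub>)" using assms(3) by (auto simp: grade_E)
  have v: "valid (T (unit x))" for x by (rule rep_valid[OF assms(1) valid_unit])
  have "gen g (\<lambda>x. T (unit x)) I b = (\<lambda>_. \<zero>\<^bsub>A\<^esub>)" if "deg I b \<noteq> s + r" for I b
  proof -
    have "T (unit x) I b \<odot>\<^bsub>B\<^esub> arg g x = \<zero>\<^bsub>B\<^esub>" for x
    proof (cases "deg (fst x) (snd x) = s")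
      case True
      then have "homog s (unit x)" by (auto simp: homog_def unit_def)
      then have "T (unit x) I b = 0" using assms(2)[OF valid_unit] that unfolding homog_def by blast
      then show ?thesis using B.smult_pol(4)[OF E_carrierD(1)[OF g]] by simp
    next
      case False
      then have "arg g x = \<zero>\<^bsub>B\<^esub>" using z by simp
      then show ?thesis using B.smult_r_null[OF validD(1)[OF v]] by metis
    qed
    then have "gen g (\<lambda>x. T (unit x)) I b = \<zero>\<^bsub>B\<^esub>" unfolding gen_def B.ev_def by (simp del: poly_ext_simps)
    then show ?thesis by simp
  qed
  then show ?thesis unfolding rep_apply[OF assms(1) g] grade_E using gen_closed[OF g, of "\<lambda>x. T (unit x)"] v by simp
qed

end

section \<open>The factorisations with differentials \<open>d\<close> and
  \<open>d_K + d\<close>\<close>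

context tensor_module
begin

lemma E_module_kxz: "module (kxz n l) E" and Mt_module_kxz: "module (kxz n l) Mt"
  by (rule module_pol_ring_mono[OF E_module] module_pol_ring_mono[OF Mt_module], blast)+

lemma linear_map_kxz:
  "linear_map (kxyz n m l) M N f \<Longrightarrow> linear_map (kxz n l) M N f"
  by (auto simp: linear_map_def kxz_kxyz)

lemma UW_closed: "U - W \<in> carrier (kxz n l)"
  by (intro pol_ring_closed pol_ring_mono[OF U] pol_ring_mono[OF W]) auto

definition dK where "dK g = differential E g \<oplus>\<^bsub>E\<^esub> dk g"
definition K :: "('k pol, nat set \<Rightarrow> ('my, 'mx, 'c) tens) factorisation" where "K = E\<lparr>differential := dK\<rparr>"

lemma K_simps [simp]:
  "carrier K = carrier E" "zero K = zero E" "add K = add E" "smult K = smult E" "grade K = grade E" "differential K = dK"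
  by (simp_all add: K_def)

lemma K_a_inv: "a_inv K = a_inv E"
  by (simp add: a_inv_def m_inv_def fun_eq_iff)

lemma rep_dK: "rep dK (\<lambda>v I b. td v I b + tk v I b)"
  unfolding dK_def[abs_def] by (rule rep_add[OF rep_differential rep_dk])

lemma grade_submodule: "submodule (grade E s) (kxz n l) E"
proof -
  have neg: "(\<ominus>\<^bsub>E\<^esub> g) I b = (\<lambda>_. \<zero>\<^bsub>A\<^esub>)" if "g \<in> carrier E" "g I b = (\<lambda>_. \<zero>\<^bsub>A\<^esub>)" for g I b
  proof -
    have "\<ominus>\<^bsub>E\<^esub> g = (- 1) \<odot>\<^bsub>E\<^esub> g" using E.smult_pol_uminus[of 1 g] E.smult_pol(3) that by simp
    then show ?thesis using B.smult_r_null[of "- 1"] that(2) by simp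
  qed
  show ?thesis
  proof (rule module.submoduleI[OF E_module_kxz])
    show "\<ominus>\<^bsub>E\<^esub> g \<in> grade E s" if "g \<in> grade E s" for g
      using that neg E.M.a_inv_closed unfolding grade_E by simp
    show "g \<oplus>\<^bsub>E\<^esub> h \<in> grade E s" if "g \<in> grade E s" "h \<in> grade E s" for g h
      using that E.M.a_closed[of g h] unfolding grade_E by (simp add: fun_eq_iff)
    show "p \<odot>\<^bsub>E\<^esub> g \<in> grade E s" if "p \<in> carrier (kxz n l)" "g \<in> grade E s" for p g
      using that E.smult_closed[OF kxz_kxyz[OF that(1)], of g] B.smult_r_null[OF kxz_kxyz[OF that(1)]]
      unfolding grade_E by simp
  qed (auto simp: grade_E E_carrier B.M.zero_closed[simplified])
qed

lemma E_decomposition: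
  assumes "g \<in> carrier E"
  shows "\<exists>!w. fst w \<in> grade E 0 \<and> snd w \<in> grade E 1 \<and> g = fst w \<oplus>\<^bsub>E\<^esub> snd w"
proof (rule ex1I)
  let ?g = "\<lambda>s I b. if deg I b = s then g I b else (\<lambda>_. \<zero>\<^bsub>A\<^esub>)"
  have "?g s \<in> grade E s" for s
    using assms B.M.zero_closed unfolding grade_E E_carrier by auto
  moreover have "g = ?g 0 \<oplus>\<^bsub>E\<^esub> ?g 1"
  proof (intro ext)
    fix I b \<mu>
    show "g I b \<mu> = (?g 0 \<oplus>\<^bsub>E\<^esub> ?g 1) I b \<mu>"
      using E_carrierD(2)[OF assms] by (cases "deg I b") auto
  qed
  ultimately show "fst (?g 0, ?g 1) \<in> grade E 0 \<and> snd (?g 0, ?g 1) \<in> grade E 1 \<and> g = fst (?g 0, ?g 1) \<oplus>\<^bsub>E\<^esub> snd (?g 0, ?g 1)"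
    by simp
  fix w assume w: "fst w \<in> grade E 0 \<and> snd w \<in> grade E 1 \<and> g = fst w \<oplus>\<^bsub>E\<^esub> snd w"
  have "fst w I b \<mu> = ?g 0 I b \<mu> \<and> snd w I b \<mu> = ?g 1 I b \<mu>" for I b \<mu>
    using w E_carrierD(2)[of "fst w" I b \<mu>] E_carrierD(2)[of "snd w" I b \<mu>] unfolding grade_E
    by (cases "deg I b") auto
  then show "w = (?g 0, ?g 1)" by (intro prod_eqI ext) simp_all
qed

lemma z2_graded_E: "z2_graded_module (kxz n l) E"
  unfolding z2_graded_module_def using E_module_kxz grade_submodule E_decomposition by blast

lemma E_factorisation: "linear_factorisation (kxz n l) (U - W) E"
  unfolding linear_factorisation_def
proof (intro conjI ballI allI)
  show "linear_map (kxz n l) E E (differential E)" by (rule linear_map_kxz[OF rep_linear[OF rep_differential]])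
  show "differential E ` grade E s \<subseteq> grade E (s + 1)" for s
    by (rule image_subsetI) (rule rep_grade[OF rep_differential], rule homog_td)
  show "differential E (differential E g) = (U - W) \<odot>\<^bsub>E\<^esub> g" if "g \<in> carrier E" for g
    by (rule rep_eq[OF rep_comp[OF rep_differential rep_differential] rep_smult[OF rep_id kxz_kxyz[OF UW_closed]] td_square that])
qed (simp_all add: UW_closed z2_graded_E del: E_simps)

text \<open>\<open>d_K\<close> squares to zero and anticommutes with \<open>d\<close>, so it does
  not alter the square.\<close>

lemma K_factorisation: "linear_factorisation (kxz n l) (U - W) K"
  unfolding linear_factorisation_def K_simps
proof (intro conjI ballI allI)
  show "linear_map (kxz n l) K K dK"
    using linear_map_kxz[OF rep_linear[OF rep_dK]] unfolding linear_map_def by simp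
  show "dK ` grade E s \<subseteq> grade E (s + 1)" for s
    by (rule image_subsetI) (rule rep_grade[OF rep_dK], intro homog_add homog_td homog_tk)
  show "dK (dK g) = (U - W) \<odot>\<^bsub>E\<^esub> g" if "g \<in> carrier E" for g
  proof (rule rep_eq[OF rep_comp[OF rep_dK rep_dK] rep_smult[OF rep_id kxz_kxyz[OF UW_closed]] _ that])
    fix v assume v: "valid v"
    show "(\<lambda>I b. td (\<lambda>I b. td v I b + tk v I b) I b + tk (\<lambda>I b. td v I b + tk v I b) I b) = (\<lambda>I b. (U - W) * v I b)"
      by (simp add: lin_add[OF lin_td] lin_add[OF lin_tk] td_square[OF v] tk_tk[OF v] td_tk[OF v])
  qed
  have "module (kxz n l) K"
    using E_module_kxz abelian_group.axioms
    unfolding module_def module_axioms_def abelian_group_def abelian_monoid_def abelian_group_axioms_def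
    by simp
  moreover have "submodule (grade E s) (kxz n l) K" for s
    using grade_submodule[of s] unfolding submodule_def submodule_axioms_def by simp
  ultimately show "z2_graded_module (kxz n l) K"
    unfolding z2_graded_module_def using E_decomposition by simp
qed (rule UW_closed)

text \<open>By \<open>td_texp\<close> with \<open>c = - 1\<close>, moving \<open>d\<close> to the
  right of \<open>exp (- \<delta>)\<close> produces a term \<open>- d_K\<close>, which the
  \<open>d_K\<close> in the target differential absorbs. The two exponentials are strictly inverse,
  so no homotopies arise.\<close>

lemma exp_iso: "inverse_homotopy_equivalences (kxz n l) E K (gexp (- 1)) (gexp 1)"
proof (rule inverse_homotopy_equivalencesI_iso[OF E_factorisation K_factorisation])
  have q1: "q (- 1) = - 1" using q_add[of 1 "- 1"] by (simp add: eq_neg_iff_add_eq_0 add.commute)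
  note l = linear_map_kxz[OF rep_linear[OF rep_exp]]
  have g: "gexp c g \<in> grade E s" if "g \<in> grade E s" for c g s
  proof -
    have "gexp c g \<in> grade E (s + 0)" by (rule rep_grade[OF rep_exp _ that]) (simp only: add_0_right homog_texp)
    then show ?thesis by (simp only: add_0_right)
  qed
  show "factorisation_morphism (kxz n l) E K (gexp (- 1))"
    unfolding factorisation_morphism_def K_simps
  proof (intro conjI allI ballI image_subsetI)
    show "linear_map (kxz n l) E K (gexp (- 1))" using l[of "- 1"] unfolding linear_map_def by simp
    show "gexp (- 1) (differential E v) = dK (gexp (- 1) v)" if "v \<in> carrier E" for v
    proof (rule rep_eq[OF rep_comp[OF rep_exp rep_differential] rep_comp[OF rep_dK rep_exp] _ that])
      fix u assume u: "valid u"
      show "texp (- 1) (td u) = (\<lambda>I b. td (texp (- 1) u) I b + tk (texp (- 1) u) I b)"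
        by (simp add: td_texp[OF u] tk_texp[OF u] q1)
    qed
  qed (rule g)
  show "factorisation_morphism (kxz n l) K E (gexp 1)"
    unfolding factorisation_morphism_def K_simps
  proof (intro conjI allI ballI image_subsetI)
    show "linear_map (kxz n l) K E (gexp 1)" using l[of 1] unfolding linear_map_def by simp
    show "gexp 1 (dK v) = differential E (gexp 1 v)" if "v \<in> carrier E" for v
    proof (rule rep_eq[OF rep_comp[OF rep_exp rep_dK] rep_comp[OF rep_differential rep_exp] _ that])
      fix u assume u: "valid u"
      have "lin (texp 1)" unfolding texp_def[abs_def] by (rule lin_combination) (rule lin_pow[OF lin_tdel])
      then show "texp 1 (\<lambda>I b. td u I b + tk u I b) = td (texp 1 u)"
        by (simp add: lin_add td_texp[OF u] fun_eq_iff)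
    qed
  qed (rule g)
  show "gexp 1 (gexp (- 1) v) = v" if "v \<in> carrier E" for v
    by (rule rep_eq[OF rep_comp[OF rep_exp rep_exp] rep_id _ that]) (simp add: texp_texp texp_zero)
  show "gexp (- 1) (gexp 1 v) = v" if "v \<in> carrier K" for v
    by (rule rep_eq[OF rep_comp[OF rep_exp rep_exp] rep_id]) (use that in \<open>simp_all add: texp_texp texp_zero\<close>)
qed

text \<open>\<open>Y \<otimes> A \<otimes> X\<close> is the part of \<open>\<theta>\<close>-degree \<open>0\<close> of \<open>S\<^sub>m \<otimes> (Y \<otimes> A \<otimes> X)\<close>.\<close>

definition emb where "emb g = (\<lambda>I. if I = {} then g else \<zero>\<^bsub>Mt\<^esub>)"

lemma emb_simps [simp]: "emb g {} = g" "I \<noteq> {} \<Longrightarrow> emb g I = \<zero>\<^bsub>Mt\<^esub>"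
  by (simp_all add: emb_def)

lemma emb_closed: "g \<in> carrier Mt \<Longrightarrow> emb g \<in> carrier E"
  unfolding E_carrier' emb_def using Mt.M.zero_closed by auto

lemma differential_emb: "g \<in> carrier Mt \<Longrightarrow> differential E (emb g) {} = differential Mt g"
  by (simp add: ext_factorisation_def ext_odd_def signed_def)

lemma differential_E: "g \<in> carrier E \<Longrightarrow> g I = \<zero>\<^bsub>Mt\<^esub> \<Longrightarrow> differential E g I = \<zero>\<^bsub>Mt\<^esub>"
proof -
  assume g: "g \<in> carrier E" "g I = \<zero>\<^bsub>Mt\<^esub>"
  have z: "differential Mt \<zero>\<^bsub>Mt\<^esub> = \<zero>\<^bsub>Mt\<^esub>"
  proof -
    have "differential E \<zero>\<^bsub>E\<^esub> = \<zero>\<^bsub>E\<^esub>"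
      by (rule linear_map_zero_minus(1)[OF E_module E_module rep_linear[OF rep_differential]])
    moreover have "emb \<zero>\<^bsub>Mt\<^esub> = \<zero>\<^bsub>E\<^esub>" by (auto simp: emb_def fun_eq_iff)
    ultimately have "differential E (emb \<zero>\<^bsub>Mt\<^esub>) {} = \<zero>\<^bsub>E\<^esub> {}" by simp
    then show ?thesis using differential_emb[OF Mt.M.zero_closed] by simp
  qed
  have "\<ominus>\<^bsub>Mt\<^esub> \<zero>\<^bsub>Mt\<^esub> = \<zero>\<^bsub>Mt\<^esub>" using Mt.M.minus_equality[of "\<zero>\<^bsub>Mt\<^esub>" "\<zero>\<^bsub>Mt\<^esub>"] Mt.M.zero_closed Mt.M.l_zero by blast
  then show ?thesis using g(2) z by (simp add: ext_factorisation_def ext_odd_def signed_def)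
qed

lemma differential_emb': "g \<in> carrier Mt \<Longrightarrow> differential E (emb g) = emb (differential Mt g)"
proof
  fix I assume g: "g \<in> carrier Mt"
  show "differential E (emb g) I = emb (differential Mt g) I"
    using differential_emb[OF g] differential_E[OF emb_closed[OF g], of I] by (cases "I = {}") auto
qed

lemma grade_emb: "g \<in> grade Mt s \<longleftrightarrow> g \<in> carrier Mt \<and> emb g \<in> grade E s"
proof -
  have "\<zero>\<^bsub>Mt\<^esub> \<in> grade Mt r" for r using Mt.M.zero_closed by (simp add: tensor_def)
  moreover have "grade Mt s \<subseteq> carrier Mt" by (auto simp: tensor_def)
  ultimately show ?thesis
    using emb_closed[of g] by (auto simp: ext_factorisation_def emb_def split: if_splits)
qed

text \<open>Everything descends from \<open>E\<close>: \<open>emb\<close> is a homogeneous inclusion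
  compatible with the differentials, and evaluation at \<open>{}\<close> undoes it.\<close>

lemma Mt_factorisation: "linear_factorisation (kxz n l) (U - W) Mt"
proof -
  interpret E: factorisation "kxz n l" "U - W" E by standard (rule E_factorisation)
  have D: "differential Mt g \<in> carrier Mt" if "g \<in> carrier Mt" for g
    using E.D_closed[OF emb_closed[OF that]] E_carrierD(4)[of "differential E (emb g)" "{}"] differential_emb[OF that] by simp
  have add: "emb (g \<oplus>\<^bsub>Mt\<^esub> h) = emb g \<oplus>\<^bsub>E\<^esub> emb h" if "g \<in> carrier Mt" "h \<in> carrier Mt" for g h
    by (auto simp: emb_def fun_eq_iff)
  have smult: "emb (p \<odot>\<^bsub>Mt\<^esub> g) = p \<odot>\<^bsub>E\<^esub> emb g" if "g \<in> carrier Mt" "p \<in> carrier (kxz n l)" for p :: "'k pol" and g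
    using B.smult_r_null[OF kxz_kxyz[OF that(2)]] by (auto simp: emb_def fun_eq_iff)
  show ?thesis unfolding linear_factorisation_def
  proof (intro conjI ballI allI)
    show "linear_map (kxz n l) Mt Mt (differential Mt)"
    proof (rule linear_mapI)
      fix g h assume gh: "g \<in> carrier Mt" "h \<in> carrier Mt"
      have "differential E (emb (g \<oplus>\<^bsub>Mt\<^esub> h)) {} = (differential E (emb g) \<oplus>\<^bsub>E\<^esub> differential E (emb h)) {}"
        unfolding add[OF gh] by (simp only: E.D_add[OF emb_closed[OF gh(1)] emb_closed[OF gh(2)]])
      then show "differential Mt (g \<oplus>\<^bsub>Mt\<^esub> h) = differential Mt g \<oplus>\<^bsub>Mt\<^esub> differential Mt h"
        using gh Mt.M.a_closed[OF gh] by (simp add: differential_emb)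
    next
      fix p :: "'k pol" and g assume pg: "p \<in> carrier (kxz n l)" "g \<in> carrier Mt"
      have "differential E (emb (p \<odot>\<^bsub>Mt\<^esub> g)) {} = (p \<odot>\<^bsub>E\<^esub> differential E (emb g)) {}"
        unfolding smult[OF pg(2,1)] by (simp only: E.D_smult[OF pg(1) emb_closed[OF pg(2)]])
      then show "differential Mt (p \<odot>\<^bsub>Mt\<^esub> g) = p \<odot>\<^bsub>Mt\<^esub> differential Mt g"
        using pg Mt.smult_closed[OF kxz_kxyz[OF pg(1)] pg(2)] by (simp add: differential_emb)
    qed (rule D)
    show "differential Mt ` grade Mt s \<subseteq> grade Mt (s + 1)" for s
      using E.D_grade[of _ s] D by (auto simp only: grade_emb differential_emb'[symmetric])
    show "differential Mt (differential Mt g) = (U - W) \<odot>\<^bsub>Mt\<^esub> g" if "g \<in> carrier Mt" for g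
    proof -
      have "differential E (differential E (emb g)) {} = ((U - W) \<odot>\<^bsub>E\<^esub> emb g) {}"
        by (simp only: E.D_square[OF emb_closed[OF that]])
      then show ?thesis using that D by (simp add: differential_emb' differential_emb)
    qed
    have "submodule (grade Mt s) (kxz n l) Mt" for s
    proof (rule module.submoduleI[OF Mt_module_kxz])
      have z: "\<zero>\<^bsub>E\<^esub> = emb \<zero>\<^bsub>Mt\<^esub>" by (auto simp: emb_def fun_eq_iff)
      show "\<zero>\<^bsub>Mt\<^esub> \<in> grade Mt s" unfolding grade_emb z[symmetric] using E.grade_zero Mt.M.zero_closed by blast
      show ad: "g \<oplus>\<^bsub>Mt\<^esub> h \<in> grade Mt s" if "g \<in> grade Mt s" "h \<in> grade Mt s" for g h
        using that E.grade_add Mt.M.a_closed add unfolding grade_emb by simp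
      show sm: "p \<odot>\<^bsub>Mt\<^esub> g \<in> grade Mt s" if "p \<in> carrier (kxz n l)" "g \<in> grade Mt s" for p :: "'k pol" and g
        using that module.submoduleE(4)[OF E_module_kxz grade_submodule] Mt.smult_closed[OF kxz_kxyz[OF that(1)]] smult unfolding grade_emb by simp
      show "\<ominus>\<^bsub>Mt\<^esub> g \<in> grade Mt s" if "g \<in> grade Mt s" for g
      proof -
        have "\<ominus>\<^bsub>Mt\<^esub> g = (- 1) \<odot>\<^bsub>Mt\<^esub> g"
          using Mt.smult_pol_uminus[of 1 g] Mt.smult_pol(3)[of g] that unfolding grade_emb by simp
        then show ?thesis using sm[OF _ that, of "- 1"] by simp
      qed
    qed (simp add: grade_emb subset_iff)
    moreover have "\<exists>!w. fst w \<in> grade Mt 0 \<and> snd w \<in> grade Mt 1 \<and> g = fst w \<oplus>\<^bsub>Mt\<^esub> snd w" if g: "g \<in> carrier Mt" for g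
    proof -
      obtain w where w: "fst w \<in> grade E 0" "snd w \<in> grade E 1" "emb g = fst w \<oplus>\<^bsub>E\<^esub> snd w"
        using E_decomposition[OF emb_closed[OF g]] by blast
      have z: "emb (u {}) \<in> grade E s \<and> u {} \<in> carrier Mt" if "u \<in> grade E s" for u s
        using that E_carrierD(4)[of u "{}"] emb_closed[of "u {}"] unfolding grade_E by (auto simp: emb_def)
      show ?thesis
      proof (rule ex1I[of _ "(fst w {}, snd w {})"])
        show "fst (fst w {}, snd w {}) \<in> grade Mt 0 \<and> snd (fst w {}, snd w {}) \<in> grade Mt 1 \<and>
            g = fst (fst w {}, snd w {}) \<oplus>\<^bsub>Mt\<^esub> snd (fst w {}, snd w {})"
          using z[OF w(1)] z[OF w(2)] fun_cong[OF w(3), of "{}"] unfolding grade_emb by simp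
        fix w' assume w': "fst w' \<in> grade Mt 0 \<and> snd w' \<in> grade Mt 1 \<and> g = fst w' \<oplus>\<^bsub>Mt\<^esub> snd w'"
        then have "emb g = emb (fst w') \<oplus>\<^bsub>E\<^esub> emb (snd w')" using add unfolding grade_emb by blast
        then have "(emb (fst w'), emb (snd w')) = w"
          using E_decomposition[OF emb_closed[OF g]] w w' unfolding grade_emb by (metis fst_conv snd_conv)
        then show "w' = (fst w {}, snd w {})" by (metis emb_simps(1) fst_conv prod.collapse snd_conv)
      qed
    qed
    ultimately show "z2_graded_module (kxz n l) Mt"
      unfolding z2_graded_module_def using Mt_module_kxz by blast
  qed (rule UW_closed)
qed

end

section \<open>Contractions of Koszul complexes\<close>

text \<open>Linearity over \<open>k\<close> for modules over \<open>k[y]\<close>. No more can be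
  asked of \<open>\<sigma>\<close> and of the contracting homotopies.\<close>

definition const_linear ::
  "('k::comm_ring_1 pol, 'a, 'q) module_scheme \<Rightarrow> ('k pol, 'b, 's) module_scheme \<Rightarrow> ('a \<Rightarrow> 'b) \<Rightarrow> bool" where
  "const_linear A A' \<phi> \<longleftrightarrow> \<phi> \<in> carrier A \<rightarrow> carrier A' \<and>
     (\<forall>v\<in>carrier A. \<forall>w\<in>carrier A. \<phi> (v \<oplus>\<^bsub>A\<^esub> w) = \<phi> v \<oplus>\<^bsub>A'\<^esub> \<phi> w) \<and>
     (\<forall>c. \<forall>v\<in>carrier A. \<phi> (const c \<odot>\<^bsub>A\<^esub> v) = const c \<odot>\<^bsub>A'\<^esub> \<phi> v)"

lemma const_linearD:
  assumes "const_linear A A' \<phi>"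
  shows "v \<in> carrier A \<Longrightarrow> \<phi> v \<in> carrier A'"
    and "v \<in> carrier A \<Longrightarrow> w \<in> carrier A \<Longrightarrow> \<phi> (v \<oplus>\<^bsub>A\<^esub> w) = \<phi> v \<oplus>\<^bsub>A'\<^esub> \<phi> w"
    and "v \<in> carrier A \<Longrightarrow> \<phi> (const c \<odot>\<^bsub>A\<^esub> v) = const c \<odot>\<^bsub>A'\<^esub> \<phi> v"
  using assms by (auto simp: const_linear_def)

lemma const_linear_zero:
  assumes "module (ky m) A" "module (ky m) A'" "const_linear A A' \<phi>" shows "\<phi> \<zero>\<^bsub>A\<^esub> = \<zero>\<^bsub>A'\<^esub>"
proof -
  interpret A: pol_module "yvars m" A by (rule pol_moduleI) fact
  interpret A': pol_module "yvars m" A' by (rule pol_moduleI) fact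
  have "\<phi> (const 0 \<odot>\<^bsub>A\<^esub> \<zero>\<^bsub>A\<^esub>) = const 0 \<odot>\<^bsub>A'\<^esub> \<phi> \<zero>\<^bsub>A\<^esub>" by (rule const_linearD(3)[OF assms(3)]) simp
  then show ?thesis using const_linearD(1)[OF assms(3), of "\<zero>\<^bsub>A\<^esub>"] by (simp add: A.smult_pol A'.smult_pol)
qed

text \<open>An element of \<open>k[x,z]\<close> acts by shifts and by constants from
  \<open>k\<close>, and a \<open>k\<close>-linear map on coefficients commutes with both.\<close>

lemma act_const_linear:
  assumes "module (ky m) A" "module (ky m) A'" "const_linear A A' \<phi>" "p \<in> carrier (kxz n l)"
    "\<And>\<mu>. g \<mu> \<in> carrier A"
  shows "\<phi> (act A p g \<mu>) = act A' p (\<lambda>\<mu>. \<phi> (g \<mu>)) \<mu>"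
proof -
  interpret A: coeff_module m A using assms(1) by (simp add: coeff_module_def pol_module_def)
  interpret A': coeff_module m A' using assms(2) by (simp add: coeff_module_def pol_module_def)
  note \<phi> = const_linearD[OF assms(3)]
  have c: "\<phi> \<in> carrier A \<rightarrow> carrier A'" using \<phi>(1) by auto
  note z = const_linear_zero[OF assms(1-3)]
  have y: "ycoeff p \<nu> \<odot>\<^bsub>A\<^esub> g (\<mu> - \<nu>) \<in> carrier A" for \<nu>
    by (intro A.smult_closed ycoeff_closed[OF kxz_kxyz[OF assms(4)]] assms(5))
  have y': "ycoeff p \<nu> \<odot>\<^bsub>A'\<^esub> \<phi> (g (\<mu> - \<nu>)) \<in> carrier A'" for \<nu>
    by (intro A'.smult_closed ycoeff_closed[OF kxz_kxyz[OF assms(4)]] assms(5) \<phi>(1))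
  have "\<phi> (act A p g \<mu>) = (\<Oplus>\<^bsub>A'\<^esub>\<nu>\<in>{\<nu> \<in> monomials (range XV \<union> range ZV). \<exists>\<rho>. \<mu> = \<nu> + \<rho>}. \<phi> (ycoeff p \<nu> \<odot>\<^bsub>A\<^esub> g (\<mu> - \<nu>)))"
    unfolding act_def by (rule finsum_additive[OF A.M.abelian_monoid_axioms A'.M.abelian_monoid_axioms c z \<phi>(2) y])
  also have "\<dots> = act A' p (\<lambda>\<mu>. \<phi> (g \<mu>)) \<mu>"
    unfolding act_def
    by (rule A'.M.finsum_cong') (use y' in \<open>auto simp: ycoeff_kxz[OF assms(4)] \<phi>(3)[OF assms(5)]\<close>)
  finally show ?thesis .
qed

definition ext_module :: "nat \<Rightarrow> ('k::comm_ring_1 pol, 'a) module \<Rightarrow> ('k pol, nat set \<Rightarrow> 'a) module" where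
  "ext_module m A =
     \<lparr>carrier = ext_carrier m A, monoid.mult = undefined, one = undefined, zero = (\<lambda>_. \<zero>\<^bsub>A\<^esub>),
      add = (\<lambda>x y I. x I \<oplus>\<^bsub>A\<^esub> y I), smult = (\<lambda>p x I. p \<odot>\<^bsub>A\<^esub> x I)\<rparr>"

lemma ext_module_simps [simp]:
  "carrier (ext_module m A) = ext_carrier m A" "zero (ext_module m A) = (\<lambda>_. \<zero>\<^bsub>A\<^esub>)"
  "add (ext_module m A) = (\<lambda>x y I. x I \<oplus>\<^bsub>A\<^esub> y I)" "smult (ext_module m A) = (\<lambda>p x I. p \<odot>\<^bsub>A\<^esub> x I)"
  by (simp_all add: ext_module_def)

lemma ext_carrierD: "x \<in> ext_carrier m A \<Longrightarrow> x I \<in> carrier A" "x \<in> ext_carrier m A \<Longrightarrow> \<not> I \<subseteq> {..<m} \<Longrightarrow> x I = \<zero>\<^bsub>A\<^esub>"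
  by (auto simp: ext_carrier_def)

lemma (in coeff_module) ext_group: "abelian_group (ext_module m A)"
  by (rule abelian_group_pointwise[OF M.abelian_group_axioms, of _ "\<lambda>I. I \<subseteq> {..<m}"]) (auto simp: ext_carrier_def)

lemma (in coeff_module) ext_module: "module (ky m) (ext_module m A)"
  by (rule moduleI[OF cring_pol_ring ext_group]) (auto simp: ext_carrier_def smult_pol smult_r_distr)

text \<open>Allows a homotopy that mixes different \<open>I\<close> to be treated as a coefficient
  map, with \<open>S_m \<otimes> A\<close> as the coefficient module.\<close>

lemma (in coeff_module) act_ext_module:
  assumes "p \<in> carrier (kxyz n m l)" "\<And>\<mu>. x \<mu> \<in> ext_carrier m A"
  shows "act (ext_module m A) p x \<mu> I = act A p (\<lambda>\<mu>. x \<mu> I) \<mu>"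
proof -
  interpret Ext: module "ky m" "ext_module m A" by (rule ext_module)
  have "ycoeff p \<nu> \<odot>\<^bsub>ext_module m A\<^esub> x (\<mu> - \<nu>) \<in> carrier (ext_module m A)" for \<nu>
    by (intro Ext.smult_closed ycoeff_closed[OF assms(1)]) (simp add: assms(2))
  then have "(\<Oplus>\<^bsub>ext_module m A\<^esub>\<nu>\<in>D. ycoeff p \<nu> \<odot>\<^bsub>ext_module m A\<^esub> x (\<mu> - \<nu>)) =
      (\<lambda>I. \<Oplus>\<nu>\<in>D. (ycoeff p \<nu> \<odot>\<^bsub>ext_module m A\<^esub> x (\<mu> - \<nu>)) I)" for D
    by (intro finsum_pointwise[OF M.abelian_group_axioms ext_group]) (auto simp: ext_carrier_def)
  then show ?thesis unfolding act_def by simp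
qed

section \<open>Change of coefficients along a map linear over \<open>k[y]\<close>\<close>

locale tensor_map = A: tensor_module n m l U V W Y BY X BX DY DX q A + A': tensor_module n m l U V W Y BY X BX DY DX q A'
  for n m l :: nat and U V W :: "'k::comm_ring_1 pol"
    and Y :: "('k pol, 'my) factorisation" and BY :: "'my set"
    and X :: "('k pol, 'mx) factorisation" and BX :: "'mx set"
    and DY :: "'my \<Rightarrow> 'my \<Rightarrow> 'k pol" and DX :: "'mx \<Rightarrow> 'mx \<Rightarrow> 'k pol" and q :: "rat \<Rightarrow> 'k"
    and A :: "('k pol, 'c) module" and A' :: "('k pol, 'd) module" +
  fixes \<phi> :: "'c \<Rightarrow> 'd"
  assumes phi: "linear_map (ky m) A A' \<phi>"
begin

definition cw :: "(nat set \<Rightarrow> ('my, 'mx, 'c) tens) \<Rightarrow> nat set \<Rightarrow> ('my, 'mx, 'd) tens" where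
  "cw g = (\<lambda>I b \<mu>. \<phi> (g I b \<mu>))"

lemmas phi_simps = linear_mapD[OF phi] linear_map_zero_minus[OF A.A.module_axioms A'.A.module_axioms phi]

lemma phi_act: "p \<in> carrier (kxyz n m l) \<Longrightarrow> (\<And>\<mu>. g \<mu> \<in> carrier A) \<Longrightarrow> (\<lambda>\<mu>. \<phi> (act A p g \<mu>)) = act A' p (\<lambda>\<mu>. \<phi> (g \<mu>))"
  by (rule ext) (rule coeffwise_act[OF A.A.module_axioms A'.A.module_axioms phi])

lemma phi_B: assumes "g \<in> carrier A.B" shows "(\<lambda>\<mu>. \<phi> (g \<mu>)) \<in> carrier A'.B"
proof -
  have "finite {\<mu>. \<phi> (g \<mu>) \<noteq> \<zero>\<^bsub>A'\<^esub>}"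
    by (rule finite_subset[of _ "{\<mu>. g \<mu> \<noteq> \<zero>\<^bsub>A\<^esub>}"]) (use assms in \<open>auto simp: poly_ext_def phi_simps\<close>)
  with assms show ?thesis by (simp add: poly_ext_def phi_simps)
qed

lemma cw_closed: "g \<in> carrier A.E \<Longrightarrow> cw g \<in> carrier A'.E"
  unfolding A.E_carrier A'.E_carrier cw_def using phi_B by (simp add: phi_simps)

lemma cw_gen:
  assumes g: "g \<in> carrier A.E" and v: "\<And>x. A.valid (v x)" shows "cw (A.gen g v) = A'.gen (cw g) v"
proof (intro ext)
  fix I b \<mu>
  let ?f = "\<lambda>h \<mu>. \<phi> (h \<mu>)"
  have vc: "v x I b \<in> carrier (kxyz n m l)" for x by (rule A.validD(1)[OF v])
  have cl: "v x I b \<odot>\<^bsub>A.B\<^esub> A.arg g x \<in> carrier A.B" for x by (intro A.B.smult_closed vc A.E_carrierD(1)[OF g])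
  have e: "?f (v x I b \<odot>\<^bsub>A.B\<^esub> A.arg g x) = v x I b \<odot>\<^bsub>A'.B\<^esub> A'.arg (cw g) x" for x
    unfolding cw_def poly_ext_simps by (rule phi_act[OF vc A.E_carrierD(2)[OF g]])
  have "?f (\<Oplus>\<^bsub>A.B\<^esub>x\<in>A.P. v x I b \<odot>\<^bsub>A.B\<^esub> A.arg g x) = (\<Oplus>\<^bsub>A'.B\<^esub>x\<in>A.P. ?f (v x I b \<odot>\<^bsub>A.B\<^esub> A.arg g x))"
    by (rule finsum_additive[OF A.B.M.abelian_monoid_axioms A'.B.M.abelian_monoid_axioms _ _ _ cl])
      (auto simp: phi_B phi_simps A.B_carrier)
  then show "cw (A.gen g v) I b \<mu> = A'.gen (cw g) v I b \<mu>"
    unfolding A.gen_def A'.gen_def A.B.ev_def A'.B.ev_def cw_def[of "\<lambda>I b. _ I b"] e by (rule fun_cong)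
qed

text \<open>Both operators are the same matrix over \<open>k[x,y,z]\<close>, and changing
  coefficients commutes with applying a matrix.\<close>

lemma cw_natural:
  assumes "A.rep op T" "A'.rep op' T" "g \<in> carrier A.E" shows "cw (op g) = op' (cw g)"
  unfolding A.rep_apply[OF assms(1,3)] A'.rep_apply[OF assms(2) cw_closed[OF assms(3)]]
  by (rule cw_gen[OF assms(3)]) (intro A.rep_valid[OF assms(1)] A.valid_unit)

lemma cw_add: "g \<in> carrier A.E \<Longrightarrow> h \<in> carrier A.E \<Longrightarrow> cw (g \<oplus>\<^bsub>A.E\<^esub> h) = cw g \<oplus>\<^bsub>A'.E\<^esub> cw h"
  by (simp add: cw_def phi_simps A.E_carrierD)

lemma cw_smult: "p \<in> carrier (kxyz n m l) \<Longrightarrow> g \<in> carrier A.E \<Longrightarrow> cw (p \<odot>\<^bsub>A.E\<^esub> g) = p \<odot>\<^bsub>A'.E\<^esub> cw g"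
  unfolding cw_def A.E_simps A'.E_simps by (intro ext) (metis phi_act A.E_carrierD(2))

lemma cw_grade: "g \<in> grade A.E s \<Longrightarrow> cw g \<in> grade A'.E s"
  unfolding A.grade_E A'.grade_E using cw_closed by (simp add: cw_def phi_simps)

lemma cw_morphism: "factorisation_morphism (kxz n l) A.E A'.E cw"
  unfolding factorisation_morphism_def linear_map_def
  using cw_closed cw_add cw_smult[OF kxz_kxyz] cw_grade cw_natural[OF A.rep_differential A'.rep_differential]
  by (simp add: Pi_iff image_subset_iff del: A.E_simps A'.E_simps)

end

text \<open>Two instances are intended: the completion with \<open>koszul_H\<close>, and
  \<open>k[y]\<close> with a homotopy obtained from exactness. \<open>h_degree\<close> says that
  \<open>h\<close> raises the theta-degree by one: the component of \<open>h x\<close> at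
  \<open>I\<close> depends only on components of \<open>x\<close> of size one less.\<close>

locale koszul_contraction = tensor_map n m l U V W Y BY X BX DY DX q A A' \<phi>
  for n m l :: nat and U V W :: "'k::comm_ring_1 pol"
    and Y :: "('k pol, 'my) factorisation" and BY :: "'my set"
    and X :: "('k pol, 'mx) factorisation" and BX :: "'mx set"
    and DY :: "'my \<Rightarrow> 'my \<Rightarrow> 'k pol" and DX :: "'mx \<Rightarrow> 'mx \<Rightarrow> 'k pol" and q :: "rat \<Rightarrow> 'k"
    and A :: "('k pol, 'c) module" and A' :: "('k pol, 'd) module" and \<phi> :: "'c \<Rightarrow> 'd" +
  fixes \<sigma> :: "'d \<Rightarrow> 'c" and h :: "(nat set \<Rightarrow> 'c) \<Rightarrow> nat set \<Rightarrow> 'c"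
  assumes sigma: "const_linear A' A \<sigma>" "\<And>r. r \<in> carrier A' \<Longrightarrow> \<phi> (\<sigma> r) = r"
    and phi_koszul: "\<And>x. x \<in> ext_carrier m A \<Longrightarrow> \<phi> (koszul_diff m (tseq V) A x {}) = \<zero>\<^bsub>A'\<^esub>"
    and h: "const_linear (ext_module m A) (ext_module m A) h"
    and h_degree: "\<And>x I. x \<in> ext_carrier m A \<Longrightarrow> (\<And>J. Suc (card J) = card I \<Longrightarrow> x J = \<zero>\<^bsub>A\<^esub>) \<Longrightarrow> h x I = \<zero>\<^bsub>A\<^esub>"
    and h_homotopy: "\<And>x I. x \<in> ext_carrier m A \<Longrightarrow>
       koszul_diff m (tseq V) A (h x) I \<oplus>\<^bsub>A\<^esub> h (koszul_diff m (tseq V) A x) I \<oplus>\<^bsub>A\<^esub>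
         (if I = {} then \<sigma> (\<phi> (x {})) else \<zero>\<^bsub>A\<^esub>) = x I"
begin

definition hh where "hh g = (\<lambda>I b \<mu>. h (\<lambda>J. g J b \<mu>) I)"
definition pp where "pp g = (\<lambda>b \<mu>. \<phi> (g {} b \<mu>))"
definition ss :: "('my, 'mx, 'd) tens \<Rightarrow> nat set \<Rightarrow> ('my, 'mx, 'c) tens" where
  "ss g = (\<lambda>I b \<mu>. if I = {} then \<sigma> (g b \<mu>) else \<zero>\<^bsub>A\<^esub>)"
text \<open>The decreasing filtration by theta-degree, which measures how far \<open>h\<close> and
  \<open>d\<close> fail to commute.\<close>

definition F :: "nat \<Rightarrow> (nat set \<Rightarrow> ('my, 'mx, 'c) tens) set" where
  "F r = {g. \<forall>I. card I < r \<longrightarrow> g I = (\<lambda>_ _. \<zero>\<^bsub>A\<^esub>)}"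

lemma slice: "g \<in> carrier A.E \<Longrightarrow> (\<lambda>J. g J b \<mu>) \<in> ext_carrier m A"
  by (auto simp: ext_carrier_def A.E_carrierD)

lemmas h_simps = const_linearD[OF h, simplified]
lemma h_zero: "h (\<lambda>_. \<zero>\<^bsub>A\<^esub>) = (\<lambda>_. \<zero>\<^bsub>A\<^esub>)"
  using const_linear_zero[OF A.A.ext_module A.A.ext_module h] by simp

lemma sigma_zero: "\<sigma> \<zero>\<^bsub>A'\<^esub> = \<zero>\<^bsub>A\<^esub>"
  by (rule const_linear_zero[OF A'.A.module_axioms A.A.module_axioms sigma(1)])

lemma hh_closed: assumes g: "g \<in> carrier A.E" shows "hh g \<in> carrier A.E"
  unfolding A.E_carrier
proof (intro conjI allI impI)
  fix I b
  note hc = ext_carrierD[OF h_simps(1)[OF slice[OF g]]]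
  \<comment> \<open>As \<open>h\<close> maps zero to zero, a monomial occurs in the result only if
    it occurs in some component of \<open>g\<close>, and there are finitely many components.\<close>
  have sub: "{\<mu>. hh g I b \<mu> \<noteq> \<zero>\<^bsub>A\<^esub>} \<subseteq> (\<Union>J\<in>Pow {..<m}. {\<mu>. g J b \<mu> \<noteq> \<zero>\<^bsub>A\<^esub>})"
  proof
    fix \<mu> assume "\<mu> \<in> {\<mu>. hh g I b \<mu> \<noteq> \<zero>\<^bsub>A\<^esub>}"
    then have "(\<lambda>J. g J b \<mu>) \<noteq> (\<lambda>_. \<zero>\<^bsub>A\<^esub>)" using h_zero by (auto simp: hh_def)
    then obtain J where "g J b \<mu> \<noteq> \<zero>\<^bsub>A\<^esub>" by auto
    moreover from this have "(J, b) \<in> A.P" using A.E_carrierD(3)[OF g, of J b] by metis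
    then have "J \<in> Pow {..<m}" by (rule SigmaD1)
    ultimately show "\<mu> \<in> (\<Union>J\<in>Pow {..<m}. {\<mu>. g J b \<mu> \<noteq> \<zero>\<^bsub>A\<^esub>})" by blast
  qed
  have "finite {\<mu>. g J b \<mu> \<noteq> \<zero>\<^bsub>A\<^esub>}" for J
    using A.E_carrierD(1)[OF g, of J b] by (simp add: poly_ext_def)
  then have "finite (\<Union>J\<in>Pow {..<m}. {\<mu>. g J b \<mu> \<noteq> \<zero>\<^bsub>A\<^esub>})" by simp
  then have "finite {\<mu>. hh g I b \<mu> \<noteq> \<zero>\<^bsub>A\<^esub>}" by (rule finite_subset[OF sub])
  moreover have "hh g I b \<mu> = \<zero>\<^bsub>A\<^esub>" if "\<mu> \<notin> monomials (xvars n \<union> zvars l)" for \<mu>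
  proof -
    have "(\<lambda>J. g J b \<mu>) = (\<lambda>_. \<zero>\<^bsub>A\<^esub>)" using A.E_carrierD(1)[OF g, of _ b] that by (auto simp: poly_ext_def)
    then show ?thesis using h_zero by (simp add: hh_def)
  qed
  ultimately show "hh g I b \<in> carrier A.B" using hc(1) by (simp add: poly_ext_def hh_def)
  assume ib: "(I, b) \<notin> A.P"
  show "hh g I b = (\<lambda>_. \<zero>\<^bsub>A\<^esub>)"
  proof (cases "b \<in> BY \<times> BX")
    case True
    then show ?thesis using ib hc(2)[of I] by (auto simp: hh_def)
  next
    case False
    then have "(\<lambda>J. g J b \<mu>) = (\<lambda>_. \<zero>\<^bsub>A\<^esub>)" for \<mu> using A.E_carrierD(3)[OF g, of _ b] by auto
    then show ?thesis using h_zero by (simp add: hh_def)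
  qed
qed

lemma hh_linear: "linear_map (kxz n l) A.K A.K hh"
proof (rule linear_mapI; unfold A.K_simps)
  fix g g' assume "g \<in> carrier A.E" "g' \<in> carrier A.E"
  then show "hh (g \<oplus>\<^bsub>A.E\<^esub> g') = hh g \<oplus>\<^bsub>A.E\<^esub> hh g'"
    using h_simps(2)[OF slice slice] by (simp add: hh_def)
next
  fix p :: "'k pol" and g assume pg: "p \<in> carrier (kxz n l)" "g \<in> carrier A.E"
  show "hh (p \<odot>\<^bsub>A.E\<^esub> g) = p \<odot>\<^bsub>A.E\<^esub> hh g"
  proof (intro ext)
    fix I b \<mu>
    let ?x = "\<lambda>\<mu> J. g J b \<mu>"
    note xc = slice[OF pg(2)]
    \<comment> \<open>The component of \<open>h\<close> at a fixed \<open>I\<close> is a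
      \<open>k\<close>-linear map from \<open>S_m \<otimes> A\<close> to \<open>A\<close>, to which
      \<open>act_const_linear\<close> applies.\<close>
    have "const_linear (ext_module m A) A (\<lambda>x. h x I)"
      unfolding const_linear_def using h_simps ext_carrierD(1)[OF h_simps(1)] by (simp add: Pi_iff)
    from act_const_linear[OF A.A.ext_module A.A.module_axioms this pg(1), of ?x \<mu>] xc
    have "h (act (ext_module m A) p ?x \<mu>) I = act A p (\<lambda>\<mu>. h (?x \<mu>) I) \<mu>" by simp
    moreover have "act (ext_module m A) p ?x \<mu> = (\<lambda>J. act A p (g J b) \<mu>)"
      using A.A.act_ext_module[OF kxz_kxyz[OF pg(1)] xc] by auto
    ultimately show "hh (p \<odot>\<^bsub>A.E\<^esub> g) I b \<mu> = (p \<odot>\<^bsub>A.E\<^esub> hh g) I b \<mu>" by (simp add: hh_def)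
  qed
qed (rule hh_closed)

lemma hh_vanish:
  assumes "g \<in> carrier A.E" "\<And>J. Suc (card J) = card I \<Longrightarrow> g J b = (\<lambda>_. \<zero>\<^bsub>A\<^esub>)" shows "hh g I b = (\<lambda>_. \<zero>\<^bsub>A\<^esub>)"
  unfolding hh_def using assms(2) by (intro ext h_degree slice assms(1)) metis

lemma hh_grade: "g \<in> grade A.K s \<Longrightarrow> hh g \<in> grade A.K (s + 1)"
proof -
  assume "g \<in> grade A.K s"
  then have g: "g \<in> carrier A.E" "\<And>I b. A.deg I b \<noteq> s \<Longrightarrow> g I b = (\<lambda>_. \<zero>\<^bsub>A\<^esub>)" by (auto simp: A.grade_E)
  have "hh g I b = (\<lambda>_. \<zero>\<^bsub>A\<^esub>)" if d: "A.deg I b \<noteq> s + 1" for I b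
  proof (rule hh_vanish[OF g(1)])
    fix J :: "nat set" assume "Suc (card J) = card I"
    then have "A.deg I b = A.deg J b + 1" by (simp only: A.deg_def \<open>Suc (card J) = card I\<close>[symmetric] of_nat_Suc ac_simps)
    with d have "A.deg J b \<noteq> s" by auto
    then show "g J b = (\<lambda>_. \<zero>\<^bsub>A\<^esub>)" by (rule g(2))
  qed
  then show ?thesis using hh_closed[OF g(1)] by (simp add: A.grade_E)
qed

lemma pp_cw: "pp g = cw g {}"
  by (simp add: pp_def cw_def)

lemma pp_closed: "g \<in> carrier A.E \<Longrightarrow> pp g \<in> carrier A'.Mt"
  unfolding pp_cw by (intro A'.E_carrierD(4) cw_closed)

text \<open>In theta-degree zero \<open>\<phi>\<close> kills the contribution of \<open>d_K\<close>,
  and \<open>d\<close> is natural in the coefficients.\<close>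

lemma pp_morphism: "factorisation_morphism (kxz n l) A.K A'.Mt pp"
  unfolding factorisation_morphism_def A.K_simps
proof (intro conjI allI ballI image_subsetI)
  show "linear_map (kxz n l) A.K A'.Mt pp"
    unfolding linear_map_def A.K_simps using pp_closed cw_add cw_smult[OF kxz_kxyz] unfolding pp_cw by (simp add: Pi_iff)
  show "pp g \<in> grade A'.Mt s" if "g \<in> grade A.E s" for g s
  proof -
    have "cw g \<in> grade A'.E s" by (rule cw_grade[OF that])
    then have "A'.emb (cw g {}) \<in> grade A'.E s"
      using A'.emb_closed[OF A'.E_carrierD(4)] unfolding A'.grade_E A'.emb_def by (auto split: if_splits)
    moreover have "g \<in> carrier A.E" using that by (simp add: A.grade_E)
    ultimately show ?thesis using pp_closed A'.grade_emb unfolding pp_cw by blast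
  qed
  show "pp (A.dK g) = differential A'.Mt (pp g)" if g: "g \<in> carrier A.E" for g
  proof -
    note rl = linear_mapD(1)[OF A.rep_linear[OF A.rep_differential] g] linear_mapD(1)[OF A.rep_linear[OF A.rep_dk] g]
    have "cw (A.dk g) {} b \<mu> = \<zero>\<^bsub>A'\<^esub>" for b \<mu>
      unfolding cw_def by (rule phi_koszul[OF slice[OF g]])
    then have z: "cw (A.dk g) {} = \<zero>\<^bsub>A'.Mt\<^esub>" by (intro ext) simp
    have "pp (A.dK g) = cw (differential A.E g) {} \<oplus>\<^bsub>A'.Mt\<^esub> cw (A.dk g) {}"
      unfolding pp_cw A.dK_def using cw_add[OF rl] by simp
    also have "\<dots> = differential A'.E (cw g) {}"
      unfolding z cw_natural[OF A.rep_differential A'.rep_differential g]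
      using A'.Mt.M.r_zero[OF A'.E_carrierD(4)[OF linear_mapD(1)[OF A'.rep_linear[OF A'.rep_differential] cw_closed[OF g]]]] by blast
    also have "\<dots> = differential A'.Mt (pp g)"
      by (simp add: pp_cw ext_factorisation_def ext_odd_def signed_def)
    finally show ?thesis .
  qed
qed

lemma ss_closed: assumes "g \<in> carrier A'.Mt" shows "ss g \<in> carrier A.E"
proof -
  have "g b \<in> carrier A'.B" for b using assms unfolding A'.Mt_carrier by blast
  then have fin: "finite {\<mu>. g b \<mu> \<noteq> \<zero>\<^bsub>A'\<^esub>}" and cl: "g b \<mu> \<in> carrier A'"
    and out: "\<mu> \<notin> monomials (xvars n \<union> zvars l) \<Longrightarrow> g b \<mu> = \<zero>\<^bsub>A'\<^esub>" for b \<mu> by (auto simp: poly_ext_def)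
  have "finite {\<mu>. ss g I b \<mu> \<noteq> \<zero>\<^bsub>A\<^esub>}" for I b
    by (rule finite_subset[OF _ fin[of b]]) (auto simp: ss_def sigma_zero split: if_splits)
  moreover have "ss g I b = (\<lambda>_. \<zero>\<^bsub>A\<^esub>)" if "(I, b) \<notin> A.P" for I b
  proof (cases "I = {}")
    case True
    then have "b \<notin> BY \<times> BX" using that by (metis Pow_bottom SigmaI)
    then have "g b \<mu> = \<zero>\<^bsub>A'\<^esub>" for \<mu> using assms unfolding A'.Mt_carrier by auto
    then show ?thesis using True by (simp add: ss_def sigma_zero)
  qed (simp add: ss_def)
  moreover have "ss g I b \<mu> \<in> carrier A" for I b \<mu> using cl const_linearD(1)[OF sigma(1)] by (simp add: ss_def)
  moreover have "ss g I b \<mu> = \<zero>\<^bsub>A\<^esub>" if "\<mu> \<notin> monomials (xvars n \<union> zvars l)" for I b \<mu>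
    using out[OF that] by (simp add: ss_def sigma_zero)
  ultimately show ?thesis
    unfolding A.E_carrier by (simp add: poly_ext_def)
qed

lemma ss_linear: "linear_map (kxz n l) A'.Mt A.K ss"
proof (rule linear_mapI; unfold A.K_simps)
  note cl = A'.B_carrier
  fix g g' assume "g \<in> carrier A'.Mt" "g' \<in> carrier A'.Mt"
  then show "ss (g \<oplus>\<^bsub>A'.Mt\<^esub> g') = ss g \<oplus>\<^bsub>A.E\<^esub> ss g'"
    using const_linearD(2)[OF sigma(1)] A'.B_carrier unfolding A'.Mt_carrier by (auto simp: ss_def fun_eq_iff)
next
  fix p :: "'k pol" and g assume pg: "p \<in> carrier (kxz n l)" "g \<in> carrier A'.Mt"
  then have "g b \<in> carrier A'.B" for b unfolding A'.Mt_carrier by blast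
  then have "\<sigma> (act A' p (g b) \<mu>) = act A p (\<lambda>\<mu>. \<sigma> (g b \<mu>)) \<mu>" for b \<mu>
    by (intro act_const_linear[OF A'.A.module_axioms A.A.module_axioms sigma(1) pg(1)] A'.B_carrier)
  moreover have "act A p (\<lambda>_. \<zero>\<^bsub>A\<^esub>) = (\<lambda>_. \<zero>\<^bsub>A\<^esub>)" using A.B.smult_r_null[OF kxz_kxyz[OF pg(1)]] by simp
  ultimately show "ss (p \<odot>\<^bsub>A'.Mt\<^esub> g) = p \<odot>\<^bsub>A.E\<^esub> ss g" by (auto simp: ss_def fun_eq_iff)
qed (rule ss_closed)

lemma ss_grade: "g \<in> grade A'.Mt s \<Longrightarrow> ss g \<in> grade A.K s"
  using ss_closed[of g] unfolding A.K_simps A'.grade_emb A'.grade_E A.grade_E A'.emb_def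
  by (auto simp: ss_def sigma_zero fun_eq_iff split: if_splits) (metis sigma_zero)

text \<open>On the kernel of \<open>pp\<close> the homotopy formula loses its
  \<open>\<sigma>\<close>-term, so \<open>[d_K, h]\<close> is the identity there. The rest of the
  commutator is \<open>[d, h]\<close>, which raises the theta-degree because \<open>h\<close> does
  and \<open>d\<close> preserves it.\<close>

lemma T_filtration:
  assumes g: "g \<in> carrier A.K" "pp g = \<zero>\<^bsub>A'.Mt\<^esub>" "g \<in> F r"
  shows "(A.dK (hh g) \<oplus>\<^bsub>A.K\<^esub> hh (A.dK g)) \<ominus>\<^bsub>A.K\<^esub> g \<in> F (Suc r)"
proof -
  have g': "g \<in> carrier A.E" using g(1) by simp
  note dl = linear_mapD(1)[OF A.rep_linear[OF A.rep_differential]] linear_mapD(1)[OF A.rep_linear[OF A.rep_dk]]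
  note hg = hh_closed[OF g']
  note dg = dl(1)[OF g'] and kg = dl(2)[OF g']
  have add: "hh (A.dK g) = hh (differential A.E g) \<oplus>\<^bsub>A.E\<^esub> hh (A.dk g)"
    using linear_mapD(2)[OF hh_linear, of "differential A.E g" "A.dk g"] dg kg unfolding A.dK_def by simp
  have k: "A.dk (hh g) \<oplus>\<^bsub>A.E\<^esub> hh (A.dk g) = g"
  proof (intro ext)
    fix I b \<mu>
    have "\<phi> (g {} b \<mu>) = \<zero>\<^bsub>A'\<^esub>" using g(2) by (auto simp: pp_def fun_eq_iff)
    then have "koszul_diff m (tseq V) A (h (\<lambda>J. g J b \<mu>)) I \<oplus>\<^bsub>A\<^esub> h (koszul_diff m (tseq V) A (\<lambda>J. g J b \<mu>)) I \<oplus>\<^bsub>A\<^esub> \<zero>\<^bsub>A\<^esub> = g I b \<mu>"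
      using h_homotopy[of "\<lambda>J. g J b \<mu>" I, OF slice[OF g']] by (cases "I = {}") (simp_all add: sigma_zero)
    moreover have "koszul_diff m (tseq V) A (h (\<lambda>J. g J b \<mu>)) I \<in> carrier A" "h (koszul_diff m (tseq V) A (\<lambda>J. g J b \<mu>)) I \<in> carrier A"
      using A.E_carrierD(2)[OF dl(2)[OF hg], where I = I and b = b and \<mu> = \<mu>]
        A.E_carrierD(2)[OF hh_closed[OF kg], where I = I and b = b and \<mu> = \<mu>]
      by (simp_all add: hh_def)
    ultimately show "(A.dk (hh g) \<oplus>\<^bsub>A.E\<^esub> hh (A.dk g)) I b \<mu> = g I b \<mu>" by (simp add: hh_def)
  qed
  let ?N = "differential A.E (hh g) \<oplus>\<^bsub>A.E\<^esub> hh (differential A.E g)"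
  have "A.dK (hh g) \<oplus>\<^bsub>A.E\<^esub> hh (A.dK g) = ?N \<oplus>\<^bsub>A.E\<^esub> (A.dk (hh g) \<oplus>\<^bsub>A.E\<^esub> hh (A.dk g))"
    unfolding add A.dK_def[of "hh g"]
    by (rule A.E.M.add_add_swap[OF dl(1)[OF hg] dl(2)[OF hg] hh_closed[OF dg] hh_closed[OF kg]])
  also have "\<dots> = ?N \<oplus>\<^bsub>A.E\<^esub> g" unfolding k ..
  finally have "(A.dK (hh g) \<oplus>\<^bsub>A.E\<^esub> hh (A.dK g)) \<ominus>\<^bsub>A.E\<^esub> g = ?N"
    using A.E.M.a_closed[OF dl(1)[OF hg] hh_closed[OF dg]] g' by (simp add: a_minus_def A.E.M.a_assoc A.E.M.r_neg del: A.E_simps)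
  moreover have "?N \<in> F (Suc r)"
    unfolding F_def
  proof (intro CollectI allI impI)
    fix I :: "nat set" assume I: "card I < Suc r"
    have gJ: "g J = \<zero>\<^bsub>A.Mt\<^esub>" if "Suc (card J) = card I" for J using g(3) I that by (simp add: F_def)
    have "hh g I = \<zero>\<^bsub>A.Mt\<^esub>"
      using hh_vanish[OF g', where I = I] gJ by (auto simp: fun_eq_iff)
    then have "differential A.E (hh g) I = \<zero>\<^bsub>A.Mt\<^esub>" by (rule A.differential_E[OF hg])
    moreover have "hh (differential A.E g) I = \<zero>\<^bsub>A.Mt\<^esub>"
    proof
      fix b
      show "hh (differential A.E g) I b = \<zero>\<^bsub>A.Mt\<^esub> b"
        using hh_vanish[OF dg, where I = I and b = b] A.differential_E[OF g' gJ] by simp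
    qed
    ultimately show "?N I = (\<lambda>_ _. \<zero>\<^bsub>A\<^esub>)" by simp
  qed
  ultimately show ?thesis by (simp add: a_minus_def A.K_a_inv del: A.E_simps)
qed

text \<open>The filtration ends at \<open>Suc m\<close>, since subsets of \<open>{..<m}\<close> have
  at most \<open>m\<close> elements.\<close>

sublocale retract: perturbed_retract "kxz n l" "U - W" A.K A'.Mt pp ss hh F "Suc m"
proof unfold_locales
  show "linear_factorisation (kxz n l) (U - W) A.K" by (rule A.K_factorisation)
  show "linear_factorisation (kxz n l) (U - W) A'.Mt" by (rule A'.Mt_factorisation)
  show "v \<in> carrier A'.Mt \<Longrightarrow> pp (ss v) = v" for v
    using sigma(2) A'.B_carrier unfolding A'.Mt_carrier by (auto simp: pp_def ss_def fun_eq_iff)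
  show "v \<in> carrier A.K \<Longrightarrow> pp (hh v) = \<zero>\<^bsub>A'.Mt\<^esub>" for v
    using hh_vanish[of v "{}"] by (auto simp: pp_def fun_eq_iff phi_simps)
  show "v = \<zero>\<^bsub>A.K\<^esub>" if "v \<in> carrier A.K" "v \<in> F (Suc m)" for v
  proof (intro ext)
    fix I b \<mu>
    show "v I b \<mu> = \<zero>\<^bsub>A.K\<^esub> I b \<mu>"
    proof (cases "I \<subseteq> {..<m}")
      case True
      then have "card I < Suc m" using card_mono[of "{..<m}" I] by auto
      then show ?thesis using that(2) by (simp add: F_def)
    next
      case False
      then show ?thesis using A.E_carrierD(3)[of v I b] that(1) by auto
    qed
  qed
  show "v \<in> F r" if "v \<in> carrier A.K" "\<ominus>\<^bsub>A.K\<^esub> v \<in> F r" for r v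
  proof -
    have "\<ominus>\<^bsub>A.E\<^esub> (\<ominus>\<^bsub>A.E\<^esub> v) = v" using that(1) by simp
    moreover have "\<ominus>\<^bsub>A.E\<^esub> u = (\<lambda>I b. act A (- 1) (u I b))" if "u \<in> carrier A.E" for u
      using A.E.smult_pol_uminus[of 1 u] A.E.smult_pol(3)[OF that] that by simp
    ultimately have eq: "v = (\<lambda>I b. act A (- 1) ((\<ominus>\<^bsub>A.E\<^esub> v) I b))" using that(1) A.E.M.a_inv_closed[of v] by simp
    show ?thesis unfolding F_def
    proof (intro CollectI allI impI)
      fix I :: "nat set" assume "card I < r"
      then have "(\<ominus>\<^bsub>A.E\<^esub> v) I = (\<lambda>_ _. \<zero>\<^bsub>A\<^esub>)" using that(2) unfolding F_def A.K_a_inv by blast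
      then show "v I = (\<lambda>_ _. \<zero>\<^bsub>A\<^esub>)" using fun_cong[OF eq, of I] A.B.smult_r_null[of "- 1"] by simp
    qed
  qed
  show "carrier A.K \<subseteq> F 0" by (simp add: F_def)
  show "v \<in> carrier A.K \<Longrightarrow> pp v = \<zero>\<^bsub>A'.Mt\<^esub> \<Longrightarrow> v \<in> F r \<Longrightarrow>
      (differential A.K (hh v) \<oplus>\<^bsub>A.K\<^esub> hh (differential A.K v)) \<ominus>\<^bsub>A.K\<^esub> v \<in> F (Suc r)" for r v
    using T_filtration[of v r] by (simp del: A.E_simps)
qed (rule pp_morphism ss_linear hh_linear | erule ss_grade hh_grade)+

end

section \<open>The completion\<close>

lemma finite_mindex_less: "finite {u \<in> mindex m. mdeg m u < N}"
proof -
  have "{u \<in> mindex m. mdeg m u < N} \<subseteq> {f. \<forall>i. (i \<in> {..<m} \<longrightarrow> f i \<in> {..<N}) \<and> (i \<notin> {..<m} \<longrightarrow> f i = 0)}"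
  proof (intro subsetI CollectI allI conjI impI)
    fix u i assume u: "u \<in> {u \<in> mindex m. mdeg m u < N}"
    show "u i \<in> {..<N}" if "i \<in> {..<m}"
    proof -
      have "u i \<le> (\<Sum>i<m. u i)" using that by (intro member_le_sum) auto
      then show ?thesis using u by (simp add: mdeg_def)
    qed
    show "u i = 0" if "i \<notin> {..<m}" using u that by (simp add: mindex_def)
  qed
  then show ?thesis by (rule finite_subset) (rule finite_set_of_finite_funs, auto)
qed

lemma finite_mindex_eq: "finite {u \<in> mindex m. mdeg m u = N}"
  by (rule finite_subset[OF _ finite_mindex_less[of m "Suc N"]]) auto

text \<open>Written with sums on both sides, so that it serves for raising and for lowering an
  exponent without truncated subtraction.\<close>

lemma mdeg_upd: "i < m \<Longrightarrow> mdeg m (u(i := j)) + u i = mdeg m u + j"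
  by (simp add: mdeg_def sum.remove[of "{..<m}" i])

lemma mindex_upd: "i < m \<Longrightarrow> u \<in> mindex m \<Longrightarrow> u(i := j) \<in> mindex m"
  by (simp add: mindex_def)

lemma mdeg_zero: "u \<in> mindex m \<Longrightarrow> mdeg m u = 0 \<longleftrightarrow> u = (\<lambda>_. 0)"
  by (auto simp: mdeg_def mindex_def fun_eq_iff) (metis lessThan_iff not_le)

locale adic =
  fixes m :: nat and V :: "'k::comm_ring_1 pol"
  assumes V: "V \<in> carrier (ky m)"
begin

abbreviation R :: "'k pol ring" where "R \<equiv> ky m"
abbreviation t :: "nat \<Rightarrow> 'k pol" where "t \<equiv> tseq V"
abbreviation "I \<equiv> jacobi_ideal YV m V"
definition Ip where "Ip N = ideal_pow R I N"
definition cs where "cs N p = Ip N +>\<^bsub>R\<^esub> p"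
abbreviation "HR \<equiv> hat_ring m V"
abbreviation "HM \<equiv> hat_module m V"
abbreviation "J \<equiv> jacobi_module YV m V"

sublocale R: cring R by (rule cring_pol_ring)

lemma t_closed [simp]: "t i \<in> carrier R"
  using V by simp

lemma I_ideal: "ideal I R"
  unfolding jacobi_ideal_def by (rule R.genideal_ideal) (use t_closed in \<open>auto simp del: pol_ring_simps\<close>)

lemma Ip_ideal: "ideal (Ip N) R"
proof (induction N)
  case 0
  show ?case using R.oneideal by (simp add: Ip_def ideal_pow_def)
next
  case (Suc N)
  then show ?case using R.ideal_prod_is_ideal[OF I_ideal] by (simp add: Ip_def ideal_pow_def)
qed

lemma Ip_0: "Ip 0 = carrier R" by (simp add: Ip_def ideal_pow_def)

lemma Ip_Suc: "Ip (Suc N) = ideal_prod R I (Ip N)" by (simp add: Ip_def ideal_pow_def)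

lemma ideal_typed:
  assumes "ideal K R"
  shows "0 \<in> K" "p \<in> K \<Longrightarrow> r \<in> K \<Longrightarrow> p + r \<in> K" "p \<in> K \<Longrightarrow> r \<in> carrier R \<Longrightarrow> r * p \<in> K" "p \<in> K \<Longrightarrow> p \<in> carrier R"
    "p \<in> K \<Longrightarrow> - p \<in> K" "p \<in> K \<Longrightarrow> r \<in> K \<Longrightarrow> p - r \<in> K" "p \<in> K \<Longrightarrow> r \<in> carrier R \<Longrightarrow> p * r \<in> K"
proof -
  interpret ideal K R by fact
  show z: "0 \<in> K" using zero_closed by simp
  show a: "p \<in> K \<Longrightarrow> r \<in> K \<Longrightarrow> p + r \<in> K" for p r using a_closed[of p r] by simp
  show s: "p \<in> K \<Longrightarrow> r \<in> carrier R \<Longrightarrow> r * p \<in> K" for p r using I_l_closed[of p r] by simp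
  show c: "p \<in> K \<Longrightarrow> p \<in> carrier R" for p by (rule Icarr)
  show u: "p \<in> K \<Longrightarrow> - p \<in> K" for p using s[of p "- 1"] by simp
  show "p \<in> K \<Longrightarrow> r \<in> K \<Longrightarrow> p - r \<in> K" using a[OF _ u[of r], of p] by simp
  show "p \<in> K \<Longrightarrow> r \<in> carrier R \<Longrightarrow> p * r \<in> K" using s[of p r] by (simp add: mult.commute)
qed

lemmas Ip_simps = ideal_typed[OF Ip_ideal]

lemma Ip_sum: "(\<And>i. i \<in> A \<Longrightarrow> f i \<in> Ip N) \<Longrightarrow> sum f A \<in> Ip N"
  by (induction A rule: infinite_finite_induct) (auto simp: Ip_simps)

lemma Ip_1: "Ip (Suc 0) = I"
proof
  show "Ip (Suc 0) \<subseteq> I" unfolding Ip_Suc Ip_0 using R.ideal_prod_inter[OF I_ideal R.oneideal] by blast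
  show "I \<subseteq> Ip (Suc 0)"
  proof
    fix p assume "p \<in> I"
    then have "p \<otimes>\<^bsub>R\<^esub> 1 \<in> ideal_prod R I (carrier R)" by (intro ideal_prod.prod) auto
    then show "p \<in> Ip (Suc 0)" by (simp add: Ip_Suc Ip_0)
  qed
qed

lemma Ip_Suc_le: "Ip (Suc N) \<subseteq> Ip N"
  unfolding Ip_Suc using R.ideal_prod_inter[OF I_ideal Ip_ideal] by blast

lemma Ip_mono: "M \<le> N \<Longrightarrow> Ip N \<subseteq> Ip M"
  by (induction N rule: dec_induct) (use Ip_Suc_le in auto)

lemma cs_alt: "cs N p = (\<lambda>x. x + p) ` Ip N"
  by (auto simp: cs_def a_r_coset_def')

lemma cs_eq: assumes "p \<in> carrier R" "r \<in> carrier R" shows "cs N p = cs N r \<longleftrightarrow> p - r \<in> Ip N"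
proof
  assume "cs N p = cs N r"
  moreover have "p \<in> cs N p" unfolding cs_alt using Ip_simps(1) by force
  ultimately show "p - r \<in> Ip N" by (auto simp: cs_alt)
next
  assume *: "p - r \<in> Ip N"
  show "cs N p = cs N r"
  proof
    show "cs N p \<subseteq> cs N r"
      unfolding cs_alt using Ip_simps(2)[OF _ *] by (auto intro!: image_eqI[of _ _ "_ + (p - r)"])
    show "cs N r \<subseteq> cs N p"
      unfolding cs_alt using Ip_simps(6)[OF _ *] by (auto intro!: image_eqI[of _ _ "_ - (p - r)"])
  qed
qed

lemma Q_simps:
  "carrier (R Quot Ip N) = cs N ` carrier R" "zero (R Quot Ip N) = cs N 0" "one (R Quot Ip N) = cs N 1"
  "p \<in> carrier R \<Longrightarrow> r \<in> carrier R \<Longrightarrow> cs N p \<oplus>\<^bsub>R Quot Ip N\<^esub> cs N r = cs N (p + r)"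
  "p \<in> carrier R \<Longrightarrow> r \<in> carrier R \<Longrightarrow> cs N p \<otimes>\<^bsub>R Quot Ip N\<^esub> cs N r = cs N (p * r)"
  using ideal.a_rcos_sum[OF Ip_ideal, of p r N] ideal.rcoset_mult_add[OF Ip_ideal, of p r N]
  by (auto simp: FactRing_def A_RCOSETS_def' cs_def a_r_coset_def')

lemma hat_simps:
  "carrier HR = {a. \<forall>N. a N \<in> cs N ` carrier R \<and> a (Suc N) \<subseteq> a N}"
  "zero HR = (\<lambda>N. cs N 0)" "add HR = (\<lambda>a b N. a N \<oplus>\<^bsub>R Quot Ip N\<^esub> b N)" "monoid.mult HR = (\<lambda>a b N. a N \<otimes>\<^bsub>R Quot Ip N\<^esub> b N)"
  by (simp_all add: hat_ring_def completion_def Ip_def[symmetric] Q_simps(1,2))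

lemma HM_simps [simp]:
  "carrier HM = carrier HR" "zero HM = zero HR" "add HM = add HR" "smult HM = (\<lambda>p a. to_hat m V p \<otimes>\<^bsub>HR\<^esub> a)"
  by (simp_all add: hat_module_def via_hom_def)

lemma to_hat_alt: "to_hat m V p = (\<lambda>N. cs N p)"
  by (simp add: to_hat_def to_completion_def cs_def Ip_def)

text \<open>\<open>apx N a p\<close>: the polynomial \<open>p\<close> represents \<open>a\<close> modulo \<open>I\<^sup>N\<close>.\<close>

definition apx :: "nat \<Rightarrow> 'k hat \<Rightarrow> 'k pol \<Rightarrow> bool" where
  "apx N a p \<longleftrightarrow> p \<in> carrier R \<and> (\<forall>M\<le>N. a M = cs M p)"

lemma apx_closed: "apx N a p \<Longrightarrow> p \<in> carrier R"
  and apxD: "apx N a p \<Longrightarrow> M \<le> N \<Longrightarrow> a M = cs M p"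
  by (auto simp: apx_def)

text \<open>The cosets of a compatible sequence are nested, so a representative chosen at level
  \<open>N\<close> is one at all lower levels.\<close>

lemma hat_carrier: "a \<in> carrier HR \<longleftrightarrow> (\<forall>N. \<exists>p. apx N a p)"
proof
  assume a: "a \<in> carrier HR"
  show "\<forall>N. \<exists>p. apx N a p"
  proof
    fix N
    obtain p where p: "p \<in> carrier R" "a N = cs N p" using a unfolding hat_simps(1) by blast
    have "a M = cs M p" if "M \<le> N" for M
    proof -
      have "a N \<subseteq> a M" using that
        by (induction N rule: dec_induct) (use a in \<open>auto simp: hat_simps(1)\<close>)
      moreover have "p \<in> a N" unfolding p(2) cs_alt using Ip_simps(1) by force
      moreover obtain r where r: "r \<in> carrier R" "a M = cs M r" using a unfolding hat_simps(1) by blast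
      ultimately have "p - r \<in> Ip M" unfolding cs_alt by auto
      then show ?thesis using cs_eq[OF p(1) r(1), of M] r(2) by metis
    qed
    with p(1) show "\<exists>p. apx N a p" by (auto simp: apx_def)
  qed
next
  assume *: "\<forall>N. \<exists>p. apx N a p"
  show "a \<in> carrier HR" unfolding hat_simps(1)
  proof (intro CollectI allI)
    fix N
    obtain p where p: "apx (Suc N) a p" using * by blast
    then show "a N \<in> cs N ` carrier R \<and> a (Suc N) \<subseteq> a N"
      using Ip_Suc_le[of N] unfolding apx_def cs_alt by auto
  qed
qed

lemma apx_ex: assumes "a \<in> carrier HR" obtains p where "apx N a p"
  using assms hat_carrier by blast

lemma hat_eqI:
  assumes "\<And>N. \<exists>p r. apx N a p \<and> apx N b r \<and> p - r \<in> Ip N" shows "a = b"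
proof
  fix N
  obtain p r where pr: "apx N a p" "apx N b r" "p - r \<in> Ip N" using assms by blast
  then show "a N = b N" using cs_eq[of p r N] by (auto simp: apx_def)
qed

lemma apx_level: "apx N a p \<Longrightarrow> apx N b r \<Longrightarrow> a N = b N \<longleftrightarrow> p - r \<in> Ip N"
  using cs_eq[of p r N] by (auto simp: apx_def)

lemma apx_le: "apx N a p \<Longrightarrow> M \<le> N \<Longrightarrow> apx M a p"
  by (auto simp: apx_def)

lemma apx_add: "apx N a p \<Longrightarrow> apx N b r \<Longrightarrow> apx N (a \<oplus>\<^bsub>HR\<^esub> b) (p + r)"
  by (auto simp: apx_def hat_simps Q_simps)

lemma apx_mult: "apx N a p \<Longrightarrow> apx N b r \<Longrightarrow> apx N (a \<otimes>\<^bsub>HR\<^esub> b) (p * r)"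
  by (auto simp: apx_def hat_simps Q_simps)

lemma apx_to_hat: "p \<in> carrier R \<Longrightarrow> apx N (to_hat m V p) p"
  by (auto simp: apx_def to_hat_alt)

lemma apx_smult: "r \<in> carrier R \<Longrightarrow> apx N a p \<Longrightarrow> apx N (r \<odot>\<^bsub>HM\<^esub> a) (r * p)"
  by (simp add: apx_mult apx_to_hat)

lemma apx_zero: "apx N \<zero>\<^bsub>HR\<^esub> 0"
  by (simp add: apx_def hat_simps)

text \<open>The axioms of the completion are verified on representatives, where they are identities
  between polynomials.\<close>

lemma apx_eq:
  assumes "\<And>N. apx N a (p N)" "\<And>N. apx N b (r N)" "\<And>N. p N = r N" shows "a = b"
  by (rule hat_eqI) (metis Ip_simps(1) diff_self assms)

lemma HR_group: "abelian_group HR"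
proof (rule abelian_groupI)
    fix a b c assume "a \<in> carrier HR" "b \<in> carrier HR" "c \<in> carrier HR"
    then obtain p r s where prs: "\<And>N. apx N a (p N)" "\<And>N. apx N b (r N)" "\<And>N. apx N c (s N)"
      using hat_carrier by metis
    show "a \<oplus>\<^bsub>HR\<^esub> b \<oplus>\<^bsub>HR\<^esub> c = a \<oplus>\<^bsub>HR\<^esub> (b \<oplus>\<^bsub>HR\<^esub> c)"
      by (rule apx_eq[OF apx_add[OF apx_add[OF prs(1,2)] prs(3)] apx_add[OF prs(1) apx_add[OF prs(2,3)]]]) simp
  next
    fix a b assume "a \<in> carrier HR" "b \<in> carrier HR"
    then obtain p r where pr: "\<And>N. apx N a (p N)" "\<And>N. apx N b (r N)" using hat_carrier by metis
    show "a \<oplus>\<^bsub>HR\<^esub> b \<in> carrier HR" using apx_add[OF pr] hat_carrier by blast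
    show "a \<oplus>\<^bsub>HR\<^esub> b = b \<oplus>\<^bsub>HR\<^esub> a"
      by (rule apx_eq[OF apx_add[OF pr] apx_add[OF pr(2,1)]]) simp
  next
    fix a assume "a \<in> carrier HR"
    then obtain p where p: "\<And>N. apx N a (p N)" using hat_carrier by metis
    show "\<zero>\<^bsub>HR\<^esub> \<oplus>\<^bsub>HR\<^esub> a = a"
      by (rule apx_eq[OF apx_add[OF apx_zero p] p]) simp
    \<comment> \<open>The additive inverse is obtained by multiplying with the class of
      \<open>- 1\<close>.\<close>
    have n: "apx N (to_hat m V (- 1) \<otimes>\<^bsub>HR\<^esub> a) ((- 1) * p N)" for N by (rule apx_mult[OF apx_to_hat p]) simp
    then have "to_hat m V (- 1) \<otimes>\<^bsub>HR\<^esub> a \<in> carrier HR" using hat_carrier by blast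
    moreover have "to_hat m V (- 1) \<otimes>\<^bsub>HR\<^esub> a \<oplus>\<^bsub>HR\<^esub> a = \<zero>\<^bsub>HR\<^esub>"
      by (rule apx_eq[OF apx_add[OF n p] apx_zero]) simp
    ultimately show "\<exists>b\<in>carrier HR. b \<oplus>\<^bsub>HR\<^esub> a = \<zero>\<^bsub>HR\<^esub>" by blast
  next
    show "\<zero>\<^bsub>HR\<^esub> \<in> carrier HR" using apx_zero hat_carrier by blast
  qed

lemma HM_module: "module (ky m) HM"
proof (rule moduleI[OF cring_pol_ring])
  interpret HR: abelian_group HR by (rule HR_group)
  show "abelian_group HM"
    by (rule abelian_groupI) (auto simp: HR.a_ac intro!: bexI[of _ "\<ominus>\<^bsub>HR\<^esub> _"] HR.l_neg)
next
  have ex: "\<exists>p. apx N a p" if "a \<in> carrier HM" for N a using that hat_carrier by simp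
  fix x y :: "'k pol" and a b assume xy: "x \<in> carrier R" "y \<in> carrier R" and "a \<in> carrier HM" "b \<in> carrier HM"
  then obtain p r where pr: "\<And>N. apx N a (p N)" "\<And>N. apx N b (r N)" using ex by metis
  note sm = apx_smult[OF xy(1)] apx_smult[OF xy(2)]
  show "(x \<oplus>\<^bsub>R\<^esub> y) \<odot>\<^bsub>HM\<^esub> a = x \<odot>\<^bsub>HM\<^esub> a \<oplus>\<^bsub>HM\<^esub> y \<odot>\<^bsub>HM\<^esub> a"
    unfolding pol_ring_simps HM_simps(3)
    by (rule apx_eq[OF apx_smult[OF pol_ring_closed(3)[OF xy] pr(1)] apx_add[OF sm(1)[OF pr(1)] sm(2)[OF pr(1)]]])
      (simp add: distrib_right)
  show "(x \<otimes>\<^bsub>R\<^esub> y) \<odot>\<^bsub>HM\<^esub> a = x \<odot>\<^bsub>HM\<^esub> (y \<odot>\<^bsub>HM\<^esub> a)"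
    unfolding pol_ring_simps
    by (rule apx_eq[OF apx_smult[OF mult_pol_ring[OF xy] pr(1)] sm(1)[OF sm(2)[OF pr(1)]]]) (simp add: mult.assoc)
  show "x \<odot>\<^bsub>HM\<^esub> (a \<oplus>\<^bsub>HM\<^esub> b) = x \<odot>\<^bsub>HM\<^esub> a \<oplus>\<^bsub>HM\<^esub> x \<odot>\<^bsub>HM\<^esub> b"
    unfolding HM_simps(3)
    by (rule apx_eq[OF sm(1)[OF apx_add[OF pr]] apx_add[OF sm(1)[OF pr(1)] sm(1)[OF pr(2)]]]) (simp add: distrib_left)
  show "x \<odot>\<^bsub>HM\<^esub> a \<in> carrier HM" using apx_smult[OF xy(1) pr(1)] hat_carrier by auto
next
  fix a assume "a \<in> carrier HM"
  then obtain p where p: "\<And>N. apx N a (p N)" using hat_carrier HM_simps(1) by metis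
  show "\<one>\<^bsub>R\<^esub> \<odot>\<^bsub>HM\<^esub> a = a"
    unfolding pol_ring_simps by (rule apx_eq[OF apx_smult[OF pol_ring_closed(2) p] p]) simp
qed

sublocale HM: coeff_module m HM
  by (simp add: coeff_module_def pol_module_def HM_module)

sublocale HR: abelian_group HR by (rule HR_group)

lemma HM_finsum: "finsum HM = finsum HR"
  by (simp add: finsum_def finprod_def fun_eq_iff)

lemma HM_a_inv: "a_inv HM = a_inv HR"
  by (simp add: a_inv_def m_inv_def fun_eq_iff)

lemma apx_sum:
  assumes "\<And>i. i \<in> A \<Longrightarrow> apx N (f i) (p i)" "\<And>i. i \<in> A \<Longrightarrow> f i \<in> carrier HR"
  shows "apx N (\<Oplus>\<^bsub>HR\<^esub>i\<in>A. f i) (\<Sum>i\<in>A. p i)"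
  using assms
proof (induction A rule: infinite_finite_induct)
  case (insert i F)
  then show ?case by (subst HR.finsum_insert) (auto intro: apx_add)
qed (auto simp: apx_zero HR.finsum_infinite)

lemma apx_uminus: assumes "apx N a p" "a \<in> carrier HR" shows "apx N (\<ominus>\<^bsub>HR\<^esub> a) (- p)"
proof -
  have "\<ominus>\<^bsub>HM\<^esub> a = (- 1) \<odot>\<^bsub>HM\<^esub> a" using HM.smult_pol_uminus[of 1 a] HM.smult_pol(3)[of a] assms(2) by simp
  then show ?thesis using apx_smult[OF _ assms(1), of "- 1"] by (simp add: HM_a_inv)
qed

section \<open>Monomials in the \<open>t_i\<close> and the powers of the ideal\<close>

definition T where "T u = (\<Prod>i<m. t i ^ u i)"

lemma T_closed [simp]: "T u \<in> carrier R" by (simp add: T_def)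

lemma mpower_T: "mpower R m t u = T u"
  unfolding mpower_def T_def by (subst finprod_pol_ring) (auto simp: pow_pol_ring)

lemma t_power_apx: "apx N (t_power m V u) (T u)"
  by (simp add: t_power_def mpower_T apx_to_hat)

lemma T_upd: "i < m \<Longrightarrow> T (u(i := Suc (u i))) = t i * T u"
  by (simp add: T_def prod.remove[of "{..<m}" i] ac_simps)

lemma t_I: "i < m \<Longrightarrow> t i \<in> I"
  unfolding jacobi_ideal_def by (rule R.genideal_self[THEN subsetD]) (use t_closed in \<open>auto simp del: pol_ring_simps\<close>)

lemma ideal_prod_Ip: "p \<in> I \<Longrightarrow> r \<in> Ip N \<Longrightarrow> p * r \<in> Ip (Suc N)"
  unfolding Ip_Suc using ideal_prod.prod[of p I r "Ip N" R] by simp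

lemma T_Ip: "u \<in> mindex m \<Longrightarrow> T u \<in> Ip (mdeg m u)"
proof (induction "mdeg m u" arbitrary: u)
  case 0
  show ?case using 0(1)[symmetric] by (simp add: Ip_0)
next
  case (Suc d)
  then obtain i where i: "i < m" "u i \<noteq> 0" unfolding mdeg_def by (metis Zero_not_Suc lessThan_iff sum.neutral)
  let ?v = "u(i := u i - 1)"
  have d: "d = mdeg m ?v" using mdeg_upd[OF i(1), of u "u i - 1"] Suc(2) i(2) by simp
  have "T ?v \<in> Ip (mdeg m ?v)" using Suc(1)[OF d] mindex_upd[OF i(1) Suc(3)] by simp
  then have "t i * T ?v \<in> Ip (Suc (mdeg m ?v))" by (intro ideal_prod_Ip t_I i)
  moreover have "t i * T ?v = T u" using T_upd[OF i(1), of ?v] i(2) by simp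
  ultimately show ?case using Suc(2) d by simp
qed

text \<open>The combinations of the \<open>t_i\<close> form an ideal containing them, hence contain
  the generated ideal.\<close>

lemma I_elements: assumes "p \<in> I" shows "\<exists>c. (\<forall>i. c i \<in> carrier R) \<and> p = (\<Sum>i<m. c i * t i)"
proof -
  let ?K = "{p. \<exists>c. (\<forall>i. c i \<in> carrier R) \<and> p = (\<Sum>i<m. c i * t i)}"
  have sm: "r * p \<in> ?K" if "p \<in> ?K" "r \<in> carrier R" for p r
  proof -
    obtain c where "\<forall>i. c i \<in> carrier R" "p = (\<Sum>i<m. c i * t i)" using \<open>p \<in> ?K\<close> by auto
    then show ?thesis using that(2) by (auto intro!: exI[of _ "\<lambda>i. r * c i"] simp: sum_distrib_left mult.assoc)
  qed
  have "ideal ?K R"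
  proof (rule idealI[OF R.ring_axioms])
    show "subgroup ?K (add_monoid R)"
    proof (rule R.add.subgroupI)
      show "?K \<noteq> {}" by (auto intro!: exI[of _ "\<lambda>_. 0"])
      show "?K \<subseteq> carrier R" by auto
      fix a b assume "a \<in> ?K" "b \<in> ?K"
      then obtain c d where cd: "\<forall>i. c i \<in> carrier R" "a = (\<Sum>i<m. c i * t i)" "\<forall>i. d i \<in> carrier R" "b = (\<Sum>i<m. d i * t i)" by auto
      then show "a \<oplus>\<^bsub>R\<^esub> b \<in> ?K"
        by (auto intro!: exI[of _ "\<lambda>i. c i + d i"] simp: distrib_right sum.distrib)
      have "a \<in> carrier R" using cd by auto
      then have "\<ominus>\<^bsub>R\<^esub> a = - 1 * a" using R.minus_equality[of "- a" a] by simp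
      then show "\<ominus>\<^bsub>R\<^esub> a \<in> ?K" using sm[OF \<open>a \<in> ?K\<close>, of "- 1"] by simp
    qed
  qed (use sm in \<open>auto simp: mult.commute\<close>)
  moreover have "t ` {..<m} \<subseteq> ?K"
  proof
    fix x assume "x \<in> t ` {..<m}"
    then obtain i where "i < m" "x = t i" by auto
    then show "x \<in> ?K" by (auto intro!: exI[of _ "\<lambda>j. if j = i then 1 else 0"] simp: if_distrib[of "\<lambda>c. c * _"] cong: if_cong)
  qed
  ultimately have "I \<subseteq> ?K" unfolding jacobi_ideal_def by (rule R.genideal_minimal)
  with assms show ?thesis by auto
qed

text \<open>Multiplying a combination of monomials of degree \<open>N\<close> by a combination of
  the \<open>t_i\<close> gives one of degree \<open>N + 1\<close>, and such combinations are closed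
  under addition, which is all that \<open>ideal_prod\<close> generates.\<close>

lemma Ip_elements:
  assumes "p \<in> Ip N"
  shows "\<exists>c. (\<forall>u. c u \<in> carrier R) \<and> p = (\<Sum>u\<in>{u \<in> mindex m. mdeg m u = N}. c u * T u)"
  using assms
proof (induction N arbitrary: p)
  case 0
  have "{u \<in> mindex m. mdeg m u = 0} = {\<lambda>_. 0}" using mdeg_zero[of _ m] by (auto simp: mindex_def mdeg_def)
  then show ?case using 0 by (intro exI[of _ "\<lambda>_. p"]) (simp add: Ip_0 T_def)
next
  case (Suc N)
  let ?U = "\<lambda>N. {u \<in> mindex m. mdeg m u = N}"
  let ?P = "\<lambda>p. \<exists>c. (\<forall>u. c u \<in> carrier R) \<and> p = (\<Sum>u\<in>?U (Suc N). c u * T u)"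
  have add: "?P (p + r)" if "?P p" "?P r" for p r
  proof -
    obtain c where "\<forall>u. c u \<in> carrier R" "p = (\<Sum>u\<in>?U (Suc N). c u * T u)" using \<open>?P p\<close> by blast
    moreover obtain d where "\<forall>u. d u \<in> carrier R" "r = (\<Sum>u\<in>?U (Suc N). d u * T u)" using \<open>?P r\<close> by blast
    ultimately show ?thesis by (intro exI[of _ "\<lambda>u. c u + d u"]) (simp add: distrib_right sum.distrib)
  qed
  have zero: "?P 0" by (rule exI[of _ "\<lambda>_. 0"]) simp
  have sum: "?P (sum f A)" if "\<And>i. i \<in> A \<Longrightarrow> ?P (f i)" for f and A :: "'z set"
    using that
  proof (induction A rule: infinite_finite_induct)
    case (insert x F)
    then show ?case using add[of "f x" "sum f F"] by simp
  qed (use zero in auto)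
  \<comment> \<open>The coefficient family concentrated at \<open>u\<close>; finiteness of the set
    of multi-indices is used here.\<close>
  have single: "?P (a * T u)" if "a \<in> carrier R" "u \<in> ?U (Suc N)" for a u
  proof (intro exI conjI allI)
    show "(if v = u then a else 0) \<in> carrier R" for v using that by simp
    have "(\<Sum>v\<in>?U (Suc N). (if v = u then a else 0) * T v) = (\<Sum>v\<in>?U (Suc N). if v = u then a * T v else 0)"
      by (intro sum.cong) auto
    then show "a * T u = (\<Sum>v\<in>?U (Suc N). (if v = u then a else 0) * T v)"
      using that(2) finite_mindex_eq[of m "Suc N"] by simp
  qed
  from Suc.prems show ?case unfolding Ip_Suc
  proof (induction p rule: ideal_prod.induct)
    case (prod p r)
    obtain c where c: "\<forall>i. c i \<in> carrier R" "p = (\<Sum>i<m. c i * t i)" using I_elements[OF prod(1)] by blast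
    obtain d where d: "\<forall>u. d u \<in> carrier R" "r = (\<Sum>u\<in>?U N. d u * T u)" using Suc.IH[OF prod(2)] by blast
    have e: "p \<otimes>\<^bsub>R\<^esub> r = (\<Sum>i<m. \<Sum>u\<in>?U N. (c i * d u) * T (u(i := Suc (u i))))"
      unfolding c(2) d(2) by (simp add: sum_product T_upd ac_simps)
    have "?P ((c i * d u) * T (u(i := Suc (u i))))" if "i < m" "u \<in> ?U N" for i u
      using that c(1) d(1) mdeg_upd[OF that(1), of u "Suc (u i)"] by (intro single) (auto simp: mindex_upd)
    then show ?case unfolding e by (intro sum) (simp only: lessThan_iff)
  next
    case (sum p r)
    then show ?case using add[of p r] by simp
  qed
qed

end

section \<open>Bases\<close>

lemma (in abelian_monoid) finsum_neutral:
  assumes "finite B" "A \<subseteq> B" "\<And>b. b \<in> B - A \<Longrightarrow> f b = \<zero>" "\<And>b. b \<in> A \<Longrightarrow> f b \<in> carrier G"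
  shows "finsum G f A = finsum G f B"
proof -
  have "f b \<in> carrier G" if "b \<in> B" for b using assms(3)[of b] assms(4)[of b] that by (cases "b \<in> A") auto
  then show ?thesis by (intro add.finprod_mono_neutral_cong_left) (use assms in auto)
qed

lemma basis_expansion_finite:
  assumes "module R M" "finite B" "B \<subseteq> carrier M"
  shows "basis_expansion R M B v c \<longleftrightarrow>
    (\<forall>b\<in>B. c b \<in> carrier R) \<and> (\<forall>b. b \<notin> B \<longrightarrow> c b = \<zero>\<^bsub>R\<^esub>) \<and> v = (\<Oplus>\<^bsub>M\<^esub>b\<in>B. c b \<odot>\<^bsub>M\<^esub> b)"
proof -
  interpret module R M by fact
  have "finite {b. c b \<noteq> \<zero>\<^bsub>R\<^esub>} \<and> (\<Oplus>\<^bsub>M\<^esub>b\<in>{b. c b \<noteq> \<zero>\<^bsub>R\<^esub>}. c b \<odot>\<^bsub>M\<^esub> b) = (\<Oplus>\<^bsub>M\<^esub>b\<in>B. c b \<odot>\<^bsub>M\<^esub> b)"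
    if c: "\<forall>b\<in>B. c b \<in> carrier R" "\<forall>b. b \<notin> B \<longrightarrow> c b = \<zero>\<^bsub>R\<^esub>"
  proof
    have sub: "{b. c b \<noteq> \<zero>\<^bsub>R\<^esub>} \<subseteq> B" using c(2) by auto
    then show "finite {b. c b \<noteq> \<zero>\<^bsub>R\<^esub>}" using assms(2) finite_subset by blast
    show "(\<Oplus>\<^bsub>M\<^esub>b\<in>{b. c b \<noteq> \<zero>\<^bsub>R\<^esub>}. c b \<odot>\<^bsub>M\<^esub> b) = (\<Oplus>\<^bsub>M\<^esub>b\<in>B. c b \<odot>\<^bsub>M\<^esub> b)"
      by (rule M.finsum_neutral[OF assms(2) sub]) (use assms(3) c sub in \<open>auto intro!: smult_closed\<close>)
  qed
  then show ?thesis unfolding basis_expansion_def by (metis (no_types, lifting))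
qed

lemma type_ring_simps [simp]:
  "carrier type_ring = UNIV" "monoid.mult type_ring = (*)" "one type_ring = 1" "zero type_ring = 0" "add type_ring = (+)"
  by (simp_all add: type_ring_def)

lemma cring_type_ring: "cring type_ring"
proof (intro cringI abelian_groupI comm_monoidI)
  fix x :: 'a show "\<exists>y\<in>carrier type_ring. y \<oplus>\<^bsub>type_ring\<^esub> x = \<zero>\<^bsub>type_ring\<^esub>"
    by (intro bexI[of _ "- x"]) auto
qed (auto simp: algebra_simps)

lemma restrict_scalars_simps [simp]:
  "carrier (restrict_scalars \<phi> M) = carrier M" "zero (restrict_scalars \<phi> M) = zero M" "add (restrict_scalars \<phi> M) = add M"
  "smult (restrict_scalars \<phi> M) = (\<lambda>c v. \<phi> c \<odot>\<^bsub>M\<^esub> v)"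
  by (simp_all add: restrict_scalars_def)

lemma finsum_restrict_scalars: "finsum (restrict_scalars \<phi> M) = finsum M"
  by (simp add: finsum_def finprod_def fun_eq_iff)

lemma module_restrict_scalars:
  assumes "module (pol_ring S) M" shows "module type_ring (restrict_scalars const M)"
proof -
  interpret pol_module S M by (rule pol_moduleI) fact
  have "abelian_group (restrict_scalars const M)"
    by (rule abelian_groupI) (auto simp: M.a_ac intro!: bexI[of _ "\<ominus>\<^bsub>M\<^esub> _"] M.l_neg)
  then show ?thesis
    by (rule moduleI[OF cring_type_ring]) (auto simp: smult_pol smult_r_distr)
qed

section \<open>Koszul homotopies in coordinates\<close>

definition sgk :: "bit \<Rightarrow> 'k::comm_ring_1" where "sgk s = (if s = 0 then 1 else - 1)"

lemma sgk_simps [simp]: "sgk s * sgk s = 1" "sgk 0 = 1" "sgk 1 = - 1" and sgk_add: "sgk (s + t) = sgk s * sgk t"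
  by (cases s; cases t; simp add: sgk_def)+

lemma sgk_cancel: "sgk s * (sgk s * d) = d" "sgk s * (r * (sgk s * d)) = r * d"
proof -
  show 1: "sgk s * (sgk s * d) = d" for d :: 'a by (simp add: mult.assoc[symmetric])
  show "sgk s * (r * (sgk s * d)) = r * d" by (simp only: mult.left_commute[of r] 1)
qed

text \<open>The summands of \<open>d\<^sub>K\<close> and \<open>\<nabla>\<close> on the coefficients \<open>D I u\<close> of \<open>t\<^sup>u \<theta>\<^sub>I\<close>.\<close>

definition kt :: "(nat set \<Rightarrow> (nat \<Rightarrow> nat) \<Rightarrow> 'k::comm_ring_1) \<Rightarrow> nat set \<Rightarrow> (nat \<Rightarrow> nat) \<Rightarrow> nat \<Rightarrow> 'k" where
  "kt D I u i = (if i \<notin> I \<and> 0 < u i then sgk (theta_sign i I) * D (insert i I) (u(i := u i - 1)) else 0)"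

definition nt :: "(nat set \<Rightarrow> (nat \<Rightarrow> nat) \<Rightarrow> 'k::comm_ring_1) \<Rightarrow> nat set \<Rightarrow> (nat \<Rightarrow> nat) \<Rightarrow> nat \<Rightarrow> 'k" where
  "nt D I u i = (if i \<in> I then sgk (theta_sign i I) * (of_nat (Suc (u i)) * D (I - {i}) (u(i := Suc (u i)))) else 0)"

definition kc1 :: "nat \<Rightarrow> (nat set \<Rightarrow> (nat \<Rightarrow> nat) \<Rightarrow> 'k::comm_ring_1) \<Rightarrow> nat set \<Rightarrow> (nat \<Rightarrow> nat) \<Rightarrow> 'k" where
  "kc1 m D = (\<lambda>I u. \<Sum>i<m. kt D I u i)"

definition nc1 :: "nat \<Rightarrow> (nat set \<Rightarrow> (nat \<Rightarrow> nat) \<Rightarrow> 'k::comm_ring_1) \<Rightarrow> nat set \<Rightarrow> (nat \<Rightarrow> nat) \<Rightarrow> 'k" where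
  "nc1 m D = (\<lambda>I u. \<Sum>i<m. nt D I u i)"

lemma theta_sign_remove: "i \<in> I \<Longrightarrow> theta_sign j I = theta_sign j (I - {i}) + (if i < j then 1 else 0)"
  using theta_sign_insert[of i "I - {i}" j] by (simp add: insert_absorb)

text \<open>For \<open>i \<noteq> j\<close> contraction by one index and multiplication by the other
  anticommute, so these terms cancel. A diagonal term gives \<open>u i\<close>, and one more if
  \<open>i \<in> I\<close>: the derivative sees \<open>u i\<close> when \<open>i\<close> is first
  put into \<open>I\<close>, and \<open>u i + 1\<close> when \<open>t_i\<close> is multiplied in
  first.\<close>

lemma kc1_nc1:
  assumes "I \<subseteq> {..<m}"
  shows "kc1 m (nc1 m D) I u + nc1 m (kc1 m D) I u = of_nat (mdeg m u + card I) * D I u"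
proof -
  \<comment> \<open>\<open>X i j\<close> is the term of \<open>d_K \<nabla>\<close> with contraction
    index \<open>j\<close> and derivative index \<open>i\<close>; \<open>Z i j\<close> is the term
    of \<open>\<nabla> d_K\<close> with derivative index \<open>i\<close> and contraction index
    \<open>j\<close>.\<close>
  define X where "X i j = (if j \<notin> I \<and> 0 < u j then
     sgk (theta_sign j I) * nt D (insert j I) (u(j := u j - 1)) i else 0)" for i j
  define Z where "Z i j = (if i \<in> I then
     sgk (theta_sign i I) * (of_nat (Suc (u i)) * kt D (I - {i}) (u(i := Suc (u i))) j) else 0)" for i j
  have "kt (nc1 m D) I u j = (\<Sum>i<m. X i j)" for j
    unfolding X_def kt_def[of "nc1 m D"] by (simp add: nc1_def sum_distrib_left)
  then have 1: "kc1 m (nc1 m D) I u = (\<Sum>j<m. \<Sum>i<m. X i j)" by (simp add: kc1_def[of m "nc1 m D"])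
  have "nt (kc1 m D) I u i = (\<Sum>j<m. Z i j)" for i
    unfolding Z_def nt_def[of "kc1 m D"] by (simp add: kc1_def sum_distrib_left)
  then have 2: "nc1 m (kc1 m D) I u = (\<Sum>i<m. \<Sum>j<m. Z i j)" by (simp add: nc1_def[of m "kc1 m D"])
  have XZ: "X i j + Z i j = (if i = j then (of_nat (u i) + (if i \<in> I then 1 else 0)) * D I u else 0)" for i j
  proof (cases "i = j")
    case True
    show ?thesis
    proof (cases "i \<in> I")
      case i: True
      then have "theta_sign i (I - {i}) = theta_sign i I" using theta_sign_remove[OF i, of i] by simp
      then show ?thesis using True i by (simp add: X_def Z_def nt_def kt_def insert_absorb sgk_cancel add.commute)
    next
      case i: False
      have "theta_sign i (insert i I) = theta_sign i I" using theta_sign_insert[OF i, of i] by simp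
      then show ?thesis using True i by (cases "u i") (simp_all add: X_def Z_def nt_def kt_def sgk_cancel fun_upd_idem)
    qed
  next
    case False
    show ?thesis
    proof (cases "i \<in> I \<and> j \<notin> I \<and> 0 < u j")
      case True
      have s: "sgk (theta_sign j I) * sgk (theta_sign i (insert j I)) = - (sgk (theta_sign i I) * sgk (theta_sign j (I - {i})) :: 'a)"
      proof -
        have e: "theta_sign i (insert j I) = theta_sign i I + (if j < i then 1 else 0)"
          "theta_sign j I = theta_sign j (I - {i}) + (if i < j then 1 else 0)"
          using theta_sign_insert[of j I i] theta_sign_remove[of i I j] True by blast+
        have "j < i \<longleftrightarrow> \<not> i < j" using False by auto
        then show ?thesis unfolding e sgk_add by simp
      qed
      have "u(j := u j - 1, i := Suc (u i)) = u(i := Suc (u i), j := u j - 1)" using False by (simp add: fun_upd_twist)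
      moreover have "insert j I - {i} = insert j (I - {i})" using False by auto
      ultimately have "X i j = sgk (theta_sign j I) * sgk (theta_sign i (insert j I)) *
          (of_nat (Suc (u i)) * D (insert j (I - {i})) (u(i := Suc (u i), j := u j - 1)))"
        "Z i j = sgk (theta_sign i I) * sgk (theta_sign j (I - {i})) *
          (of_nat (Suc (u i)) * D (insert j (I - {i})) (u(i := Suc (u i), j := u j - 1)))"
        using True False by (simp_all add: X_def Z_def nt_def kt_def ac_simps)
      then show ?thesis using False s by simp
    qed (use False in \<open>auto simp: X_def Z_def nt_def kt_def\<close>)
  qed
  have "kc1 m (nc1 m D) I u + nc1 m (kc1 m D) I u = (\<Sum>i<m. \<Sum>j<m. X i j + Z i j)"
    unfolding 1 2 by (subst sum.swap) (simp add: sum.distrib)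
  also have "\<dots> = (\<Sum>i<m. (of_nat (u i) + (if i \<in> I then 1 else 0)) * D I u)" unfolding XZ by simp
  also have "\<dots> = (of_nat (mdeg m u) + (\<Sum>i<m. if i \<in> I then 1 else 0)) * D I u"
    by (simp add: sum_distrib_right[symmetric] sum.distrib mdeg_def)
  also have "(\<Sum>i<m. if i \<in> I then 1 else 0) = (of_nat (card I) :: 'a)"
    using assms by (simp add: sum.If_cases Int_absorb1)
  finally show ?thesis by simp
qed

text \<open>Flatness: the partial derivatives commute and the \<open>\<theta>_i\<close>
  anticommute.\<close>

lemma nc1_nc1: "nc1 m (nc1 m D) I u = 0"
proof -
  define Z where "Z i j = (if i \<in> I then sgk (theta_sign i I) * (of_nat (Suc (u i)) * nt D (I - {i}) (u(i := Suc (u i))) j) else 0)" for i j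
  have "nt (nc1 m D) I u i = (\<Sum>j<m. Z i j)" for i
    unfolding Z_def nt_def[of "nc1 m D"] by (simp add: nc1_def sum_distrib_left)
  then have "nc1 m (nc1 m D) I u = (\<Sum>i<m. \<Sum>j<m. Z i j)" by (simp add: nc1_def[of m "nc1 m D"])
  also have "\<dots> = 0"
  proof (rule sum_antisymmetric)
    show "Z i i = 0" for i by (simp add: Z_def nt_def)
    show "Z i j = - Z j i" for i j
    proof (cases "i \<in> I \<and> j \<in> I \<and> i \<noteq> j")
      case True
      then have s: "sgk (theta_sign i I) * sgk (theta_sign j (I - {i})) = - (sgk (theta_sign j I) * sgk (theta_sign i (I - {j})) :: 'a)"
      proof -
        have e: "theta_sign i I = theta_sign i (I - {j}) + (if j < i then 1 else 0)"
          "theta_sign j I = theta_sign j (I - {i}) + (if i < j then 1 else 0)"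
          using theta_sign_remove[of i I j] theta_sign_remove[of j I i] True by blast+
        have "j < i \<longleftrightarrow> \<not> i < j" using True by auto
        then show ?thesis unfolding e sgk_add by simp
      qed
      have "u(i := Suc (u i), j := Suc (u j)) = u(j := Suc (u j), i := Suc (u i))" using True by (simp add: fun_upd_twist)
      moreover have "I - {i} - {j} = I - {j} - {i}" by auto
      ultimately have "Z i j = (sgk (theta_sign i I) * sgk (theta_sign j (I - {i}))) *
          (of_nat (Suc (u i)) * of_nat (Suc (u j)) * D (I - {i} - {j}) (u(i := Suc (u i), j := Suc (u j))))"
        "Z j i = (sgk (theta_sign j I) * sgk (theta_sign i (I - {j}))) *
          (of_nat (Suc (u i)) * of_nat (Suc (u j)) * D (I - {i} - {j}) (u(i := Suc (u i), j := Suc (u j))))"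
        using True by (simp_all add: Z_def nt_def ac_simps del: of_nat_Suc)
      with s show ?thesis by simp
    qed (auto simp: Z_def nt_def)
  qed
  finally show ?thesis .
qed

section \<open>Coordinates on the completion\<close>

text \<open>With the finite basis \<open>B\<close> of \<open>J_V\<close> fixed, an element of the
  completion becomes an array of scalars indexed by \<open>B\<close> and by the exponents of
  \<open>t\<close>.\<close>

locale hat_coords = adic m V for m and V :: "'k::comm_ring_1 pol" +
  fixes \<sigma> :: "'k pol set \<Rightarrow> 'k hat" and B :: "'k pol set set" and q :: "rat \<Rightarrow> 'k"
  assumes qr: "quasi_regular (ky m) m (tseq V)"
    and B: "finite B" "is_basis type_ring (restrict_scalars const (jacobi_module YV m V)) B"
    and is_sec: "is_section m V \<sigma>"
    and q_hom: "q \<in> ring_hom type_ring type_ring"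
begin

lemma J_simps [simp]:
  "carrier J = cs (Suc 0) ` carrier R" "zero J = cs (Suc 0) 0" "add J = add (R Quot I)"
  "smult J = (\<lambda>p v. cs (Suc 0) p \<otimes>\<^bsub>R Quot I\<^esub> v)"
  using Q_simps(1,2)[of "Suc 0"] by (simp_all add: jacobi_module_def via_hom_def Ip_1 Let_def cs_def fun_eq_iff)

lemmas Q1 = Q_simps(4,5)[of _ _ "Suc 0", unfolded Ip_1]

lemma J_module: "module (ky m) J"
proof (rule moduleI[OF cring_pol_ring])
  show "abelian_group J"
  proof (rule abelian_groupI)
    fix x assume "x \<in> carrier J"
    then obtain p where p: "p \<in> carrier R" "x = cs (Suc 0) p" by auto
    then show "\<exists>y\<in>carrier J. y \<oplus>\<^bsub>J\<^esub> x = \<zero>\<^bsub>J\<^esub>"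
      by (intro bexI[of _ "cs (Suc 0) (- p)"]) (auto simp: Q1)
  qed (auto simp: Q1 ac_simps)
qed (auto simp: Q1 algebra_simps)

sublocale J: coeff_module m J
  by (simp add: coeff_module_def pol_module_def J_module)

lemma sigma: "const_linear J HM \<sigma>" and sigma_section: "r \<in> carrier J \<Longrightarrow> \<sigma> r (Suc 0) = r"
  using is_sec by (auto simp: is_section_def const_linear_def linear_map_def hat_quotient_def simp del: HM_simps J_simps)

definition Jsum where "Jsum c = (\<Oplus>\<^bsub>J\<^esub>b\<in>B. const (c b) \<odot>\<^bsub>J\<^esub> b)"

lemma B_carrier: "B \<subseteq> carrier J"
  using B(2) by (simp add: is_basis_def)

lemma J_coords: assumes "r \<in> carrier J" shows "\<exists>!c. (\<forall>b. b \<notin> B \<longrightarrow> c b = 0) \<and> r = Jsum c"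
proof -
  have "\<exists>!c. basis_expansion type_ring (restrict_scalars const J) B r c"
    using B(2) assms unfolding is_basis_def restrict_scalars_simps by blast
  moreover have "basis_expansion type_ring (restrict_scalars const J) B r c \<longleftrightarrow> (\<forall>b. b \<notin> B \<longrightarrow> c b = 0) \<and> r = Jsum c" for c
    unfolding basis_expansion_finite[OF module_restrict_scalars[OF J_module] B(1), simplified, OF B_carrier[simplified]]
    by (simp add: Jsum_def finsum_restrict_scalars)
  ultimately show ?thesis by simp
qed

lemma Jsum_term: "b \<in> B \<Longrightarrow> const a \<odot>\<^bsub>J\<^esub> b \<in> carrier J"
  using B_carrier by (intro J.smult_closed) auto

lemma Jsum_closed: "Jsum c \<in> carrier J"
  unfolding Jsum_def by (rule J.M.finsum_closed) (use Jsum_term in auto)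

text \<open>A polynomial representing \<open>\<sigma> b\<close> modulo \<open>I^N\<close>.
  Representatives at different levels are chosen independently and agree modulo the smaller power,
  see \<open>s_stab\<close>.\<close>

definition s where "s N b = (SOME p. apx N (\<sigma> b) p)"

lemma sigma_closed: "r \<in> carrier J \<Longrightarrow> \<sigma> r \<in> carrier HR"
  using const_linearD(1)[OF sigma] by simp

lemma s: assumes "b \<in> B" shows "apx N (\<sigma> b) (s N b)"
  using sigma_closed[of b] B_carrier assms hat_carrier unfolding s_def by (metis someI_ex subsetD)

lemma s_closed [simp]: "b \<in> B \<Longrightarrow> s N b \<in> carrier R"
  using s apx_closed by blast

lemma s_stab: "b \<in> B \<Longrightarrow> N \<le> N' \<Longrightarrow> s N' b - s N b \<in> Ip N"
  using apx_level[OF apx_le[OF s[of b N']] s[of b N]] by blast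

lemma sigma_Jsum: "apx N (\<sigma> (Jsum c)) (\<Sum>b\<in>B. const (c b) * s N b)"
proof -
  have "\<sigma> (Jsum c) = (\<Oplus>\<^bsub>HM\<^esub>b\<in>B. \<sigma> (const (c b) \<odot>\<^bsub>J\<^esub> b))"
    unfolding Jsum_def
    by (rule finsum_additive[OF J.M.abelian_monoid_axioms HM.M.abelian_monoid_axioms])
      (use const_linearD[OF sigma] const_linear_zero[OF J_module HM_module sigma] Jsum_term in auto)
  also have "\<dots> = (\<Oplus>\<^bsub>HR\<^esub>b\<in>B. const (c b) \<odot>\<^bsub>HM\<^esub> \<sigma> b)" (is "_ = ?e")
    unfolding HM_finsum
  proof (rule HR.finsum_cong')
    show "\<sigma> (const (c b) \<odot>\<^bsub>J\<^esub> b) = const (c b) \<odot>\<^bsub>HM\<^esub> \<sigma> b" if "b \<in> B" for b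
      by (rule const_linearD(3)[OF sigma]) (use B_carrier that in blast)
    show "(\<lambda>b. const (c b) \<odot>\<^bsub>HM\<^esub> \<sigma> b) \<in> B \<rightarrow> carrier HR"
      using HM.smult_closed[of "const _" "\<sigma> _"] sigma_closed B_carrier by (auto simp del: J_simps)
  qed simp
  finally have e: "\<sigma> (Jsum c) = ?e" .
  show ?thesis unfolding e
  proof (rule apx_sum)
    show "apx N (const (c b) \<odot>\<^bsub>HM\<^esub> \<sigma> b) (const (c b) * s N b)" if "b \<in> B" for b
      by (rule apx_smult[OF _ s[OF that]]) simp
    show "const (c b) \<odot>\<^bsub>HM\<^esub> \<sigma> b \<in> carrier HR" if "b \<in> B" for b
      using HM.smult_closed[of "const (c b)" "\<sigma> b"] sigma_closed B_carrier that by (auto simp del: J_simps)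
  qed
qed

lemma Jsum_cs: "0 < N \<Longrightarrow> Jsum c = cs (Suc 0) (\<Sum>b\<in>B. const (c b) * s N b)"
  using sigma_section[OF Jsum_closed] apxD[OF sigma_Jsum, of "Suc 0" N c] by simp

lemma Jsum_zero: "Jsum (\<lambda>_. 0) = \<zero>\<^bsub>J\<^esub>"
  using Jsum_cs[of 1 "\<lambda>_. 0"] by simp

text \<open>Normalises the arrays outside the meaningful indices, without which coordinates could
  not be unique.\<close>

definition supp :: "('k pol set \<Rightarrow> (nat \<Rightarrow> nat) \<Rightarrow> 'k) \<Rightarrow> bool" where
  "supp c \<longleftrightarrow> (\<forall>b u. b \<notin> B \<or> u \<notin> mindex m \<longrightarrow> c b u = 0)"

abbreviation "lowdeg N \<equiv> {u \<in> mindex m. mdeg m u < N}"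

text \<open>\<open>w N c u\<close> represents the coefficient of \<open>t^u\<close> modulo
  \<open>I^N\<close>, and \<open>pl N c\<close> is the partial sum of degree less than
  \<open>N\<close>, which determines the series modulo \<open>I^N\<close>.\<close>

definition w where "w N c u = (\<Sum>b\<in>B. const (c b u) * s N b)"
definition pl where "pl N c = (\<Sum>u\<in>lowdeg N. w N c u * T u)"
text \<open>\<open>Psi c\<close> is the series \<open>\<Sum>\<^sub>u \<sigma> (\<Sum>\<^sub>b c b u b) t\<^sup>u\<close>, with \<open>b\<close> running through the basis \<open>B\<close> of \<open>J\<^sub>V\<close>.\<close>

definition Psi where "Psi c = (\<lambda>N. cs N (pl N c))"

lemma w_closed [simp]: "w N c u \<in> carrier R" by (simp add: w_def)
lemma pl_closed [simp]: "pl N c \<in> carrier R" by (simp add: pl_def)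

lemma w_stab: "N \<le> N' \<Longrightarrow> w N' c u - w N c u \<in> Ip N"
  unfolding w_def sum_subtractf[symmetric] right_diff_distrib[symmetric]
  by (intro Ip_sum Ip_simps(3) s_stab) auto

lemma term_Ip: assumes "u \<in> mindex m" "N \<le> mdeg m u" "p \<in> carrier R" shows "p * T u \<in> Ip N"
  using T_Ip[OF assms(1)] Ip_mono[OF assms(2)] assms(3) by (intro Ip_simps(3)) auto

lemma sum_lowdeg_Ip:
  assumes "N \<le> M" "\<And>u. P u \<in> carrier R" shows "(\<Sum>u\<in>lowdeg M. P u * T u) - (\<Sum>u\<in>lowdeg N. P u * T u) \<in> Ip N"
proof -
  have "lowdeg M = lowdeg N \<union> (lowdeg M - lowdeg N)" using assms(1) by auto
  then have "(\<Sum>u\<in>lowdeg M. P u * T u) = (\<Sum>u\<in>lowdeg N. P u * T u) + (\<Sum>u\<in>lowdeg M - lowdeg N. P u * T u)"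
    using finite_mindex_less[of m M] finite_mindex_less[of m N] by (metis (no_types, lifting) Diff_disjoint finite_Diff sum.union_disjoint)
  moreover have "(\<Sum>u\<in>lowdeg M - lowdeg N. P u * T u) \<in> Ip N"
    by (rule Ip_sum) (use assms(2) in \<open>auto intro!: term_Ip\<close>)
  ultimately show ?thesis by simp
qed

text \<open>Raising the level adds terms of degree at least \<open>N\<close> and changes the
  representatives of the \<open>\<sigma> b\<close>; both errors lie in \<open>I^N\<close>.\<close>

lemma pl_stab: assumes "N \<le> N'" shows "pl N' c - pl N c \<in> Ip N"
proof -
  have "(\<Sum>u\<in>lowdeg N'. w N' c u * T u) - (\<Sum>u\<in>lowdeg N. w N' c u * T u) \<in> Ip N"
    by (rule sum_lowdeg_Ip[OF assms]) simp
  moreover have "(\<Sum>u\<in>lowdeg N. w N' c u * T u) - (\<Sum>u\<in>lowdeg N. w N c u * T u) \<in> Ip N"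
    unfolding sum_subtractf[symmetric] left_diff_distrib[symmetric]
    by (intro Ip_sum Ip_simps(7) w_stab assms) simp
  ultimately show ?thesis unfolding pl_def using Ip_simps(2) by fastforce
qed

lemma Psi_apx: "apx N (Psi c) (pl N c)"
  unfolding apx_def Psi_def using pl_stab cs_eq[OF pl_closed pl_closed] by (auto, metis)

lemma Psi_closed: "Psi c \<in> carrier HR"
  using Psi_apx hat_carrier by blast

lemma Psi_eqI: "a \<in> carrier HR \<Longrightarrow> (\<And>N. \<exists>p. apx N a p \<and> p - pl N c \<in> Ip N) \<Longrightarrow> a = Psi c"
  by (rule hat_eqI) (use Psi_apx in blast)

lemma Psi_add: "Psi (\<lambda>b u. c b u + d b u) = Psi c \<oplus>\<^bsub>HR\<^esub> Psi d"
  by (rule apx_eq[OF Psi_apx apx_add[OF Psi_apx Psi_apx]])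
    (simp add: pl_def w_def distrib_right sum.distrib)

lemma Psi_smult: "Psi (\<lambda>b u. a * c b u) = const a \<odot>\<^bsub>HM\<^esub> Psi c"
  by (rule apx_eq[OF Psi_apx apx_smult[OF pol_ring_closed(6) Psi_apx]])
    (simp add: pl_def w_def sum_distrib_left sum_distrib_right mult.assoc)

lemma Psi_zero: "Psi (\<lambda>b u. 0) = \<zero>\<^bsub>HR\<^esub>"
  by (rule apx_eq[OF Psi_apx apx_zero]) (simp add: pl_def w_def)

lemma Psi_uminus: "Psi (\<lambda>b u. - c b u) = \<ominus>\<^bsub>HR\<^esub> Psi c"
  by (rule apx_eq[OF Psi_apx apx_uminus[OF Psi_apx Psi_closed]]) (simp add: pl_def w_def sum_negf)

lemma Psi_sum: "Psi (\<lambda>b u. \<Sum>i\<in>A. c i b u) = (\<Oplus>\<^bsub>HR\<^esub>i\<in>A. Psi (c i))"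
proof (induction A rule: infinite_finite_induct)
  case (insert i F)
  then show ?case by (simp add: Psi_add HR.finsum_insert Psi_closed Pi_def)
qed (simp_all add: Psi_zero HR.finsum_infinite)

lemma Psi_sgk: "Psi (\<lambda>b u. sgk r * c b u) = signed HR r (Psi c)"
  by (cases r) (simp_all add: signed_def Psi_uminus)

lemma qr_coeff:
  assumes "\<And>u. c u \<in> carrier R" "(\<Sum>u\<in>{u \<in> mindex m. mdeg m u = N}. c u * T u) \<in> Ip (Suc N)" "u \<in> mindex m" "mdeg m u = N"
  shows "c u \<in> I"
proof -
  let ?E = "{u \<in> mindex m. mdeg m u = N}"
  have I: "Idl\<^bsub>R\<^esub> (t ` {..<m}) = I" by (simp only: jacobi_ideal_def)
  have "(\<Oplus>\<^bsub>R\<^esub>u\<in>?E. c u \<otimes>\<^bsub>R\<^esub> mpower R m t u) = (\<Sum>u\<in>?E. c u * T u)"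
    by (subst finsum_pol_ring) (auto simp: mpower_T assms(1))
  then have "(\<forall>u. c u \<in> carrier R) \<and> (\<Oplus>\<^bsub>R\<^esub>u\<in>?E. c u \<otimes>\<^bsub>R\<^esub> mpower R m t u) \<in> ideal_pow R I (Suc N)"
    using assms(1,2) by (simp only: Ip_def simp_thms)
  with qr[unfolded quasi_regular_def Let_def I, THEN spec[of _ N], THEN spec[of _ c]] have "\<forall>u\<in>?E. c u \<in> I"
    by (rule mp)
  then show ?thesis using assms(3,4) by blast
qed

text \<open>Induction on the degree. If all coefficients below degree \<open>N\<close> vanish, the
  part of degree \<open>N\<close> lies in \<open>I^(N+1)\<close>. Quasi-regularity puts its
  coefficients into \<open>I\<close>, so they vanish in \<open>J_V\<close>, and the basis makes the
  scalars zero.\<close>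

lemma Psi_inj_zero:
  assumes "supp c" "Psi c = \<zero>\<^bsub>HR\<^esub>" shows "c = (\<lambda>_ _. 0)"
proof -
  have *: "\<forall>b. c b u = 0" if "mdeg m u < N" for u N
    using that
  proof (induction N arbitrary: u)
    case (Suc N)
    show ?case
    proof (cases "u \<in> mindex m")
      case u: True
      show ?thesis
      proof (cases "mdeg m u = N")
        case True
        let ?E = "{u \<in> mindex m. mdeg m u = N}"
        have "pl (Suc N) c = (\<Sum>u\<in>?E. w (Suc N) c u * T u)"
          unfolding pl_def
        proof (intro sum.mono_neutral_right ballI)
          fix v assume v: "v \<in> lowdeg (Suc N) - ?E"
          then have "mdeg m v < N" by auto
          then show "w (Suc N) c v * T v = 0" using Suc.IH by (simp add: w_def const_simps)
        qed (use finite_mindex_less[of m "Suc N"] in auto)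
        moreover have "pl (Suc N) c \<in> Ip (Suc N)"
          using apx_level[OF Psi_apx[of "Suc N" c] apx_zero[of "Suc N"]] assms(2) by simp
        ultimately have "(\<Sum>u\<in>?E. w (Suc N) c u * T u) \<in> Ip (Suc N)" by (simp only:)
        from qr_coeff[OF w_closed this u True] have "w (Suc N) c u \<in> Ip (Suc 0)" unfolding Ip_1 .
        then have "Jsum (\<lambda>b. c b u) = \<zero>\<^bsub>J\<^esub>"
          using Jsum_cs[of "Suc N" "\<lambda>b. c b u"] cs_eq[of "w (Suc N) c u" 0 "Suc 0"] by (simp add: w_def[symmetric])
        then have "(\<lambda>b. c b u) = (\<lambda>_. 0)"
          using J_coords[OF J.M.zero_closed] Jsum_zero assms(1) unfolding supp_def by metis
        then show ?thesis by metis
      qed (use Suc in auto)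
    qed (use assms(1) in \<open>auto simp: supp_def\<close>)
  qed simp
  then show ?thesis by (intro ext) blast
qed

lemma supp_minus: "supp c \<Longrightarrow> supp d \<Longrightarrow> supp (\<lambda>b u. c b u + - d b u)"
  by (simp add: supp_def)

lemma Psi_inj: assumes "supp c" "supp d" "Psi c = Psi d" shows "c = d"
proof -
  have "Psi (\<lambda>b u. c b u + - d b u) = \<zero>\<^bsub>HR\<^esub>"
    unfolding Psi_add Psi_uminus assms(3) using Psi_closed by (simp add: HR.r_neg)
  from Psi_inj_zero[OF supp_minus[OF assms(1,2)] this] show ?thesis
    by (intro ext) (metis add.right_inverse add_right_cancel)
qed

text \<open>The level is a successor because level \<open>0\<close> carries no information about the
  class modulo \<open>I\<close>.\<close>

lemma poly_coords: assumes "p \<in> carrier R" shows "\<exists>c. (\<forall>b. b \<notin> B \<longrightarrow> c b = 0) \<and> p - (\<Sum>b\<in>B. const (c b) * s (Suc N) b) \<in> Ip (Suc 0)"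
proof -
  obtain c where c: "\<forall>b. b \<notin> B \<longrightarrow> c b = 0" "cs (Suc 0) p = Jsum c"
    using J_coords[of "cs (Suc 0) p"] assms by auto
  then show ?thesis using Jsum_cs[of "Suc N" c] cs_eq[OF assms, of "\<Sum>b\<in>B. const (c b) * s (Suc N) b" "Suc 0"] by auto
qed

text \<open>Successive approximation. What is missing at stage \<open>N\<close> lies in
  \<open>I^N\<close>, hence is a combination of monomials of degree \<open>N\<close>; its
  coefficients are expanded in \<open>B\<close> modulo \<open>I\<close>, and the new error lies in
  \<open>I^(N+1)\<close>.\<close>

lemma Psi_surj: assumes h: "h \<in> carrier HR" shows "\<exists>c. supp c \<and> h = Psi c"
proof -
  let ?Q = "\<lambda>N c. supp c \<and> (\<exists>p. apx N h p \<and> p - pl N c \<in> Ip N)"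
  \<comment> \<open>Each stage depends on the array chosen before and must not change it in lower
    degrees.\<close>
  have "\<exists>f. \<forall>N. ?Q N (f N) \<and> (\<forall>b u. mdeg m u < N \<longrightarrow> f (Suc N) b u = f N b u)"
  proof (rule dependent_nat_choice)
    obtain p where "apx 0 h p" using apx_ex[OF h] by blast
    then show "\<exists>c. ?Q 0 c" by (intro exI[of _ "\<lambda>_ _. 0"]) (auto simp: supp_def Ip_0 pl_def dest: apx_closed)
  next
    fix c N assume c: "?Q N c"
    then obtain p where p: "apx N h p" "p - pl N c \<in> Ip N" by blast
    obtain r where r: "apx (Suc N) h r" using apx_ex[OF h] by blast
    let ?E = "{u \<in> mindex m. mdeg m u = N}"
    let ?S = "\<Sum>u\<in>lowdeg N. w (Suc N) c u * T u"
    have "r - p \<in> Ip N" using apx_level[OF apx_le[OF r] p(1)] by simp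
    moreover have "?S - pl N c \<in> Ip N"
      unfolding pl_def sum_subtractf[symmetric] left_diff_distrib[symmetric]
      by (intro Ip_sum Ip_simps(7) w_stab) auto
    ultimately have "(r - p) + (p - pl N c) - (?S - pl N c) \<in> Ip N" using p(2)
      by (intro Ip_simps(6)[OF Ip_simps(2)])
    then have "r - ?S \<in> Ip N" by simp
    from Ip_elements[OF this] obtain d where d: "\<forall>u. d u \<in> carrier R" "r - ?S = (\<Sum>u\<in>?E. d u * T u)"
      by (elim exE conjE)
    have "\<forall>u. \<exists>c. (\<forall>b. b \<notin> B \<longrightarrow> c b = 0) \<and> d u - (\<Sum>b\<in>B. const (c b) * s (Suc N) b) \<in> Ip (Suc 0)"
      using d(1) by (intro allI poly_coords) (elim allE)
    from choice[OF this] obtain e where "\<forall>u. (\<forall>b. b \<notin> B \<longrightarrow> e u b = 0) \<and> d u - (\<Sum>b\<in>B. const (e u b) * s (Suc N) b) \<in> Ip (Suc 0)"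
      by (elim exE)
    then have e: "\<And>u b. b \<notin> B \<Longrightarrow> e u b = 0" "\<And>u. d u - (\<Sum>b\<in>B. const (e u b) * s (Suc N) b) \<in> Ip (Suc 0)"
      by (simp_all only: simp_thms)
    \<comment> \<open>Only degree \<open>N\<close> is filled in; higher degrees are reset to zero to
      keep the array explicit.\<close>
    define c' where "c' = (\<lambda>b u. if u \<in> ?E then e u b else if mdeg m u < N then c b u else 0)"
    have "lowdeg (Suc N) = lowdeg N \<union> ?E" by auto
    then have "pl (Suc N) c' = (\<Sum>u\<in>lowdeg N. w (Suc N) c' u * T u) + (\<Sum>u\<in>?E. w (Suc N) c' u * T u)"
      unfolding pl_def using finite_mindex_less[of m N] finite_mindex_eq[of m N] by (simp, intro sum.union_disjoint) auto
    also have "(\<Sum>u\<in>lowdeg N. w (Suc N) c' u * T u) = ?S" by (intro sum.cong) (auto simp: w_def c'_def)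
    also have "(\<Sum>u\<in>?E. w (Suc N) c' u * T u) = (\<Sum>u\<in>?E. (\<Sum>b\<in>B. const (e u b) * s (Suc N) b) * T u)"
      by (intro sum.cong) (auto simp: w_def c'_def)
    finally have diff: "r - pl (Suc N) c' = (\<Sum>u\<in>?E. (d u - (\<Sum>b\<in>B. const (e u b) * s (Suc N) b)) * T u)"
      using d(2) by (simp add: left_diff_distrib sum_subtractf algebra_simps)
    have "(d u - (\<Sum>b\<in>B. const (e u b) * s (Suc N) b)) * T u \<in> Ip (Suc N)" if "u \<in> ?E" for u
      by (rule ideal_prod_Ip) (use e(2)[of u] T_Ip[of u] that in \<open>auto simp: Ip_1\<close>)
    then have "r - pl (Suc N) c' \<in> Ip (Suc N)" unfolding diff by (rule Ip_sum)
    moreover have "supp c'" using c e(1) by (auto simp: supp_def c'_def)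
    ultimately show "\<exists>c'. ?Q (Suc N) c' \<and> (\<forall>b u. mdeg m u < N \<longrightarrow> c' b u = c b u)"
      using r by (intro exI[of _ c']) (auto simp: c'_def)
  qed
  then obtain f where f: "\<And>N. ?Q N (f N)" "\<And>N b u. mdeg m u < N \<Longrightarrow> f (Suc N) b u = f N b u" by blast
  have f': "f N b u = f (Suc (mdeg m u)) b u" if "mdeg m u < N" for N b u
    using that
  proof (induction N)
    case (Suc N)
    then show ?case by (cases "mdeg m u < N") (simp_all add: f(2) less_Suc_eq)
  qed simp
  \<comment> \<open>The entry at \<open>u\<close> no longer changes from stage
    \<open>mdeg m u + 1\<close> on.\<close>
  define c where "c = (\<lambda>b u. f (Suc (mdeg m u)) b u)"
  have "supp c" using f(1) by (auto simp: supp_def c_def)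
  moreover have "h = Psi c"
  proof (rule Psi_eqI[OF h])
    fix N
    have "w N c u = w N (f N) u" if "mdeg m u < N" for u unfolding w_def c_def f'[OF that] ..
    then have "pl N c = pl N (f N)" unfolding pl_def by (intro sum.cong) simp_all
    then show "\<exists>p. apx N h p \<and> p - pl N c \<in> Ip N" using f(1)[of N] by (simp only: simp_thms)
  qed
  ultimately show ?thesis by blast
qed

end

section \<open>Series, derivatives and multiplication by \<open>t_i\<close> in coordinates\<close>

lemma mindex_upd_iff: "i < m \<Longrightarrow> u(i := j) \<in> mindex m \<longleftrightarrow> u \<in> mindex m"
  by (auto simp: mindex_def)

lemma mindex_zero: "(\<lambda>_. 0) \<in> mindex m"
  by (simp add: mindex_def)

context hat_coords
begin

text \<open>The threshold \<open>Suc N\<close> leaves room for differentiation: the derivative of a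
  partial sum of degree below \<open>M\<close> covers only degrees below
  \<open>M - 1\<close>.\<close>

lemma has_seriesI:
  assumes F: "\<And>N u. apx N (F u) (P N u)" and h: "\<And>N. apx N h (p N)"
    and d: "\<And>N M. Suc N \<le> M \<Longrightarrow> (\<Sum>u\<in>lowdeg M. P N u) - p N \<in> Ip N"
  shows "has_series m V F h"
  unfolding has_series_def
proof (intro conjI allI exI impI)
  show "h \<in> carrier HR" using h hat_carrier by blast
  fix N M assume M: "Suc N \<le> M"
  have Fc: "F u \<in> carrier HR" for u using F hat_carrier by blast
  have "apx N (\<Oplus>\<^bsub>HR\<^esub>u\<in>lowdeg M. F u) (\<Sum>u\<in>lowdeg M. P N u)" by (rule apx_sum[OF F Fc])
  from apx_level[OF this h] d[OF M] show "(\<Oplus>\<^bsub>HR\<^esub>u\<in>lowdeg M. F u) N = h N" by simp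
qed

lemma has_series_unique: assumes "has_series m V F h" "has_series m V F h'" shows "h = h'"
proof
  fix N
  obtain M0 where "\<forall>M\<ge>M0. (\<Oplus>\<^bsub>HR\<^esub>u\<in>lowdeg M. F u) N = h N" using assms(1) by (auto simp: has_series_def)
  moreover obtain M1 where "\<forall>M\<ge>M1. (\<Oplus>\<^bsub>HR\<^esub>u\<in>lowdeg M. F u) N = h' N" using assms(2) by (auto simp: has_series_def)
  ultimately show "h N = h' N" by (metis max.cobounded1 max.cobounded2)
qed

lemma has_series_Psi: "has_series m V (\<lambda>u. \<sigma> (Jsum (\<lambda>b. c b u)) \<otimes>\<^bsub>HR\<^esub> t_power m V u) (Psi c)"
proof (rule has_seriesI[OF apx_mult[OF sigma_Jsum t_power_apx] Psi_apx])
  show "(\<Sum>u\<in>lowdeg M. (\<Sum>b\<in>B. const (c b u) * s N b) * T u) - pl N c \<in> Ip N" if "Suc N \<le> M" for N M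
    unfolding pl_def w_def by (rule sum_lowdeg_Ip) (use that in auto)
qed

lemma supp_Jsum_out: "supp c \<Longrightarrow> u \<notin> mindex m \<Longrightarrow> Jsum (\<lambda>b. c b u) = \<zero>\<^bsub>J\<^esub>"
  using Jsum_zero by (simp only: supp_def simp_thms)

text \<open>A competing family of coefficients in \<open>J_V\<close> is expanded in
  \<open>B\<close>; it then has the same series, and injectivity of \<open>Psi\<close> identifies
  the arrays.\<close>

lemma t_coeffs_Psi: assumes c: "supp c" shows "t_coeffs m V \<sigma> (Psi c) = (\<lambda>u. Jsum (\<lambda>b. c b u))"
  unfolding t_coeffs_def
proof (rule the_equality)
  show "(\<forall>u\<in>mindex m. Jsum (\<lambda>b. c b u) \<in> carrier J) \<and> (\<forall>u. u \<notin> mindex m \<longrightarrow> Jsum (\<lambda>b. c b u) = \<zero>\<^bsub>J\<^esub>) \<and>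
      has_series m V (\<lambda>u. \<sigma> (Jsum (\<lambda>b. c b u)) \<otimes>\<^bsub>HR\<^esub> t_power m V u) (Psi c)"
    using Jsum_closed supp_Jsum_out[OF c] has_series_Psi by blast
  fix r assume r: "(\<forall>u\<in>mindex m. r u \<in> carrier J) \<and> (\<forall>u. u \<notin> mindex m \<longrightarrow> r u = \<zero>\<^bsub>J\<^esub>) \<and>
      has_series m V (\<lambda>u. \<sigma> (r u) \<otimes>\<^bsub>HR\<^esub> t_power m V u) (Psi c)"
  have "\<forall>u. \<exists>d. (\<forall>b. b \<notin> B \<longrightarrow> d b = 0) \<and> (u \<in> mindex m \<longrightarrow> r u = Jsum d)"
  proof
    fix u show "\<exists>d. (\<forall>b. b \<notin> B \<longrightarrow> d b = 0) \<and> (u \<in> mindex m \<longrightarrow> r u = Jsum d)"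
    proof (cases "u \<in> mindex m")
      case True
      then have "r u \<in> carrier J" using r by blast
      from ex1_implies_ex[OF J_coords[OF this]] show ?thesis by (simp only: True simp_thms)
    qed (auto intro!: exI[of _ "\<lambda>_. 0"])
  qed
  from choice[OF this] obtain d where d: "\<forall>u. (\<forall>b. b \<notin> B \<longrightarrow> d u b = 0) \<and> (u \<in> mindex m \<longrightarrow> r u = Jsum (d u))"
    by (elim exE)
  define c' where "c' b u = (if u \<in> mindex m then d u b else 0)" for b u
  have c': "supp c'" using d by (simp add: supp_def c'_def)
  have rc: "r = (\<lambda>u. Jsum (\<lambda>b. c' b u))"
  proof
    fix u show "r u = Jsum (\<lambda>b. c' b u)"
    proof (cases "u \<in> mindex m")
      case True
      then show ?thesis using d by (simp add: c'_def)
    next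
      case False
      then show ?thesis using r Jsum_zero by (simp add: c'_def)
    qed
  qed
  then have "Psi c = Psi c'" using r has_series_unique[OF _ has_series_Psi[of c']] by blast
  then have "c = c'" by (rule Psi_inj[OF c c'])
  then show "r = (\<lambda>u. Jsum (\<lambda>b. c b u))" using rc by simp
qed

text \<open>Shifting by the \<open>i\<close>-th unit vector is injective and misses only exponents
  with \<open>u i = 0\<close>. It serves both the derivative and the product with
  \<open>t_i\<close>, which move degrees in opposite directions.\<close>

lemma sum_lowdeg_reindex:
  assumes i: "i < m" and z: "\<And>u. u i = 0 \<Longrightarrow> f u = 0"
  shows "(\<Sum>u\<in>lowdeg (Suc M). f u) = (\<Sum>v\<in>lowdeg M. f (v(i := Suc (v i))))"
proof -
  let ?s = "\<lambda>v :: nat \<Rightarrow> nat. v(i := Suc (v i))"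
  have inj: "inj_on ?s X" for X
  proof (rule inj_onI)
    fix x y :: "nat \<Rightarrow> nat" assume e: "?s x = ?s y"
    show "x = y"
    proof
      fix j show "x j = y j" using fun_cong[OF e, of j] by (cases "j = i") auto
    qed
  qed
  have sub: "?s ` lowdeg M \<subseteq> lowdeg (Suc M)"
  proof (rule image_subsetI)
    fix v assume "v \<in> lowdeg M"
    then show "?s v \<in> lowdeg (Suc M)" using i mdeg_upd[OF i, of v "Suc (v i)"] by (simp add: mindex_upd)
  qed
  have "f u = 0" if "u \<in> lowdeg (Suc M) - ?s ` lowdeg M" for u
  proof (rule z, rule ccontr)
    assume u: "u i \<noteq> 0"
    let ?v = "u(i := u i - 1)"
    have u': "u \<in> mindex m" "mdeg m u < Suc M" using that by auto
    then have "mdeg m ?v < M" using u mdeg_upd[OF i, of u "u i - 1"] by linarith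
    then have "?v \<in> lowdeg M" using mindex_upd[OF i u'(1)] by simp
    moreover have "u = ?s ?v" using u by simp
    ultimately show False using that by blast
  qed
  then have "(\<Sum>u\<in>lowdeg (Suc M). f u) = (\<Sum>u\<in>?s ` lowdeg M. f u)"
    by (intro sum.mono_neutral_right[OF finite_mindex_less sub] ballI)
  also have "\<dots> = (\<Sum>v\<in>lowdeg M. f (?s v))" by (simp add: sum.reindex[OF inj])
  finally show ?thesis .
qed

lemma apx_add_pow: assumes "apx N a p" "a \<in> carrier HR" shows "apx N ([k] \<cdot>\<^bsub>HR\<^esub> a) (of_nat k * p)"
proof (induction k)
  case (Suc k)
  show ?case using apx_add[OF Suc assms(1)] assms(2) by (simp add: HR.add.nat_pow_Suc distrib_right add.commute)
qed (simp add: apx_zero)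

lemma const_of_nat: "const (of_nat k) = (of_nat k :: 'k pol)"
  by (induction k) (simp_all add: const_simps)

lemma t_deriv_Psi:
  assumes i: "i < m" and c: "supp c"
  shows "t_deriv m V \<sigma> i (Psi c) = Psi (\<lambda>b u. of_nat (Suc (u i)) * c b (u(i := Suc (u i))))" (is "_ = Psi ?d")
proof -
  let ?F = "\<lambda>u. [u i] \<cdot>\<^bsub>HR\<^esub> (\<sigma> (Jsum (\<lambda>b. c b u)) \<otimes>\<^bsub>HR\<^esub> t_power m V (u(i := u i - 1)))"
  let ?P = "\<lambda>N u. of_nat (u i) * (w N c u * T (u(i := u i - 1)))"
  have a: "apx N (\<sigma> (Jsum (\<lambda>b. c b u)) \<otimes>\<^bsub>HR\<^esub> t_power m V (u(i := u i - 1))) (w N c u * T (u(i := u i - 1)))" for N u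
    unfolding w_def by (rule apx_mult[OF sigma_Jsum t_power_apx])
  then have F: "apx N (?F u) (?P N u)" for N u using hat_carrier by (intro apx_add_pow[OF a]) blast
  have "has_series m V ?F (Psi ?d)"
  proof (rule has_seriesI[OF F Psi_apx])
    fix N M :: nat assume "Suc N \<le> M"
    \<comment> \<open>The derivative lowers degrees by one, so a bound \<open>M\<close> on the
      series becomes the bound \<open>M - 1\<close> on its derivative.\<close>
    then obtain M' where M: "M = Suc M'" "N \<le> M'" by (cases M) auto
    have "(\<Sum>u\<in>lowdeg M. ?P N u) = (\<Sum>v\<in>lowdeg M'. ?P N (v(i := Suc (v i))))"
      unfolding M(1) by (rule sum_lowdeg_reindex[OF i]) simp
    also have "\<dots> = (\<Sum>v\<in>lowdeg M'. w N ?d v * T v)"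
    proof (rule sum.cong[OF refl])
      fix v :: "nat \<Rightarrow> nat"
      have "w N ?d v = of_nat (Suc (v i)) * w N c (v(i := Suc (v i)))"
        by (simp add: w_def const_simps const_of_nat sum_distrib_left mult.assoc del: of_nat_Suc)
      then show "?P N (v(i := Suc (v i))) = w N ?d v * T v" by (simp add: mult.assoc)
    qed
    finally show "(\<Sum>u\<in>lowdeg M. ?P N u) - pl N ?d \<in> Ip N"
      using sum_lowdeg_Ip[OF M(2), of "w N ?d"] by (simp add: pl_def)
  qed
  then show ?thesis unfolding t_deriv_def t_coeffs_Psi[OF c]
    by (intro the_equality has_series_unique[of ?F])
qed

lemma t_smult_Psi:
  assumes i: "i < m"
  shows "t i \<odot>\<^bsub>HM\<^esub> Psi c = Psi (\<lambda>b u. if 0 < u i then c b (u(i := u i - 1)) else 0)" (is "_ = Psi ?d")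
proof (rule Psi_eqI)
  have a: "apx N (t i \<odot>\<^bsub>HM\<^esub> Psi c) (t i * pl N c)" for N by (rule apx_smult[OF t_closed Psi_apx])
  then show "t i \<odot>\<^bsub>HM\<^esub> Psi c \<in> carrier HR" using hat_carrier by blast
  fix N
  have "(\<Sum>u\<in>lowdeg (Suc N). w N ?d u * T u) = (\<Sum>v\<in>lowdeg N. w N ?d (v(i := Suc (v i))) * T (v(i := Suc (v i))))"
    by (rule sum_lowdeg_reindex[OF i]) (simp add: w_def const_simps)
  also have "\<dots> = t i * pl N c"
    unfolding pl_def sum_distrib_left by (rule sum.cong[OF refl]) (simp add: w_def T_upd[OF i] ac_simps)
  finally show "\<exists>p. apx N (t i \<odot>\<^bsub>HM\<^esub> Psi c) p \<and> p - pl N ?d \<in> Ip N"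
    using a sum_lowdeg_Ip[of N "Suc N" "w N ?d"] by (intro exI[of _ "t i * pl N c"]) (simp add: pl_def[of N ?d])
qed

lemma sigma_Psi: "\<sigma> (Jsum d) = Psi (\<lambda>b u. if u = (\<lambda>_. 0) then d b else 0)" (is "_ = Psi ?d")
proof (rule Psi_eqI[OF sigma_closed[OF Jsum_closed]])
  fix N
  show "\<exists>p. apx N (\<sigma> (Jsum d)) p \<and> p - pl N ?d \<in> Ip N"
  proof (intro exI conjI, rule sigma_Jsum)
    show "(\<Sum>b\<in>B. const (d b) * s N b) - pl N ?d \<in> Ip N"
    \<comment> \<open>At level \<open>0\<close> the partial sum is empty, but modulo
      \<open>I^0 = k[y]\<close> there is nothing to show.\<close>
    proof (cases N)
      case 0
      then show ?thesis by (simp add: Ip_0)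
    next
      case (Suc M)
      have "pl N ?d = (\<Sum>u\<in>{\<lambda>_. 0}. w N ?d u * T u)"
        unfolding pl_def
      proof (rule sum.mono_neutral_right[OF finite_mindex_less])
        show "{\<lambda>_. 0} \<subseteq> lowdeg N" using Suc by (simp add: mindex_zero mdeg_def)
      qed (simp add: w_def const_simps)
      then show ?thesis by (simp add: w_def T_def Ip_simps)
    qed
  qed
qed

text \<open>At level one only the monomial of degree zero is left.\<close>

lemma Psi_quotient: "Psi c (Suc 0) = Jsum (\<lambda>b. c b (\<lambda>_. 0))"
proof -
  have l: "lowdeg (Suc 0) = {\<lambda>_. 0}" using mdeg_zero[of _ m] mindex_zero[of m] by auto
  show ?thesis unfolding apxD[OF Psi_apx le_refl] Jsum_cs[of "Suc 0", simplified]
    unfolding pl_def l by (simp add: w_def T_def)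
qed

lemma q_simps: "q (a + b) = q a + q b" "q (a * b) = q a * q b" "q 1 = 1"
  using ring_hom_memE[OF q_hom] by auto

lemma q_of_nat: "q (of_nat k) = of_nat k"
proof (induction k)
  case 0
  have "q 0 + q 0 = q 0" using q_simps(1)[of 0 0] by simp
  then show ?case by simp
qed (simp add: q_simps)

lemma q_inverse: "0 < k \<Longrightarrow> q (1 / of_nat k) * of_nat k = 1"
  using q_simps(2)[of "1 / of_nat k" "of_nat k"] by (simp add: q_of_nat q_simps(3))

lemma q_cancel: "0 < k \<Longrightarrow> q (1 / of_nat k) * (of_nat k * a) = a" "0 < k \<Longrightarrow> of_nat k * (q (1 / of_nat k) * a) = a"
  using arg_cong[OF q_inverse[of k], of "\<lambda>x. x * a"] by (simp_all add: ac_simps)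

section \<open>The Koszul differential, the connection and \<open>H\<close> in coordinates\<close>

definition vs :: "(nat set \<Rightarrow> 'k pol set \<Rightarrow> (nat \<Rightarrow> nat) \<Rightarrow> 'k) \<Rightarrow> bool" where
  "vs C \<longleftrightarrow> (\<forall>I b u. b \<notin> B \<or> u \<notin> mindex m \<or> \<not> I \<subseteq> {..<m} \<longrightarrow> C I b u = 0)"

definition PsiE where "PsiE C = (\<lambda>I. Psi (C I))"
definition kcC where "kcC C = (\<lambda>I b u. kc1 m (\<lambda>I u. C I b u) I u)"
definition ncC where "ncC C = (\<lambda>I b u. nc1 m (\<lambda>I u. C I b u) I u)"
text \<open>Division by the weight \<open>mdeg m u + card I\<close>, the eigenvalue of
  \<open>[d_K, \<nabla>]\<close>. At weight zero the convention \<open>1 / 0 = 0\<close> makes the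
  factor \<open>q 0 = 0\<close>.\<close>

definition Sc where "Sc C = (\<lambda>I b u. q (1 / of_nat (mdeg m u + card I)) * C I b u)"

lemma vsD: "vs C \<Longrightarrow> \<not> I \<subseteq> {..<m} \<Longrightarrow> C I = (\<lambda>_ _. 0)" and vs_supp: "vs C \<Longrightarrow> supp (C I)"
  for I :: "nat set"
  by (auto simp: vs_def supp_def fun_eq_iff)

lemma vs_ops: assumes "vs C" shows "vs (kcC C)" "vs (ncC C)" "vs (Sc C)"
proof -
  have z: "C I b u = 0" if "b \<notin> B \<or> u \<notin> mindex m \<or> \<not> I \<subseteq> {..<m}" for I b u
    using assms that by (simp add: vs_def)
  show "vs (kcC C)" unfolding vs_def kcC_def kc1_def kt_def
    by (intro allI impI sum.neutral ballI) (simp add: z mindex_upd_iff)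
  show "vs (ncC C)" unfolding vs_def ncC_def nc1_def nt_def
  proof (intro allI impI sum.neutral ballI)
    fix I b u i assume *: "b \<notin> B \<or> u \<notin> mindex m \<or> \<not> I \<subseteq> {..<m}" "i \<in> {..<m}"
    then have "C (I - {i}) b (u(i := Suc (u i))) = 0" by (intro z) (auto simp: mindex_upd_iff)
    then show "(if i \<in> I then sgk (theta_sign i I) * (of_nat (Suc (u i)) * C (I - {i}) b (u(i := Suc (u i)))) else 0) = 0" by simp
  qed
  show "vs (Sc C)" using z by (simp add: vs_def Sc_def)
qed

lemma PsiE_closed: "vs C \<Longrightarrow> PsiE C \<in> ext_carrier m HM"
  by (simp add: ext_carrier_def PsiE_def Psi_closed vsD Psi_zero)

lemma PsiE_inj: assumes "vs C" "vs D" "PsiE C = PsiE D" shows "C = D"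
proof
  fix I
  have "Psi (C I) = Psi (D I)" using fun_cong[OF assms(3), of I] unfolding PsiE_def .
  then show "C I = D I" by (rule Psi_inj[OF vs_supp[OF assms(1)] vs_supp[OF assms(2)]])
qed

lemma ext_coords: assumes "g \<in> ext_carrier m HM" obtains C where "vs C" "g = PsiE C"
proof -
  have "\<forall>I. \<exists>c. supp c \<and> g I = Psi c" using Psi_surj assms by (simp add: ext_carrier_def)
  from choice[OF this] obtain C where C: "\<forall>I. supp (C I) \<and> g I = Psi (C I)" by (elim exE)
  let ?C = "\<lambda>I b u. if I \<subseteq> {..<m} then C I b u else 0"
  have "vs ?C" using C by (auto simp: vs_def supp_def)
  moreover have "g = PsiE ?C"
  proof
    fix I show "g I = PsiE ?C I" using C assms by (cases "I \<subseteq> {..<m}") (simp_all add: PsiE_def ext_carrier_def Psi_zero)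
  qed
  ultimately show ?thesis by (rule that)
qed

lemma koszul_PsiE: "koszul_diff m t HM (PsiE C) = PsiE (kcC C)"
proof
  fix I
  have "t i \<odot>\<^bsub>HM\<^esub> contract HM i (PsiE C) I = Psi (\<lambda>b u. kt (\<lambda>I u. C I b u) I u i)" if i: "i < m" for i
  proof -
    have e: "contract HM i (PsiE C) I = Psi (\<lambda>b u. if i \<in> I then 0 else sgk (theta_sign i I) * C (insert i I) b u)"
      by (simp add: contract_def Psi_sgk Psi_zero PsiE_def signed_def HM_a_inv)
    show ?thesis unfolding e t_smult_Psi[OF i] by (rule arg_cong[of _ _ Psi]) (auto simp: kt_def fun_eq_iff)
  qed
  then have "koszul_diff m t HM (PsiE C) I = (\<Oplus>\<^bsub>HR\<^esub>i\<in>{..<m}. Psi (\<lambda>b u. kt (\<lambda>I u. C I b u) I u i))"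
    unfolding koszul_diff_def HM_finsum by (intro HR.finsum_cong') (simp_all add: Psi_closed)
  then show "koszul_diff m t HM (PsiE C) I = PsiE (kcC C) I"
    unfolding PsiE_def kcC_def kc1_def Psi_sum .
qed

lemma nabla_PsiE: assumes "vs C" shows "nabla m V \<sigma> (PsiE C) = PsiE (ncC C)"
proof
  fix I
  have "wedge HR i (\<lambda>I'. t_deriv m V \<sigma> i (PsiE C I')) I = Psi (\<lambda>b u. nt (\<lambda>I u. C I b u) I u i)" if i: "i < m" for i
  proof (cases "i \<in> I")
    case True
    then show ?thesis
      by (simp add: wedge_def nt_def Psi_sgk PsiE_def t_deriv_Psi[OF i vs_supp[OF assms]] del: of_nat_Suc)
  qed (simp add: wedge_def nt_def Psi_zero)
  then have "nabla m V \<sigma> (PsiE C) I = (\<Oplus>\<^bsub>HR\<^esub>i\<in>{..<m}. Psi (\<lambda>b u. nt (\<lambda>I u. C I b u) I u i))"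
    unfolding nabla_def by (intro HR.finsum_cong') (simp_all add: Psi_closed)
  then show "nabla m V \<sigma> (PsiE C) I = PsiE (ncC C) I"
    unfolding PsiE_def ncC_def nc1_def Psi_sum .
qed

lemma kc_nc: fixes I :: "nat set" assumes "vs C" shows "kcC (ncC C) I b u + ncC (kcC C) I b u = of_nat (mdeg m u + card I) * C I b u"
proof (cases "I \<subseteq> {..<m}")
  case True
  show ?thesis unfolding kcC_def ncC_def by (rule kc1_nc1[OF True])
next
  case False
  show ?thesis using vsD[OF vs_ops(1)[OF vs_ops(2)[OF assms]] False] vsD[OF vs_ops(2)[OF vs_ops(1)[OF assms]] False] vsD[OF assms False]
    by simp
qed

lemma commutator_PsiE:
  assumes "vs C"
  shows "koszul_nabla_commutator m V \<sigma> (PsiE C) = PsiE (\<lambda>I b u. of_nat (mdeg m u + card I) * C I b u)"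
  unfolding koszul_nabla_commutator_def hat_koszul_diff_def nabla_PsiE[OF assms] koszul_PsiE nabla_PsiE[OF vs_ops(1)[OF assms]]
  unfolding kc_nc[OF assms, symmetric] by (simp only: PsiE_def Psi_add)

lemma weight_pos: "I \<subseteq> {..<m} \<Longrightarrow> I \<noteq> {} \<Longrightarrow> 0 < mdeg m u + card I" for I :: "nat set"
  using finite_subset[of I "{..<m}"] by (simp add: card_gt_0_iff)

lemma ncC_empty: "ncC C {} = (\<lambda>_ _. 0)"
  by (simp add: ncC_def nc1_def nt_def)

text \<open>Away from \<open>I = {}\<close> the weight is positive and hence invertible in
  \<open>k\<close>; at \<open>I = {}\<close> the array is zero by assumption.\<close>

lemma weight_cancel:
  assumes "vs C" "C {} = (\<lambda>_ _. 0)"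
  shows "Sc (\<lambda>I b u. of_nat (mdeg m u + card I) * C I b u) = C" "(\<lambda>I b u. of_nat (mdeg m u + card I) * Sc C I b u) = C"
proof -
  have "Sc (\<lambda>I b u. of_nat (mdeg m u + card I) * C I b u) I b u = C I b u \<and> of_nat (mdeg m u + card I) * Sc C I b u = C I b u" for I b u
  proof (cases "I \<subseteq> {..<m} \<and> I \<noteq> {}")
    case True
    then show ?thesis unfolding Sc_def using q_cancel[OF weight_pos] by (simp only: simp_thms)
  next
    case False
    have "C I = (\<lambda>_ _. 0)"
    proof (cases "I = {}")
      case True
      then show ?thesis using assms(2) by (simp only:)
    next
      case I: False
      with False show ?thesis by (intro vsD[OF assms(1)]) blast
    qed
    then show ?thesis by (simp add: Sc_def)
  qed
  then show "Sc (\<lambda>I b u. of_nat (mdeg m u + card I) * C I b u) = C" "(\<lambda>I b u. of_nat (mdeg m u + card I) * Sc C I b u) = C"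
    by (intro ext; simp only:)+
qed

lemma negative_part_coords: assumes "g \<in> negative_part m V" obtains C where "vs C" "C {} = (\<lambda>_ _. 0)" "g = PsiE C"
proof -
  have "g \<in> ext_carrier m HM" using assms by (simp add: negative_part_def ext_carrier_def)
  then obtain C where C: "vs C" "g = PsiE C" by (rule ext_coords)
  moreover have "C {} = (\<lambda>_ _. 0)"
    by (rule Psi_inj_zero[OF vs_supp[OF C(1)]]) (use assms C(2) in \<open>simp add: negative_part_def PsiE_def\<close>)
  ultimately show ?thesis by (intro that)
qed

text \<open>The commutator multiplies by the weight, so it is injective on the negative part, and
  the weighted array is an explicit preimage of \<open>\<nabla>\<close>. This determines the value
  of \<open>inv_into\<close>.\<close>

lemma koszul_H_PsiE: assumes C: "vs C" shows "koszul_H m V \<sigma> (PsiE C) = PsiE (Sc (ncC C))"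
proof -
  note n = vs_ops(2)[OF C]
  have "inj_on (koszul_nabla_commutator m V \<sigma>) (negative_part m V)"
  proof (rule inj_onI)
    fix x y assume x: "x \<in> negative_part m V" and y: "y \<in> negative_part m V"
      and e: "koszul_nabla_commutator m V \<sigma> x = koszul_nabla_commutator m V \<sigma> y"
    obtain D where D: "vs D" "D {} = (\<lambda>_ _. 0)" "x = PsiE D" by (rule negative_part_coords[OF x])
    obtain D' where D': "vs D'" "D' {} = (\<lambda>_ _. 0)" "y = PsiE D'" by (rule negative_part_coords[OF y])
    have vsm: "vs (\<lambda>I b u. of_nat (mdeg m u + card I) * E I b u)" if "vs E" for E
      using that by (simp add: vs_def)
    have "(\<lambda>I b u. of_nat (mdeg m u + card I) * D I b u) = (\<lambda>I b u. of_nat (mdeg m u + card I) * D' I b u)"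
      by (rule PsiE_inj[OF vsm[OF D(1)] vsm[OF D'(1)]])
        (use e in \<open>simp only: D(3) D'(3) commutator_PsiE[OF D(1)] commutator_PsiE[OF D'(1)]\<close>)
    from arg_cong[OF this, of Sc] have "D = D'" unfolding weight_cancel(1)[OF D(1,2)] weight_cancel(1)[OF D'(1,2)] .
    then show "x = y" using D(3) D'(3) by simp
  qed
  moreover have "PsiE (Sc (ncC C)) \<in> negative_part m V"
    using PsiE_closed[OF vs_ops(3)[OF n]] by (simp add: negative_part_def ext_carrier_def) (simp add: PsiE_def Sc_def ncC_empty Psi_zero)
  moreover have "koszul_nabla_commutator m V \<sigma> (PsiE (Sc (ncC C))) = nabla m V \<sigma> (PsiE C)"
    unfolding commutator_PsiE[OF vs_ops(3)[OF n]] weight_cancel(2)[OF n ncC_empty] nabla_PsiE[OF C] ..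
  ultimately show ?thesis unfolding koszul_H_def by (metis inv_into_f_f)
qed

text \<open>\<open>d_K\<close> trades one \<open>\<theta>\<close> for one \<open>t\<close>, so the
  weight is the same before and after.\<close>

lemma kcC_Sc: assumes "vs C" shows "kcC (Sc C) = Sc (kcC C)"
proof (intro ext)
  fix I b u
  show "kcC (Sc C) I b u = Sc (kcC C) I b u"
  proof (cases "I \<subseteq> {..<m}")
    case True
    then have fin: "finite I" using finite_subset by blast
    have "kt (\<lambda>I u. Sc C I b u) I u i = q (1 / of_nat (mdeg m u + card I)) * kt (\<lambda>I u. C I b u) I u i" if i: "i < m" for i
    proof (cases "i \<notin> I \<and> 0 < u i")
      case True
      have "card (insert i I) = Suc (card I)" using True fin by simp
      then have e: "mdeg m (u(i := u i - 1)) + card (insert i I) = mdeg m u + card I"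
        using mdeg_upd[OF i, of u "u i - 1"] True by linarith
      show ?thesis unfolding kt_def Sc_def e by (simp add: mult.left_commute del: of_nat_add)
    qed (auto simp: kt_def)
    then show ?thesis unfolding kcC_def Sc_def[of "\<lambda>I b u. _ I b u"] kc1_def sum_distrib_left by (intro sum.cong) simp_all
  next
    case False
    show ?thesis by (simp only: vsD[OF vs_ops(1)[OF vs_ops(3)[OF assms]] False] vsD[OF vs_ops(3)[OF vs_ops(1)[OF assms]] False])
  qed
qed

text \<open>\<open>\<nabla>\<close> trades one \<open>t\<close> for one \<open>\<theta>\<close>,
  again at constant weight.\<close>

lemma ncC_Sc: assumes "vs C" shows "ncC (Sc C) = Sc (ncC C)"
proof (intro ext)
  fix I b u
  show "ncC (Sc C) I b u = Sc (ncC C) I b u"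
  proof (cases "I \<subseteq> {..<m}")
    case True
    then have fin: "finite I" using finite_subset by blast
    have "nt (\<lambda>I u. Sc C I b u) I u i = q (1 / of_nat (mdeg m u + card I)) * nt (\<lambda>I u. C I b u) I u i" if i: "i < m" for i
    proof (cases "i \<in> I")
      case True
      then have "card I = Suc (card (I - {i}))" using fin by (metis card_Suc_Diff1)
      then have e: "mdeg m (u(i := Suc (u i))) + card (I - {i}) = mdeg m u + card I"
        using mdeg_upd[OF i, of u "Suc (u i)"] by linarith
      show ?thesis unfolding nt_def Sc_def e by (simp add: mult.left_commute del: of_nat_Suc of_nat_add)
    qed (auto simp: nt_def)
    then show ?thesis unfolding ncC_def Sc_def[of "\<lambda>I b u. _ I b u"] nc1_def sum_distrib_left by (intro sum.cong) simp_all
  next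
    case False
    show ?thesis by (simp only: vsD[OF vs_ops(2)[OF vs_ops(3)[OF assms]] False] vsD[OF vs_ops(3)[OF vs_ops(2)[OF assms]] False])
  qed
qed

lemma koszul_H_closed: "x \<in> ext_carrier m HM \<Longrightarrow> koszul_H m V \<sigma> x \<in> ext_carrier m HM"
  by (erule ext_coords) (simp only: koszul_H_PsiE PsiE_closed vs_ops)

lemma koszul_H_degree:
  fixes I :: "nat set"
  assumes x: "x \<in> ext_carrier m HM" and z: "\<And>J. Suc (card J) = card I \<Longrightarrow> x J = \<zero>\<^bsub>HM\<^esub>"
  shows "koszul_H m V \<sigma> x I = \<zero>\<^bsub>HM\<^esub>"
proof (cases "I \<subseteq> {..<m}")
  case True
  obtain C where C: "vs C" "x = PsiE C" by (rule ext_coords[OF x])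
  have "nt (\<lambda>I u. C I b u) I u i = 0" for b u i
  proof (cases "i \<in> I")
    case i: True
    then have "Suc (card (I - {i})) = card I" using finite_subset[OF True] by (metis card_Suc_Diff1 finite_lessThan)
    then have "Psi (C (I - {i})) = \<zero>\<^bsub>HR\<^esub>" using z C(2) by (simp add: PsiE_def)
    then have "C (I - {i}) = (\<lambda>_ _. 0)" by (rule Psi_inj_zero[OF vs_supp[OF C(1)]])
    then show ?thesis by (simp add: nt_def)
  qed (simp add: nt_def)
  then have "Sc (ncC C) I = (\<lambda>_ _. 0)" by (simp add: Sc_def ncC_def nc1_def)
  then show ?thesis unfolding C(2) koszul_H_PsiE[OF C(1)] by (simp add: PsiE_def Psi_zero)
qed (use koszul_H_closed[OF x] in \<open>simp add: ext_carrier_def\<close>)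

lemma koszul_H_linear: "const_linear (ext_module m HM) (ext_module m HM) (koszul_H m V \<sigma>)"
  unfolding const_linear_def ext_module_simps
proof (intro conjI ballI allI Pi_I)
  fix x assume x: "x \<in> ext_carrier m HM"
  show "koszul_H m V \<sigma> x \<in> ext_carrier m HM" by (rule koszul_H_closed[OF x])
  obtain C where C: "vs C" "x = PsiE C" by (rule ext_coords[OF x])
  fix y assume y: "y \<in> ext_carrier m HM"
  obtain D where D: "vs D" "y = PsiE D" by (rule ext_coords[OF y])
  have vsa: "vs (\<lambda>I b u. C I b u + D I b u)" using C(1) D(1) by (simp add: vs_def)
  have e: "Sc (ncC (\<lambda>I b u. C I b u + D I b u)) I = (\<lambda>b u. Sc (ncC C) I b u + Sc (ncC D) I b u)" for I
    unfolding Sc_def ncC_def nc1_def sum.distrib[symmetric] distrib_left[symmetric]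
    by (intro ext arg_cong2[of _ _ _ _ "(*)"] refl sum.cong) (simp add: nt_def algebra_simps)
  have s: "(\<lambda>I. x I \<oplus>\<^bsub>HM\<^esub> y I) = PsiE (\<lambda>I b u. C I b u + D I b u)"
    by (simp add: C(2) D(2) PsiE_def Psi_add)
  show "koszul_H m V \<sigma> (\<lambda>I. x I \<oplus>\<^bsub>HM\<^esub> y I) = (\<lambda>I. koszul_H m V \<sigma> x I \<oplus>\<^bsub>HM\<^esub> koszul_H m V \<sigma> y I)"
    unfolding s koszul_H_PsiE[OF vsa] unfolding C(2) D(2) koszul_H_PsiE[OF C(1)] koszul_H_PsiE[OF D(1)]
    by (simp add: PsiE_def e Psi_add)
next
  fix x a assume x: "x \<in> ext_carrier m HM"
  obtain C where C: "vs C" "x = PsiE C" by (rule ext_coords[OF x])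
  have vsa: "vs (\<lambda>I b u. a * C I b u)" using C(1) by (simp add: vs_def)
  have e: "Sc (ncC (\<lambda>I b u. a * C I b u)) I = (\<lambda>b u. a * Sc (ncC C) I b u)" for I
    unfolding Sc_def ncC_def nc1_def mult.left_commute[of a] unfolding sum_distrib_left[of a]
    by (intro ext arg_cong2[of _ _ _ _ "(*)"] refl sum.cong) (simp add: nt_def algebra_simps)
  have s: "(\<lambda>I. const a \<odot>\<^bsub>HM\<^esub> x I) = PsiE (\<lambda>I b u. a * C I b u)"
    by (simp add: C(2) PsiE_def Psi_smult del: HM_simps)
  show "koszul_H m V \<sigma> (\<lambda>I. const a \<odot>\<^bsub>HM\<^esub> x I) = (\<lambda>I. const a \<odot>\<^bsub>HM\<^esub> koszul_H m V \<sigma> x I)"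
    unfolding s koszul_H_PsiE[OF vsa] unfolding C(2) koszul_H_PsiE[OF C(1)]
    by (simp add: PsiE_def e Psi_smult del: HM_simps)
qed

text \<open>\<open>H\<close> is \<open>\<nabla>\<close> followed by division by the weight; the two
  commute, and \<open>\<nabla>\<close> squares to zero.\<close>

lemma koszul_H_square: "x \<in> ext_carrier m HM \<Longrightarrow> koszul_H m V \<sigma> (koszul_H m V \<sigma> x) = (\<lambda>_. \<zero>\<^bsub>HM\<^esub>)"
proof (erule ext_coords)
  fix C assume C: "vs C" "x = PsiE C"
  have "ncC (Sc (ncC C)) = (\<lambda>_ _ _. 0)"
    unfolding ncC_Sc[OF vs_ops(2)[OF C(1)]] by (simp add: ncC_def nc1_nc1 Sc_def)
  then show ?thesis by (simp add: C(2) koszul_H_PsiE[OF C(1)] koszul_H_PsiE vs_ops C(1))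
    (simp add: PsiE_def Sc_def Psi_zero)
qed

text \<open>Elements \<open>\<sigma> r\<close> involve only \<open>t^0\<close> and are constant for
  the connection.\<close>

lemma koszul_H_sigma:
  assumes "r \<in> carrier J" shows "koszul_H m V \<sigma> (\<lambda>I. if I = {} then \<sigma> r else \<zero>\<^bsub>HM\<^esub>) = (\<lambda>_. \<zero>\<^bsub>HM\<^esub>)"
proof -
  obtain d where d: "\<forall>b. b \<notin> B \<longrightarrow> d b = 0" "r = Jsum d" using J_coords[OF assms] by blast
  let ?C = "\<lambda>I b u. if I = {} \<and> u = (\<lambda>_. 0) then d b else (0 :: 'k)"
  have C: "vs ?C" using d(1) mindex_zero by (simp add: vs_def)
  have "(if I = {} then \<sigma> r else \<zero>\<^bsub>HM\<^esub>) = PsiE ?C I" for I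
    unfolding PsiE_def by (cases "I = {}") (simp_all add: d(2) sigma_Psi Psi_zero)
  then have e: "(\<lambda>I. if I = {} then \<sigma> r else \<zero>\<^bsub>HM\<^esub>) = PsiE ?C" by (rule ext)
  have "nt (\<lambda>I u. ?C I b u) I u i = 0" for I b u i
  proof -
    have "u(i := Suc (u i)) \<noteq> (\<lambda>_. 0)" by (metis fun_upd_same Zero_not_Suc)
    then show ?thesis by (simp add: nt_def)
  qed
  then have "Sc (ncC ?C) = (\<lambda>_ _ _. 0)" by (simp add: Sc_def ncC_def nc1_def)
  then show ?thesis unfolding e koszul_H_PsiE[OF C] by (simp add: PsiE_def Psi_zero)
qed

text \<open>Division by the weight commutes with \<open>d_K\<close>, so \<open>[d_K, H]\<close> is
  \<open>[d_K, \<nabla>]\<close> divided by the weight. That is the identity in positive weight and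
  zero in weight zero, where \<open>\<sigma>\<close> composed with the quotient map takes
  over.\<close>

lemma koszul_H_homotopy:
  fixes I :: "nat set"
  assumes x: "x \<in> ext_carrier m HM"
  shows "koszul_diff m t HM (koszul_H m V \<sigma> x) I \<oplus>\<^bsub>HM\<^esub> koszul_H m V \<sigma> (koszul_diff m t HM x) I \<oplus>\<^bsub>HM\<^esub>
     (if I = {} then \<sigma> (hat_quotient (x {})) else \<zero>\<^bsub>HM\<^esub>) = x I"
proof -
  obtain C where C: "vs C" "x = PsiE C" by (rule ext_coords[OF x])
  let ?R = "\<lambda>b u. if I = {} \<and> u = (\<lambda>_. 0) then C {} b u else (0 :: 'k)"
  have R: "(if I = {} then \<sigma> (hat_quotient (x {})) else \<zero>\<^bsub>HM\<^esub>) = Psi ?R"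
    by (simp add: C(2) PsiE_def hat_quotient_def Psi_quotient sigma_Psi Psi_zero cong: if_cong)
  have "Sc (kcC (ncC C)) I b u + Sc (ncC (kcC C)) I b u + ?R b u = C I b u" for b u
  proof -
    have "Sc (kcC (ncC C)) I b u + Sc (ncC (kcC C)) I b u = q (1 / of_nat (mdeg m u + card I)) * (of_nat (mdeg m u + card I) * C I b u)"
      unfolding Sc_def kc_nc[OF C(1), symmetric] by (simp add: distrib_left)
    \<comment> \<open>Either the weight is positive, or the index is that of the constant term, or
      the array vanishes there.\<close>
    moreover have "0 < mdeg m u + card I \<and> \<not> (I = {} \<and> u = (\<lambda>_. 0)) \<or> I = {} \<and> u = (\<lambda>_. 0) \<or> C I b u = 0"
    proof (cases "I = {}")
      case True
      then show ?thesis using mdeg_zero[of u m] C(1) by (cases "u \<in> mindex m") (auto simp: vs_def)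
    next
      case False
      then show ?thesis
      proof (cases "I \<subseteq> {..<m}")
        case True
        have "0 < mdeg m u + card I" by (rule weight_pos[OF True False])
        then show ?thesis using False by simp
      next
        case out: False
        show ?thesis by (simp add: vsD[OF C(1) out])
      qed
    qed
    ultimately show ?thesis using q_cancel(1)[of "mdeg m u + card I" "C I b u"] by (auto simp: mdeg_def)
  qed
  then have "Psi (\<lambda>b u. Sc (kcC (ncC C)) I b u + Sc (ncC (kcC C)) I b u + ?R b u) = x I" by (simp add: C(2) PsiE_def)
  then show ?thesis
    unfolding R unfolding Psi_add C(2) koszul_H_PsiE[OF C(1)] koszul_PsiE koszul_H_PsiE[OF vs_ops(1)[OF C(1)]] kcC_Sc[OF vs_ops(2)[OF C(1)]]
    by (simp only: PsiE_def HM_simps)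
qed

lemma quotient_linear: "linear_map (ky m) HM J hat_quotient"
proof (rule linear_mapI)
  fix a assume "a \<in> carrier HM"
  then obtain p where p: "apx (Suc 0) a p" using apx_ex by auto
  have e: "a (Suc 0) = cs (Suc 0) p" by (rule apxD[OF p]) simp
  show "hat_quotient a \<in> carrier J" using e apx_closed[OF p] by (simp add: hat_quotient_def)
  show "hat_quotient (r \<odot>\<^bsub>HM\<^esub> a) = r \<odot>\<^bsub>J\<^esub> hat_quotient a" if "r \<in> carrier (ky m)" for r
    using apxD[OF apx_smult[OF that p] le_refl] e Q1(2)[OF that apx_closed[OF p]] by (simp add: hat_quotient_def del: HM_simps)
  fix b assume "b \<in> carrier HM"
  then obtain r where r: "apx (Suc 0) b r" using apx_ex by auto
  have "b (Suc 0) = cs (Suc 0) r" by (rule apxD[OF r]) simp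
  then show "hat_quotient (a \<oplus>\<^bsub>HM\<^esub> b) = hat_quotient a \<oplus>\<^bsub>J\<^esub> hat_quotient b"
    using apxD[OF apx_add[OF p r] le_refl] e Q1(1)[OF apx_closed[OF p] apx_closed[OF r]] by (simp add: hat_quotient_def)
qed

text \<open>In coordinates: after multiplication by some \<open>t_i\<close> there is no constant
  term.\<close>

lemma quotient_koszul:
  assumes "x \<in> ext_carrier m HM" shows "hat_quotient (koszul_diff m t HM x {}) = \<zero>\<^bsub>J\<^esub>"
proof -
  obtain C where C: "vs C" "x = PsiE C" by (rule ext_coords[OF assms])
  show ?thesis unfolding C(2) koszul_PsiE unfolding PsiE_def hat_quotient_def One_nat_def Psi_quotient kcC_def kc1_def kt_def
    by (simp add: Jsum_zero del: J_simps)
qed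

lemma quotient_to_hat: "hat_quotient (to_hat m V p) = cs (Suc 0) p"
  by (simp add: hat_quotient_def to_hat_alt)

end

section \<open>The Koszul complex over the polynomial ring\<close>

context hat_coords
begin

abbreviation Ay :: "('k pol, 'k pol) module" where "Ay \<equiv> via_hom (\<lambda>p. p) R"

lemma Ay_simps [simp]: "carrier Ay = carrier R" "zero Ay = 0" "add Ay = (+)" "smult Ay = (*)"
  by (simp_all add: via_hom_def fun_eq_iff)

lemma Ay_module: "module (ky m) Ay"
proof (rule moduleI[OF cring_pol_ring])
  show "abelian_group Ay"
  proof (rule abelian_groupI)
    fix x assume "x \<in> carrier Ay"
    then show "\<exists>y\<in>carrier Ay. y \<oplus>\<^bsub>Ay\<^esub> x = \<zero>\<^bsub>Ay\<^esub>" by (intro bexI[of _ "- x"]) auto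
  qed (auto simp: ac_simps)
qed (auto simp: algebra_simps)

sublocale Ay: coeff_module m Ay
  by (simp add: coeff_module_def pol_module_def Ay_module)

lemma Ay_finsum: assumes "\<And>i. i \<in> S \<Longrightarrow> f i \<in> carrier R" shows "finsum Ay f S = sum f S"
proof -
  have e: "finsum Ay = finsum R" by (simp add: finsum_def finprod_def fun_eq_iff)
  show ?thesis unfolding e by (rule finsum_pol_ring[OF assms])
qed

lemma Ay_signed: "p \<in> carrier R \<Longrightarrow> signed Ay r p = sgk r * p"
  using Ay.M.minus_equality[of "- p" p] by (cases r) (simp_all add: signed_def)

lemma EA: "x \<in> ext_carrier m Ay \<longleftrightarrow> (\<forall>K. x K \<in> carrier R) \<and> (\<forall>K. \<not> K \<subseteq> {..<m} \<longrightarrow> x K = 0)"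
  by (simp add: ext_carrier_def)

definition dy :: "(nat set \<Rightarrow> 'k pol) \<Rightarrow> nat set \<Rightarrow> 'k pol" where
  "dy x = (\<lambda>K. \<Sum>i<m. t i * (if i \<in> K then 0 else sgk (theta_sign i K) * x (insert i K)))"

lemma sgk_closed [simp]: "sgk r \<in> carrier R"
  by (simp add: sgk_def)

lemma koszul_dy: "x \<in> ext_carrier m Ay \<Longrightarrow> koszul_diff m t Ay x = dy x"
proof
  fix K assume x: "x \<in> ext_carrier m Ay"
  have c: "contract Ay i x K = (if i \<in> K then 0 else sgk (theta_sign i K) * x (insert i K))" for i
    using x by (simp add: contract_def Ay_signed EA)
  show "koszul_diff m t Ay x K = dy x K"
    unfolding koszul_diff_def c dy_def by (subst Ay_finsum) (use x in \<open>simp_all add: EA\<close>)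
qed

lemma dy_closed: assumes "x \<in> ext_carrier m Ay" shows "dy x \<in> ext_carrier m Ay"
proof -
  have "dy x K \<in> carrier R" for K unfolding dy_def using assms by (intro sum_pol_ring) (simp add: EA)
  moreover have "dy x K = 0" if "\<not> K \<subseteq> {..<m}" for K
  proof -
    have "x (insert i K) = 0" for i using assms that by (simp add: EA)
    then have e: "(if i \<in> K then 0 else sgk (theta_sign i K) * x (insert i K)) = 0" for i by simp
    show ?thesis unfolding dy_def e by simp
  qed
  ultimately show ?thesis by (simp add: EA)
qed

lemma dy_linear: "const_linear (ext_module m Ay) (ext_module m Ay) dy"
  unfolding const_linear_def ext_module_simps Ay_simps
proof (intro conjI ballI allI Pi_I dy_closed ext)
  fix x y and K :: "nat set"
  show "dy (\<lambda>K. x K + y K) K = dy x K + dy y K"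
    unfolding dy_def sum.distrib[symmetric] by (rule sum.cong[OF refl]) (simp add: algebra_simps)
  fix c
  show "dy (\<lambda>K. const c * x K) K = const c * dy x K"
    unfolding dy_def sum_distrib_left by (rule sum.cong[OF refl]) (simp add: algebra_simps)
qed

lemma dy_dy: "dy (dy x) = (\<lambda>_. 0)"
proof
  fix K :: "nat set"
  define Z where "Z i j = t i * (if i \<in> K then 0 else sgk (theta_sign i K) *
    (t j * (if j \<in> insert i K then 0 else sgk (theta_sign j (insert i K)) * x (insert j (insert i K)))))" for i j
  have "dy (dy x) K = (\<Sum>i<m. \<Sum>j<m. Z i j)"
    unfolding dy_def[of "dy x"] Z_def by (rule sum.cong[OF refl]) (simp add: dy_def sum_distrib_left)
  also have "\<dots> = 0"
  proof (rule sum_antisymmetric)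
    show "Z i i = 0" for i by (simp add: Z_def)
    show "Z i j = - Z j i" for i j
    proof (cases "i \<notin> K \<and> j \<notin> K \<and> i \<noteq> j")
      case True
      have s: "sgk (theta_sign i K) * sgk (theta_sign j (insert i K)) = - (sgk (theta_sign j K) * sgk (theta_sign i (insert j K)) :: 'k pol)"
      proof -
        have e: "theta_sign i (insert j K) = theta_sign i K + (if j < i then 1 else 0)"
          "theta_sign j (insert i K) = theta_sign j K + (if i < j then 1 else 0)"
          using theta_sign_insert[of j K i] theta_sign_insert[of i K j] True by blast+
        have "j < i \<longleftrightarrow> \<not> i < j" using True by auto
        then show ?thesis unfolding e sgk_add by simp
      qed
      have "Z i j = (sgk (theta_sign i K) * sgk (theta_sign j (insert i K))) * (t i * t j * x (insert i (insert j K)))"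
        "Z j i = (sgk (theta_sign j K) * sgk (theta_sign i (insert j K))) * (t i * t j * x (insert i (insert j K)))"
        using True by (simp_all add: Z_def ac_simps insert_commute)
      with s show ?thesis by simp
    qed (auto simp: Z_def)
  qed
  finally show "dy (dy x) K = 0" .
qed

section \<open>Maps linear over \<open>k\<close>, prescribed on the elements
  \<open>y^\<beta> \<theta>_K\<close>\<close>

definition eb :: "nat set \<Rightarrow> 'k pol \<Rightarrow> nat set \<Rightarrow> 'k pol" where "eb K p = (\<lambda>L. if L = K then p else 0)"

lemma eb_closed: "K \<subseteq> {..<m} \<Longrightarrow> p \<in> carrier R \<Longrightarrow> eb K p \<in> ext_carrier m Ay"
  by (auto simp: EA eb_def)

lemma const_linear_zero_Ay: "const_linear (ext_module m Ay) (ext_module m Ay) f \<Longrightarrow> f (\<lambda>_. 0) = (\<lambda>_. 0)"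
  using const_linear_zero[OF Ay.ext_module Ay.ext_module] by simp

text \<open>The elements \<open>y^\<beta> \<theta>_K\<close> span over \<open>k\<close>. The
  predicate \<open>Q\<close> restricts the comparison to those \<open>K\<close> on which
  \<open>x\<close> lives, here a range of theta-degrees.\<close>

lemma const_linear_ext:
  assumes f: "const_linear (ext_module m Ay) (ext_module m Ay) f" and g: "const_linear (ext_module m Ay) (ext_module m Ay) g"
    and e: "\<And>K \<beta>. K \<subseteq> {..<m} \<Longrightarrow> Q K \<Longrightarrow> \<beta> \<in> monomials (yvars m) \<Longrightarrow> f (eb K (single \<beta> 1)) = g (eb K (single \<beta> 1))"
    and x: "x \<in> ext_carrier m Ay" "\<And>K. \<not> Q K \<Longrightarrow> x K = 0"
  shows "f x = g x"
proof -
  note fs = const_linearD[OF f, simplified] const_linear_zero_Ay[OF f]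
  note gs = const_linearD[OF g, simplified] const_linear_zero_Ay[OF g]
  have 1: "f (eb K p) = g (eb K p)" if K: "K \<subseteq> {..<m}" "Q K" and p: "p \<in> carrier R" for K p
    using p
  proof (induction p rule: pol_ring_induct)
    case zero
    have "eb K 0 = (\<lambda>_. 0)" by (simp add: eb_def fun_eq_iff)
    then show ?case using fs(4) gs(4) by (simp only:)
  next
    case (single \<beta> c)
    have "eb K (single \<beta> c) = (\<lambda>L. const c * eb K (single \<beta> 1) L)" by (simp add: eb_def fun_eq_iff const_def mult_single)
    moreover have "eb K (single \<beta> 1) \<in> ext_carrier m Ay" using single by (intro eb_closed K single_pol_ring)
    ultimately show ?case using fs(3) gs(3) e[OF K single] by simp
  next
    case (add p r)
    have "eb K (p + r) = (\<lambda>L. eb K p L + eb K r L)" by (simp add: eb_def fun_eq_iff)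
    then show ?case using fs(2)[OF eb_closed[OF K(1) add(1)] eb_closed[OF K(1) add(2)]]
        gs(2)[OF eb_closed[OF K(1) add(1)] eb_closed[OF K(1) add(2)]] add(3,4) by simp
  qed
  have "f (\<lambda>K. if K \<in> S then x K else 0) = g (\<lambda>K. if K \<in> S then x K else 0)" if "finite S" "S \<subseteq> Pow {..<m}" for S
    using that
  proof (induction S)
    case empty
    then show ?case using fs(4) gs(4) by simp
  next
    case (insert K S)
    let ?y = "\<lambda>K. if K \<in> S then x K else 0"
    have K: "K \<subseteq> {..<m}" using insert by simp
    have y: "?y \<in> ext_carrier m Ay" and b: "eb K (x K) \<in> ext_carrier m Ay"
      using x(1) by (auto simp: EA eb_def)
    have "f (eb K (x K)) = g (eb K (x K))"
    proof (cases "Q K")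
      case True
      with x(1) show ?thesis by (intro 1 K) (simp_all add: EA)
    next
      case False
      then have "eb K (x K) = (\<lambda>_. 0)" using x(2) by (simp add: eb_def fun_eq_iff)
      then show ?thesis using fs(4) gs(4) by (simp only:)
    qed
    moreover have "(\<lambda>L. if L \<in> insert K S then x L else 0) = (\<lambda>L. ?y L + eb K (x K) L)"
      using insert(2) by (auto simp: eb_def fun_eq_iff)
    ultimately show ?case using fs(2)[OF y b] gs(2)[OF y b] insert.IH insert.prems by simp
  qed
  from this[of "Pow {..<m}"] have "f (\<lambda>K. if K \<in> Pow {..<m} then x K else 0) = g (\<lambda>K. if K \<in> Pow {..<m} then x K else 0)" by simp
  moreover have "(\<lambda>K. if K \<in> Pow {..<m} then x K else 0) = x" using x(1) by (auto simp: EA fun_eq_iff)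
  ultimately show ?thesis by (simp only:)
qed

text \<open>The \<open>k\<close>-linear map on polynomials that sends the monomial
  \<open>y^\<beta>\<close> to \<open>g \<beta>\<close>.\<close>

definition lc :: "(mono \<Rightarrow> 'k pol) \<Rightarrow> 'k pol \<Rightarrow> 'k pol" where
  "lc g p = (\<Sum>\<beta>\<in>keys p. const (lookup p \<beta>) * g \<beta>)"

lemma lc_superset: "finite S \<Longrightarrow> keys p \<subseteq> S \<Longrightarrow> lc g p = (\<Sum>\<beta>\<in>S. const (lookup p \<beta>) * g \<beta>)"
  unfolding lc_def by (rule sum.mono_neutral_left) (auto simp: in_keys_iff)

lemma lc_add: "lc g (p + r) = lc g p + lc g r"
proof -
  let ?S = "keys p \<union> keys r"
  have "keys (p + r) \<subseteq> ?S" by (rule keys_add)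
  then show ?thesis using lc_superset[of ?S p] lc_superset[of ?S r] lc_superset[of ?S "p + r"]
    by (simp add: lookup_add distrib_right sum.distrib)
qed

lemma lc_const: "lc g (const c * p) = const c * lc g p"
proof -
  have l: "lookup (const c * p) \<beta> = c * lookup p \<beta>" for \<beta>
    unfolding const_def mult_map_scale_conv_mult[symmetric] by (simp add: map.rep_eq when_def)
  then have "keys (const c * p) \<subseteq> keys p" by (auto simp: in_keys_iff)
  then show ?thesis using lc_superset[of "keys p" "const c * p"]
    by (simp add: l lc_def sum_distrib_left mult.assoc)
qed

text \<open>The \<open>k\<close>-linear map with value \<open>\<psi> K \<beta>\<close> on
  \<open>y^\<beta> \<theta>_K\<close>.\<close>

definition lin :: "(nat set \<Rightarrow> mono \<Rightarrow> nat set \<Rightarrow> 'k pol) \<Rightarrow> (nat set \<Rightarrow> 'k pol) \<Rightarrow> nat set \<Rightarrow> 'k pol" where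
  "lin \<psi> x = (\<lambda>L. \<Sum>K\<in>Pow {..<m}. lc (\<lambda>\<beta>. \<psi> K \<beta> L) (x K))"

lemma lin_linear:
  assumes "\<And>K \<beta>. \<psi> K \<beta> \<in> ext_carrier m Ay" shows "const_linear (ext_module m Ay) (ext_module m Ay) (lin \<psi>)"
  unfolding const_linear_def ext_module_simps Ay_simps
proof (intro conjI ballI allI Pi_I ext)
  fix x y and L :: "nat set"
  show "lin \<psi> (\<lambda>K. x K + y K) L = lin \<psi> x L + lin \<psi> y L"
    unfolding lin_def sum.distrib[symmetric] lc_add ..
  show "lin \<psi> (\<lambda>K. const c * x K) L = const c * lin \<psi> x L" for c
    unfolding lin_def sum_distrib_left lc_const ..
  have "lc (\<lambda>\<beta>. \<psi> K \<beta> L) p \<in> carrier R" for K L p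
    unfolding lc_def using assms by (intro sum_pol_ring) (simp add: EA)
  moreover have "lc (\<lambda>\<beta>. \<psi> K \<beta> L) p = 0" if "\<not> L \<subseteq> {..<m}" for K L p
    unfolding lc_def using assms that by (simp add: EA)
  ultimately show "lin \<psi> x \<in> ext_carrier m Ay"
    unfolding EA lin_def by simp
qed

lemma lc_single: "lc g (single \<beta> 1) = g \<beta>"
  by (simp add: lc_def)

lemma lc_zero: "lc g 0 = 0"
  by (simp add: lc_def)

lemma lin_eb: "K \<subseteq> {..<m} \<Longrightarrow> lin \<psi> (eb K (single \<beta> 1)) = \<psi> K \<beta>"
proof
  fix L assume K: "K \<subseteq> {..<m}"
  have "lin \<psi> (eb K (single \<beta> 1)) L = (\<Sum>K'\<in>Pow {..<m}. if K' = K then \<psi> K \<beta> L else 0)"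
    unfolding lin_def eb_def by (rule sum.cong[OF refl]) (simp add: lc_single lc_zero)
  then show "lin \<psi> (eb K (single \<beta> 1)) L = \<psi> K \<beta> L" using K by simp
qed

lemma lin_cong: "(\<And>K. x K = 0 \<or> \<psi> K = \<psi>' K) \<Longrightarrow> lin \<psi> x = lin \<psi>' x"
  unfolding lin_def by (intro ext sum.cong refl) (metis lc_zero)

definition jc :: "'k pol set \<Rightarrow> 'k pol set \<Rightarrow> 'k" where
  "jc r = (THE c. (\<forall>b. b \<notin> B \<longrightarrow> c b = 0) \<and> r = Jsum c)"

lemma jc: assumes "r \<in> carrier J" shows "\<forall>b. b \<notin> B \<longrightarrow> jc r b = 0" "r = Jsum (jc r)"
  using theI'[OF J_coords[OF assms]] unfolding jc_def by blast+

lemma jc_unique: "r \<in> carrier J \<Longrightarrow> \<forall>b. b \<notin> B \<longrightarrow> c b = 0 \<Longrightarrow> r = Jsum c \<Longrightarrow> jc r = c"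
  unfolding jc_def by (rule the1_equality[OF J_coords]) simp_all

text \<open>A \<open>k\<close>-linear section of the quotient map from \<open>k[y]\<close> to
  \<open>J_V\<close>. \<open>\<sigma>\<close> itself takes values in the completion, so its basis
  values are replaced by polynomials representing them modulo \<open>I\<close>.\<close>

definition s0 :: "'k pol set \<Rightarrow> 'k pol" where "s0 r = (\<Sum>b\<in>B. const (jc r b) * s (Suc 0) b)"

lemma s0_closed [simp]: "s0 r \<in> carrier R"
  unfolding s0_def by (intro sum_pol_ring) simp

lemma cs_s0: "r \<in> carrier J \<Longrightarrow> cs (Suc 0) (s0 r) = r"
  using Jsum_cs[of "Suc 0" "jc r"] jc(2)[of r] unfolding s0_def by simp

lemma Jsum_add: "Jsum (\<lambda>b. c b + d b) = Jsum c \<oplus>\<^bsub>J\<^esub> Jsum d"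
proof -
  have "(\<Sum>b\<in>B. const (e b) * s (Suc 0) b) \<in> carrier R" for e by (intro sum_pol_ring) simp
  from Q1(1)[OF this this, of c d] show ?thesis
    unfolding Jsum_cs[of "Suc 0", simplified] J_simps by (simp add: distrib_right sum.distrib)
qed

lemma Jsum_smult: "Jsum (\<lambda>b. a * c b) = const a \<odot>\<^bsub>J\<^esub> Jsum c"
proof -
  have "(\<Sum>b\<in>B. const (c b) * s (Suc 0) b) \<in> carrier R" by (intro sum_pol_ring) simp
  from Q1(2)[OF _ this, of "const a"] show ?thesis
    unfolding Jsum_cs[of "Suc 0", simplified] J_simps by (simp add: sum_distrib_left mult.assoc)
qed

lemma s0_linear: "const_linear J Ay s0"
  unfolding const_linear_def
proof (intro conjI ballI allI Pi_I)
  fix v w assume v: "v \<in> carrier J" and w: "w \<in> carrier J"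
  have "jc (v \<oplus>\<^bsub>J\<^esub> w) = (\<lambda>b. jc v b + jc w b)"
  proof (rule jc_unique[OF J.M.a_closed[OF v w]])
    show "v \<oplus>\<^bsub>J\<^esub> w = Jsum (\<lambda>b. jc v b + jc w b)" unfolding Jsum_add jc(2)[OF v, symmetric] jc(2)[OF w, symmetric] ..
  qed (simp add: jc(1)[OF v] jc(1)[OF w])
  then show "s0 (v \<oplus>\<^bsub>J\<^esub> w) = s0 v \<oplus>\<^bsub>Ay\<^esub> s0 w" by (simp add: s0_def distrib_right sum.distrib)
next
  fix c v assume v: "v \<in> carrier J"
  have cv: "const c \<odot>\<^bsub>J\<^esub> v \<in> carrier J" by (rule J.smult_closed[OF _ v]) simp
  have "jc (const c \<odot>\<^bsub>J\<^esub> v) = (\<lambda>b. c * jc v b)"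
  proof (rule jc_unique[OF cv])
    show "const c \<odot>\<^bsub>J\<^esub> v = Jsum (\<lambda>b. c * jc v b)" unfolding Jsum_smult jc(2)[OF v, symmetric] ..
  qed (simp add: jc(1)[OF v])
  then show "s0 (const c \<odot>\<^bsub>J\<^esub> v) = const c \<odot>\<^bsub>Ay\<^esub> s0 v" by (simp add: s0_def sum_distrib_left mult.assoc)
qed (simp)

lemma cs_linear: "linear_map (ky m) Ay J (cs (Suc 0))"
  by (rule linear_mapI) (simp_all add: Q1)

text \<open>The projection of the Koszul complex onto the copy of \<open>J_V\<close> in theta-degree
  zero, to which it is to be contracted.\<close>

definition sp :: "(nat set \<Rightarrow> 'k pol) \<Rightarrow> nat set \<Rightarrow> 'k pol" where
  "sp x = (\<lambda>K. if K = {} then s0 (cs (Suc 0) (x {})) else 0)"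

lemma sp_linear: "const_linear (ext_module m Ay) (ext_module m Ay) sp"
  unfolding const_linear_def ext_module_simps
proof (intro conjI ballI allI Pi_I ext)
  fix x y K assume x: "x \<in> ext_carrier m Ay" and y: "y \<in> ext_carrier m Ay"
  have xy: "x {} \<in> carrier Ay" "y {} \<in> carrier Ay" using x y by (simp_all add: EA)
  note l = linear_mapD[OF cs_linear]
  show "sp (\<lambda>K. x K \<oplus>\<^bsub>Ay\<^esub> y K) K = sp x K \<oplus>\<^bsub>Ay\<^esub> sp y K"
    using const_linearD(2)[OF s0_linear l(1)[OF xy(1)] l(1)[OF xy(2)]] l(2)[OF xy] by (simp add: sp_def del: J_simps)
next
  fix x c K assume x: "x \<in> ext_carrier m Ay"
  have xy: "x {} \<in> carrier Ay" using x by (simp add: EA)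
  note l = linear_mapD[OF cs_linear]
  have "const c \<in> carrier R" by simp
  then show "sp (\<lambda>K. const c \<odot>\<^bsub>Ay\<^esub> x K) K = const c \<odot>\<^bsub>Ay\<^esub> sp x K"
    using const_linearD(3)[OF s0_linear l(1)[OF xy], of c] l(3)[OF _ xy, of "const c"] by (simp add: sp_def del: J_simps)
qed (simp add: EA sp_def)

lemma cs_dy: assumes x: "x \<in> ext_carrier m Ay" shows "cs (Suc 0) (dy x {}) = \<zero>\<^bsub>J\<^esub>"
proof -
  have "dy x {} \<in> Ip (Suc 0)"
    unfolding dy_def by (rule Ip_sum, rule Ip_simps(7)) (use x in \<open>auto simp: t_I Ip_1 EA\<close>)
  then show ?thesis using cs_eq[of "dy x {}" 0 "Suc 0"] dy_closed[OF x] by (simp add: EA)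
qed

lemma sp_dy: "x \<in> ext_carrier m Ay \<Longrightarrow> sp (dy x) = (\<lambda>_. 0)"
proof -
  have "s0 \<zero>\<^bsub>J\<^esub> = 0" using const_linear_zero[OF J_module Ay_module s0_linear] by simp
  then show "x \<in> ext_carrier m Ay \<Longrightarrow> sp (dy x) = (\<lambda>_. 0)" by (simp add: sp_def cs_dy fun_eq_iff del: J_simps)
qed

lemma theta_part_Ay: "x \<in> theta_part m Ay r \<longleftrightarrow> x \<in> ext_carrier m Ay \<and> (\<forall>K. card K \<noteq> r \<longrightarrow> x K = 0)"
  by (simp add: theta_part_def)

text \<open>\<open>koszul_exact\<close> speaks of positive theta-degree. In degree zero the
  boundaries are the elements of \<open>I\<close>, so there the condition is that the class in
  \<open>J_V\<close> vanishes.\<close>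

lemma dy_exact:
  assumes ex: "koszul_exact R m t" and z: "z \<in> theta_part m Ay r"
    and d: "dy z = (\<lambda>_. 0)" and z0: "r = 0 \<Longrightarrow> cs (Suc 0) (z {}) = \<zero>\<^bsub>J\<^esub>"
  shows "\<exists>y\<in>theta_part m Ay (Suc r). dy y = z"
proof (cases r)
  case (Suc r')
  have zc: "z \<in> ext_carrier m Ay" using z by (simp add: theta_part_Ay)
  have "\<exists>y\<in>theta_part m Ay (Suc r). koszul_diff m t Ay y = z"
    using ex z d Suc unfolding koszul_exact_def Let_def by (simp add: koszul_dy[OF zc])
  then show ?thesis using koszul_dy by (metis theta_part_Ay)
next
  case 0
  have zr: "z {} \<in> carrier R" and z0': "\<And>K. K \<noteq> {} \<Longrightarrow> z K = 0"
  proof -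
    show "z {} \<in> carrier R" using z by (simp add: theta_part_Ay EA)
    fix K :: "nat set" assume "K \<noteq> {}"
    then have "\<not> K \<subseteq> {..<m} \<or> card K \<noteq> 0" using finite_subset[of K "{..<m}"] by auto
    then show "z K = 0" using z 0 by (auto simp: theta_part_Ay EA)
  qed
  have "z {} \<in> I" using z0[OF 0] cs_eq[OF zr, of 0 "Suc 0"] by (simp add: Ip_1)
  from I_elements[OF this] obtain c where c: "\<forall>i. c i \<in> carrier R" "z {} = (\<Sum>i<m. c i * t i)" by (elim exE conjE)
  \<comment> \<open>The chain \<open>\<Sum> c_i \<theta>_i\<close>, whose boundary is
    \<open>\<Sum> c_i t_i\<close>.\<close>
  define y where "y K = (\<Sum>i<m. if K = {i} then c i else 0)" for K
  have y0: "y K = 0" if "card K \<noteq> Suc 0" for K unfolding y_def using that by (intro sum.neutral) auto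
  have "y \<in> theta_part m Ay (Suc r)"
    unfolding theta_part_Ay EA 0
  proof (intro conjI allI impI)
    show "y K = 0" if "card K \<noteq> Suc 0" for K by (rule y0[OF that])
    show "y K \<in> carrier R" for K unfolding y_def using c(1) by (intro sum_pol_ring) simp
    show "y K = 0" if "\<not> K \<subseteq> {..<m}" for K unfolding y_def using that by (intro sum.neutral) auto
  qed
  moreover have "dy y K = z K" for K
  proof (cases "K = {}")
    case True
    have "y {i} = c i" if "i < m" for i
    proof -
      have "y {i} = (\<Sum>j<m. if j = i then c j else 0)" unfolding y_def by (rule sum.cong) auto
      then show ?thesis using that by simp
    qed
    moreover have "theta_sign i {} = 0" for i by (simp add: theta_sign_def)
    ultimately show ?thesis using True c(2) by (simp add: dy_def mult.commute)
  next
    case False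
    have "y (insert i K) = 0" if "i \<notin> K" for i
      using that False by (intro y0) (cases "finite K"; simp)
    then have e: "(if i \<in> K then 0 else sgk (theta_sign i K) * y (insert i K)) = 0" for i by simp
    have "dy y K = 0" unfolding dy_def e by simp
    then show ?thesis using z0'[OF False] by simp
  qed
  ultimately show ?thesis by blast
qed

lemma dy_degree: "(\<And>K. card K \<noteq> Suc r \<Longrightarrow> x K = 0) \<Longrightarrow> x \<in> ext_carrier m Ay \<Longrightarrow> card K \<noteq> r \<Longrightarrow> dy x K = 0"
proof -
  assume x: "\<And>K. card K \<noteq> Suc r \<Longrightarrow> x K = 0" "x \<in> ext_carrier m Ay" and K: "card K \<noteq> r"
  have "x (insert i K) = 0" if "i \<notin> K" for i
  proof (cases "finite K")
    case True
    then show ?thesis using that K by (intro x(1)) simp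
  next
    case False
    then have "\<not> insert i K \<subseteq> {..<m}" using finite_subset[of K "{..<m}"] by auto
    then show ?thesis using x(2) by (simp add: EA)
  qed
  then have e: "(if i \<in> K then 0 else sgk (theta_sign i K) * x (insert i K)) = 0" for i by simp
  show ?thesis unfolding dy_def e by simp
qed

text \<open>\<open>\<psi> K \<beta>\<close> is the value of the homotopy on \<open>y\<^sup>\<beta> \<theta>\<^sub>K\<close>; it is chosen by recursion on the degree \<open>r\<close>.\<close>

definition good :: "nat \<Rightarrow> (nat set \<Rightarrow> mono \<Rightarrow> nat set \<Rightarrow> 'k pol) \<Rightarrow> bool" where
  "good r \<psi> \<longleftrightarrow> (\<forall>K \<beta>. \<psi> K \<beta> \<in> theta_part m Ay (Suc (card K))) \<and>
     (\<forall>K \<beta>. K \<subseteq> {..<m} \<longrightarrow> card K < r \<longrightarrow> \<beta> \<in> monomials (yvars m) \<longrightarrow>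
        (\<lambda>L. dy (\<psi> K \<beta>) L + lin \<psi> (dy (eb K (single \<beta> 1))) L + sp (eb K (single \<beta> 1)) L) = eb K (single \<beta> 1))"

lemma const_linear_plus:
  assumes "const_linear (ext_module m Ay) (ext_module m Ay) f" "const_linear (ext_module m Ay) (ext_module m Ay) g"
  shows "const_linear (ext_module m Ay) (ext_module m Ay) (\<lambda>x L. f x L + g x L)"
proof -
  note f = const_linearD[OF assms(1), simplified] and g = const_linearD[OF assms(2), simplified]
  show ?thesis unfolding const_linear_def ext_module_simps Ay_simps
  proof (intro conjI ballI allI Pi_I)
    show "x \<in> ext_carrier m Ay \<Longrightarrow> (\<lambda>L. f x L + g x L) \<in> ext_carrier m Ay" for x
      using f(1)[of x] g(1)[of x] by (simp add: EA)
    fix x y assume x: "x \<in> ext_carrier m Ay" and y: "y \<in> ext_carrier m Ay"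
    show "(\<lambda>L. f (\<lambda>I. x I + y I) L + g (\<lambda>I. x I + y I) L) = (\<lambda>I. f x I + g x I + (f y I + g y I))"
      unfolding f(2)[OF x y] g(2)[OF x y] by (simp add: add_ac)
  next
    fix c x assume x: "x \<in> ext_carrier m Ay"
    show "(\<lambda>L. f (\<lambda>I. const c * x I) L + g (\<lambda>I. const c * x I) L) = (\<lambda>I. const c * (f x I + g x I))"
      unfolding f(3)[OF x] g(3)[OF x] by (simp add: distrib_left)
  qed
qed

lemma const_linear_compose:
  assumes "const_linear (ext_module m Ay) (ext_module m Ay) f" "const_linear (ext_module m Ay) (ext_module m Ay) g"
  shows "const_linear (ext_module m Ay) (ext_module m Ay) (\<lambda>x. f (g x))"
proof -
  note f = const_linearD[OF assms(1), simplified] and g = const_linearD[OF assms(2), simplified]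
  show ?thesis unfolding const_linear_def ext_module_simps Ay_simps
    by (intro conjI ballI allI Pi_I) (simp_all add: f g)
qed

lemma const_linear_ident: "const_linear (ext_module m Ay) (ext_module m Ay) (\<lambda>x. x)"
  by (simp add: const_linear_def)

lemma good_linear: "good r \<psi> \<Longrightarrow> const_linear (ext_module m Ay) (ext_module m Ay) (lin \<psi>)"
  by (rule lin_linear) (simp add: good_def theta_part_Ay)

text \<open>Both sides are \<open>k\<close>-linear in \<open>x\<close>, so the identity extends from
  the elements on which \<open>\<psi>\<close> was chosen.\<close>

lemma good_homotopy:
  assumes g: "good r \<psi>" and x: "x \<in> ext_carrier m Ay" "\<And>K. r \<le> card K \<Longrightarrow> x K = 0"
  shows "(\<lambda>L. dy (lin \<psi> x) L + lin \<psi> (dy x) L + sp x L) = x"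
proof (rule const_linear_ext[where Q = "\<lambda>K. card K < r", OF _ const_linear_ident _ x(1)])
  show "const_linear (ext_module m Ay) (ext_module m Ay) (\<lambda>x L. dy (lin \<psi> x) L + lin \<psi> (dy x) L + sp x L)"
    using const_linear_plus[OF const_linear_plus[OF const_linear_compose[OF dy_linear good_linear[OF g]]
      const_linear_compose[OF good_linear[OF g] dy_linear]] sp_linear] .
  show "(\<lambda>L. dy (lin \<psi> (eb K (single \<beta> 1))) L + lin \<psi> (dy (eb K (single \<beta> 1))) L + sp (eb K (single \<beta> 1)) L) = eb K (single \<beta> 1)"
    if "K \<subseteq> {..<m}" "card K < r" "\<beta> \<in> monomials (yvars m)" for K \<beta>
    using g that unfolding good_def by (simp add: lin_eb)
qed (use x(2) in simp)

text \<open>For \<open>e = y^\<beta> \<theta>_K\<close> of degree \<open>r\<close>, the element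
  \<open>z = e - \<psi> (d_K e) - sp e\<close> is a cycle by the homotopy identity in lower degree,
  and exactness provides a value of \<open>\<psi>\<close> with boundary \<open>z\<close>.\<close>

lemma good_step:
  assumes ex: "koszul_exact R m t" and g: "good r \<psi>" shows "\<exists>\<psi>. good (Suc r) \<psi>"
proof -
  define z where "z K \<beta> = (\<lambda>L. eb K (single \<beta> 1) L + - (lin \<psi> (dy (eb K (single \<beta> 1))) L + sp (eb K (single \<beta> 1)) L))" for K \<beta>
  have y: "\<exists>y\<in>theta_part m Ay (Suc r). dy y = z K \<beta>" if K: "K \<subseteq> {..<m}" "card K = r" and \<beta>: "\<beta> \<in> monomials (yvars m)" for K \<beta>
  proof (rule dy_exact[OF ex])
    let ?e = "eb K (single \<beta> 1)"
    have e: "?e \<in> ext_carrier m Ay" by (intro eb_closed K single_pol_ring \<beta>)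
    note de = dy_closed[OF e]
    note l = const_linearD[OF good_linear[OF g], simplified]
    note dl = const_linearD[OF dy_linear, simplified]
    note spl = const_linearD[OF sp_linear, simplified]
    have lz: "lin \<psi> (\<lambda>_. 0) = (\<lambda>_. 0)" by (rule const_linear_zero_Ay[OF good_linear[OF g]])
    have dz0: "dy (\<lambda>_. 0) = (\<lambda>_. 0)" by (rule const_linear_zero_Ay[OF dy_linear])
    have neg: "(\<lambda>L. - x L) = (\<lambda>L. const (- 1) * x L)" for x :: "nat set \<Rightarrow> 'k pol" by simp
    have negc: "(\<lambda>L. - x L) \<in> ext_carrier m Ay" if "x \<in> ext_carrier m Ay" for x using that by (simp add: EA)
    have dneg: "dy (\<lambda>L. - x L) = (\<lambda>L. - dy x L)" if "x \<in> ext_carrier m Ay" for x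
      unfolding neg using dl(3)[OF that, of "- 1"] by simp
    let ?w = "\<lambda>L. lin \<psi> (dy ?e) L + sp ?e L"
    have w: "?w \<in> ext_carrier m Ay" using l(1)[OF de] spl(1)[OF e] by (simp add: EA)
    have zc: "z K \<beta> \<in> ext_carrier m Ay"
      unfolding EA z_def
    proof (intro conjI allI impI)
      fix L :: "nat set"
      have c: "?e L \<in> carrier R" "?w L \<in> carrier R" using e w unfolding EA by blast+
      show "?e L + - ?w L \<in> carrier R" by (rule pol_ring_closed(3)[OF c(1) pol_ring_closed(5)[OF c(2)]])
      assume "\<not> L \<subseteq> {..<m}"
      then have "?e L = 0" "?w L = 0" using e w unfolding EA by blast+
      then show "?e L + - ?w L = 0" by (simp only: minus_zero add_0)
    qed
    have deg: "dy ?e L = 0" if "Suc (card L) \<noteq> r" for L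
    proof (cases r)
      case 0
      then have "K = {}" using K finite_subset[of K "{..<m}"] by simp
      then have e0: "(if i \<in> L then 0 else sgk (theta_sign i L) * ?e (insert i L)) = 0" for i L by (simp add: eb_def)
      show ?thesis unfolding dy_def e0 by simp
    next
      case (Suc r')
      then show ?thesis using that K(2) by (intro dy_degree[OF _ e, of r']) (auto simp: eb_def)
    qed
    have "z K \<beta> L = 0" if L: "card L \<noteq> r" for L
    proof -
      have "lc (\<lambda>\<gamma>. \<psi> K' \<gamma> L) (dy ?e K') = 0" for K'
      proof (cases "Suc (card K') = r")
        case True
        then have "\<psi> K' \<gamma> L = 0" for \<gamma> using g L by (simp add: good_def theta_part_Ay)
        then show ?thesis by (simp add: lc_def)
      next
        case False
        then show ?thesis by (simp add: deg lc_zero)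
      qed
      then have "lin \<psi> (dy ?e) L = 0" by (simp add: lin_def)
      moreover have "?e L = 0" using L K(2) by (auto simp: eb_def)
      moreover have "sp ?e L = 0"
      proof (cases "L = {}")
        case True
        then have "?e {} = 0" using L K(2) by (auto simp: eb_def)
        moreover have "s0 \<zero>\<^bsub>J\<^esub> = 0" using const_linear_zero[OF J_module Ay_module s0_linear] by simp
        ultimately show ?thesis by (simp add: sp_def)
      qed (simp add: sp_def)
      ultimately show ?thesis by (simp add: z_def)
    qed
    then show "z K \<beta> \<in> theta_part m Ay r" using zc by (simp add: theta_part_Ay)
    have dz: "dy (z K \<beta>) = (\<lambda>L. dy ?e L + - (dy (lin \<psi> (dy ?e)) L + dy (sp ?e) L))"
      unfolding z_def dl(2)[OF e negc[OF w]] dneg[OF w] dl(2)[OF l(1)[OF de] spl(1)[OF e]] ..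
    \<comment> \<open>The identity already known for \<open>d_K e\<close>; its second term vanishes
      because \<open>d_K\<close> squares to zero, its third because \<open>d_K e\<close> has class
      zero.\<close>
    have h: "dy (lin \<psi> (dy ?e)) L = dy ?e L" for L
      using fun_cong[OF good_homotopy[OF g de], of L] deg by (simp add: dy_dy lz sp_dy[OF e])
    have e1: "(if i \<in> L then 0 else sgk (theta_sign i L) * sp ?e (insert i L)) = 0" for i L by (simp add: sp_def)
    have "dy (sp ?e) = (\<lambda>_. 0)" unfolding dy_def e1 by simp
    then show "dy (z K \<beta>) = (\<lambda>_. 0)" unfolding dz h by simp
    \<comment> \<open>In degree zero \<open>z\<close> is \<open>e\<close> minus the chosen
      representative of its class, hence it lies in \<open>I\<close>.\<close>
    assume r: "r = 0"
    then have "dy ?e = (\<lambda>_. 0)" using deg by (simp add: fun_eq_iff)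
    then have "z K \<beta> {} = ?e {} - s0 (cs (Suc 0) (?e {}))" by (simp add: z_def lz sp_def)
    moreover have "?e {} \<in> carrier R" using e by (simp add: EA)
    moreover have "cs (Suc 0) (s0 (cs (Suc 0) (?e {}))) = cs (Suc 0) (?e {})"
      using \<open>?e {} \<in> carrier R\<close> by (intro cs_s0) simp
    ultimately show "cs (Suc 0) (z K \<beta> {}) = \<zero>\<^bsub>J\<^esub>"
      using cs_eq[of "s0 (cs (Suc 0) (?e {}))" "?e {}" "Suc 0"] cs_eq[of "z K \<beta> {}" 0 "Suc 0"] Ip_simps(5)[of "s0 (cs (Suc 0) (?e {})) - ?e {}" "Suc 0"]
      by simp
  qed
  \<comment> \<open>Only values in degree \<open>r\<close> are replaced, so the identities
    established in lower degree stay intact.\<close>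
  define \<psi>' where "\<psi>' K \<beta> = (if K \<subseteq> {..<m} \<and> card K = r \<and> \<beta> \<in> monomials (yvars m)
    then (SOME y. y \<in> theta_part m Ay (Suc r) \<and> dy y = z K \<beta>) else \<psi> K \<beta>)" for K \<beta>
  have \<psi>': "\<psi>' K \<beta> \<in> theta_part m Ay (Suc r) \<and> dy (\<psi>' K \<beta>) = z K \<beta>"
    if "K \<subseteq> {..<m}" "card K = r" "\<beta> \<in> monomials (yvars m)" for K \<beta>
    using someI_ex[OF y[OF that, unfolded Bex_def]] that by (simp add: \<psi>'_def)
  have same: "\<psi>' K = \<psi> K" if "card K \<noteq> r" for K using that by (simp add: \<psi>'_def fun_eq_iff)
  have "good (Suc r) \<psi>'"
    unfolding good_def
  proof (intro conjI allI impI)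
    fix K \<beta>
    show "\<psi>' K \<beta> \<in> theta_part m Ay (Suc (card K))"
    proof (cases "K \<subseteq> {..<m} \<and> card K = r \<and> \<beta> \<in> monomials (yvars m)")
      case True
      then show ?thesis using \<psi>'[of K \<beta>] by simp
    next
      case False
      then have "\<psi>' K \<beta> = \<psi> K \<beta>" by (simp only: \<psi>'_def if_False)
      then show ?thesis using g by (simp add: good_def)
    qed
    assume K: "K \<subseteq> {..<m}" "card K < Suc r" and \<beta>: "\<beta> \<in> monomials (yvars m)"
    let ?e = "eb K (single \<beta> 1)"
    have e: "?e \<in> ext_carrier m Ay" by (intro eb_closed K single_pol_ring \<beta>)
    have "dy ?e L = 0" if "card L = r" for L
    proof (cases "card K")
      case 0
      then have "K = {}" using K finite_subset[of K "{..<m}"] by simp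
      then have e0: "(if i \<in> L then 0 else sgk (theta_sign i L) * ?e (insert i L)) = 0" for i L by (simp add: eb_def)
      show ?thesis unfolding dy_def e0 by simp
    next
      case (Suc r')
      then show ?thesis using that K(2) by (intro dy_degree[OF _ e, of r']) (auto simp: eb_def)
    qed
    \<comment> \<open>\<open>d_K e\<close> lives in degree less than \<open>r\<close>, where
      \<open>\<psi>\<close> and \<open>\<psi>'\<close> agree.\<close>
    then have "dy ?e L = 0 \<or> \<psi>' L = \<psi> L" for L using same by blast
    then have le: "lin \<psi>' (dy ?e) = lin \<psi> (dy ?e)" by (rule lin_cong)
    show "(\<lambda>L. dy (\<psi>' K \<beta>) L + lin \<psi>' (dy ?e) L + sp ?e L) = ?e"
    proof (cases "card K = r")
      case True
      have "dy (\<psi>' K \<beta>) = z K \<beta>" using \<psi>'[OF K(1) True \<beta>] by simp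
      then show ?thesis unfolding le by (simp add: z_def fun_eq_iff)
    next
      case False
      have "(\<lambda>L. dy (\<psi> K \<beta>) L + lin \<psi> (dy ?e) L + sp ?e L) = ?e"
        using g K False \<beta> unfolding good_def by simp
      then show ?thesis unfolding le same[OF False] .
    qed
  qed
  then show ?thesis by blast
qed

end

section \<open>Homogeneous bases\<close>

context module
begin

lemma expansionD:
  assumes "basis_expansion R M B v c"
  shows "c b \<in> carrier R" "b \<notin> B \<Longrightarrow> c b = \<zero>\<^bsub>R\<^esub>" "finite {b. c b \<noteq> \<zero>\<^bsub>R\<^esub>}" "{b. c b \<noteq> \<zero>\<^bsub>R\<^esub>} \<subseteq> B"
    "v = (\<Oplus>\<^bsub>M\<^esub>b\<in>{b. c b \<noteq> \<zero>\<^bsub>R\<^esub>}. c b \<odot>\<^bsub>M\<^esub> b)"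
proof -
  have a: "\<And>b. b \<in> B \<Longrightarrow> c b \<in> carrier R" "\<And>b. b \<notin> B \<Longrightarrow> c b = \<zero>\<^bsub>R\<^esub>"
    using assms unfolding basis_expansion_def by blast+
  then show "c b \<in> carrier R" by (cases "b \<in> B") auto
  show "b \<notin> B \<Longrightarrow> c b = \<zero>\<^bsub>R\<^esub>" by (rule a(2))
  show "{b. c b \<noteq> \<zero>\<^bsub>R\<^esub>} \<subseteq> B" using a(2) by auto
qed (use assms in \<open>simp_all only: basis_expansion_def simp_thms\<close>)

lemma expansion_sum:
  assumes c: "basis_expansion R M B v c" and B: "B \<subseteq> carrier M" and T: "finite T" "{b. c b \<noteq> \<zero>\<^bsub>R\<^esub>} \<subseteq> T" "T \<subseteq> B"
  shows "v = (\<Oplus>\<^bsub>M\<^esub>b\<in>T. c b \<odot>\<^bsub>M\<^esub> b)"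
proof -
  have "(\<Oplus>\<^bsub>M\<^esub>b\<in>{b. c b \<noteq> \<zero>\<^bsub>R\<^esub>}. c b \<odot>\<^bsub>M\<^esub> b) = (\<Oplus>\<^bsub>M\<^esub>b\<in>T. c b \<odot>\<^bsub>M\<^esub> b)"
  proof (rule M.finsum_neutral[OF T(1,2)])
    fix b assume "b \<in> {b. c b \<noteq> \<zero>\<^bsub>R\<^esub>}"
    then show "c b \<odot>\<^bsub>M\<^esub> b \<in> carrier M" using T B by (intro smult_closed expansionD(1)[OF c]) auto
  next
    fix b assume "b \<in> T - {b. c b \<noteq> \<zero>\<^bsub>R\<^esub>}"
    moreover from this have "b \<in> carrier M" using T B by auto
    ultimately show "c b \<odot>\<^bsub>M\<^esub> b = \<zero>\<^bsub>M\<^esub>" by simp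
  qed
  then show ?thesis using expansionD(5)[OF c] by (simp only:)
qed

lemma expansionI:
  assumes B: "B \<subseteq> carrier M" and c: "\<And>b. b \<in> B \<Longrightarrow> c b \<in> carrier R" and T: "finite T" "\<And>b. b \<notin> T \<Longrightarrow> c b = \<zero>\<^bsub>R\<^esub>" "T \<subseteq> B"
    and v: "v = (\<Oplus>\<^bsub>M\<^esub>b\<in>T. c b \<odot>\<^bsub>M\<^esub> b)"
  shows "basis_expansion R M B v c"
proof -
  have sub: "{b. c b \<noteq> \<zero>\<^bsub>R\<^esub>} \<subseteq> T" using T(2) by auto
  have e: "(\<Oplus>\<^bsub>M\<^esub>b\<in>{b. c b \<noteq> \<zero>\<^bsub>R\<^esub>}. c b \<odot>\<^bsub>M\<^esub> b) = (\<Oplus>\<^bsub>M\<^esub>b\<in>T. c b \<odot>\<^bsub>M\<^esub> b)"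
  proof (rule M.finsum_neutral[OF T(1) sub])
    fix b assume "b \<in> {b. c b \<noteq> \<zero>\<^bsub>R\<^esub>}"
    then have "b \<in> B" using sub T by auto
    then show "c b \<odot>\<^bsub>M\<^esub> b \<in> carrier M" using B by (intro smult_closed c) auto
  next
    fix b assume "b \<in> T - {b. c b \<noteq> \<zero>\<^bsub>R\<^esub>}"
    moreover from this have "b \<in> carrier M" using T B by auto
    ultimately show "c b \<odot>\<^bsub>M\<^esub> b = \<zero>\<^bsub>M\<^esub>" by simp
  qed
  show ?thesis unfolding basis_expansion_def e
    using c T(2,3) v finite_subset[OF sub T(1)] by (intro conjI ballI allI impI) auto
qed

lemma expansion_closed: assumes "basis_expansion R M B v c" "B \<subseteq> carrier M" shows "v \<in> carrier M"
proof -
  have "c b \<odot>\<^bsub>M\<^esub> b \<in> carrier M" if "b \<in> {b. c b \<noteq> \<zero>\<^bsub>R\<^esub>}" for b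
    using expansionD(4)[OF assms(1)] that assms(2) by (intro smult_closed expansionD(1)[OF assms(1)]) auto
  then show ?thesis by (subst expansionD(5)[OF assms(1)]) (rule M.finsum_closed, auto)
qed

lemma expansion_add:
  assumes B: "B \<subseteq> carrier M" and c: "basis_expansion R M B v c" and d: "basis_expansion R M B w d"
  shows "basis_expansion R M B (v \<oplus>\<^bsub>M\<^esub> w) (\<lambda>b. c b \<oplus>\<^bsub>R\<^esub> d b)"
proof (rule expansionI[OF B])
  let ?T = "{b. c b \<noteq> \<zero>\<^bsub>R\<^esub>} \<union> {b. d b \<noteq> \<zero>\<^bsub>R\<^esub>}"
  show T: "finite ?T" "?T \<subseteq> B" using expansionD(3,4)[OF c] expansionD(3,4)[OF d] by auto
  have v: "v = (\<Oplus>\<^bsub>M\<^esub>b\<in>?T. c b \<odot>\<^bsub>M\<^esub> b)" by (rule expansion_sum[OF c B T(1) _ T(2)]) auto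
  have w: "w = (\<Oplus>\<^bsub>M\<^esub>b\<in>?T. d b \<odot>\<^bsub>M\<^esub> b)" by (rule expansion_sum[OF d B T(1) _ T(2)]) auto
  have m: "b \<in> carrier M" if "b \<in> ?T" for b using that T(2) B by blast
  show "v \<oplus>\<^bsub>M\<^esub> w = (\<Oplus>\<^bsub>M\<^esub>b\<in>?T. (c b \<oplus>\<^bsub>R\<^esub> d b) \<odot>\<^bsub>M\<^esub> b)"
    unfolding v w
    by (rule M.finsum_add_eq[symmetric]) (simp_all only: m smult_closed expansionD(1)[OF c] expansionD(1)[OF d] smult_l_distr)
qed (use expansionD(1)[OF c] expansionD(1)[OF d] in auto)

lemma expansion_smult:
  assumes B: "B \<subseteq> carrier M" and c: "basis_expansion R M B v c" and r: "r \<in> carrier R"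
  shows "basis_expansion R M B (r \<odot>\<^bsub>M\<^esub> v) (\<lambda>b. r \<otimes>\<^bsub>R\<^esub> c b)"
proof (rule expansionI[OF B _ expansionD(3)[OF c] _ expansionD(4)[OF c]])
  let ?T = "{b. c b \<noteq> \<zero>\<^bsub>R\<^esub>}"
  have m: "b \<in> carrier M" if "b \<in> ?T" for b using that expansionD(4)[OF c] B by blast
  have "r \<odot>\<^bsub>M\<^esub> v = (\<Oplus>\<^bsub>M\<^esub>b\<in>?T. r \<odot>\<^bsub>M\<^esub> (c b \<odot>\<^bsub>M\<^esub> b))"
    by (subst expansionD(5)[OF c], rule finsum_smult_ldistr[OF expansionD(3)[OF c] r]) (use m expansionD(1)[OF c] in auto)
  also have "\<dots> = (\<Oplus>\<^bsub>M\<^esub>b\<in>?T. (r \<otimes>\<^bsub>R\<^esub> c b) \<odot>\<^bsub>M\<^esub> b)"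
    by (rule M.finsum_cong') (use m r expansionD(1)[OF c] in \<open>auto simp: smult_assoc1\<close>)
  finally show "r \<odot>\<^bsub>M\<^esub> v = (\<Oplus>\<^bsub>M\<^esub>b\<in>?T. (r \<otimes>\<^bsub>R\<^esub> c b) \<odot>\<^bsub>M\<^esub> b)" .
qed (use r expansionD(1)[OF c] in auto)

lemma expansion_zero: "B \<subseteq> carrier M \<Longrightarrow> basis_expansion R M B \<zero>\<^bsub>M\<^esub> (\<lambda>_. \<zero>\<^bsub>R\<^esub>)"
  by (rule expansionI[of _ _ "{}"]) auto

lemma expansion_basis: "B \<subseteq> carrier M \<Longrightarrow> b \<in> B \<Longrightarrow> basis_expansion R M B b (\<lambda>b'. if b' = b then \<one>\<^bsub>R\<^esub> else \<zero>\<^bsub>R\<^esub>)"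
  by (rule expansionI[of _ _ "{b}"]) auto

lemma expansion_finsum:
  assumes B: "B \<subseteq> carrier M" and c: "\<And>j. j \<in> J \<Longrightarrow> basis_expansion R M B (v j) (c j)" and "finite J"
  shows "basis_expansion R M B (\<Oplus>\<^bsub>M\<^esub>j\<in>J. v j) (\<lambda>b. \<Oplus>\<^bsub>R\<^esub>j\<in>J. c j b)"
  using assms(3) c
proof (induction J)
  case empty
  show ?case using expansion_zero[OF B] by simp
next
  case (insert j J)
  have "v i \<in> carrier M" if "i \<in> insert j J" for i using expansion_closed[OF insert.prems[OF that] B] .
  moreover have "c i b \<in> carrier R" if "i \<in> insert j J" for i b using expansionD(1)[OF insert.prems[OF that]] .
  moreover have "basis_expansion R M B (v j \<oplus>\<^bsub>M\<^esub> (\<Oplus>\<^bsub>M\<^esub>j\<in>J. v j)) (\<lambda>b. c j b \<oplus>\<^bsub>R\<^esub> (\<Oplus>\<^bsub>R\<^esub>j\<in>J. c j b))"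
    using insert by (intro expansion_add[OF B]) auto
  ultimately show ?case using insert(1,2) by (simp add: Pi_def)
qed

lemma is_basisI:
  assumes "B \<subseteq> carrier M" "\<And>v. v \<in> carrier M \<Longrightarrow> \<exists>c. basis_expansion R M B v c"
    and "\<And>v c c'. v \<in> carrier M \<Longrightarrow> basis_expansion R M B v c \<Longrightarrow> basis_expansion R M B v c' \<Longrightarrow> c = c'"
  shows "is_basis R M B"
  unfolding is_basis_def using assms by (intro conjI ballI ex_ex1I) auto

lemma coord: assumes "is_basis R M B" "v \<in> carrier M" shows "basis_expansion R M B v (coord R M B v)"
proof -
  have "\<exists>!c. basis_expansion R M B v c" using assms unfolding is_basis_def by (elim conjE) (rule bspec)
  then show ?thesis unfolding coord_def by (rule theI')
qed

lemma coord_eq: assumes "is_basis R M B" "basis_expansion R M B v c" shows "coord R M B v = c"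
proof -
  have "v \<in> carrier M" using expansion_closed[OF assms(2)] assms(1) by (simp add: is_basis_def)
  then have "\<exists>!c. basis_expansion R M B v c" using assms(1) by (simp add: is_basis_def)
  then show ?thesis unfolding coord_def by (rule the1_equality) (rule assms(2))
qed

text \<open>Finitely many generators involve finitely many basis elements in total. Any further
  basis element would be a combination of these, and its coordinate at itself would be both one and
  zero.\<close>

lemma finite_basis:
  assumes b: "is_basis R M B" and fg: "finitely_generated R M" and n: "\<one>\<^bsub>R\<^esub> \<noteq> \<zero>\<^bsub>R\<^esub>" shows "finite B"
proof -
  have B: "B \<subseteq> carrier M" using b by (simp add: is_basis_def)
  obtain S where S: "finite S" "S \<subseteq> carrier M" "\<forall>v\<in>carrier M. \<exists>c\<in>S \<rightarrow> carrier R. v = (\<Oplus>\<^bsub>M\<^esub>s\<in>S. c s \<odot>\<^bsub>M\<^esub> s)"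
    using fg unfolding finitely_generated_def by (elim exE conjE)
  let ?F = "\<Union>s\<in>S. {b. coord R M B s b \<noteq> \<zero>\<^bsub>R\<^esub>}"
  have cs: "basis_expansion R M B s (coord R M B s)" if "s \<in> S" for s by (rule coord[OF b]) (use that S(2) in blast)
  have "finite ?F" using S(1) expansionD(3)[OF cs] by blast
  moreover have "B \<subseteq> ?F"
  proof (rule subsetI, rule ccontr)
    fix x assume x: "x \<in> B" "x \<notin> ?F"
    obtain c where c: "c \<in> S \<rightarrow> carrier R" "x = (\<Oplus>\<^bsub>M\<^esub>s\<in>S. c s \<odot>\<^bsub>M\<^esub> s)"
      using S(3) x(1) B by (meson subsetD)
    have "basis_expansion R M B x (\<lambda>b. \<Oplus>\<^bsub>R\<^esub>s\<in>S. c s \<otimes>\<^bsub>R\<^esub> coord R M B s b)"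
      by (subst c(2), rule expansion_finsum[OF B expansion_smult[OF B cs] S(1)]) (use c(1) in auto)
    from trans[OF sym[OF coord_eq[OF b expansion_basis[OF B x(1)]]] coord_eq[OF b this]]
    have "(if x = x then \<one>\<^bsub>R\<^esub> else \<zero>\<^bsub>R\<^esub>) = (\<Oplus>\<^bsub>R\<^esub>s\<in>S. c s \<otimes>\<^bsub>R\<^esub> coord R M B s x)" by (rule fun_cong)
    then have "\<one>\<^bsub>R\<^esub> = (\<Oplus>\<^bsub>R\<^esub>s\<in>S. c s \<otimes>\<^bsub>R\<^esub> coord R M B s x)" by simp
    also have "\<dots> = (\<Oplus>\<^bsub>R\<^esub>s\<in>S. \<zero>\<^bsub>R\<^esub>)"
      by (rule R.finsum_cong') (use x(2) c(1) in \<open>auto simp: Pi_iff\<close>)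
    also have "\<dots> = \<zero>\<^bsub>R\<^esub>" by simp
    finally show False using n by simp
  qed
  ultimately show ?thesis by (rule rev_finite_subset)
qed

end

context factorisation
begin

context
  fixes B assumes hb: "homogeneous_basis R M B" and fin: "finite B"
begin

lemma basis: "is_basis R M B" "B \<subseteq> carrier M"
  using hb by (simp_all add: homogeneous_basis_def is_basis_def)

lemma matrix_closed: "e' \<in> B \<Longrightarrow> matrix_of R M B D e e' \<in> carrier R"
  unfolding matrix_of_def by (rule expansionD(1)[OF coord[OF basis(1) D_closed[OF subsetD[OF basis(2)]]]])

lemma matrix_out: "e' \<in> B \<Longrightarrow> e \<notin> B \<Longrightarrow> matrix_of R M B D e e' = \<zero>\<^bsub>R\<^esub>"
  unfolding matrix_of_def by (rule expansionD(2)[OF coord[OF basis(1) D_closed[OF subsetD[OF basis(2)]]]])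

text \<open>Coordinates of \<open>D (D e'')\<close> computed in two ways. Expanding the inner
  \<open>D\<close> first yields the factors in the opposite order, corrected by commutativity at the
  end.\<close>

lemma matrix_square:
  assumes "e \<in> B" "e'' \<in> B"
  shows "(\<Oplus>\<^bsub>R\<^esub>e'\<in>B. matrix_of R M B D e e' \<otimes>\<^bsub>R\<^esub> matrix_of R M B D e' e'') = (if e = e'' then w else \<zero>\<^bsub>R\<^esub>)"
proof -
  let ?m = "matrix_of R M B D"
  have c: "e \<in> carrier M" if "e \<in> B" for e using that basis(2) by blast
  note mc = matrix_closed
  have mcl: "?m e' e'' \<odot>\<^bsub>M\<^esub> e' \<in> carrier M" if "e' \<in> B" for e' by (rule smult_closed[OF mc[OF assms(2)] c[OF that]])
  have "D e'' = (\<Oplus>\<^bsub>M\<^esub>e'\<in>B. ?m e' e'' \<odot>\<^bsub>M\<^esub> e')"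
    unfolding matrix_of_def
    by (rule expansion_sum[OF coord[OF basis(1) D_closed[OF c[OF assms(2)]]] basis(2) fin expansionD(4)[OF coord[OF basis(1) D_closed[OF c[OF assms(2)]]]]]) simp
  then have "D (D e'') = D (\<Oplus>\<^bsub>M\<^esub>e'\<in>B. ?m e' e'' \<odot>\<^bsub>M\<^esub> e')" by (rule arg_cong)
  also have "\<dots> = (\<Oplus>\<^bsub>M\<^esub>e'\<in>B. D (?m e' e'' \<odot>\<^bsub>M\<^esub> e'))"
    by (rule finsum_additive[OF M.abelian_monoid_axioms M.abelian_monoid_axioms _ D_zero D_add mcl])
      (use D_closed in auto)
  also have "\<dots> = (\<Oplus>\<^bsub>M\<^esub>e'\<in>B. ?m e' e'' \<odot>\<^bsub>M\<^esub> D e')"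
  proof (rule M.finsum_cong')
    show "(\<lambda>e'. ?m e' e'' \<odot>\<^bsub>M\<^esub> D e') \<in> B \<rightarrow> carrier M"
      by (intro Pi_I smult_closed mc[OF assms(2)] D_closed c)
    show "D (?m e' e'' \<odot>\<^bsub>M\<^esub> e') = ?m e' e'' \<odot>\<^bsub>M\<^esub> D e'" if "e' \<in> B" for e'
      by (rule D_smult[OF mc[OF assms(2)] c[OF that]])
  qed simp
  finally have "w \<odot>\<^bsub>M\<^esub> e'' = (\<Oplus>\<^bsub>M\<^esub>e'\<in>B. ?m e' e'' \<odot>\<^bsub>M\<^esub> D e')" using D_square[OF c[OF assms(2)]] by simp
  moreover have "basis_expansion R M B (\<Oplus>\<^bsub>M\<^esub>e'\<in>B. ?m e' e'' \<odot>\<^bsub>M\<^esub> D e') (\<lambda>e. \<Oplus>\<^bsub>R\<^esub>e'\<in>B. ?m e' e'' \<otimes>\<^bsub>R\<^esub> coord R M B (D e') e)"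
    by (rule expansion_finsum[OF basis(2) expansion_smult[OF basis(2) coord[OF basis(1) D_closed[OF c]] mc[OF assms(2)]] fin])
  ultimately have "basis_expansion R M B (w \<odot>\<^bsub>M\<^esub> e'') (\<lambda>e. \<Oplus>\<^bsub>R\<^esub>e'\<in>B. ?m e' e'' \<otimes>\<^bsub>R\<^esub> coord R M B (D e') e)" by simp
  from coord_eq[OF basis(1) this] coord_eq[OF basis(1) expansion_smult[OF basis(2) expansion_basis[OF basis(2) assms(2)] w_closed]]
  have "(\<lambda>e. \<Oplus>\<^bsub>R\<^esub>e'\<in>B. ?m e' e'' \<otimes>\<^bsub>R\<^esub> coord R M B (D e') e) = (\<lambda>e. w \<otimes>\<^bsub>R\<^esub> (if e = e'' then \<one>\<^bsub>R\<^esub> else \<zero>\<^bsub>R\<^esub>))" by (rule trans[OF sym])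
  from fun_cong[OF this, of e] have "(\<Oplus>\<^bsub>R\<^esub>e'\<in>B. ?m e' e'' \<otimes>\<^bsub>R\<^esub> ?m e e') = (if e = e'' then w else \<zero>\<^bsub>R\<^esub>)"
    using w_closed unfolding matrix_of_def by simp
  moreover have "(\<Oplus>\<^bsub>R\<^esub>e'\<in>B. ?m e e' \<otimes>\<^bsub>R\<^esub> ?m e' e'') = (\<Oplus>\<^bsub>R\<^esub>e'\<in>B. ?m e' e'' \<otimes>\<^bsub>R\<^esub> ?m e e')"
    by (rule R.finsum_cong') (use mc assms in \<open>auto intro: R.m_comm\<close>)
  ultimately show ?thesis by simp
qed

lemma basis_grade: "b \<in> B \<Longrightarrow> b \<in> grade M (parity M b)"
  using hb unfolding homogeneous_basis_def parity_def by auto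

lemma grade_smult: "v \<in> grade M s \<Longrightarrow> r \<in> carrier R \<Longrightarrow> r \<odot>\<^bsub>M\<^esub> v \<in> grade M s"
  using submoduleE(4)[OF grade_submodule] by blast

lemma grade_finsum: "(\<And>i. i \<in> J \<Longrightarrow> f i \<in> grade M s) \<Longrightarrow> (\<Oplus>\<^bsub>M\<^esub>i\<in>J. f i) \<in> grade M s"
proof (induction J rule: infinite_finite_induct)
  case (insert j J)
  then have "f j \<in> carrier M" "f \<in> J \<rightarrow> carrier M" using grade_closed by auto
  then show ?case using insert by (simp add: grade_add)
qed (simp_all add: grade_zero M.finsum_infinite)

text \<open>Otherwise \<open>v\<close> would have the two decompositions \<open>v + 0\<close> and
  \<open>0 + v\<close>.\<close>

lemma grade_inter: assumes "v \<in> grade M s" "v \<in> grade M (s + 1)" shows "v = \<zero>\<^bsub>M\<^esub>"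
proof -
  have v: "v \<in> grade M 0" "v \<in> grade M 1" using assms by (cases s; simp)+
  have vc: "v \<in> carrier M" by (rule grade_closed[OF v(1)])
  have "\<exists>!u. fst u \<in> grade M 0 \<and> snd u \<in> grade M 1 \<and> v = fst u \<oplus>\<^bsub>M\<^esub> snd u"
    using lf vc by (simp add: linear_factorisation_def z2_graded_module_def)
  then have "(v, \<zero>\<^bsub>M\<^esub>) = (\<zero>\<^bsub>M\<^esub>, v)"
    by (rule ex1E) (metis M.l_zero M.r_zero fst_conv grade_zero snd_conv v vc)
  then show ?thesis by (rule Pair_inject)
qed

text \<open>Grouping the expansion by the parity of the basis elements gives two homogeneous
  summands. The one of the wrong degree is a difference of elements of degree \<open>s\<close>, so
  it lies in both grades and vanishes.\<close>

lemma coord_grade: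
  assumes v: "v \<in> grade M s" and c: "coord R M B v b \<noteq> \<zero>\<^bsub>R\<^esub>" shows "parity M b = s"
proof (rule ccontr)
  assume ne: "parity M b \<noteq> s"
  let ?c = "coord R M B v"
  note vc = grade_closed[OF v]
  note e = coord[OF basis(1) vc]
  define p where "p r b = (if parity M b = r then ?c b else \<zero>\<^bsub>R\<^esub>)" for r b
  define V where "V r = (\<Oplus>\<^bsub>M\<^esub>b\<in>B. p r b \<odot>\<^bsub>M\<^esub> b)" for r
  have pc: "p r b \<in> carrier R" for r b using expansionD(1)[OF e] by (simp add: p_def)
  have Vr: "basis_expansion R M B (V r) (p r)" for r
    by (rule expansionI[OF basis(2) pc fin _ subset_refl]) (simp_all add: V_def p_def expansionD(2)[OF e])
  have Vg: "V r \<in> grade M r" for r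
    unfolding V_def
  proof (rule grade_finsum)
    fix b assume b: "b \<in> B"
    then have "b \<in> carrier M" using basis(2) by blast
    then show "p r b \<odot>\<^bsub>M\<^esub> b \<in> grade M r"
      using grade_smult[OF basis_grade[OF b] pc[of r b]] grade_zero by (cases "parity M b = r") (simp_all add: p_def)
  qed
  have "parity M b = s + 1 \<longleftrightarrow> parity M b \<noteq> s" for b by (cases s; cases "parity M b") simp_all
  then have "p s b \<oplus>\<^bsub>R\<^esub> p (s + 1) b = ?c b" for b using expansionD(1)[OF e] by (simp add: p_def)
  then have "(\<lambda>b. p s b \<oplus>\<^bsub>R\<^esub> p (s + 1) b) = ?c" by (rule ext)
  then have Vx: "basis_expansion R M B (V s \<oplus>\<^bsub>M\<^esub> V (s + 1)) ?c" using expansion_add[OF basis(2) Vr[of s] Vr[of "s + 1"]] by simp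
  have vs: "v = V s \<oplus>\<^bsub>M\<^esub> V (s + 1)" by (rule trans[OF expansionD(5)[OF e] expansionD(5)[OF Vx, symmetric]])
  note Vc = grade_closed[OF Vg]
  have "u' = (u \<oplus>\<^bsub>M\<^esub> u') \<ominus>\<^bsub>M\<^esub> u" if "u \<in> carrier M" "u' \<in> carrier M" for u u'
    using that by (simp add: a_minus_def M.a_comm[of u u'] M.a_assoc M.r_neg)
  from this[OF Vc[of s] Vc[of "s + 1"]] have "V (s + 1) = v \<ominus>\<^bsub>M\<^esub> V s" unfolding vs[symmetric] .
  then have "V (s + 1) \<in> grade M s" using grade_minus[OF v Vg[of s]] by simp
  then have "V (s + 1) = \<zero>\<^bsub>M\<^esub>" using grade_inter Vg by blast
  then have "v = V s" using vs Vc by simp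
  then have "?c = p s" using coord_eq[OF basis(1) Vr[of s]] by simp
  then have "?c b = p s b" by (rule fun_cong)
  then show False using c ne by (simp add: p_def)
qed

lemma matrix_odd: "e' \<in> B \<Longrightarrow> matrix_of R M B D e e' \<noteq> \<zero>\<^bsub>R\<^esub> \<Longrightarrow> parity M e = parity M e' + 1"
  unfolding matrix_of_def by (rule coord_grade[OF D_grade[OF basis_grade]])

end

end

text \<open>Applied twice: from \<open>A[x,z]\<close> to the tensor product over
  \<open>BY \<times> BX\<close>, and from there to \<open>S_m\<close> tensored with it over the
  subsets of \<open>{..<m}\<close>.\<close>

lemma direct_sum_basis:
  fixes N :: "('r, 'n, 'q) module_scheme" and G :: "('r, 'i \<Rightarrow> 'n, 's) module_scheme"
  assumes N: "module R N" and G: "module R G" and b: "is_basis R N B" and fin: "finite S"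
    and cG: "carrier G = {g. (\<forall>i. g i \<in> carrier N) \<and> (\<forall>i. i \<notin> S \<longrightarrow> g i = \<zero>\<^bsub>N\<^esub>)}"
    and ops: "zero G = (\<lambda>_. \<zero>\<^bsub>N\<^esub>)" "add G = (\<lambda>g h i. g i \<oplus>\<^bsub>N\<^esub> h i)" "smult G = (\<lambda>r g i. r \<odot>\<^bsub>N\<^esub> g i)"
  shows "is_basis R G (\<Union>i\<in>S. (\<lambda>b j. if j = i then b else \<zero>\<^bsub>N\<^esub>) ` B)"
proof -
  interpret N: module R N by fact
  interpret G: module R G by fact
  define dl where "dl i = (\<lambda>(b::'n) (j::'i). if j = i then b else \<zero>\<^bsub>N\<^esub>)" for i
  let ?B = "\<Union>i\<in>S. dl i ` B"
  have B: "B \<subseteq> carrier N" using b by (simp add: is_basis_def)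
  have dlc: "dl i v \<in> carrier G" if "i \<in> S" "v \<in> carrier N" for i v
    using that by (simp add: cG dl_def)
  have BG: "?B \<subseteq> carrier G" using dlc B by blast
  have inj: "inj_on (dl i) T" for i T by (rule inj_onI) (metis dl_def)
  \<comment> \<open>Existence: an expansion in one summand is one in the direct sum, extended by
    zero.\<close>
  have push: "basis_expansion R G ?B (dl i v) (\<lambda>e. if e \<in> dl i ` B then c (e i) else \<zero>\<^bsub>R\<^esub>)"
    if c: "basis_expansion R N B v c" and i: "i \<in> S" for i v c
  proof (rule G.expansionI[OF BG])
    let ?T = "{b. c b \<noteq> \<zero>\<^bsub>R\<^esub>}"
    note T = N.expansionD[OF c]
    have Tc: "b \<in> carrier N" if "b \<in> ?T" for b using that T(4) B by blast
    show "finite (dl i ` ?T)" using T(3) by simp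
    show "dl i ` ?T \<subseteq> ?B" using T(4) i by blast
    show "(if e \<in> dl i ` B then c (e i) else \<zero>\<^bsub>R\<^esub>) = \<zero>\<^bsub>R\<^esub>" if "e \<notin> dl i ` ?T" for e
      using that by (auto simp: dl_def)
    show "(if e \<in> dl i ` B then c (e i) else \<zero>\<^bsub>R\<^esub>) \<in> carrier R" for e using T(1) by simp
    have "dl i v = dl i (\<Oplus>\<^bsub>N\<^esub>b\<in>?T. c b \<odot>\<^bsub>N\<^esub> b)" using T(5) by simp
    also have "\<dots> = (\<Oplus>\<^bsub>G\<^esub>b\<in>?T. dl i (c b \<odot>\<^bsub>N\<^esub> b))"
      by (rule finsum_additive[OF N.M.abelian_monoid_axioms G.M.abelian_monoid_axioms])
        (use dlc[OF i] T(1) Tc in \<open>auto simp: ops dl_def fun_eq_iff\<close>)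
    also have "\<dots> = (\<Oplus>\<^bsub>G\<^esub>b\<in>?T. (if dl i b \<in> dl i ` B then c (dl i b i) else \<zero>\<^bsub>R\<^esub>) \<odot>\<^bsub>G\<^esub> dl i b)"
    proof (rule G.M.finsum_cong')
      fix b assume b: "b \<in> ?T"
      then have "dl i b \<in> dl i ` B" using T(4) by blast
      then show "dl i (c b \<odot>\<^bsub>N\<^esub> b) = (if dl i b \<in> dl i ` B then c (dl i b i) else \<zero>\<^bsub>R\<^esub>) \<odot>\<^bsub>G\<^esub> dl i b"
        using T(1)[of b] by (auto simp: ops dl_def fun_eq_iff)
    qed (use T(1) Tc in \<open>auto intro!: G.smult_closed dlc[OF i]\<close>)
    also have "\<dots> = (\<Oplus>\<^bsub>G\<^esub>e\<in>dl i ` ?T. (if e \<in> dl i ` B then c (e i) else \<zero>\<^bsub>R\<^esub>) \<odot>\<^bsub>G\<^esub> e)"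
      by (rule G.M.finsum_reindex[symmetric, OF _ inj]) (use T(1) Tc in \<open>auto intro!: G.smult_closed dlc[OF i]\<close>)
    finally show "dl i v = (\<Oplus>\<^bsub>G\<^esub>e\<in>dl i ` ?T. (if e \<in> dl i ` B then c (e i) else \<zero>\<^bsub>R\<^esub>) \<odot>\<^bsub>G\<^esub> e)" .
  qed
  have gN: "g i \<in> carrier N" if "g \<in> carrier G" for g i using that by (simp add: cG)
  have pw: "(\<Oplus>\<^bsub>G\<^esub>j\<in>J. f j) i = (\<Oplus>\<^bsub>N\<^esub>j\<in>J. f j i)" if "\<And>j. j \<in> J \<Longrightarrow> f j \<in> carrier G" for J i and f :: "'z \<Rightarrow> 'i \<Rightarrow> 'n"
  proof -
    have "(\<Oplus>\<^bsub>G\<^esub>j\<in>J. f j) = (\<lambda>i. \<Oplus>\<^bsub>N\<^esub>j\<in>J. f j i)"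
      by (rule finsum_pointwise[OF N.M.abelian_group_axioms G.M.abelian_group_axioms ops(1,2)]) (simp_all only: gN that)
    then show ?thesis by (rule fun_cong)
  qed
  show ?thesis
    unfolding dl_def[symmetric]
  proof (rule G.is_basisI[OF BG])
    fix g assume g: "g \<in> carrier G"
    have "g = (\<Oplus>\<^bsub>G\<^esub>i\<in>S. dl i (g i))"
    proof
      fix j
      have "(\<Oplus>\<^bsub>G\<^esub>i\<in>S. dl i (g i)) j = (\<Oplus>\<^bsub>N\<^esub>i\<in>S. dl i (g i) j)" by (rule pw) (intro dlc gN g)
      also have "\<dots> = (\<Oplus>\<^bsub>N\<^esub>i\<in>S. if j = i then g i else \<zero>\<^bsub>N\<^esub>)" unfolding dl_def ..
      also have "\<dots> = g j"
      proof (cases "j \<in> S")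
        case True
        then show ?thesis by (rule N.M.finsum_singleton[OF _ fin]) (use gN[OF g] in auto)
      next
        case False
        then have "(\<Oplus>\<^bsub>N\<^esub>i\<in>S. if j = i then g i else \<zero>\<^bsub>N\<^esub>) = (\<Oplus>\<^bsub>N\<^esub>i\<in>S. \<zero>\<^bsub>N\<^esub>)"
          by (intro N.M.finsum_cong') auto
        then show ?thesis using g False by (simp add: cG)
      qed
      finally show "g j = (\<Oplus>\<^bsub>G\<^esub>i\<in>S. dl i (g i)) j" by simp
    qed
    moreover have "basis_expansion R G ?B (\<Oplus>\<^bsub>G\<^esub>i\<in>S. dl i (g i)) (\<lambda>e. \<Oplus>\<^bsub>R\<^esub>i\<in>S. (if e \<in> dl i ` B then coord R N B (g i) (e i) else \<zero>\<^bsub>R\<^esub>))"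
      by (rule G.expansion_finsum[OF BG _ fin]) (rule push[OF N.coord[OF b gN[OF g]]])
    ultimately show "\<exists>c. basis_expansion R G ?B g c" by (metis (no_types))
  next
    \<comment> \<open>Uniqueness: the coefficients belonging to the summand \<open>i\<close> expand
      the component \<open>g i\<close>, so they are its coordinates.\<close>
    have pull: "c (dl i x) = coord R N B (g i) x" if c: "basis_expansion R G ?B g c" and i: "i \<in> S" and x: "x \<in> B" for g c i x
    proof -
      note T = G.expansionD[OF c]
      let ?S = "{e. c e \<noteq> \<zero>\<^bsub>R\<^esub>}" and ?T = "{b \<in> B. c (dl i b) \<noteq> \<zero>\<^bsub>R\<^esub>}" and ?c = "\<lambda>b. if b \<in> B then c (dl i b) else \<zero>\<^bsub>R\<^esub>"
      have Sc: "e \<in> carrier G" if "e \<in> ?S" for e using that T(4) BG by blast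
      have "basis_expansion R N B (g i) ?c"
      proof (rule N.expansionI[OF B])
        have sub: "dl i ` ?T \<subseteq> ?S" by auto
        show fT: "finite ?T" by (rule finite_imageD[OF finite_subset[OF sub T(3)] inj])
        show "?T \<subseteq> B" by auto
        have cl: "(c (dl i b) \<odot>\<^bsub>G\<^esub> dl i b) i \<in> carrier N" if "b \<in> B" for b
          by (rule gN[OF G.smult_closed[OF T(1) dlc[OF i subsetD[OF B that]]]])
        have "g i = (\<Oplus>\<^bsub>G\<^esub>e\<in>?S. c e \<odot>\<^bsub>G\<^esub> e) i" using T(5) by simp
        also have "\<dots> = (\<Oplus>\<^bsub>N\<^esub>e\<in>?S. (c e \<odot>\<^bsub>G\<^esub> e) i)" by (rule pw) (intro G.smult_closed T(1) Sc)
        also have "\<dots> = (\<Oplus>\<^bsub>N\<^esub>e\<in>dl i ` ?T. (c e \<odot>\<^bsub>G\<^esub> e) i)"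
        proof (rule N.M.finsum_neutral[symmetric, OF T(3) sub])
          fix e assume e: "e \<in> ?S - dl i ` ?T"
          then obtain i' y where y: "i' \<in> S" "y \<in> B" "e = dl i' y" using T(4) by blast
          then have "i' \<noteq> i" using e by blast
          then show "(c e \<odot>\<^bsub>G\<^esub> e) i = \<zero>\<^bsub>N\<^esub>" using T(1) y(3) by (simp add: ops dl_def)
        next
          fix e assume "e \<in> dl i ` ?T"
          then have "e \<in> ?S" using sub by blast
          then show "(c e \<odot>\<^bsub>G\<^esub> e) i \<in> carrier N" by (intro gN G.smult_closed T(1) Sc)
        qed
        also have "\<dots> = (\<Oplus>\<^bsub>N\<^esub>b\<in>?T. (c (dl i b) \<odot>\<^bsub>G\<^esub> dl i b) i)"
          by (rule N.M.finsum_reindex[OF _ inj]) (use cl in auto)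
        also have "\<dots> = (\<Oplus>\<^bsub>N\<^esub>b\<in>?T. ?c b \<odot>\<^bsub>N\<^esub> b)"
          by (rule N.M.finsum_cong') (use B T(1) in \<open>auto simp: ops dl_def intro!: N.smult_closed\<close>)
        finally show "g i = (\<Oplus>\<^bsub>N\<^esub>b\<in>?T. ?c b \<odot>\<^bsub>N\<^esub> b)" .
      qed (use T(1) in auto)
      from N.coord_eq[OF b this] x show ?thesis by simp
    qed
    fix g c c' assume c: "basis_expansion R G ?B g c" and c': "basis_expansion R G ?B g c'"
    show "c = c'"
    proof
      fix e
      show "c e = c' e"
      proof (cases "e \<in> ?B")
        case True
        then obtain i x where "i \<in> S" "x \<in> B" "e = dl i x" by blast
        then show ?thesis using pull[OF c] pull[OF c'] by simp
      next
        case False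
        then show ?thesis using G.expansionD(2)[OF c] G.expansionD(2)[OF c'] by simp
      qed
    qed
  qed
qed

section \<open>Bases over \<open>k[x,z]\<close> from bases over \<open>k\<close>\<close>

context coeff_module
begin

lemma act_delta:
  assumes p: "p \<in> carrier (kxz n l)" and a: "a \<in> carrier A"
  shows "act A p (\<lambda>\<mu>. if \<mu> = 0 then a else \<zero>\<^bsub>A\<^esub>) \<mu> = const (lookup p \<mu>) \<odot>\<^bsub>A\<^esub> a"
proof -
  let ?M = "monomials (range XV \<union> range ZV)" and ?d = "\<lambda>\<mu>. if \<mu> = (0 :: mono) then a else \<zero>\<^bsub>A\<^esub>"
  let ?D = "{\<nu> \<in> ?M. \<exists>\<rho>. \<mu> = \<nu> + \<rho>}"
  have y: "ycoeff p \<nu> = const (lookup p \<nu>)" if "\<nu> \<in> ?D" for \<nu> using ycoeff_kxz[OF p] that by blast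
  have t: "ycoeff p \<nu> \<odot>\<^bsub>A\<^esub> ?d (\<mu> - \<nu>) = (if \<mu> = \<nu> then const (lookup p \<nu>) \<odot>\<^bsub>A\<^esub> a else \<zero>\<^bsub>A\<^esub>)" if \<nu>: "\<nu> \<in> ?D" for \<nu>
  proof -
    obtain \<rho> where "\<mu> = \<nu> + \<rho>" using \<nu> by blast
    then have "\<mu> - \<nu> = 0 \<longleftrightarrow> \<mu> = \<nu>" by simp
    then show ?thesis using smult_r_null[of "const (lookup p \<nu>)"] by (simp add: y[OF \<nu>])
  qed
  have s: "act A p ?d \<mu> = (\<Oplus>\<nu>\<in>?D. if \<mu> = \<nu> then const (lookup p \<nu>) \<odot>\<^bsub>A\<^esub> a else \<zero>\<^bsub>A\<^esub>)"
    unfolding act_def by (rule M.finsum_cong') (use t a in \<open>auto intro!: smult_closed\<close>)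
  show ?thesis
  proof (cases "\<mu> \<in> ?M")
    case True
    have "\<mu> = \<mu> + 0" by simp
    then have "\<mu> \<in> ?D" using True by blast
    moreover have "finite ?D" using finite_divisors[of \<mu>] by (rule rev_finite_subset) blast
    ultimately show ?thesis unfolding s
      by (intro M.finsum_singleton) (use a in \<open>auto intro!: smult_closed\<close>)
  next
    case False
    then have "(\<Oplus>\<nu>\<in>?D. if \<mu> = \<nu> then const (lookup p \<nu>) \<odot>\<^bsub>A\<^esub> a else \<zero>\<^bsub>A\<^esub>) = (\<Oplus>\<nu>\<in>?D. \<zero>\<^bsub>A\<^esub>)"
      by (intro M.finsum_cong') auto
    moreover have "lookup p \<mu> = 0"
    proof -
      have "monomials (xvars n \<union> zvars l) \<subseteq> ?M" by (auto simp: monomials_def)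
      then show ?thesis using p False by (auto simp: pol_ring_def in_keys_iff)
    qed
    ultimately show ?thesis unfolding s using a by (simp add: smult_pol)
  qed
qed

text \<open>\<open>A[x,z]\<close> is \<open>A \<otimes>_k k[x,z]\<close>, so a
  \<open>k\<close>-basis of \<open>A\<close>, placed at the monomial \<open>1\<close>, is a basis
  over \<open>k[x,z]\<close>. The coefficient at \<open>\<mu>\<close> of a coordinate polynomial is
  the \<open>k\<close>-coordinate of \<open>g \<mu>\<close>.\<close>

lemma poly_ext_basis:
  assumes b: "is_basis type_ring (restrict_scalars const A) BA"
  shows "is_basis (kxz n l) (poly_ext n l A) ((\<lambda>a \<mu>. if \<mu> = 0 then a else \<zero>\<^bsub>A\<^esub>) ` BA)"
proof -
  let ?k = "restrict_scalars const A" and ?P = "poly_ext n l A" and ?R = "kxz n l"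
  interpret K: module type_ring ?k by (rule module_restrict_scalars[OF module_axioms])
  interpret P: module ?R ?P by (rule module_pol_ring_mono[OF poly_ext_module]) blast
  define d where "d = (\<lambda>a \<mu>. if \<mu> = (0 :: mono) then a else \<zero>\<^bsub>A\<^esub>)"
  have ad: "act A p (d a) \<mu> = const (lookup p \<mu>) \<odot>\<^bsub>A\<^esub> a" if "p \<in> carrier ?R" "a \<in> carrier A" for p a \<mu>
    unfolding d_def by (rule act_delta[OF that])
  have B: "BA \<subseteq> carrier A" using b by (simp add: is_basis_def)
  have z: "(0 :: mono) \<in> monomials (xvars n \<union> zvars l)" by (simp add: monomials_def)
  have dc: "d a \<in> carrier ?P" if "a \<in> carrier A" for a
  proof -
    have "finite {\<mu>. d a \<mu> \<noteq> \<zero>\<^bsub>A\<^esub>}" by (rule finite_subset[of _ "{0}"]) (auto simp: d_def)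
    then show ?thesis using that z by (auto simp: poly_ext_def d_def)
  qed
  have inj: "inj_on d T" for T by (rule inj_onI) (metis d_def)
  have BP: "d ` BA \<subseteq> carrier ?P" using dc B by blast
  have pc: "g \<mu> \<in> carrier A" if "g \<in> carrier ?P" for g \<mu> using that by (simp add: poly_ext_def)
  have pw: "(\<Oplus>\<^bsub>?P\<^esub>j\<in>J. f j) \<mu> = (\<Oplus>\<^bsub>A\<^esub>j\<in>J. f j \<mu>)" if "\<And>j. j \<in> J \<Longrightarrow> f j \<in> carrier ?P" for J \<mu> and f :: "'z \<Rightarrow> _"
  proof -
    have "(\<Oplus>\<^bsub>?P\<^esub>j\<in>J. f j) = (\<lambda>\<mu>. \<Oplus>\<^bsub>A\<^esub>j\<in>J. f j \<mu>)"
      by (rule finsum_pointwise[OF M.abelian_group_axioms P.M.abelian_group_axioms]) (simp_all add: pc that)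
    then show ?thesis by (rule fun_cong)
  qed
  have cd: "d (const x \<odot>\<^bsub>A\<^esub> a) = act A (const x) (d a)" if "a \<in> carrier A" for x a
    using that by (intro ext) (simp add: ad, simp add: d_def const_def lookup_single when_def smult_pol[unfolded const_def] const_simps(1)[unfolded const_def])
  have push: "basis_expansion ?R ?P (d ` BA) (d v) (\<lambda>e. if e \<in> d ` BA then const (c (e 0)) else \<zero>\<^bsub>?R\<^esub>)"
    if c: "basis_expansion type_ring ?k BA v c" for v c
  proof (rule P.expansionI[OF BP])
    let ?T = "{b. c b \<noteq> \<zero>\<^bsub>type_ring\<^esub>}"
    note T = K.expansionD[OF c]
    have Tc: "b \<in> carrier A" if "b \<in> ?T" for b using that T(4) B by blast
    show "finite (d ` ?T)" using T(3) by simp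
    show "d ` ?T \<subseteq> d ` BA" using T(4) by blast
    show "(if e \<in> d ` BA then const (c (e 0)) else \<zero>\<^bsub>?R\<^esub>) = \<zero>\<^bsub>?R\<^esub>" if "e \<notin> d ` ?T" for e
      using that by (auto simp: d_def)
    show "(if e \<in> d ` BA then const (c (e 0)) else \<zero>\<^bsub>?R\<^esub>) \<in> carrier ?R" for e by simp
    have "d v = d (\<Oplus>\<^bsub>A\<^esub>b\<in>?T. const (c b) \<odot>\<^bsub>A\<^esub> b)"
      using T(5) unfolding finsum_restrict_scalars restrict_scalars_simps by (rule arg_cong)
    also have "\<dots> = (\<Oplus>\<^bsub>?P\<^esub>b\<in>?T. d (const (c b) \<odot>\<^bsub>A\<^esub> b))"
      by (rule finsum_additive[OF M.abelian_monoid_axioms P.M.abelian_monoid_axioms])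
        (use dc Tc in \<open>auto simp: d_def fun_eq_iff intro!: smult_closed\<close>)
    also have "\<dots> = (\<Oplus>\<^bsub>?P\<^esub>b\<in>?T. (if d b \<in> d ` BA then const (c (d b 0)) else \<zero>\<^bsub>?R\<^esub>) \<odot>\<^bsub>?P\<^esub> d b)"
    proof (rule P.M.finsum_cong')
      fix b assume b: "b \<in> ?T"
      then have "d b \<in> d ` BA" using T(4) by blast
      then show "d (const (c b) \<odot>\<^bsub>A\<^esub> b) = (if d b \<in> d ` BA then const (c (d b 0)) else \<zero>\<^bsub>?R\<^esub>) \<odot>\<^bsub>?P\<^esub> d b"
        using cd[OF Tc[OF b], of "c b"] by (simp add: d_def)
    qed (use Tc in \<open>auto intro!: P.smult_closed[simplified] dc\<close>)
    also have "\<dots> = (\<Oplus>\<^bsub>?P\<^esub>e\<in>d ` ?T. (if e \<in> d ` BA then const (c (e 0)) else \<zero>\<^bsub>?R\<^esub>) \<odot>\<^bsub>?P\<^esub> e)"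
      by (rule P.M.finsum_reindex[symmetric, OF _ inj]) (use Tc in \<open>auto intro!: P.smult_closed[simplified] dc\<close>)
    finally show "d v = (\<Oplus>\<^bsub>?P\<^esub>e\<in>d ` ?T. (if e \<in> d ` BA then const (c (e 0)) else \<zero>\<^bsub>?R\<^esub>) \<odot>\<^bsub>?P\<^esub> e)" .
  qed
  show ?thesis
    unfolding d_def[symmetric]
  proof (rule P.is_basisI[OF BP])
    fix g assume g: "g \<in> carrier ?P"
    let ?S = "{\<mu>. g \<mu> \<noteq> \<zero>\<^bsub>A\<^esub>}"
    have S: "finite ?S" "?S \<subseteq> monomials (xvars n \<union> zvars l)" using g by (auto simp: poly_ext_def)
    have s1: "single \<mu> 1 \<in> carrier ?R" if "\<mu> \<in> ?S" for \<mu> using that S(2) by (intro single_pol_ring) blast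
    have e: "basis_expansion ?R ?P (d ` BA) (single \<mu> 1 \<odot>\<^bsub>?P\<^esub> d (g \<mu>))
        (\<lambda>e. single \<mu> 1 \<otimes>\<^bsub>?R\<^esub> (if e \<in> d ` BA then const (coord type_ring ?k BA (g \<mu>) (e 0)) else \<zero>\<^bsub>?R\<^esub>))" if "\<mu> \<in> ?S" for \<mu>
      by (rule P.expansion_smult[OF BP push[OF K.coord[OF b]] s1[OF that]]) (simp add: pc[OF g])
    have ge: "g = (\<Oplus>\<^bsub>?P\<^esub>\<mu>\<in>?S. single \<mu> 1 \<odot>\<^bsub>?P\<^esub> d (g \<mu>))"
    proof
      fix \<nu>
      have "(\<Oplus>\<^bsub>?P\<^esub>\<mu>\<in>?S. single \<mu> 1 \<odot>\<^bsub>?P\<^esub> d (g \<mu>)) \<nu> = (\<Oplus>\<^bsub>A\<^esub>\<mu>\<in>?S. (single \<mu> 1 \<odot>\<^bsub>?P\<^esub> d (g \<mu>)) \<nu>)"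
        by (rule pw) (intro P.smult_closed s1 dc pc g)
      also have "\<dots> = (\<Oplus>\<^bsub>A\<^esub>\<mu>\<in>?S. if \<nu> = \<mu> then g \<mu> else \<zero>\<^bsub>A\<^esub>)"
      proof (rule M.finsum_cong')
        fix \<mu> assume "\<mu> \<in> ?S"
        then show "(single \<mu> 1 \<odot>\<^bsub>?P\<^esub> d (g \<mu>)) \<nu> = (if \<nu> = \<mu> then g \<mu> else \<zero>\<^bsub>A\<^esub>)"
          using ad[OF s1 pc[OF g], of \<mu> \<mu> \<nu>] pc[OF g] by (simp add: lookup_single when_def smult_pol)
      qed (auto simp: pc[OF g])
      also have "\<dots> = g \<nu>"
      proof (cases "\<nu> \<in> ?S")
        case True
        then show ?thesis by (rule M.finsum_singleton[OF _ S(1)]) (use pc[OF g] in auto)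
      next
        case False
        then have "(\<Oplus>\<^bsub>A\<^esub>\<mu>\<in>?S. if \<nu> = \<mu> then g \<mu> else \<zero>\<^bsub>A\<^esub>) = (\<Oplus>\<^bsub>A\<^esub>\<mu>\<in>?S. \<zero>\<^bsub>A\<^esub>)"
          by (intro M.finsum_cong') auto
        then show ?thesis using False by simp
      qed
      finally show "g \<nu> = (\<Oplus>\<^bsub>?P\<^esub>\<mu>\<in>?S. single \<mu> 1 \<odot>\<^bsub>?P\<^esub> d (g \<mu>)) \<nu>" by simp
    qed
    have "\<exists>c. basis_expansion ?R ?P (d ` BA) (\<Oplus>\<^bsub>?P\<^esub>\<mu>\<in>?S. single \<mu> 1 \<odot>\<^bsub>?P\<^esub> d (g \<mu>)) c"
      by (rule exI, rule P.expansion_finsum[OF BP _ S(1)], rule e)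
    then show "\<exists>c. basis_expansion ?R ?P (d ` BA) g c" unfolding ge[symmetric] .
  next
    have pull: "lookup (c (d x)) \<mu> = coord type_ring ?k BA (g \<mu>) x" if c: "basis_expansion ?R ?P (d ` BA) g c" and x: "x \<in> BA" for g c x \<mu>
    proof -
      note T = P.expansionD[OF c]
      let ?S = "{e. c e \<noteq> \<zero>\<^bsub>?R\<^esub>}" and ?T = "{b \<in> BA. c (d b) \<noteq> \<zero>\<^bsub>?R\<^esub>}" and ?c = "\<lambda>b. if b \<in> BA then lookup (c (d b)) \<mu> else 0"
      have ST: "?S = d ` ?T" using T(4) by blast
      have Tc: "b \<in> carrier A" if "b \<in> ?T" for b using that B by blast
      have Sc: "e \<in> carrier ?P" if "e \<in> ?S" for e using that T(4) BP by blast
      have "basis_expansion type_ring ?k BA (g \<mu>) ?c"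
      proof (rule K.expansionI)
        show "BA \<subseteq> carrier ?k" using B by simp
        show "finite ?T" using T(3) unfolding ST by (rule finite_imageD[OF _ inj])
        show "?T \<subseteq> BA" by auto
        show "?c b = \<zero>\<^bsub>type_ring\<^esub>" if "b \<notin> ?T" for b using that by auto
        have cl: "(c (d b) \<odot>\<^bsub>?P\<^esub> d b) \<mu> \<in> carrier A" if "b \<in> ?T" for b
          by (rule pc[OF P.smult_closed[OF T(1) dc[OF Tc[OF that]]]])
        have "g \<mu> = (\<Oplus>\<^bsub>?P\<^esub>e\<in>?S. c e \<odot>\<^bsub>?P\<^esub> e) \<mu>" using T(5) by simp
        also have "\<dots> = (\<Oplus>\<^bsub>A\<^esub>e\<in>?S. (c e \<odot>\<^bsub>?P\<^esub> e) \<mu>)" by (rule pw) (intro P.smult_closed T(1) Sc)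
        also have "\<dots> = (\<Oplus>\<^bsub>A\<^esub>b\<in>?T. (c (d b) \<odot>\<^bsub>?P\<^esub> d b) \<mu>)"
          unfolding ST by (rule M.finsum_reindex[OF _ inj]) (use cl in auto)
        also have "\<dots> = (\<Oplus>\<^bsub>A\<^esub>b\<in>?T. const (?c b) \<odot>\<^bsub>A\<^esub> b)"
          by (rule M.finsum_cong') (use Tc ad[OF T(1)] in \<open>auto intro!: smult_closed\<close>)
        finally show "g \<mu> = (\<Oplus>\<^bsub>?k\<^esub>b\<in>?T. ?c b \<odot>\<^bsub>?k\<^esub> b)" unfolding finsum_restrict_scalars restrict_scalars_simps .
      qed simp
      from K.coord_eq[OF b this] x show ?thesis by simp
    qed
    fix g c c' assume c: "basis_expansion ?R ?P (d ` BA) g c" and c': "basis_expansion ?R ?P (d ` BA) g c'"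
    show "c = c'"
    proof
      fix e
      show "c e = c' e"
      proof (cases "e \<in> d ` BA")
        case True
        then obtain x where "x \<in> BA" "e = d x" by blast
        then show ?thesis using pull[OF c] pull[OF c'] by (intro poly_mapping_eqI) simp
      next
        case False
        then show ?thesis using P.expansionD(2)[OF c] P.expansionD(2)[OF c'] by simp
      qed
    qed
  qed
qed

end

lemma monomial_basis: "is_basis type_ring (restrict_scalars const (via_hom (\<lambda>p. p) (pol_ring S))) ((\<lambda>\<beta>. single \<beta> 1) ` monomials S)"
proof -
  let ?A = "via_hom (\<lambda>p :: 'k::comm_ring_1 pol. p) (pol_ring S)" and ?s = "\<lambda>\<beta>. single \<beta> (1 :: 'k)"
  have As: "carrier ?A = carrier (pol_ring S)" "zero ?A = 0" "add ?A = (+)" "smult ?A = (*)"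
    by (simp_all add: via_hom_def fun_eq_iff)
  have fe: "finsum ?A = finsum (pol_ring S)" by (simp add: finsum_def finprod_def fun_eq_iff via_hom_def)
  have fs: "finsum (restrict_scalars const ?A) f T = sum f T" if "\<And>i. i \<in> T \<Longrightarrow> f i \<in> carrier (pol_ring S)" for f and T :: "'z set"
    unfolding finsum_restrict_scalars fe by (rule finsum_pol_ring[OF that])
  have "module (pol_ring S) ?A"
  proof (rule moduleI[OF cring_pol_ring])
    show "abelian_group ?A"
    proof (rule abelian_groupI)
      fix x assume "x \<in> carrier ?A"
      then show "\<exists>y\<in>carrier ?A. y \<oplus>\<^bsub>?A\<^esub> x = \<zero>\<^bsub>?A\<^esub>" by (intro bexI[of _ "- x"]) (auto simp: As)
    qed (auto simp: As ac_simps)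
  qed (auto simp: As algebra_simps)
  then interpret K: module type_ring "restrict_scalars const ?A" by (rule module_restrict_scalars)
  have inj: "inj_on ?s T" for T by (rule inj_onI) (metis lookup_single_eq lookup_single_not_eq zero_neq_one)
  have cs: "const c * ?s \<beta> = single \<beta> c" for c \<beta> by (simp add: const_def mult_single)
  have B: "?s ` monomials S \<subseteq> carrier (restrict_scalars const ?A)" by (auto simp: As)
  show ?thesis
  proof (rule K.is_basisI[OF B])
    fix p assume "p \<in> carrier (restrict_scalars const ?A)"
    then have "p \<in> carrier (pol_ring S)" by (simp only: restrict_scalars_simps As)
    then have p: "keys p \<subseteq> monomials S" by (simp add: pol_ring_def)
    \<comment> \<open>Coefficients have to be a function of the basis element \<open>e\<close>, not
      of its exponent; the test \<open>e = ?s \<beta>\<close> recovers the exponent.\<close>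
    let ?c = "\<lambda>e. \<Sum>\<beta>\<in>keys p. if e = ?s \<beta> then lookup p \<beta> else 0"
    have c: "?c (?s \<beta>) = lookup p \<beta>" for \<beta>
    proof -
      have "?c (?s \<beta>) = (\<Sum>\<gamma>\<in>keys p. if \<gamma> = \<beta> then lookup p \<beta> else 0)"
        by (rule sum.cong[OF refl]) (use inj_onD[OF inj[of UNIV], of \<beta>] in auto)
      then show ?thesis by (cases "lookup p \<beta> = 0") (simp_all add: in_keys_iff)
    qed
    have "basis_expansion type_ring (restrict_scalars const ?A) (?s ` monomials S) p ?c"
    proof (rule K.expansionI[OF B, of _ "?s ` keys p"])
      show "?s ` keys p \<subseteq> ?s ` monomials S" using p by blast
      show "?c e = \<zero>\<^bsub>type_ring\<^esub>" if "e \<notin> ?s ` keys p" for e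
        using that by (simp, intro sum.neutral) auto
      have "(\<Oplus>\<^bsub>restrict_scalars const ?A\<^esub>e\<in>?s ` keys p. ?c e \<odot>\<^bsub>restrict_scalars const ?A\<^esub> e) = (\<Sum>e\<in>?s ` keys p. const (?c e) * e)"
        using p by (subst fs) (auto simp: As intro!: mult_pol_ring single_pol_ring simp del: const_simps)
      also have "\<dots> = (\<Sum>\<beta>\<in>keys p. const (lookup p \<beta>) * ?s \<beta>)"
        unfolding sum.reindex[OF inj] comp_def c ..
      also have "\<dots> = p" unfolding cs by (rule pol_expansion[symmetric])
      finally show "p = (\<Oplus>\<^bsub>restrict_scalars const ?A\<^esub>e\<in>?s ` keys p. ?c e \<odot>\<^bsub>restrict_scalars const ?A\<^esub> e)" by simp
    qed simp_all
    then show "\<exists>c. basis_expansion type_ring (restrict_scalars const ?A) (?s ` monomials S) p c" by blast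
  next
    have pull: "c (?s \<beta>) = lookup p \<beta>"
      if c: "basis_expansion type_ring (restrict_scalars const ?A) (?s ` monomials S) p c" and \<beta>: "\<beta> \<in> monomials S" for p c \<beta>
    proof -
      note T = K.expansionD[OF c]
      let ?T = "{\<gamma> \<in> monomials S. c (?s \<gamma>) \<noteq> 0}"
      have ST: "{e. c e \<noteq> \<zero>\<^bsub>type_ring\<^esub>} = ?s ` ?T" using T(4) by auto
      have fT: "finite ?T" using T(3) unfolding ST by (rule finite_imageD[OF _ inj])
      have "p = (\<Sum>e\<in>?s ` ?T. const (c e) * e)"
        by (subst T(5), unfold ST, subst fs) (auto simp: As intro!: mult_pol_ring single_pol_ring)
      also have "\<dots> = (\<Sum>\<gamma>\<in>?T. single \<gamma> (c (?s \<gamma>)))" unfolding sum.reindex[OF inj] comp_def cs ..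
      finally have "lookup p \<beta> = (\<Sum>\<gamma>\<in>?T. if \<gamma> = \<beta> then c (?s \<gamma>) else 0)"
        by (simp add: lookup_sum lookup_single when_def)
      also have "\<dots> = (if \<beta> \<in> ?T then c (?s \<beta>) else 0)" using fT by (simp add: sum.delta)
      finally show ?thesis using \<beta> by simp
    qed
    fix p c c' assume c: "basis_expansion type_ring (restrict_scalars const ?A) (?s ` monomials S) p c"
      and c': "basis_expansion type_ring (restrict_scalars const ?A) (?s ` monomials S) p c'"
    show "c = c'"
    proof
      fix e show "c e = c' e"
      proof (cases "e \<in> ?s ` monomials S")
        case True
        then show ?thesis using pull[OF c] pull[OF c'] by auto
      next
        case False
        then show ?thesis using K.expansionD(2)[OF c] K.expansionD(2)[OF c'] by simp
      qed
    qed
  qed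
qed

section \<open>Freeness of the factorisations as graded modules\<close>

context tensor_module
begin

text \<open>The elements \<open>f \<otimes> a \<otimes> e\<close> with \<open>f\<close>,
  \<open>e\<close> in the given bases and \<open>a\<close> in a \<open>k\<close>-basis of
  \<open>A\<close>.\<close>

definition "MB BA = (\<Union>b\<in>BY \<times> BX. (\<lambda>x b'. if b' = b then x else \<zero>\<^bsub>B\<^esub>) ` (\<lambda>a \<mu>. if \<mu> = 0 then a else \<zero>\<^bsub>A\<^esub>) ` BA)"

lemma Mt_homogeneous_basis:
  assumes "is_basis type_ring (restrict_scalars const A) BA" shows "homogeneous_basis (kxz n l) Mt (MB BA)"
proof -
  have "module (kxz n l) B" by (rule module_pol_ring_mono[OF A.poly_ext_module]) blast
  then have b: "is_basis (kxz n l) Mt (MB BA)"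
    unfolding MB_def
    by (rule direct_sum_basis[OF _ Mt_module_kxz A.poly_ext_basis[OF assms]])
      (simp_all add: finite_BY finite_BX Mt_carrier del: mem_Sigma_iff)
  have "g \<in> grade Mt 0 \<union> grade Mt 1" if g: "g \<in> MB BA" for g
  proof -
    have gc: "g \<in> carrier Mt" using b g by (auto simp: is_basis_def)
    from g obtain f e x where x: "g = (\<lambda>b'. if b' = (f, e) then x else \<zero>\<^bsub>B\<^esub>)" unfolding MB_def by blast
    have "g \<in> grade Mt (parity Y f + parity X e)"
      using gc by (simp add: tensor_def x)
    then show ?thesis by (cases "parity Y f + parity X e") (simp_all only: Un_iff simp_thms)
  qed
  with b show ?thesis unfolding homogeneous_basis_def by blast
qed

lemma E_homogeneous_basis:
  assumes "is_basis type_ring (restrict_scalars const A) BA" shows "\<exists>BE. homogeneous_basis (kxz n l) E BE"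
proof -
  note M = Mt_homogeneous_basis[OF assms]
  let ?B = "\<Union>I\<in>Pow {..<m}. (\<lambda>x J. if J = I then x else \<zero>\<^bsub>Mt\<^esub>) ` MB BA"
  have b: "is_basis (kxz n l) E ?B"
    by (rule direct_sum_basis[OF Mt_module_kxz E_module_kxz])
      (use M E_carrier' in \<open>simp_all add: homogeneous_basis_def ext_factorisation_def\<close>)
  have "g \<in> grade E 0 \<union> grade E 1" if g: "g \<in> ?B" for g
  proof -
    have gc: "g \<in> carrier E" using b g by (auto simp: is_basis_def)
    from g obtain I x where x: "g = (\<lambda>J. if J = I then x else \<zero>\<^bsub>Mt\<^esub>)" "x \<in> MB BA" by blast
    then obtain s where s: "x \<in> grade Mt s" using M unfolding homogeneous_basis_def by blast
    have zero: "\<zero>\<^bsub>Mt\<^esub> \<in> grade Mt r" for r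
      using Mt.M.zero_closed by (simp add: tensor_def)
    \<comment> \<open>Twice the theta-degree is zero modulo two; this brings the degree into the
      form in which \<open>grade\<close> of the extension is defined.\<close>
    have "s = s + of_nat (card I) + of_nat (card I)" by (cases s; cases "of_nat (card I) :: bit") simp_all
    then have "g J \<in> grade Mt (s + of_nat (card I) + of_nat (card J))" for J
      using s zero by (cases "J = I") (simp_all add: x(1))
    then have "g \<in> grade E (s + of_nat (card I))"
      using gc by (simp add: ext_factorisation_def)
    then show ?thesis by (cases "s + of_nat (card I)") (simp_all only: Un_iff simp_thms)
  qed
  with b have "homogeneous_basis (kxz n l) E ?B" unfolding homogeneous_basis_def by blast
  then show ?thesis by blast
qed

lemma Mt_finitely_generated:
  assumes "is_basis type_ring (restrict_scalars const A) BA" "finite BA" shows "finitely_generated (kxz n l) Mt"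
proof -
  have b: "is_basis (kxz n l) Mt (MB BA)" using Mt_homogeneous_basis[OF assms(1)] by (simp add: homogeneous_basis_def)
  have fin: "finite (MB BA)" unfolding MB_def using finite_BY finite_BX assms(2) by simp
  have c: "MB BA \<subseteq> carrier Mt" using b by (simp add: is_basis_def)
  show ?thesis unfolding finitely_generated_def
  proof (intro exI[of _ "MB BA"] conjI fin c ballI)
    fix v assume "v \<in> carrier Mt"
    note e = module.coord[OF Mt_module_kxz b this]
    show "\<exists>c\<in>MB BA \<rightarrow> carrier (kxz n l). v = (\<Oplus>\<^bsub>Mt\<^esub>s\<in>MB BA. c s \<odot>\<^bsub>Mt\<^esub> s)"
    proof (rule bexI)
      show "v = (\<Oplus>\<^bsub>Mt\<^esub>s\<in>MB BA. coord (kxz n l) Mt (MB BA) v s \<odot>\<^bsub>Mt\<^esub> s)"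
        by (rule module.expansion_sum[OF Mt_module_kxz e c fin module.expansionD(4)[OF Mt_module_kxz e] subset_refl])
      show "coord (kxz n l) Mt (MB BA) v \<in> MB BA \<rightarrow> carrier (kxz n l)"
        using module.expansionD(1)[OF Mt_module_kxz e] by simp
    qed
  qed
qed

end

context hat_coords
begin

text \<open>Values of the homotopy are chosen degree by degree by \<open>good_step\<close>, starting
  from zero.\<close>

lemma ex_koszul_homotopy:
  assumes ex: "koszul_exact R m t"
  shows "\<exists>h. const_linear (ext_module m Ay) (ext_module m Ay) h \<and>
    (\<forall>x K. x \<in> ext_carrier m Ay \<longrightarrow> (\<forall>L. Suc (card L) = card K \<longrightarrow> x L = \<zero>\<^bsub>Ay\<^esub>) \<longrightarrow> h x K = \<zero>\<^bsub>Ay\<^esub>) \<and>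
    (\<forall>x K. x \<in> ext_carrier m Ay \<longrightarrow> koszul_diff m t Ay (h x) K \<oplus>\<^bsub>Ay\<^esub> h (koszul_diff m t Ay x) K \<oplus>\<^bsub>Ay\<^esub>
       (if K = {} then s0 (cs (Suc 0) (x {})) else \<zero>\<^bsub>Ay\<^esub>) = x K)"
proof -
  have "\<exists>\<psi>. good r \<psi>" for r
  proof (induction r)
    case 0
    have "good 0 (\<lambda>_ _ _. 0)" unfolding good_def theta_part_Ay EA by (intro conjI allI impI) simp_all
    then show ?case by (intro exI[of _ "\<lambda>_ _ _. 0"])
  next
    case (Suc r)
    then obtain \<psi> where "good r \<psi>" by (elim exE)
    from good_step[OF ex this] show ?case .
  qed
  \<comment> \<open>No element has theta-degree above \<open>m\<close>, so at stage
    \<open>Suc m\<close> the identity holds everywhere.\<close>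
  from this[of "Suc m"] obtain \<psi> where g: "good (Suc m) \<psi>" by (elim exE)
  show ?thesis
  proof (intro exI[of _ "lin \<psi>"] conjI allI impI good_linear[OF g])
    fix x and K :: "nat set" assume x: "x \<in> ext_carrier m Ay"
    have xK: "x K = 0" if "Suc m \<le> card K" for K
    proof -
      have "\<not> K \<subseteq> {..<m}" using that card_mono[of "{..<m}" K] by auto
      then show ?thesis using x by (simp add: EA)
    qed
    have lx: "lin \<psi> x \<in> ext_carrier m Ay" using const_linearD(1)[OF good_linear[OF g]] x by simp
    show "koszul_diff m t Ay (lin \<psi> x) K \<oplus>\<^bsub>Ay\<^esub> lin \<psi> (koszul_diff m t Ay x) K \<oplus>\<^bsub>Ay\<^esub>
       (if K = {} then s0 (cs (Suc 0) (x {})) else \<zero>\<^bsub>Ay\<^esub>) = x K"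
      using fun_cong[OF good_homotopy[OF g x xK], of K] unfolding koszul_dy[OF lx] koszul_dy[OF x] sp_def by (cases "K = {}") simp_all
    assume z: "\<forall>L. Suc (card L) = card K \<longrightarrow> x L = \<zero>\<^bsub>Ay\<^esub>"
    have "lc (\<lambda>\<beta>. \<psi> L \<beta> K) (x L) = 0" for L
    proof (cases "Suc (card L) = card K")
      case True
      then show ?thesis using z by (simp add: lc_zero)
    next
      case False
      then have "\<psi> L \<beta> K = 0" for \<beta> using g by (simp add: good_def theta_part_Ay)
      then show ?thesis by (simp add: lc_def)
    qed
    then show "lin \<psi> x K = \<zero>\<^bsub>Ay\<^esub>" by (simp add: lin_def)
  qed
qed

end

section \<open>The perturbed section\<close>

text \<open>The side conditions \<open>h h = 0\<close> and \<open>h \<sigma> = 0\<close> are what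
  identifies the explicit series as a morphism. They are available for \<open>koszul_H\<close>, and
  nothing of the kind is asked of the homotopy over \<open>k[y]\<close>.\<close>

locale strict_koszul_contraction = koszul_contraction n m l U V W Y BY X BX DY DX q A A' \<phi> \<sigma> h
  for n m l :: nat and U V W :: "'k::comm_ring_1 pol"
    and Y :: "('k pol, 'my) factorisation" and BY :: "'my set"
    and X :: "('k pol, 'mx) factorisation" and BX :: "'mx set"
    and DY :: "'my \<Rightarrow> 'my \<Rightarrow> 'k pol" and DX :: "'mx \<Rightarrow> 'mx \<Rightarrow> 'k pol" and q :: "rat \<Rightarrow> 'k"
    and A :: "('k pol, 'c) module" and A' :: "('k pol, 'd) module" and \<phi> :: "'c \<Rightarrow> 'd"
    and \<sigma> :: "'d \<Rightarrow> 'c" and h :: "(nat set \<Rightarrow> 'c) \<Rightarrow> nat set \<Rightarrow> 'c" +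
  assumes h_square: "\<And>x. x \<in> ext_carrier m A \<Longrightarrow> h (h x) = (\<lambda>_. \<zero>\<^bsub>A\<^esub>)"
    and h_sigma: "\<And>r. r \<in> carrier A' \<Longrightarrow> h (\<lambda>I. if I = {} then \<sigma> r else \<zero>\<^bsub>A\<^esub>) = (\<lambda>_. \<zero>\<^bsub>A\<^esub>)"
begin

sublocale EF: factorisation "kxz n l" "U - W" A.E
  by unfold_locales (rule A.E_factorisation)

abbreviation "d \<equiv> differential A.E"
definition a where "a v = hh (d v)"
text \<open>With \<open>v = \<sigma> g\<close> these are the partial sums of
  \<open>\<sigma>_\<infinity>\<close>, by the recursion \<open>S (r + 1) = v - H d (S r)\<close>,
  which is easier to work with than the alternating sum.\<close>

definition S where "S r v = ((\<lambda>u. v \<ominus>\<^bsub>A.E\<^esub> a u) ^^ r) v"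

lemma S_0: "S 0 v = v" and S_Suc: "S (Suc r) v = v \<ominus>\<^bsub>A.E\<^esub> a (S r v)"
  by (simp_all add: S_def)

lemma hhE: "linear_map (kxz n l) A.E A.E hh" and ssE: "linear_map (kxz n l) A'.Mt A.E ss"
  using hh_linear ss_linear unfolding linear_map_def A.K_simps by blast+

lemma a_linear: "linear_map (kxz n l) A.E A.E a"
proof -
  have "a = hh \<circ> d" by (simp add: a_def fun_eq_iff)
  then show ?thesis using linear_map_comp[OF EF.D_linear hhE] by simp
qed

lemmas a_simps = linear_mapD[OF a_linear] linear_map_zero_minus[OF EF.module EF.module a_linear]
lemmas hh_simps = linear_mapD[OF hhE] linear_map_zero_minus[OF EF.module EF.module hhE]

lemma a_grade: assumes "v \<in> grade A.E s" shows "a v \<in> grade A.E s"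
proof -
  have "d v \<in> grade A.K (s + 1)" unfolding A.K_simps by (rule EF.D_grade[OF assms])
  from hh_grade[OF this] have "a v \<in> grade A.E (s + 1 + 1)" unfolding a_def A.K_simps .
  then show ?thesis unfolding bit_add_1_1 .
qed

lemma hh_hh: assumes "v \<in> carrier A.E" shows "hh (hh v) = \<zero>\<^bsub>A.E\<^esub>"
proof (intro ext)
  fix I b \<mu>
  have "hh (hh v) I b \<mu> = h (h (\<lambda>J. v J b \<mu>)) I" by (simp add: hh_def)
  then show "hh (hh v) I b \<mu> = \<zero>\<^bsub>A.E\<^esub> I b \<mu>" using h_square[OF slice[OF assms]] by simp
qed

lemma hh_ss: assumes "v \<in> carrier A'.Mt" shows "hh (ss v) = \<zero>\<^bsub>A.E\<^esub>"
proof (intro ext)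
  fix I b \<mu>
  have "v b \<in> carrier A'.B" using assms unfolding A'.Mt_carrier by blast
  then have "v b \<mu> \<in> carrier A'" by (rule A'.B_carrier)
  then show "hh (ss v) I b \<mu> = \<zero>\<^bsub>A.E\<^esub> I b \<mu>" using h_sigma by (simp add: hh_def ss_def)
qed

lemma S_linear: "linear_map (kxz n l) A'.Mt A.E (\<lambda>v. S r (ss v))"
proof (induction r)
  case 0
  show ?case unfolding S_0 by (rule ssE)
next
  case (Suc r)
  have "linear_map (kxz n l) A'.Mt A.E (\<lambda>v. a (S r (ss v)))"
    using linear_map_comp[OF Suc a_linear] by (simp add: comp_def)
  from linear_map_minus[OF EF.module ssE this] show ?case unfolding S_Suc .
qed

lemmas S_closed = linear_mapD(1)[OF S_linear]
lemmas ss_E = linear_mapD(1)[OF ssE]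

lemma S_grade: "v \<in> grade A'.Mt s \<Longrightarrow> S r (ss v) \<in> grade A.E s"
proof (induction r)
  case 0
  show ?case using ss_grade[OF 0] unfolding S_0 A.K_simps .
next
  case (Suc r)
  show ?case unfolding S_Suc
    using ss_grade[OF Suc.prems] unfolding A.K_simps by (rule EF.grade_minus) (rule a_grade[OF Suc.IH[OF Suc.prems]])
qed

lemma hh_S: assumes "v \<in> carrier A'.Mt" shows "hh (S r (ss v)) = \<zero>\<^bsub>A.E\<^esub>"
proof (cases r)
  case 0
  then show ?thesis using hh_ss[OF assms] by (simp only: S_0)
next
  case (Suc r')
  have ac: "a (S r' (ss v)) \<in> carrier A.E" by (rule a_simps(1)[OF S_closed[OF assms]])
  have "hh (a (S r' (ss v))) = \<zero>\<^bsub>A.E\<^esub>"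
    unfolding a_def by (rule hh_hh[OF EF.D_closed[OF S_closed[OF assms]]])
  then show ?thesis unfolding Suc S_Suc hh_simps(6)[OF ss_E[OF assms] ac] hh_ss[OF assms]
    by (simp only: A.E.M.minus_zero_right A.E.M.zero_closed)
qed

text \<open>The corrections are values of \<open>h\<close> and thus have no component in
  theta-degree zero.\<close>

lemma pp_S: assumes "v \<in> carrier A'.Mt" shows "pp (S r (ss v)) = v"
proof (intro ext)
  fix b \<mu>
  have "v b \<in> carrier A'.B" using assms unfolding A'.Mt_carrier by blast
  then have vc: "v b \<mu> \<in> carrier A'" by (rule A'.B_carrier)
  have "S r (ss v) {} b \<mu> = \<sigma> (v b \<mu>)"
  proof (cases r)
    case 0
    then show ?thesis by (simp add: S_0 ss_def)
  next
    case (Suc r')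
    let ?x = "a (S r' (ss v))"
    have xc: "?x \<in> carrier A.E" by (rule a_simps(1)[OF S_closed[OF assms]])
    have "hh (d (S r' (ss v))) {} b = (\<lambda>_. \<zero>\<^bsub>A\<^esub>)" by (rule hh_vanish[OF EF.D_closed[OF S_closed[OF assms]]]) simp
    then have x0: "?x {} b \<mu> = \<zero>\<^bsub>A\<^esub>" by (simp add: a_def)
    \<comment> \<open>Subtraction is read as a sum equation, because addition is defined pointwise
      whereas the inverse in \<open>E\<close> is not visibly so.\<close>
    have "(ss v \<ominus>\<^bsub>A.E\<^esub> ?x) \<oplus>\<^bsub>A.E\<^esub> ?x = ss v"
      using ss_E[OF assms] xc by (simp add: a_minus_def A.E.M.a_assoc A.E.M.l_neg del: A.E_simps)
    then have "(ss v \<ominus>\<^bsub>A.E\<^esub> ?x) {} b \<mu> \<oplus>\<^bsub>A\<^esub> ?x {} b \<mu> = ss v {} b \<mu>" by (simp add: fun_eq_iff)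
    moreover have "(ss v \<ominus>\<^bsub>A.E\<^esub> ?x) {} b \<mu> \<in> carrier A"
      by (rule A.E_carrierD(2)[OF A.E.M.minus_closed[OF ss_E[OF assms] xc]])
    ultimately show ?thesis unfolding Suc S_Suc using x0 by (simp add: ss_def)
  qed
  then show "pp (S r (ss v)) b \<mu> = v b \<mu>" by (simp add: pp_def sigma(2)[OF vc])
qed

lemma apow_closed: "v \<in> carrier A.E \<Longrightarrow> (a ^^ r) v \<in> carrier A.E"
  by (induction r) (simp_all add: a_simps(1) del: A.E_simps)

text \<open>By induction with linearity of \<open>H d\<close>: applying \<open>- H d\<close> to the
  last difference produces the next one, with the opposite sign.\<close>

lemma S_step:
  assumes v: "v \<in> carrier A'.Mt"
  shows "S (Suc r) (ss v) = S r (ss v) \<oplus>\<^bsub>A.E\<^esub> signed A.E (of_nat (Suc r)) ((a ^^ Suc r) (ss v))"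
proof (induction r)
  case 0
  show ?case unfolding S_Suc S_0 by (simp add: signed_def a_minus_def del: A.E_simps)
next
  case (Suc r)
  let ?x = "(a ^^ Suc r) (ss v)" and ?s = "of_nat (Suc r) :: bit"
  note c = ss_E[OF v] S_closed[OF v] apow_closed[OF ss_E[OF v]]
  have sc: "signed A.E r' x \<in> carrier A.E" if "x \<in> carrier A.E" for r' x using that by (simp add: signed_def del: A.E_simps)
  have "\<ominus>\<^bsub>A.E\<^esub> a (signed A.E ?s ?x) = signed A.E (?s + 1) (a ?x)"
    using a_simps(1)[OF c(3)] a_simps(5)[OF c(3)]
    by (cases ?s) (simp_all add: signed_def del: A.E_simps of_nat_Suc funpow.simps)
  moreover have "?s + 1 = of_nat (Suc (Suc r))" by (simp only: of_nat_Suc add.commute)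
  ultimately have e: "\<ominus>\<^bsub>A.E\<^esub> a (signed A.E ?s ?x) = signed A.E (of_nat (Suc (Suc r))) ((a ^^ Suc (Suc r)) (ss v))"
    by (simp only: funpow.simps comp_apply)
  have "S (Suc (Suc r)) (ss v) = ss v \<ominus>\<^bsub>A.E\<^esub> a (S r (ss v) \<oplus>\<^bsub>A.E\<^esub> signed A.E ?s ?x)"
    by (subst S_Suc, subst Suc) (rule refl)
  also have "\<dots> = (ss v \<ominus>\<^bsub>A.E\<^esub> a (S r (ss v))) \<oplus>\<^bsub>A.E\<^esub> (\<ominus>\<^bsub>A.E\<^esub> a (signed A.E ?s ?x))"
    unfolding a_simps(2)[OF c(2) sc[OF c(3)]] a_minus_def
    using a_simps(1)[OF c(2)] a_simps(1)[OF sc[OF c(3)]] c(1) by (simp only: A.E.M.minus_add A.E.M.a_assoc A.E.M.a_inv_closed)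
  also have "\<dots> = S (Suc r) (ss v) \<oplus>\<^bsub>A.E\<^esub> signed A.E (of_nat (Suc (Suc r))) ((a ^^ Suc (Suc r)) (ss v))"
    unfolding e by (simp only: S_Suc)
  finally show ?case .
qed

lemma a_F: assumes "v \<in> carrier A.E" "v \<in> F r" shows "a v \<in> F (Suc r)"
  unfolding F_def a_def
proof (intro CollectI allI impI ext)
  fix I :: "nat set" and b \<mu> assume I: "card I < Suc r"
  have "d v J b = (\<lambda>_. \<zero>\<^bsub>A\<^esub>)" if "Suc (card J) = card I" for J
  proof -
    have "v J = \<zero>\<^bsub>A.Mt\<^esub>" using assms(2) I that by (simp add: F_def)
    from A.differential_E[OF assms(1) this] show ?thesis by simp
  qed
  from hh_vanish[OF EF.D_closed[OF assms(1)] this] show "hh (d v) I b \<mu> = \<zero>\<^bsub>A\<^esub>" by simp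
qed

text \<open>\<open>(H d)^(m+1)\<close> raises the theta-degree beyond \<open>m\<close> and is zero.
  So the recursion has become stationary, and its fixed point equation is the claim.\<close>

lemma S_stable: assumes v: "v \<in> carrier A'.Mt" shows "a (S m (ss v)) = ss v \<ominus>\<^bsub>A.E\<^esub> S m (ss v)"
proof -
  note c = ss_E[OF v] S_closed[OF v, of m] apow_closed[OF ss_E[OF v]]
  have "(a ^^ r) (ss v) \<in> F r" for r
  proof (induction r)
    case 0
    show ?case by (simp add: F_def)
  next
    case (Suc r)
    then show ?case using a_F[OF c(3)] by simp
  qed
  then have "(a ^^ Suc m) (ss v) = \<zero>\<^bsub>A.K\<^esub>" using c(3) unfolding A.K_simps(1)[symmetric] by (intro retract.F(2))
  then have z: "(a ^^ Suc m) (ss v) = \<zero>\<^bsub>A.E\<^esub>" by simp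
  have "S (Suc m) (ss v) = S m (ss v)"
    unfolding S_step[OF v] z using c(2) by (simp add: signed_def del: A.E_simps of_nat_Suc)
  then have e: "ss v \<ominus>\<^bsub>A.E\<^esub> a (S m (ss v)) = S m (ss v)" unfolding S_Suc .
  have "ss v \<ominus>\<^bsub>A.E\<^esub> (ss v \<ominus>\<^bsub>A.E\<^esub> a (S m (ss v))) = a (S m (ss v))"
    using c(1) a_simps(1)[OF c(2)] by (simp add: a_minus_def A.E.M.minus_add A.E.M.a_assoc[symmetric] A.E.M.r_neg del: A.E_simps)
  then show ?thesis unfolding e by simp
qed

lemma S_sum: "v \<in> carrier A'.Mt \<Longrightarrow>
  (\<Oplus>\<^bsub>A.E\<^esub>j\<in>{..r}. signed A.E (of_nat j) ((a ^^ j) (ss v))) = S r (ss v)"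
proof (induction r)
  case 0
  then show ?case using ss_E[OF 0] by (simp add: signed_def S_0 del: A.E_simps)
next
  case (Suc r)
  note c = apow_closed[OF ss_E[OF Suc.prems]]
  have sc: "signed A.E s ((a ^^ j) (ss v)) \<in> carrier A.E" for s j
    using c[of j] by (simp add: signed_def del: A.E_simps)
  have "(\<Oplus>\<^bsub>A.E\<^esub>j\<in>{..Suc r}. signed A.E (of_nat j) ((a ^^ j) (ss v))) =
      signed A.E (of_nat (Suc r)) ((a ^^ Suc r) (ss v)) \<oplus>\<^bsub>A.E\<^esub> S r (ss v)"
    unfolding atMost_Suc Suc.IH[OF Suc.prems, symmetric]
    by (rule A.E.M.finsum_insert, simp, simp, rule Pi_I, rule sc, rule sc)
  also have "\<dots> = S (Suc r) (ss v)"
    unfolding S_step[OF Suc.prems] by (rule A.E.M.a_comm[OF sc S_closed[OF Suc.prems]])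
  finally show ?case .
qed

text \<open>When \<open>h v = 0\<close> the term \<open>d_K h v\<close> drops out of the homotopy
  formula.\<close>

lemma hh_dk: assumes v: "v \<in> carrier A.E" "hh v = \<zero>\<^bsub>A.E\<^esub>" shows "hh (A.dk v) \<oplus>\<^bsub>A.E\<^esub> ss (pp v) = v"
proof (intro ext)
  fix I b \<mu>
  let ?x = "\<lambda>J. v J b \<mu>"
  note kc = linear_mapD(1)[OF A.rep_linear[OF A.rep_dk] v(1)]
  have "h ?x = (\<lambda>_. \<zero>\<^bsub>A\<^esub>)"
  proof
    fix J show "h ?x J = \<zero>\<^bsub>A\<^esub>" using fun_cong[OF fun_cong[OF fun_cong[OF v(2), of J], of b], of \<mu>] by (simp add: hh_def)
  qed
  then have "koszul_diff m (tseq V) A (h ?x) I = \<zero>\<^bsub>A\<^esub>"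
    using fun_cong[OF fun_cong[OF fun_cong[OF linear_map_zero_minus(1)[OF A.E_module A.E_module A.rep_linear[OF A.rep_dk]], of I], of b], of \<mu>] by simp
  moreover have "h (koszul_diff m (tseq V) A ?x) I \<in> carrier A"
    using A.E_carrierD(2)[OF hh_closed[OF kc], of I b \<mu>] by (simp add: hh_def)
  ultimately show "(hh (A.dk v) \<oplus>\<^bsub>A.E\<^esub> ss (pp v)) I b \<mu> = v I b \<mu>"
    using h_homotopy[OF slice[OF v(1)], of b \<mu> I] by (cases "I = {}") (simp_all add: hh_def ss_def pp_def)
qed

text \<open>For \<open>s = \<sigma>_\<infinity> v\<close> the stable recursion gives
  \<open>h d s = \<sigma> v - s\<close>, and \<open>hh_dk\<close> gives
  \<open>h d_K s = s - \<sigma> v\<close>. So \<open>h\<close> kills both \<open>s\<close> and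
  \<open>(d_K + d) s\<close>, and \<open>section_morphismI\<close> applies.\<close>

lemma S_equivalence: "inverse_homotopy_equivalences (kxz n l) A.K A'.Mt pp (\<lambda>v. S m (ss v))"
proof (rule retract.section_equivalence[OF retract.section_morphismI pp_S])
  show "linear_map (kxz n l) A'.Mt A.K (\<lambda>v. S m (ss v))"
    using S_linear unfolding linear_map_def A.K_simps .
  show "pp (S m (ss v)) = v" if "v \<in> carrier A'.Mt" for v by (rule pp_S[OF that])
  show "v \<in> grade A'.Mt s \<Longrightarrow> S m (ss v) \<in> grade A.K s" for s v
    unfolding A.K_simps by (rule S_grade)
  show "hh (S m (ss v)) = \<zero>\<^bsub>A.K\<^esub>" if "v \<in> carrier A'.Mt" for v
    unfolding A.K_simps by (rule hh_S[OF that])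
  show "hh (differential A.K (S m (ss v))) = \<zero>\<^bsub>A.K\<^esub>" if v: "v \<in> carrier A'.Mt" for v
  proof -
    let ?s = "S m (ss v)"
    note c = S_closed[OF v, of m]
    note kc = linear_mapD(1)[OF A.rep_linear[OF A.rep_dk] c]
    have k: "hh (A.dk ?s) \<oplus>\<^bsub>A.E\<^esub> ss v = ?s" using hh_dk[OF c hh_S[OF v]] unfolding pp_S[OF v] .
    have "hh (A.dK ?s) = a ?s \<oplus>\<^bsub>A.E\<^esub> hh (A.dk ?s)"
      unfolding A.dK_def a_def by (rule hh_simps(2)[OF EF.D_closed[OF c] kc])
    also have "\<dots> = (ss v \<ominus>\<^bsub>A.E\<^esub> ?s) \<oplus>\<^bsub>A.E\<^esub> hh (A.dk ?s)" unfolding S_stable[OF v] ..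
    also have "\<dots> = (hh (A.dk ?s) \<oplus>\<^bsub>A.E\<^esub> ss v) \<ominus>\<^bsub>A.E\<^esub> ?s"
      using ss_E[OF v] c hh_simps(1)[OF kc] unfolding a_minus_def
      by (simp only: A.E.M.a_ac A.E.M.a_inv_closed A.E.M.a_closed)
    also have "\<dots> = \<zero>\<^bsub>A.E\<^esub>" unfolding k by (rule A.E.M.minus_eq_zero[THEN iffD2, OF c c refl])
    finally show ?thesis by (simp only: A.K_simps)
  qed
qed

end

section \<open>The homotopy equivalence\<close>

lemma inverse_homotopy_equivalences_cong:
  assumes N: "linear_factorisation R w N" and f: "inverse_homotopy_equivalences R M N f g"
    and e: "\<And>v. v \<in> carrier N \<Longrightarrow> g' v = g v"
  shows "inverse_homotopy_equivalences R M N f g'"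
proof -
  interpret N: factorisation R w N by unfold_locales (rule N)
  have fm: "factorisation_morphism R M N f" and gm: "factorisation_morphism R N M g"
    and h: "homotopic R M M (g \<circ> f) (\<lambda>v. v)" "homotopic R N N (f \<circ> g) (\<lambda>v. v)"
    using f by (simp_all add: inverse_homotopy_equivalences_def)
  have "factorisation_morphism R N M g'"
    using gm e unfolding factorisation_morphism_def linear_map_def
    by (simp add: Pi_iff image_subset_iff N.M.a_closed N.smult_closed N.D_closed N.grade_closed)
  moreover have "homotopic R M M (g' \<circ> f) (\<lambda>v. v)"
    by (rule homotopic_cong[OF h(1)]) (simp_all add: e morphism_closed[OF fm])
  moreover have "homotopic R N N (f \<circ> g') (\<lambda>v. v)"
    by (rule homotopic_cong[OF h(2)]) (simp_all add: e)
  ultimately show ?thesis using fm by (simp add: inverse_homotopy_equivalences_def)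
qed

text \<open>Finite generation makes the given bases finite; the matrix identities then follow from
  those for the differentials.\<close>

lemma mf_pairI:
  fixes U V W :: "'k::comm_ring_1 pol"
  assumes UVW: "U \<in> carrier (pol_ring (zvars l))" "V \<in> carrier (ky m)" "W \<in> carrier (pol_ring (xvars n))"
    and X: "finite_rank_matrix_factorisation (kxy n m) (V - W) X" "homogeneous_basis (kxy n m) X BX"
    and Y: "finite_rank_matrix_factorisation (kyz m l) (U - V) Y" "homogeneous_basis (kyz m l) Y BY"
  shows "mf_pair n m l U V W Y BY X BX (matrix_of (kyz m l) Y BY (differential Y)) (matrix_of (kxy n m) X BX (differential X))"
proof -
  interpret X: factorisation "kxy n m" "V - W" X
    using X(1) by unfold_locales (simp add: finite_rank_matrix_factorisation_def matrix_factorisation_def)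
  interpret Y: factorisation "kyz m l" "U - V" Y
    using Y(1) by unfold_locales (simp add: finite_rank_matrix_factorisation_def matrix_factorisation_def)
  have fX: "finite BX"
    by (rule X.finite_basis) (use X in \<open>simp_all add: homogeneous_basis_def finite_rank_matrix_factorisation_def\<close>)
  have fY: "finite BY"
    by (rule Y.finite_basis) (use Y in \<open>simp_all add: homogeneous_basis_def finite_rank_matrix_factorisation_def\<close>)
  note mX = X.matrix_closed[OF X(2) fX] X.matrix_out[OF X(2) fX] X.matrix_odd[OF X(2) fX] X.matrix_square[OF X(2) fX]
  note mY = Y.matrix_closed[OF Y(2) fY] Y.matrix_out[OF Y(2) fY] Y.matrix_odd[OF Y(2) fY] Y.matrix_square[OF Y(2) fY]
  show ?thesis
  proof (unfold_locales; (rule refl fX fY UVW)?)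
    show "matrix_of (kyz m l) Y BY Y.D f f' \<in> carrier (kyz m l)" if "f' \<in> BY" for f f' by (rule mY(1)[OF that])
    show "matrix_of (kxy n m) X BX X.D f f' \<in> carrier (kxy n m)" if "f' \<in> BX" for f f' by (rule mX(1)[OF that])
    show "matrix_of (kyz m l) Y BY Y.D f f' = 0" if "f \<notin> BY" "f' \<in> BY" for f f' using mY(2)[OF that(2,1)] by simp
    show "matrix_of (kxy n m) X BX X.D f f' = 0" if "f \<notin> BX" "f' \<in> BX" for f f' using mX(2)[OF that(2,1)] by simp
    show "parity Y f = parity Y f' + 1" if "f \<in> BY" "f' \<in> BY" "matrix_of (kyz m l) Y BY Y.D f f' \<noteq> 0" for f f'
      by (rule mY(3)[OF that(2)]) (use that(3) in simp)
    show "parity X f = parity X f' + 1" if "f \<in> BX" "f' \<in> BX" "matrix_of (kxy n m) X BX X.D f f' \<noteq> 0" for f f'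
      by (rule mX(3)[OF that(2)]) (use that(3) in simp)
    show "(\<Sum>f'\<in>BY. matrix_of (kyz m l) Y BY Y.D f f' * matrix_of (kyz m l) Y BY Y.D f' f'') = (if f = f'' then U - V else 0)"
      if "f \<in> BY" "f'' \<in> BY" for f f''
      using mY(4)[OF that] by (subst (asm) finsum_pol_ring) (simp_all add: mY(1) that)
    show "(\<Sum>f'\<in>BX. matrix_of (kxy n m) X BX X.D f f' * matrix_of (kxy n m) X BX X.D f' f'') = (if f = f'' then V - W else 0)"
      if "f \<in> BX" "f'' \<in> BX" for f f''
      using mX(4)[OF that] by (subst (asm) finsum_pol_ring) (simp_all add: mX(1) that)
  qed
qed

lemma (in hat_coords) to_hat_linear: "linear_map (ky m) Ay HM (to_hat m V)"
proof (rule linear_mapI)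
  show "to_hat m V v \<in> carrier HM" if "v \<in> carrier Ay" for v
    using apx_to_hat that hat_carrier by auto
  show "to_hat m V (v \<oplus>\<^bsub>Ay\<^esub> w) = to_hat m V v \<oplus>\<^bsub>HM\<^esub> to_hat m V w" if "v \<in> carrier Ay" "w \<in> carrier Ay" for v w
    unfolding HM_simps Ay_simps using that
    by (intro apx_eq[OF apx_to_hat apx_add[OF apx_to_hat apx_to_hat]]) simp_all
  show "to_hat m V (r \<odot>\<^bsub>Ay\<^esub> v) = r \<odot>\<^bsub>HM\<^esub> to_hat m V v" if "r \<in> carrier (ky m)" "v \<in> carrier Ay" for r v
    unfolding HM_simps Ay_simps using that
    by (intro apx_eq[OF apx_to_hat apx_mult[OF apx_to_hat apx_to_hat]]) simp_all
qed

theorem theorem4p34: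
  fixes n m l :: nat
    and W V U :: "'k::comm_ring_1 pol"
    and X :: "('k pol, 'mx) factorisation" and BX :: "'mx set"
    and Y :: "('k pol, 'my) factorisation" and BY :: "'my set"
    and \<sigma> :: "'k pol set \<Rightarrow> 'k hat"
    and q :: "rat \<Rightarrow> 'k"
  assumes "noetherian_ring (type_ring :: 'k ring)"
    and "q \<in> ring_hom type_ring type_ring"
    and "potential XV n W" and "potential YV m V" and "potential ZV l U"
    and "finite_rank_matrix_factorisation (kxy n m) (V - W) X"
    and "finite_rank_matrix_factorisation (kyz m l) (U - V) Y"
    and "homogeneous_basis (kxy n m) X BX"
    and "homogeneous_basis (kyz m l) Y BY"
    and "is_section m V \<sigma>"
  shows "matrix_factorisation (kxz n l) (U - W) (ext_factorisation m (YX n m l Y BY X BX))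
       \<and> finite_rank_matrix_factorisation (kxz n l) (U - W) (YX_cut n m l V Y BY X BX)
       \<and> (\<exists>\<epsilon>'. inverse_homotopy_equivalences (kxz n l)
             (ext_factorisation m (YX n m l Y BY X BX))
             (ext_factorisation m (YX_hat n m l V Y BY X BX)) (ext_epsilon m V) \<epsilon>')
       \<and> (\<forall>\<epsilon>'. inverse_homotopy_equivalences (kxz n l)
             (ext_factorisation m (YX n m l Y BY X BX))
             (ext_factorisation m (YX_hat n m l V Y BY X BX)) (ext_epsilon m V) \<epsilon>' \<longrightarrow>
           inverse_homotopy_equivalences (kxz n l)
             (ext_factorisation m (YX n m l Y BY X BX))
             (YX_cut n m l V Y BY X BX)
             (Phi n m l V Y BY X BX q) (Phi_inv n m l V Y BY X BX \<sigma> q \<epsilon>'))"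
proof -
  let ?DY = "matrix_of (kyz m l) Y BY (differential Y)" and ?DX = "matrix_of (kxy n m) X BX (differential X)"
  have UVW: "U \<in> carrier (pol_ring (zvars l))" "V \<in> carrier (ky m)" "W \<in> carrier (pol_ring (xvars n))"
    using assms(3-5) by (simp_all add: potential_def Let_def)
  have V: "quasi_regular (ky m) m (tseq V)" "koszul_exact (ky m) m (tseq V)"
    and exB: "\<exists>B. finite B \<and> is_basis type_ring (restrict_scalars const (jacobi_module YV m V)) B"
    using assms(4) unfolding potential_def Let_def by simp_all
  \<comment> \<open>The basis of \<open>J_V\<close> serves the argument only; neither
    \<open>Phi\<close> nor \<open>Phi_inv\<close> depends on it.\<close>
  from exB obtain B where B: "finite B" "is_basis type_ring (restrict_scalars const (jacobi_module YV m V)) B"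
    by (elim exE conjE)
  interpret H: hat_coords m V \<sigma> B q
    by unfold_locales (fact UVW(2) V(1) B assms(10) assms(2))+
  interpret mf: mf_pair n m l U V W Y BY X BX ?DY ?DX
    by (rule mf_pairI[OF UVW assms(6,8,7,9)])
  interpret mfe: mf_pair_exp n m l U V W Y BY X BX ?DY ?DX q
    by unfold_locales (rule assms(2))
  interpret TA: tensor_module n m l U V W Y BY X BX ?DY ?DX q H.Ay ..
  interpret TH: tensor_module n m l U V W Y BY X BX ?DY ?DX q H.HM ..
  interpret TJ: tensor_module n m l U V W Y BY X BX ?DY ?DX q H.J ..
  interpret eps: tensor_map n m l U V W Y BY X BX ?DY ?DX q H.Ay H.HM "to_hat m V"
    by unfold_locales (rule H.to_hat_linear)
  from H.ex_koszul_homotopy[OF V(2)] obtain h where h: "const_linear (ext_module m H.Ay) (ext_module m H.Ay) h \<and>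
    (\<forall>x K. x \<in> ext_carrier m H.Ay \<longrightarrow> (\<forall>L. Suc (card L) = card K \<longrightarrow> x L = \<zero>\<^bsub>H.Ay\<^esub>) \<longrightarrow> h x K = \<zero>\<^bsub>H.Ay\<^esub>) \<and>
    (\<forall>x K. x \<in> ext_carrier m H.Ay \<longrightarrow> koszul_diff m (tseq V) H.Ay (h x) K \<oplus>\<^bsub>H.Ay\<^esub> h (koszul_diff m (tseq V) H.Ay x) K \<oplus>\<^bsub>H.Ay\<^esub>
       (if K = {} then H.s0 (H.cs (Suc 0) (x {})) else \<zero>\<^bsub>H.Ay\<^esub>) = x K)"
    by (elim exE)
  have h2: "h x K = \<zero>\<^bsub>H.Ay\<^esub>" if "x \<in> ext_carrier m H.Ay" "\<And>L. Suc (card L) = card K \<Longrightarrow> x L = \<zero>\<^bsub>H.Ay\<^esub>" for x K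
    by (rule conjunct1[OF conjunct2[OF h], THEN spec, THEN spec, THEN mp, THEN mp]) (use that in blast)+
  have h3: "koszul_diff m (tseq V) H.Ay (h x) K \<oplus>\<^bsub>H.Ay\<^esub> h (koszul_diff m (tseq V) H.Ay x) K \<oplus>\<^bsub>H.Ay\<^esub>
     (if K = {} then H.s0 (H.cs (Suc 0) (x {})) else \<zero>\<^bsub>H.Ay\<^esub>) = x K" if "x \<in> ext_carrier m H.Ay" for x K
    by (rule conjunct2[OF conjunct2[OF h], THEN spec, THEN spec, THEN mp]) (rule that)
  \<comment> \<open>The contraction over \<open>k[y]\<close>, with the homotopy from
    exactness.\<close>
  interpret KA: koszul_contraction n m l U V W Y BY X BX ?DY ?DX q H.Ay H.J "H.cs (Suc 0)" H.s0 h
  proof unfold_locales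
    show "linear_map (ky m) H.Ay H.J (H.cs (Suc 0))" by (rule H.cs_linear)
    show "const_linear H.J H.Ay H.s0" by (rule H.s0_linear)
    show "r \<in> carrier H.J \<Longrightarrow> H.cs (Suc 0) (H.s0 r) = r" for r by (rule H.cs_s0)
    show "x \<in> ext_carrier m H.Ay \<Longrightarrow> H.cs (Suc 0) (koszul_diff m (tseq V) H.Ay x {}) = \<zero>\<^bsub>H.J\<^esub>" for x
      using H.koszul_dy[of x] H.cs_dy[of x] by (simp only:)
    show "const_linear (ext_module m H.Ay) (ext_module m H.Ay) h" by (rule conjunct1[OF h])
  qed (fact h2 h3)+
  \<comment> \<open>The contraction over the completion, with the given \<open>\<sigma>\<close> and
    with \<open>H\<close>.\<close>
  interpret KH: strict_koszul_contraction n m l U V W Y BY X BX ?DY ?DX q H.HM H.J hat_quotient \<sigma> "koszul_H m V \<sigma>"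
  proof unfold_locales
    show "linear_map (ky m) H.HM H.J hat_quotient" by (rule H.quotient_linear)
    show "const_linear H.J H.HM \<sigma>" by (rule H.sigma)
    show "r \<in> carrier H.J \<Longrightarrow> hat_quotient (\<sigma> r) = r" for r
      unfolding hat_quotient_def One_nat_def by (rule H.sigma_section)
    show "const_linear (ext_module m H.HM) (ext_module m H.HM) (koszul_H m V \<sigma>)" by (rule H.koszul_H_linear)
  qed (fact H.quotient_koszul H.koszul_H_degree H.koszul_H_homotopy H.koszul_H_square H.koszul_H_sigma)+
  have del: "delta n m l V Y BY X BX = (\<lambda>g. TH.gdelta g)"
    unfolding delta_def[abs_def] lambda_op_def ..
  have exp: "exp_delta n m l V Y BY X BX q c = TH.gexp c" for c
    unfolding exp_delta_def[abs_def] TH.gexp_def[abs_def] Let_def del ..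
  have pr: "proj = KH.pp" by (simp add: fun_eq_iff proj_def KH.pp_def coeffwise_def)
  have ep: "ext_epsilon m V = eps.cw" by (simp add: fun_eq_iff ext_epsilon_def eps.cw_def coeffwise_def)
  have sg: "ext_sigma m V \<sigma> = KH.ss"
  proof -
    have "ext_sigma m V \<sigma> g I b \<mu> = KH.ss g I b \<mu>" for g I b \<mu>
      by (cases "I = {}") (simp_all add: ext_sigma_def KH.ss_def coeffwise_def)
    then show ?thesis by (intro ext) (simp only:)
  qed
  have eH: "ext_H m V \<sigma> = KH.hh" by (simp add: fun_eq_iff ext_H_def KH.hh_def)
  have eqKH: "inverse_homotopy_equivalences (kxz n l) TH.K TJ.Mt KH.pp (sigma_inf n m l V Y BY X BX \<sigma>)"
  proof -
    have s: "sigma_inf n m l V Y BY X BX \<sigma> v = KH.S m (KH.ss v)" if "v \<in> carrier TJ.Mt" for v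
      unfolding KH.S_sum[OF that, symmetric] sigma_inf_def Let_def sg eH KH.a_def[abs_def] ..
    show ?thesis by (rule inverse_homotopy_equivalences_cong[OF TJ.Mt_factorisation KH.S_equivalence s])
  qed
  note expH = TH.exp_iso and expA = TA.exp_iso
  note fA = TA.E_factorisation and fH = TH.E_factorisation and fKA = TA.K_factorisation and fKH = TH.K_factorisation
    and fJ = TJ.Mt_factorisation
  have "\<exists>g. inverse_homotopy_equivalences (kxz n l) TA.K TJ.Mt KA.pp g" by (rule KA.retract.ex_section)
  then obtain g where g: "inverse_homotopy_equivalences (kxz n l) TA.K TJ.Mt KA.pp g" by (elim exE)
  \<comment> \<open>The exponentials over \<open>k[y]\<close> and over the completion are one
    matrix, so they commute with the completion map, and the quotient map to \<open>J_V\<close>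
    factors through the completion.\<close>
  have comm: "(KH.pp \<circ> TH.gexp (- 1)) (eps.cw v) = (KA.pp \<circ> TA.gexp (- 1)) v" if "v \<in> carrier TA.E" for v
  proof -
    have "TH.gexp (- 1) (eps.cw v) = eps.cw (TA.gexp (- 1) v)"
      by (rule eps.cw_natural[OF TA.rep_exp TH.rep_exp that, symmetric])
    then show ?thesis by (simp add: KH.pp_def KA.pp_def eps.cw_def H.quotient_to_hat)
  qed
  \<comment> \<open>By \<open>comm\<close>, an equivalence over \<open>k[y]\<close> equals the
    completion map followed by an equivalence over the completion; two out of three applies.\<close>
  have ex: "\<exists>\<epsilon>'. inverse_homotopy_equivalences (kxz n l) TA.E TH.E (ext_epsilon m V) \<epsilon>'"
    unfolding ep
    by (rule exI, rule inverse_homotopy_equivalences_cancel[OF fA fH fJ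
        inverse_homotopy_equivalences_comp[OF fA fKA fJ expA g]
        inverse_homotopy_equivalences_comp[OF fH fKH fJ expH eqKH] eps.cw_morphism], rule comm)
  \<comment> \<open>For an arbitrary inverse \<open>\<epsilon>'\<close> the claim is the composite
    of three equivalences: the completion map, the exponential, and the projection with inverse
    \<open>sigma_inf\<close>.\<close>
  have all: "inverse_homotopy_equivalences (kxz n l) TA.E TJ.Mt (Phi n m l V Y BY X BX q) (Phi_inv n m l V Y BY X BX \<sigma> q \<epsilon>')"
    if \<epsilon>': "inverse_homotopy_equivalences (kxz n l) TA.E TH.E (ext_epsilon m V) \<epsilon>'" for \<epsilon>'
  proof -
    have "inverse_homotopy_equivalences (kxz n l) TA.E TJ.Mt (KH.pp \<circ> (TH.gexp (- 1) \<circ> ext_epsilon m V))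
        (\<epsilon>' \<circ> TH.gexp 1 \<circ> sigma_inf n m l V Y BY X BX \<sigma>)"
      by (rule inverse_homotopy_equivalences_comp[OF fA fKH fJ
            inverse_homotopy_equivalences_comp[OF fA fH fKH \<epsilon>' expH] eqKH])
    then show ?thesis unfolding Phi_def Phi_inv_def pr exp by (simp only: comp_assoc)
  qed
  \<comment> \<open>Freeness over \<open>k[x,z]\<close>: monomials in \<open>y\<close> form a
    \<open>k\<close>-basis of \<open>k[y]\<close>, giving infinite rank, while below the finite
    basis of \<open>J_V\<close> gives finite rank.\<close>
  have "matrix_factorisation (kxz n l) (U - W) TA.E"
    unfolding matrix_factorisation_def using fA TA.E_homogeneous_basis[OF monomial_basis] by blast
  moreover have "finite_rank_matrix_factorisation (kxz n l) (U - W) TJ.Mt"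
    unfolding finite_rank_matrix_factorisation_def matrix_factorisation_def
    using fJ TJ.Mt_homogeneous_basis[OF B(2)] TJ.Mt_finitely_generated[OF B(2,1)] by blast
  ultimately show ?thesis using ex all by blast
qed

end
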